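(* Let $R$ be a ring and let $(n,m)$ and $(r,s)$ be any two pairs of positive integers such that $n\neq r$. Suppose that one of the following two conditions is satisfied: (a) $R$ is semiperfect and there exists an ideal $I$ of $R$ with $\mathrm{gen}(I_R)=\max\{n,r\}$ and $I\subseteq e_jR$ for some local idempotent $e_j$; (b) $R$ is Krull-Schmidt and there exists a right ideal $I$ of $R$ with $\mathrm{gen}(I)=\max\{n,r\}$ and $I\subseteq e_jR$ for some local idempotent $e_j$. Then: (1) $(m,n)$-purity and $(s,r)$-purity of short exact sequences of left $R$-modules are not equivalent; (2) $(n,m)$-purity and $(r,s)$-purity of short exact sequences of right $R$-modules are not equivalent.
   Context: Rings are associative with unity and modules are unital. For positive integers $p,q$, an $R$-module is $(p,q)$-presented if it is a factor of the free module $R^p$ by a $q$-generated submodule. A short exact sequence of left (resp. right) $R$-modules is $(p,q)$-pure if it remains exact when tensored with any $(p,q)$-presented right (resp. left) $R$-module. Two purities are equivalent if they have the same pure short exact sequences. $\mathrm{gen}(M)$ denotes the minimal number of generators of a module $M$; $\mathrm{gen}(I_R)$ is that of $I$ as a right $R$-module. A ring $R$ with Jacobson radical $J$ is semiperfect if $R/J$ is semisimple and idempotents lift modulo $J$. An idempotent $e\in R$ is local if $eRe$ is a local ring. $R$ is Krull-Schmidt if every finitely presented left (equivalently, right) $R$-module is a direct sum of modules with local endomorphism rings. *)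

theory Defs
  imports
    "HOL-Algebra.Module"
    "HOL-Algebra.QuotRing"
    "HOL-Algebra.Exact_Sequence"
    "HOL-Algebra.Free_Abelian_Groups"
    "HOL-Library.Extended_Nat"
begin

section \<open>Modules over noncommutative rings\<close>

text \<open>
  The locale \<^locale>\<open>module\<close> of HOL-Algebra demands a commutative ring of scalars; the
  following is the same list of axioms over an arbitrary ring. As in HOL-Algebra, the
  multiplication and unit fields of the \<^typ>\<open>('a, 'b) module\<close> record carry no meaning.
\<close>

locale left_module = R?: ring R + M?: abelian_group M for R (structure) and M (structure) +
  assumes smult_closed [simp, intro]:
      "\<lbrakk>a \<in> carrier R; x \<in> carrier M\<rbrakk> \<Longrightarrow> a \<odot>\<^bsub>M\<^esub> x \<in> carrier M"
    and smult_l_distr: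
      "\<lbrakk>a \<in> carrier R; b \<in> carrier R; x \<in> carrier M\<rbrakk> \<Longrightarrow>
       (a \<oplus> b) \<odot>\<^bsub>M\<^esub> x = a \<odot>\<^bsub>M\<^esub> x \<oplus>\<^bsub>M\<^esub> b \<odot>\<^bsub>M\<^esub> x"
    and smult_r_distr:
      "\<lbrakk>a \<in> carrier R; x \<in> carrier M; y \<in> carrier M\<rbrakk> \<Longrightarrow>
       a \<odot>\<^bsub>M\<^esub> (x \<oplus>\<^bsub>M\<^esub> y) = a \<odot>\<^bsub>M\<^esub> x \<oplus>\<^bsub>M\<^esub> a \<odot>\<^bsub>M\<^esub> y"
    and smult_assoc:
      "\<lbrakk>a \<in> carrier R; b \<in> carrier R; x \<in> carrier M\<rbrakk> \<Longrightarrow>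
       (a \<otimes> b) \<odot>\<^bsub>M\<^esub> x = a \<odot>\<^bsub>M\<^esub> (b \<odot>\<^bsub>M\<^esub> x)"
    and smult_one [simp]:
      "x \<in> carrier M \<Longrightarrow> \<one> \<odot>\<^bsub>M\<^esub> x = x"

text \<open>
  Right \<open>R\<close>-modules are left modules over the opposite ring: for a right module \<open>X\<close>,
  \<open>r \<odot>\<^bsub>X\<^esub> x\<close> stands for \<open>x r\<close>.
\<close>

definition opp_ring :: "('a, 'k) ring_scheme \<Rightarrow> ('a, 'k) ring_scheme" where
  "opp_ring R = R\<lparr>monoid.mult := (\<lambda>x y. y \<otimes>\<^bsub>R\<^esub> x)\<rparr>"

abbreviation right_module :: "('a, 'k) ring_scheme \<Rightarrow> ('a, 'b) module \<Rightarrow> bool" where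
  "right_module R M \<equiv> left_module (opp_ring R) M"

definition mod_hom ::
  "('a, 'k) ring_scheme \<Rightarrow> ('a, 'b) module \<Rightarrow> ('a, 'c) module \<Rightarrow> ('b \<Rightarrow> 'c) set" where
  "mod_hom R M N = {f \<in> hom (add_monoid M) (add_monoid N).
     \<forall>r\<in>carrier R. \<forall>x\<in>carrier M. f (r \<odot>\<^bsub>M\<^esub> x) = r \<odot>\<^bsub>N\<^esub> f x}"

definition mod_iso ::
  "('a, 'k) ring_scheme \<Rightarrow> ('a, 'b) module \<Rightarrow> ('a, 'c) module \<Rightarrow> bool" where
  "mod_iso R M N \<longleftrightarrow> (\<exists>f\<in>mod_hom R M N. bij_betw f (carrier M) (carrier N))"

definition regular_module :: "('a, 'k) ring_scheme \<Rightarrow> ('a, 'a) module" where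
  "regular_module R = \<lparr>carrier = carrier R, monoid.mult = monoid.mult R, one = one R,
     ring.zero = ring.zero R, add = add R, smult = monoid.mult R\<rparr>"

definition free_module :: "('a, 'k) ring_scheme \<Rightarrow> nat \<Rightarrow> ('a, nat \<Rightarrow> 'a) module" where
  "free_module R p = \<lparr>carrier = {..<p} \<rightarrow>\<^sub>E carrier R, monoid.mult = undefined, one = undefined,
     ring.zero = (\<lambda>i\<in>{..<p}. \<zero>\<^bsub>R\<^esub>), add = (\<lambda>x y. \<lambda>i\<in>{..<p}. x i \<oplus>\<^bsub>R\<^esub> y i),
     smult = (\<lambda>r x. \<lambda>i\<in>{..<p}. r \<otimes>\<^bsub>R\<^esub> x i)\<rparr>"

definition quot_module :: "('a, 'b) module \<Rightarrow> 'b set \<Rightarrow> ('a, 'b set) module" where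
  "quot_module M K = \<lparr>carrier = a_rcosets\<^bsub>M\<^esub> K, monoid.mult = undefined, one = undefined,
     ring.zero = K, add = set_add M, smult = (\<lambda>r C. \<Union>x\<in>C. K +>\<^bsub>M\<^esub> (r \<odot>\<^bsub>M\<^esub> x))\<rparr>"

section \<open>Generators and presentations\<close>

definition lin_span :: "('a, 'k) ring_scheme \<Rightarrow> ('a, 'b) module \<Rightarrow> 'b set \<Rightarrow> 'b set" where
  "lin_span R M S = \<Inter>{H. submodule H R M \<and> S \<subseteq> H}"

text \<open>The value is \<open>\<infinity>\<close> if \<open>M\<close> is not finitely generated.\<close>

definition gen :: "('a, 'k) ring_scheme \<Rightarrow> ('a, 'b) module \<Rightarrow> enat" where
  "gen R M = Inf {enat (card S) | S. finite S \<and> S \<subseteq> carrier M \<and> lin_span R M S = carrier M}"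

definition presented :: "('a, 'k) ring_scheme \<Rightarrow> nat \<Rightarrow> nat \<Rightarrow> ('a, 'b) module \<Rightarrow> bool" where
  "presented R p q M \<longleftrightarrow> left_module R M \<and>
     (\<exists>K. submodule K R (free_module R p) \<and> gen R ((free_module R p)\<lparr>carrier := K\<rparr>) \<le> enat q \<and>
          mod_iso R M (quot_module (free_module R p) K))"

definition finitely_presented :: "('a, 'k) ring_scheme \<Rightarrow> ('a, 'b) module \<Rightarrow> bool" where
  "finitely_presented R M \<longleftrightarrow> (\<exists>p>0. \<exists>q>0. presented R p q M)"

section \<open>Tensor products\<close>

text \<open>
  \<open>X \<otimes>\<^sub>R M\<close> for a right module \<open>X\<close> and a left module \<open>M\<close>: the free abelian group on
  \<open>X \<times> M\<close> modulo the subgroup generated by the biadditivity and balancing relations.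
\<close>

definition tensor_relations ::
  "('a, 'k) ring_scheme \<Rightarrow> ('a, 'b) module \<Rightarrow> ('a, 'c) module \<Rightarrow> ('b \<times> 'c \<Rightarrow>\<^sub>0 int) set" where
  "tensor_relations R X M =
     {frag_of (x \<oplus>\<^bsub>X\<^esub> x', y) - frag_of (x, y) - frag_of (x', y) | x x' y.
        x \<in> carrier X \<and> x' \<in> carrier X \<and> y \<in> carrier M} \<union>
     {frag_of (x, y \<oplus>\<^bsub>M\<^esub> y') - frag_of (x, y) - frag_of (x, y') | x y y'.
        x \<in> carrier X \<and> y \<in> carrier M \<and> y' \<in> carrier M} \<union>
     {frag_of (r \<odot>\<^bsub>X\<^esub> x, y) - frag_of (x, r \<odot>\<^bsub>M\<^esub> y) | r x y.
        r \<in> carrier R \<and> x \<in> carrier X \<and> y \<in> carrier M}"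

definition tensor_kernel ::
  "('a, 'k) ring_scheme \<Rightarrow> ('a, 'b) module \<Rightarrow> ('a, 'c) module \<Rightarrow> ('b \<times> 'c \<Rightarrow>\<^sub>0 int) set" where
  "tensor_kernel R X M =
     generate (free_Abelian_group (carrier X \<times> carrier M)) (tensor_relations R X M)"

definition tensor ::
  "('a, 'k) ring_scheme \<Rightarrow> ('a, 'b) module \<Rightarrow> ('a, 'c) module \<Rightarrow> ('b \<times> 'c \<Rightarrow>\<^sub>0 int) set monoid" where
  "tensor R X M = free_Abelian_group (carrier X \<times> carrier M) Mod tensor_kernel R X M"

text \<open>
  The map \<open>id\<^sub>X \<otimes> f : X \<otimes>\<^sub>R M \<rightarrow> X \<otimes>\<^sub>R N\<close>. An element of \<open>X \<otimes>\<^sub>R M\<close> is a coset \<open>c\<close>; its elementwise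
  image lies in a single coset of the kernel for \<open>X \<otimes>\<^sub>R N\<close>, obtained by adding that kernel.
\<close>

definition tensor_map ::
  "('a, 'k) ring_scheme \<Rightarrow> ('a, 'b) module \<Rightarrow> ('a, 'd) module \<Rightarrow> ('c \<Rightarrow> 'd) \<Rightarrow>
   ('b \<times> 'c \<Rightarrow>\<^sub>0 int) set \<Rightarrow> ('b \<times> 'd \<Rightarrow>\<^sub>0 int) set" where
  "tensor_map R X N f c = tensor_kernel R X N <#>\<^bsub>free_Abelian_group (carrier X \<times> carrier N)\<^esub>
     (frag_extend (\<lambda>(x, y). frag_of (x, f y)) ` c)"

section \<open>Purity\<close>

text \<open>
  Quantification over all modules has to range over a fixed type. The type below contains
  a copy of every finitely presented module, namely \<open>R\<^sup>p/K\<close> itself. It also has at least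
  \<open>max(|R|, \<aleph>\<^sub>0)\<close> elements if \<open>R\<close> is nontrivial; since \<open>(p,q)\<close>-purity is a condition on the
  solvability of finite systems of linear equations, the downward Loewenheim-Skolem theorem shows that
  sequences of that size already decide whether two purities are equivalent.
\<close>

type_synonym 'a univ = "(nat \<Rightarrow> 'a) set"

definition ses ::
  "('a, 'k) ring_scheme \<Rightarrow> ('a, 'b) module \<Rightarrow> ('b \<Rightarrow> 'c) \<Rightarrow> ('a, 'c) module \<Rightarrow> ('c \<Rightarrow> 'd) \<Rightarrow>
   ('a, 'd) module \<Rightarrow> bool" where
  "ses R A f B g C \<longleftrightarrow> left_module R A \<and> left_module R B \<and> left_module R C \<and>
     f \<in> mod_hom R A B \<and> g \<in> mod_hom R B C \<and>
     inj_on f (carrier A) \<and> f ` carrier A = {y \<in> carrier B. g y = \<zero>\<^bsub>C\<^esub>} \<and>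
     g ` carrier B = carrier C"

text \<open>\<^const>\<open>short_exact_sequence\<close> lists the groups and maps from right to left.\<close>

definition pq_pure ::
  "('a, 'k) ring_scheme \<Rightarrow> nat \<Rightarrow> nat \<Rightarrow> ('a, 'a univ) module \<Rightarrow> ('a univ \<Rightarrow> 'a univ) \<Rightarrow>
   ('a, 'a univ) module \<Rightarrow> ('a univ \<Rightarrow> 'a univ) \<Rightarrow> ('a, 'a univ) module \<Rightarrow> bool" where
  "pq_pure R p q A f B g C \<longleftrightarrow> ses R A f B g C \<and>
     (\<forall>X :: ('a, 'a univ) module. presented (opp_ring R) p q X \<longrightarrow>
        short_exact_sequence (tensor R X C) (tensor R X B) (tensor R X A)
          (tensor_map R X C g) (tensor_map R X B f))"

definition equivalent_purities_left ::
  "('a, 'k) ring_scheme \<Rightarrow> nat \<times> nat \<Rightarrow> nat \<times> nat \<Rightarrow> bool" where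
  "equivalent_purities_left R = (\<lambda>(p, q) (p', q').
     \<forall>A f B g C. pq_pure R p q A f B g C \<longleftrightarrow> pq_pure R p' q' A f B g C)"

text \<open>
  Over the opposite ring, the sequences are sequences of right \<open>R\<close>-modules, the test modules are
  left \<open>R\<close>-modules since \<open>opp_ring (opp_ring R) = R\<close>, and \<open>tensor (opp_ring R) Y A\<close> is
  \<open>A \<otimes>\<^sub>R Y\<close> with the two factors written in swapped order.
\<close>

definition equivalent_purities_right ::
  "('a, 'k) ring_scheme \<Rightarrow> nat \<times> nat \<Rightarrow> nat \<times> nat \<Rightarrow> bool" where
  "equivalent_purities_right R = equivalent_purities_left (opp_ring R)"

section \<open>Local, semiperfect and Krull-Schmidt rings\<close>

definition local_ring :: "('a, 'k) ring_scheme \<Rightarrow> bool" where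
  "local_ring R \<longleftrightarrow> ring R \<and> \<one>\<^bsub>R\<^esub> \<noteq> \<zero>\<^bsub>R\<^esub> \<and>
     (\<forall>x\<in>carrier R - Units R. \<forall>y\<in>carrier R - Units R. x \<oplus>\<^bsub>R\<^esub> y \<notin> Units R)"

definition corner_ring :: "('a, 'k) ring_scheme \<Rightarrow> 'a \<Rightarrow> ('a, 'k) ring_scheme" where
  "corner_ring R e = R\<lparr>carrier := {e \<otimes>\<^bsub>R\<^esub> x \<otimes>\<^bsub>R\<^esub> e | x. x \<in> carrier R}, one := e\<rparr>"

definition local_idempotent :: "('a, 'k) ring_scheme \<Rightarrow> 'a \<Rightarrow> bool" where
  "local_idempotent R e \<longleftrightarrow> e \<in> carrier R \<and> e \<otimes>\<^bsub>R\<^esub> e = e \<and> local_ring (corner_ring R e)"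

text \<open>
  Endomorphisms are extensional functions, so that equal endomorphisms are equal elements.
\<close>

definition end_ring :: "('a, 'k) ring_scheme \<Rightarrow> ('a, 'b) module \<Rightarrow> ('b \<Rightarrow> 'b) ring" where
  "end_ring R M = \<lparr>carrier = mod_hom R M M \<inter> extensional (carrier M),
     monoid.mult = compose (carrier M), one = (\<lambda>x\<in>carrier M. x),
     ring.zero = (\<lambda>x\<in>carrier M. \<zero>\<^bsub>M\<^esub>), add = (\<lambda>f g. \<lambda>x\<in>carrier M. f x \<oplus>\<^bsub>M\<^esub> g x)\<rparr>"

text \<open>
  \<open>M\<close> is the internal direct sum of the set \<open>\<N>\<close> of submodules: every element is, in exactly one
  way, a sum of a finitely supported choice of elements. Indexing by a set rather than a family
  is no restriction for nonzero summands, which are the only ones that occur below.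
\<close>

definition direct_sum_of ::
  "('a, 'k) ring_scheme \<Rightarrow> ('a, 'b) module \<Rightarrow> 'b set set \<Rightarrow> bool" where
  "direct_sum_of R M \<N> \<longleftrightarrow> (\<forall>N\<in>\<N>. submodule N R M) \<and>
     (\<forall>x\<in>carrier M. \<exists>!h. h \<in> (\<Pi>\<^sub>E N\<in>\<N>. N) \<and> finite {N \<in> \<N>. h N \<noteq> \<zero>\<^bsub>M\<^esub>} \<and>
        x = (\<Oplus>\<^bsub>M\<^esub>N\<in>{N \<in> \<N>. h N \<noteq> \<zero>\<^bsub>M\<^esub>}. h N))"

definition simple_submodule ::
  "('a, 'k) ring_scheme \<Rightarrow> ('a, 'b) module \<Rightarrow> 'b set \<Rightarrow> bool" where
  "simple_submodule R M N \<longleftrightarrow> submodule N R M \<and> N \<noteq> {\<zero>\<^bsub>M\<^esub>} \<and>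
     (\<forall>N'. submodule N' R M \<and> N' \<subseteq> N \<longrightarrow> N' = {\<zero>\<^bsub>M\<^esub>} \<or> N' = N)"

definition semisimple_ring :: "('a, 'k) ring_scheme \<Rightarrow> bool" where
  "semisimple_ring R \<longleftrightarrow> ring R \<and>
     (\<exists>\<N>. (\<forall>N\<in>\<N>. simple_submodule R (regular_module R) N) \<and>
          direct_sum_of R (regular_module R) \<N>)"

abbreviation left_ideal :: "'a set \<Rightarrow> ('a, 'k) ring_scheme \<Rightarrow> bool" where
  "left_ideal I R \<equiv> submodule I R (regular_module R)"

abbreviation right_ideal :: "'a set \<Rightarrow> ('a, 'k) ring_scheme \<Rightarrow> bool" where
  "right_ideal I R \<equiv> left_ideal I (opp_ring R)"

definition maximal_left_ideal :: "'a set \<Rightarrow> ('a, 'k) ring_scheme \<Rightarrow> bool" where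
  "maximal_left_ideal L R \<longleftrightarrow> left_ideal L R \<and> L \<noteq> carrier R \<and>
     (\<forall>L'. left_ideal L' R \<and> L \<subseteq> L' \<longrightarrow> L' = L \<or> L' = carrier R)"

definition jacobson_radical :: "('a, 'k) ring_scheme \<Rightarrow> 'a set" where
  "jacobson_radical R = carrier R \<inter> \<Inter>{L. maximal_left_ideal L R}"

definition idempotents_lift :: "('a, 'k) ring_scheme \<Rightarrow> 'a set \<Rightarrow> bool" where
  "idempotents_lift R J \<longleftrightarrow>
     (\<forall>x\<in>carrier R. x \<otimes>\<^bsub>R\<^esub> x \<ominus>\<^bsub>R\<^esub> x \<in> J \<longrightarrow>
        (\<exists>e\<in>carrier R. e \<otimes>\<^bsub>R\<^esub> e = e \<and> e \<ominus>\<^bsub>R\<^esub> x \<in> J))"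

definition semiperfect :: "('a, 'k) ring_scheme \<Rightarrow> bool" where
  "semiperfect R \<longleftrightarrow> ring R \<and> semisimple_ring (R Quot jacobson_radical R) \<and>
     idempotents_lift R (jacobson_radical R)"

definition krull_schmidt :: "('a, 'k) ring_scheme \<Rightarrow> bool" where
  "krull_schmidt R \<longleftrightarrow> ring R \<and>
     (\<forall>M :: ('a, 'a univ) module. finitely_presented R M \<longrightarrow>
        (\<exists>\<N>. direct_sum_of R M \<N> \<and>
             (\<forall>N\<in>\<N>. local_ring (end_ring R (M\<lparr>carrier := N\<rparr>)))))"

text \<open>\<open>gen(I\<^sub>R)\<close>: the number of generators of \<open>I\<close> as a right module.\<close>

definition gen_right :: "('a, 'k) ring_scheme \<Rightarrow> 'a set \<Rightarrow> enat" where
  "gen_right R I = gen (opp_ring R) ((regular_module (opp_ring R))\<lparr>carrier := I\<rparr>)"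

end

theory Submission
  imports Defs
begin

text \<open>
  A sequence \<open>0 \<rightarrow> A \<rightarrow> B \<rightarrow> C \<rightarrow> 0\<close> is \<open>(p, q)\<close>-pure iff every homogeneous system of \<open>p\<close> equations in
  \<open>q\<close> unknowns that is solvable in \<open>C\<close> lifts to \<open>B\<close>. The sum of all maps into \<open>C\<close> from modules
  with \<open>q\<close> generators and \<open>p\<close> relations yields a canonical \<open>(p, q)\<close>-pure sequence ending in \<open>C\<close>; if it
  is also \<open>(p', q')\<close>-pure and \<open>C\<close> has \<open>q'\<close> generators and \<open>p'\<close> relations, it splits, so the identity of
  \<open>C\<close> is a sum of endomorphisms factoring through such modules.

  Let \<open>N = max n r\<close>, let \<open>a\<close> be a row of \<open>N\<close> generators of \<open>I\<close>, and let \<open>C\<close> be the left module \<open>R\<^sup>N / R a\<close>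
  (for left modules) or \<open>R / I\<close> plus a free module (for right modules). In both cases, after
  transposing in the second one, the identity matrix of size \<open>N\<close> becomes, modulo rows in \<open>R a\<close>, a sum
  of products \<open>X\<^sub>i Y\<^sub>i\<close> of inner dimension \<open>min n r\<close> that have \<open>a\<close> as an eigenvector. The corner
  \<open>e R e\<close> is local, so one of the eigenvalues is a unit \<open>u\<close>, and \<open>a = u\<inverse> (a X\<^sub>i) Y\<^sub>i\<close>. If \<open>I\<close> is two-sided,
  this exhibits \<open>min n r\<close> generators \<open>u\<inverse> a X\<^sub>i\<close> of \<open>I\<close>, which is impossible.

  If \<open>I\<close> is only a right ideal, then \<open>u\<inverse>\<close> has to be congruent to \<open>e\<close> modulo \<open>I\<close>. This is achieved
  by decomposing \<open>R\<^sup>N / R a\<close> into modules with local endomorphism rings and using the exchange property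
  of \<open>R\<^sup>N\<close> to cut out the summand that carries \<open>a\<close> by an idempotent matrix fixing \<open>a\<close>.
\<close>

text \<open>Eigenvalues in \<open>e R e\<close> are known only up to two kinds of error: multipliers
  that annihilate the row \<open>a\<close>, and multipliers \<open>z e\<close> with \<open>z\<close>
  in \<open>I\<close>. Neither is ever a unit of the corner, since \<open>a\<close> is nonzero and
  \<open>e\<close> is not in \<open>I\<close>; otherwise \<open>I\<close> would be 0 or
  \<open>e R\<close>, with at most one generator, whereas \<open>max n r\<close> is at least 2. As
  \<open>e R e\<close> is local, both errors may be dropped when a unit is sought, and this is why
  working modulo \<open>R a\<close> does no harm.

  The other obstacle is size. Purity is tested on modules whose carrier type is
  \<open>'a univ\<close>, so the sum over all maps into \<open>C\<close> must fit into that type.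
  The elements of a cokernel are named by sequences of ring elements; a linear system with a
  solution in \<open>C\<close> consists of finitely many ring elements and such names, and is packed
  into one sequence. The direct sum is therefore indexed by sequences, and its elements, being
  functions from sequences to sets of sequences, are coded injectively by sets of sequences.\<close>

context left_module
begin

lemma smult_l_null [simp]: "x \<in> carrier M \<Longrightarrow> \<zero> \<odot>\<^bsub>M\<^esub> x = \<zero>\<^bsub>M\<^esub>"
  using smult_l_distr[of \<zero> \<zero> x] by (metis M.add.l_cancel_one' R.l_zero R.zero_closed smult_closed)

lemma smult_r_null [simp]: "a \<in> carrier R \<Longrightarrow> a \<odot>\<^bsub>M\<^esub> \<zero>\<^bsub>M\<^esub> = \<zero>\<^bsub>M\<^esub>"
  using smult_r_distr[of a "\<zero>\<^bsub>M\<^esub>" "\<zero>\<^bsub>M\<^esub>"]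
  by (metis M.add.l_cancel_one' M.l_zero M.zero_closed smult_closed)

lemma smult_l_minus:
  assumes "a \<in> carrier R" "x \<in> carrier M"
  shows "(\<ominus> a) \<odot>\<^bsub>M\<^esub> x = \<ominus>\<^bsub>M\<^esub> (a \<odot>\<^bsub>M\<^esub> x)"
  using assms smult_l_distr[of "\<ominus> a" a x] M.minus_equality[of "(\<ominus> a) \<odot>\<^bsub>M\<^esub> x" "a \<odot>\<^bsub>M\<^esub> x"]
  by (simp add: R.l_neg)

lemma smult_r_minus:
  assumes "a \<in> carrier R" "x \<in> carrier M"
  shows "a \<odot>\<^bsub>M\<^esub> (\<ominus>\<^bsub>M\<^esub> x) = \<ominus>\<^bsub>M\<^esub> (a \<odot>\<^bsub>M\<^esub> x)"
  using assms smult_r_distr[of a "\<ominus>\<^bsub>M\<^esub> x" x] M.minus_equality[of "a \<odot>\<^bsub>M\<^esub> (\<ominus>\<^bsub>M\<^esub> x)" "a \<odot>\<^bsub>M\<^esub> x"]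
  by (simp add: M.l_neg)

lemma smult_finsum:
  "\<lbrakk>finite A; a \<in> carrier R; f \<in> A \<rightarrow> carrier M\<rbrakk> \<Longrightarrow>
   a \<odot>\<^bsub>M\<^esub> (\<Oplus>\<^bsub>M\<^esub>i\<in>A. f i) = (\<Oplus>\<^bsub>M\<^esub>i\<in>A. a \<odot>\<^bsub>M\<^esub> f i)"
  by (induct set: finite) (auto simp: Pi_def smult_r_distr)

lemma finsum_smult:
  "\<lbrakk>finite A; x \<in> carrier M; f \<in> A \<rightarrow> carrier R\<rbrakk> \<Longrightarrow>
   (\<Oplus>i\<in>A. f i) \<odot>\<^bsub>M\<^esub> x = (\<Oplus>\<^bsub>M\<^esub>i\<in>A. f i \<odot>\<^bsub>M\<^esub> x)"
  by (induct set: finite) (auto simp: Pi_def smult_l_distr)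

end

lemma (in abelian_monoid) finsum_swap:
  assumes "finite A" "finite B" "\<And>i j. i \<in> A \<Longrightarrow> j \<in> B \<Longrightarrow> f i j \<in> carrier G"
  shows "(\<Oplus>i\<in>A. \<Oplus>j\<in>B. f i j) = (\<Oplus>j\<in>B. \<Oplus>i\<in>A. f i j)"
  using assms(1,3)
proof (induct set: finite)
  case empty
  then show ?case by simp
next
  case (insert a A)
  then have "(\<Oplus>i\<in>insert a A. \<Oplus>j\<in>B. f i j) = (\<Oplus>j\<in>B. f a j) \<oplus> (\<Oplus>j\<in>B. \<Oplus>i\<in>A. f i j)"
    by (simp add: Pi_def)
  also have "\<dots> = (\<Oplus>j\<in>B. f a j \<oplus> (\<Oplus>i\<in>A. f i j))"
    using insert.prems by (subst finsum_addf) (auto simp: Pi_def)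
  also have "\<dots> = (\<Oplus>j\<in>B. \<Oplus>i\<in>insert a A. f i j)"
    using insert by (intro finsum_cong') (auto simp: Pi_def)
  finally show ?case .
qed

lemma (in abelian_group) neg_zero [simp]: "\<ominus> \<zero> = \<zero>"
  using add.inv_one by (simp add: a_inv_def)

lemma (in abelian_group) diff_eq_zero_iff:
  assumes "x \<in> carrier G" "y \<in> carrier G"
  shows "x \<ominus> y = \<zero> \<longleftrightarrow> x = y"
  using assms minus_equality[of x "\<ominus> y"] by (auto simp: a_minus_def r_neg)

lemma (in abelian_group) diff_eq_swap:
  "\<lbrakk>x \<in> carrier G; y \<in> carrier G; x \<ominus> y = z\<rbrakk> \<Longrightarrow> y = x \<ominus> z"
  by (auto simp: a_minus_def minus_add r_neg2)

lemma (in abelian_group) finsum_neg: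
  assumes "finite A" "f \<in> A \<rightarrow> carrier G"
  shows "(\<Oplus>i\<in>A. \<ominus> f i) = \<ominus> (\<Oplus>i\<in>A. f i)"
  using assms
proof (induct set: finite)
  case empty
  then show ?case using add.inv_one by (simp add: a_inv_def)
qed (auto simp: Pi_def minus_add)

lemma (in abelian_monoid) finsum_unique_nonzero:
  assumes "finite A" "j \<in> A" "x \<in> carrier G" "f j = x" "\<And>i. i \<in> A \<Longrightarrow> i \<noteq> j \<Longrightarrow> f i = \<zero>"
  shows "finsum G f A = x"
proof -
  have "finsum G f A = (\<Oplus>i\<in>A. if j = i then x else \<zero>)"
    by (rule finsum_cong') (use assms in auto)
  then show ?thesis
    using add.finprod_singleton[of j A "\<lambda>_. x"] assms by auto
qed

lemma PiE_into_Pi [simp]: "x \<in> A \<rightarrow>\<^sub>E B \<Longrightarrow> x \<in> A \<rightarrow> B"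
  by auto

section \<open>Linear combinations\<close>

text \<open>Vectors are total functions on \<open>nat\<close> of which only the values below the
  stated length count; a matrix is then a function of two indices, and its rows and columns are
  partial applications.\<close>

definition lincomb :: "('a, 'b, 'd) module_scheme \<Rightarrow> nat \<Rightarrow> (nat \<Rightarrow> 'a) \<Rightarrow> (nat \<Rightarrow> 'b) \<Rightarrow> 'b" where
  "lincomb M q x y = (\<Oplus>\<^bsub>M\<^esub>i\<in>{..<q}. x i \<odot>\<^bsub>M\<^esub> y i)"

text \<open>Row against column, with \<open>x\<close> on the left. All matrix products over the
  noncommutative ring are written with \<open>dot\<close>; over the opposite ring the two arguments
  trade places.\<close>

definition dot :: "('a, 'k) ring_scheme \<Rightarrow> nat \<Rightarrow> (nat \<Rightarrow> 'a) \<Rightarrow> (nat \<Rightarrow> 'a) \<Rightarrow> 'a" where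
  "dot R q x y = (\<Oplus>\<^bsub>R\<^esub>i\<in>{..<q}. x i \<otimes>\<^bsub>R\<^esub> y i)"

definition unit_vec :: "('a, 'k) ring_scheme \<Rightarrow> nat \<Rightarrow> nat \<Rightarrow> 'a" where
  "unit_vec R i = (\<lambda>j. if i = j then \<one>\<^bsub>R\<^esub> else \<zero>\<^bsub>R\<^esub>)"

lemma (in ring) unit_vec_closed [simp]: "unit_vec R i j \<in> carrier R"
  by (simp add: unit_vec_def)

lemma (in ring) dot_closed [simp]:
  "\<lbrakk>x \<in> {..<q} \<rightarrow> carrier R; y \<in> {..<q} \<rightarrow> carrier R\<rbrakk> \<Longrightarrow> dot R q x y \<in> carrier R"
  unfolding dot_def by (rule finsum_closed) auto

lemma regular_left_module:
  assumes "ring R"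
  shows "left_module R (regular_module R)"
proof -
  interpret ring R by fact
  interpret A: abelian_group "regular_module R"
    by (rule abelian_groupI) (auto simp: regular_module_def a_ac intro: l_neg a_inv_closed)
  show ?thesis
    by unfold_locales (auto simp: l_distr r_distr m_assoc regular_module_def)
qed

lemma regular_module_simps [simp]:
  "carrier (regular_module R) = carrier R" "\<zero>\<^bsub>regular_module R\<^esub> = \<zero>\<^bsub>R\<^esub>"
  "x \<oplus>\<^bsub>regular_module R\<^esub> y = x \<oplus>\<^bsub>R\<^esub> y" "r \<odot>\<^bsub>regular_module R\<^esub> x = r \<otimes>\<^bsub>R\<^esub> x"
  by (simp_all add: regular_module_def)

lemma finsum_regular_module [simp]: "finsum (regular_module R) f A = finsum R f A"
  by (simp add: finsum_def finprod_def regular_module_def)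

text \<open>Makes the arithmetic of \<open>dot\<close> a special case of that of
  \<open>lincomb\<close>, so that the rules for matrices over the ring are inherited from those for
  modules.\<close>

lemma lincomb_regular: "lincomb (regular_module R) = dot R"
  by (simp add: lincomb_def dot_def fun_eq_iff)

context left_module
begin

lemma lincomb_closed [simp]:
  "\<lbrakk>x \<in> {..<q} \<rightarrow> carrier R; y \<in> {..<q} \<rightarrow> carrier M\<rbrakk> \<Longrightarrow> lincomb M q x y \<in> carrier M"
  unfolding lincomb_def by (rule M.finsum_closed) auto

lemma lincomb_cong:
  "\<lbrakk>x' \<in> {..<q} \<rightarrow> carrier R; y' \<in> {..<q} \<rightarrow> carrier M; \<And>i. i < q \<Longrightarrow> x i = x' i; \<And>i. i < q \<Longrightarrow> y i = y' i\<rbrakk> \<Longrightarrow>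
   lincomb M q x y = lincomb M q x' y'"
  unfolding lincomb_def by (rule M.finsum_cong') auto

lemma lincomb_add_left:
  "\<lbrakk>x \<in> {..<q} \<rightarrow> carrier R; x' \<in> {..<q} \<rightarrow> carrier R; y \<in> {..<q} \<rightarrow> carrier M\<rbrakk> \<Longrightarrow>
   lincomb M q (\<lambda>i. x i \<oplus> x' i) y = lincomb M q x y \<oplus>\<^bsub>M\<^esub> lincomb M q x' y"
  unfolding lincomb_def
  by (rule trans[OF M.finsum_cong' M.finsum_addf]) (auto simp: Pi_def smult_l_distr)

lemma lincomb_add_right:
  "\<lbrakk>x \<in> {..<q} \<rightarrow> carrier R; y \<in> {..<q} \<rightarrow> carrier M; y' \<in> {..<q} \<rightarrow> carrier M\<rbrakk> \<Longrightarrow>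
   lincomb M q x (\<lambda>i. y i \<oplus>\<^bsub>M\<^esub> y' i) = lincomb M q x y \<oplus>\<^bsub>M\<^esub> lincomb M q x y'"
  unfolding lincomb_def
  by (rule trans[OF M.finsum_cong' M.finsum_addf]) (auto simp: Pi_def smult_r_distr)

lemma lincomb_neg_left:
  "\<lbrakk>x \<in> {..<q} \<rightarrow> carrier R; y \<in> {..<q} \<rightarrow> carrier M\<rbrakk> \<Longrightarrow>
   lincomb M q (\<lambda>i. \<ominus> x i) y = \<ominus>\<^bsub>M\<^esub> lincomb M q x y"
  unfolding lincomb_def
  by (rule trans[OF M.finsum_cong' M.finsum_neg]) (auto simp: Pi_def smult_l_minus)

lemma lincomb_neg_right:
  "\<lbrakk>x \<in> {..<q} \<rightarrow> carrier R; y \<in> {..<q} \<rightarrow> carrier M\<rbrakk> \<Longrightarrow>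
   lincomb M q x (\<lambda>i. \<ominus>\<^bsub>M\<^esub> y i) = \<ominus>\<^bsub>M\<^esub> lincomb M q x y"
  unfolding lincomb_def
  by (rule trans[OF M.finsum_cong' M.finsum_neg]) (auto simp: Pi_def smult_r_minus)

lemma lincomb_diff_left:
  assumes "x \<in> {..<q} \<rightarrow> carrier R" "x' \<in> {..<q} \<rightarrow> carrier R" "y \<in> {..<q} \<rightarrow> carrier M"
  shows "lincomb M q (\<lambda>i. x i \<ominus> x' i) y = lincomb M q x y \<ominus>\<^bsub>M\<^esub> lincomb M q x' y"
proof -
  have "(\<lambda>i. \<ominus> x' i) \<in> {..<q} \<rightarrow> carrier R" using assms by auto
  then show ?thesis using assms by (simp add: a_minus_def lincomb_add_left lincomb_neg_left)
qed

lemma lincomb_diff_right: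
  assumes "x \<in> {..<q} \<rightarrow> carrier R" "y \<in> {..<q} \<rightarrow> carrier M" "y' \<in> {..<q} \<rightarrow> carrier M"
  shows "lincomb M q x (\<lambda>i. y i \<ominus>\<^bsub>M\<^esub> y' i) = lincomb M q x y \<ominus>\<^bsub>M\<^esub> lincomb M q x y'"
proof -
  have "(\<lambda>i. \<ominus>\<^bsub>M\<^esub> y' i) \<in> {..<q} \<rightarrow> carrier M" using assms by auto
  then show ?thesis using assms by (simp add: a_minus_def lincomb_add_right lincomb_neg_right)
qed

lemma lincomb_smult:
  "\<lbrakk>r \<in> carrier R; x \<in> {..<q} \<rightarrow> carrier R; y \<in> {..<q} \<rightarrow> carrier M\<rbrakk> \<Longrightarrow>
   lincomb M q (\<lambda>i. r \<otimes> x i) y = r \<odot>\<^bsub>M\<^esub> lincomb M q x y"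
  unfolding lincomb_def
  by (subst smult_finsum) (auto simp: Pi_def smult_assoc intro!: M.finsum_cong')

lemma lincomb_smult_right:
  "\<lbrakk>x \<in> {..<q} \<rightarrow> carrier R; z \<in> carrier M; y \<in> {..<q} \<rightarrow> carrier R\<rbrakk> \<Longrightarrow>
   lincomb M q x (\<lambda>i. y i \<odot>\<^bsub>M\<^esub> z) = dot R q x y \<odot>\<^bsub>M\<^esub> z"
  unfolding lincomb_def dot_def
  by (subst finsum_smult) (auto simp: Pi_def smult_assoc intro!: M.finsum_cong')

lemma lincomb_zero_left [simp]:
  "y \<in> {..<q} \<rightarrow> carrier M \<Longrightarrow> lincomb M q (\<lambda>i. \<zero>) y = \<zero>\<^bsub>M\<^esub>"
  unfolding lincomb_def by (rule M.add.finprod_one_eqI) (auto simp: Pi_def)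

lemma lincomb_zero_right [simp]:
  "x \<in> {..<q} \<rightarrow> carrier R \<Longrightarrow> lincomb M q x (\<lambda>i. \<zero>\<^bsub>M\<^esub>) = \<zero>\<^bsub>M\<^esub>"
  unfolding lincomb_def by (rule M.add.finprod_one_eqI) (auto simp: Pi_def)

lemma lincomb_unit_vec:
  "\<lbrakk>j < q; y \<in> {..<q} \<rightarrow> carrier M\<rbrakk> \<Longrightarrow> lincomb M q (unit_vec R j) y = y j"
  unfolding lincomb_def
  by (rule M.finsum_unique_nonzero[of _ j]) (auto simp: unit_vec_def Pi_def)

lemma lincomb_finsum_left:
  assumes "finite A" "\<And>w i. w \<in> A \<Longrightarrow> i < q \<Longrightarrow> x w i \<in> carrier R" "y \<in> {..<q} \<rightarrow> carrier M"
  shows "lincomb M q (\<lambda>i. \<Oplus>w\<in>A. x w i) y = (\<Oplus>\<^bsub>M\<^esub>w\<in>A. lincomb M q (x w) y)"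
proof -
  have "lincomb M q (\<lambda>i. \<Oplus>w\<in>A. x w i) y = (\<Oplus>\<^bsub>M\<^esub>i\<in>{..<q}. \<Oplus>\<^bsub>M\<^esub>w\<in>A. x w i \<odot>\<^bsub>M\<^esub> y i)"
    unfolding lincomb_def using assms
    by (intro M.finsum_cong') (auto simp: Pi_def finsum_smult)
  also have "\<dots> = (\<Oplus>\<^bsub>M\<^esub>w\<in>A. lincomb M q (x w) y)"
    unfolding lincomb_def using assms by (intro M.finsum_swap) (auto simp: Pi_def)
  finally show ?thesis .
qed

lemma lincomb_finsum_right:
  assumes "finite A" "\<And>w i. w \<in> A \<Longrightarrow> i < q \<Longrightarrow> y w i \<in> carrier M" "x \<in> {..<q} \<rightarrow> carrier R"
  shows "lincomb M q x (\<lambda>i. \<Oplus>\<^bsub>M\<^esub>w\<in>A. y w i) = (\<Oplus>\<^bsub>M\<^esub>w\<in>A. lincomb M q x (y w))"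
proof -
  have "lincomb M q x (\<lambda>i. \<Oplus>\<^bsub>M\<^esub>w\<in>A. y w i) = (\<Oplus>\<^bsub>M\<^esub>i\<in>{..<q}. \<Oplus>\<^bsub>M\<^esub>w\<in>A. x i \<odot>\<^bsub>M\<^esub> y w i)"
    unfolding lincomb_def using assms
    by (intro M.finsum_cong') (auto simp: Pi_def smult_finsum)
  also have "\<dots> = (\<Oplus>\<^bsub>M\<^esub>w\<in>A. lincomb M q x (y w))"
    unfolding lincomb_def using assms by (intro M.finsum_swap) (auto simp: Pi_def)
  finally show ?thesis .
qed

text \<open>Matrix associativity \<open>(x F) y = x (F y)\<close> for a column \<open>y\<close> of
  module elements, obtained by exchanging two finite sums. Relations are moved through maps in this
  form.\<close>

lemma lincomb_assoc:
  assumes "x \<in> {..<q} \<rightarrow> carrier R" "\<And>i l. i < q \<Longrightarrow> l < p \<Longrightarrow> F i l \<in> carrier R"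
    "y \<in> {..<p} \<rightarrow> carrier M"
  shows "lincomb M p (\<lambda>l. dot R q x (\<lambda>i. F i l)) y = lincomb M q x (\<lambda>i. lincomb M p (F i) y)"
proof -
  have "lincomb M p (\<lambda>l. dot R q x (\<lambda>i. F i l)) y
      = (\<Oplus>\<^bsub>M\<^esub>i\<in>{..<q}. lincomb M p (\<lambda>l. x i \<otimes> F i l) y)"
    unfolding dot_def using assms by (intro lincomb_finsum_left) auto
  also have "\<dots> = lincomb M q x (\<lambda>i. lincomb M p (F i) y)"
    unfolding lincomb_def[of M q] using assms
    by (intro M.finsum_cong') (auto simp: Pi_def lincomb_smult)
  finally show ?thesis .
qed

end

section \<open>Homomorphisms and submodules\<close>

lemma mod_homI:
  assumes "f \<in> carrier M \<rightarrow> carrier N"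
    "\<And>x y. \<lbrakk>x \<in> carrier M; y \<in> carrier M\<rbrakk> \<Longrightarrow> f (x \<oplus>\<^bsub>M\<^esub> y) = f x \<oplus>\<^bsub>N\<^esub> f y"
    "\<And>r x. \<lbrakk>r \<in> carrier R; x \<in> carrier M\<rbrakk> \<Longrightarrow> f (r \<odot>\<^bsub>M\<^esub> x) = r \<odot>\<^bsub>N\<^esub> f x"
  shows "f \<in> mod_hom R M N"
  using assms by (auto simp: mod_hom_def hom_def)

lemma mod_hom_closed: "\<lbrakk>f \<in> mod_hom R M N; x \<in> carrier M\<rbrakk> \<Longrightarrow> f x \<in> carrier N"
  by (auto simp: mod_hom_def hom_def)

lemma mod_hom_add:
  "\<lbrakk>f \<in> mod_hom R M N; x \<in> carrier M; y \<in> carrier M\<rbrakk> \<Longrightarrow> f (x \<oplus>\<^bsub>M\<^esub> y) = f x \<oplus>\<^bsub>N\<^esub> f y"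
  by (auto simp: mod_hom_def hom_def)

lemma mod_hom_smult:
  "\<lbrakk>f \<in> mod_hom R M N; r \<in> carrier R; x \<in> carrier M\<rbrakk> \<Longrightarrow> f (r \<odot>\<^bsub>M\<^esub> x) = r \<odot>\<^bsub>N\<^esub> f x"
  by (auto simp: mod_hom_def)

lemma mod_hom_compose:
  "\<lbrakk>f \<in> mod_hom R M N; g \<in> mod_hom R N P\<rbrakk> \<Longrightarrow> (\<lambda>x. g (f x)) \<in> mod_hom R M P"
  by (simp add: mod_hom_def hom_def Pi_iff)

lemma mod_hom_cong:
  assumes "left_module R M" "f \<in> mod_hom R M N" "\<And>x. x \<in> carrier M \<Longrightarrow> g x = f x"
  shows "g \<in> mod_hom R M N"
proof -
  interpret left_module R M by fact
  show ?thesis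
    using assms(2,3) by (intro mod_homI) (auto simp: mod_hom_closed mod_hom_add mod_hom_smult)
qed

locale module_hom = M: left_module R M + N: left_module R N
  for R (structure) and M and N +
  fixes f
  assumes hom: "f \<in> mod_hom R M N"
begin

lemmas closed [simp] = mod_hom_closed[OF hom]
lemmas add = mod_hom_add[OF hom]
lemmas smult = mod_hom_smult[OF hom]

lemma zero [simp]: "f \<zero>\<^bsub>M\<^esub> = \<zero>\<^bsub>N\<^esub>"
  using add[of "\<zero>\<^bsub>M\<^esub>" "\<zero>\<^bsub>M\<^esub>"] closed[of "\<zero>\<^bsub>M\<^esub>"]
  by (metis M.M.l_zero M.M.zero_closed N.M.add.l_cancel_one')

lemma neg: "x \<in> carrier M \<Longrightarrow> f (\<ominus>\<^bsub>M\<^esub> x) = \<ominus>\<^bsub>N\<^esub> f x"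
  using add[of "\<ominus>\<^bsub>M\<^esub> x" x] N.M.minus_equality[of "f (\<ominus>\<^bsub>M\<^esub> x)" "f x"] by (simp add: M.M.l_neg)

lemma diff: "\<lbrakk>x \<in> carrier M; y \<in> carrier M\<rbrakk> \<Longrightarrow> f (x \<ominus>\<^bsub>M\<^esub> y) = f x \<ominus>\<^bsub>N\<^esub> f y"
  by (simp add: a_minus_def add neg)

lemma finsum:
  "\<lbrakk>finite A; x \<in> A \<rightarrow> carrier M\<rbrakk> \<Longrightarrow> f (\<Oplus>\<^bsub>M\<^esub>i\<in>A. x i) = (\<Oplus>\<^bsub>N\<^esub>i\<in>A. f (x i))"
  by (induct set: finite) (auto simp: Pi_def add)

lemma lincomb:
  "\<lbrakk>x \<in> {..<q} \<rightarrow> carrier R; y \<in> {..<q} \<rightarrow> carrier M\<rbrakk> \<Longrightarrow>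
   f (lincomb M q x y) = lincomb N q x (\<lambda>i. f (y i))"
  unfolding lincomb_def by (subst finsum) (auto simp: Pi_def smult intro!: N.M.finsum_cong')

end

lemma (in left_module) submoduleI:
  assumes "H \<subseteq> carrier M" "\<zero>\<^bsub>M\<^esub> \<in> H"
    "\<And>x y. \<lbrakk>x \<in> H; y \<in> H\<rbrakk> \<Longrightarrow> x \<oplus>\<^bsub>M\<^esub> y \<in> H"
    "\<And>r x. \<lbrakk>r \<in> carrier R; x \<in> H\<rbrakk> \<Longrightarrow> r \<odot>\<^bsub>M\<^esub> x \<in> H"
  shows "submodule H R M"
proof
  \<comment> \<open>Negation is multiplication by the scalar -1, so closure under it follows from
    closure under scalars.\<close>
  show "inv\<^bsub>add_monoid M\<^esub> x \<in> H" if "x \<in> H" for x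
  proof -
    have "(\<ominus> \<one>) \<odot>\<^bsub>M\<^esub> x \<in> H" using that by (intro assms(4)) auto
    then show ?thesis
      using that assms(1) smult_l_minus[of \<one> x] by (auto simp: subset_iff a_inv_def)
  qed
qed (use assms in auto)

lemma submodule_zero: "submodule H R M \<Longrightarrow> \<zero>\<^bsub>M\<^esub> \<in> H"
  using subgroup.one_closed[of H "add_monoid M"] by (simp add: submodule_def)

lemma submodule_add: "\<lbrakk>submodule H R M; x \<in> H; y \<in> H\<rbrakk> \<Longrightarrow> x \<oplus>\<^bsub>M\<^esub> y \<in> H"
  using subgroup.m_closed[of H "add_monoid M"] by (simp add: submodule_def)

lemma submodule_neg: "\<lbrakk>submodule H R M; x \<in> H\<rbrakk> \<Longrightarrow> \<ominus>\<^bsub>M\<^esub> x \<in> H"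
  using subgroup.m_inv_closed[of H "add_monoid M"] by (simp add: submodule_def a_inv_def)

lemma submodule_smult: "\<lbrakk>submodule H R M; r \<in> carrier R; x \<in> H\<rbrakk> \<Longrightarrow> r \<odot>\<^bsub>M\<^esub> x \<in> H"
  by (rule submodule.smult_closed)

lemma submodule_subset: "submodule H R M \<Longrightarrow> H \<subseteq> carrier M"
  using subgroup.subset[of H "add_monoid M"] by (simp add: submodule_def)

lemma (in left_module) submodule_lincomb:
  assumes "submodule H R M" "x \<in> {..<q} \<rightarrow> carrier R" "y \<in> {..<q} \<rightarrow> H"
  shows "lincomb M q x y \<in> H"
proof -
  have *: "(\<Oplus>\<^bsub>M\<^esub>i\<in>A. f i) \<in> H" if "finite A" "f \<in> A \<rightarrow> H" for A :: "nat set" and f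
    using that
  proof (induct set: finite)
    case (insert a A)
    then have "f \<in> A \<rightarrow> carrier M" "f a \<in> carrier M"
      using submodule_subset[OF assms(1)] by auto
    then show ?case using insert submodule_add[OF assms(1)] by auto
  qed (simp add: submodule_zero[OF assms(1)])
  show ?thesis
    unfolding lincomb_def
    by (rule *) (use assms submodule_smult[OF assms(1)] in auto)
qed

lemma (in left_module) left_module_submodule:
  assumes "submodule H R M"
  shows "left_module R (M\<lparr>carrier := H\<rparr>)"
proof -
  have sub: "x \<in> H \<Longrightarrow> x \<in> carrier M" for x using submodule_subset[OF assms] by auto
  interpret A: abelian_group "M\<lparr>carrier := H\<rparr>"
  proof (rule abelian_groupI; simp?)
    show "\<exists>y\<in>H. y \<oplus>\<^bsub>M\<^esub> x = \<zero>\<^bsub>M\<^esub>" if "x \<in> H" for x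
      using that submodule_neg[OF assms that] by (intro bexI[of _ "\<ominus>\<^bsub>M\<^esub> x"]) (auto simp: sub M.l_neg)
  qed (use submodule_zero[OF assms] submodule_add[OF assms] in \<open>auto simp: sub M.a_ac\<close>)
  show ?thesis
    by unfold_locales
      (auto simp: sub smult_l_distr smult_r_distr smult_assoc submodule_smult[OF assms])
qed

lemma (in left_module) finsum_submodule:
  assumes "submodule H R M" "finite A" "f \<in> A \<rightarrow> H"
  shows "finsum (M\<lparr>carrier := H\<rparr>) f A = finsum M f A"
proof -
  interpret H: left_module R "M\<lparr>carrier := H\<rparr>" by (rule left_module_submodule) fact
  have sub: "x \<in> H \<Longrightarrow> x \<in> carrier M" for x using submodule_subset[OF assms(1)] by auto
  show ?thesis using assms(2,3)
    by (induct set: finite) (auto simp: sub Pi_def)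
qed

lemma (in left_module) lincomb_submodule:
  assumes "submodule H R M" "x \<in> {..<q} \<rightarrow> carrier R" "y \<in> {..<q} \<rightarrow> H"
  shows "lincomb (M\<lparr>carrier := H\<rparr>) q x y = lincomb M q x y"
proof -
  have "(\<lambda>i. x i \<odot>\<^bsub>M\<^esub> y i) \<in> {..<q} \<rightarrow> H"
    using assms submodule_smult[OF assms(1)] by auto
  from finsum_submodule[OF assms(1) _ this] show ?thesis
    by (simp add: lincomb_def)
qed

section \<open>Opposite rings, free modules and quotient modules\<close>

lemma opp_ring_simps [simp]:
  "carrier (opp_ring R) = carrier R" "\<zero>\<^bsub>opp_ring R\<^esub> = \<zero>\<^bsub>R\<^esub>" "\<one>\<^bsub>opp_ring R\<^esub> = \<one>\<^bsub>R\<^esub>"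
  "x \<oplus>\<^bsub>opp_ring R\<^esub> y = x \<oplus>\<^bsub>R\<^esub> y" "x \<otimes>\<^bsub>opp_ring R\<^esub> y = y \<otimes>\<^bsub>R\<^esub> x"
  by (simp_all add: opp_ring_def)

lemma finsum_opp_ring [simp]: "finsum (opp_ring R) f A = finsum R f A"
  by (simp add: finsum_def finprod_def opp_ring_def)

lemma a_inv_opp_ring [simp]: "\<ominus>\<^bsub>opp_ring R\<^esub> x = \<ominus>\<^bsub>R\<^esub> x"
  by (simp add: a_inv_def m_inv_def opp_ring_def)

lemma dot_opp_ring: "dot (opp_ring R) q x y = dot R q y x"
  by (simp add: dot_def)

lemma unit_vec_opp_ring [simp]: "unit_vec (opp_ring R) = unit_vec R"
  by (simp add: unit_vec_def fun_eq_iff)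

lemma ring_opp_ring:
  assumes "ring R"
  shows "ring (opp_ring R)"
proof -
  interpret ring R by fact
  interpret A: abelian_group "opp_ring R"
    by (rule abelian_groupI) (auto simp: a_ac intro: l_neg a_inv_closed)
  show ?thesis
    by unfold_locales (auto simp: l_distr r_distr m_assoc)
qed

lemma free_module_simps [simp]:
  "carrier (free_module R p) = {..<p} \<rightarrow>\<^sub>E carrier R"
  "\<zero>\<^bsub>free_module R p\<^esub> = (\<lambda>i\<in>{..<p}. \<zero>\<^bsub>R\<^esub>)"
  "x \<oplus>\<^bsub>free_module R p\<^esub> y = (\<lambda>i\<in>{..<p}. x i \<oplus>\<^bsub>R\<^esub> y i)"
  "r \<odot>\<^bsub>free_module R p\<^esub> x = (\<lambda>i\<in>{..<p}. r \<otimes>\<^bsub>R\<^esub> x i)"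
  by (simp_all add: free_module_def)

lemma free_left_module:
  assumes "ring R"
  shows "left_module R (free_module R p)"
proof -
  interpret ring R by fact
  interpret A: abelian_group "free_module R p"
  proof (rule abelian_groupI)
    fix x assume x: "x \<in> carrier (free_module R p)"
    show "\<exists>y\<in>carrier (free_module R p). y \<oplus>\<^bsub>free_module R p\<^esub> x = \<zero>\<^bsub>free_module R p\<^esub>"
      by (rule bexI[of _ "\<lambda>i\<in>{..<p}. \<ominus>\<^bsub>R\<^esub> x i"]) (use x in \<open>auto simp: l_neg PiE_iff fun_eq_iff\<close>)
  qed (auto simp: a_ac PiE_iff extensional_def fun_eq_iff)
  show ?thesis
    by unfold_locales
      (auto simp: l_distr r_distr m_assoc PiE_iff extensional_def fun_eq_iff)
qed

text \<open>The carrier of \<open>free_module\<close> consists of extensional functions, so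
  \<open>unit_vec\<close> has to be cut off to become an element.\<close>

definition basis_vec :: "('a, 'k) ring_scheme \<Rightarrow> nat \<Rightarrow> nat \<Rightarrow> nat \<Rightarrow> 'a" where
  "basis_vec R p i = restrict (unit_vec R i) {..<p}"

lemma (in ring) basis_vec_closed [simp]: "basis_vec R p i \<in> {..<p} \<rightarrow>\<^sub>E carrier R"
  by (auto simp: basis_vec_def)

lemma (in ring) finsum_free_module:
  assumes "finite A" "\<And>w. w \<in> A \<Longrightarrow> x w \<in> {..<p} \<rightarrow>\<^sub>E carrier R"
  shows "(\<Oplus>\<^bsub>free_module R p\<^esub>w\<in>A. x w) = (\<lambda>i\<in>{..<p}. \<Oplus>w\<in>A. x w i)"
proof -
  interpret F: left_module R "free_module R p" by (rule free_left_module) unfold_locales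
  show ?thesis using assms
  proof (induct set: finite)
    case empty
    then show ?case using F.M.finsum_empty by simp
  next
    case (insert w A)
    have "(\<lambda>w. x w i) \<in> A \<rightarrow> carrier R" "x w i \<in> carrier R" if "i < p" for i
      using insert(4) that by (auto simp: PiE_iff)
    moreover have "x \<in> A \<rightarrow> carrier (free_module R p)" "x w \<in> carrier (free_module R p)"
      using insert(4) by auto
    ultimately show ?case
      using insert by (simp add: F.M.finsum_insert) (auto simp: fun_eq_iff)
  qed
qed

lemma (in ring) lincomb_free_module:
  assumes "s \<in> {..<q} \<rightarrow> carrier R" "k \<in> {..<q} \<rightarrow> ({..<p} \<rightarrow>\<^sub>E carrier R)"
  shows "lincomb (free_module R p) q s k = (\<lambda>i\<in>{..<p}. dot R q s (\<lambda>j. k j i))"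
proof -
  have "s j \<otimes> k j i \<in> carrier R" if "i < p" "j < q" for i j
  proof -
    have "k j \<in> {..<p} \<rightarrow>\<^sub>E carrier R" "s j \<in> carrier R" using assms that by auto
    then show ?thesis using that by (auto simp: PiE_iff)
  qed
  have *: "(\<lambda>i\<in>{..<p}. s j \<otimes> k j i) \<in> {..<p} \<rightarrow>\<^sub>E carrier R" if "j < q" for j
    using \<open>\<And>i j. \<lbrakk>i < p; j < q\<rbrakk> \<Longrightarrow> s j \<otimes> k j i \<in> carrier R\<close> that by auto
  have "lincomb (free_module R p) q s k = (\<Oplus>\<^bsub>free_module R p\<^esub>j\<in>{..<q}. (\<lambda>i\<in>{..<p}. s j \<otimes> k j i))"
    by (simp add: lincomb_def)
  also have "\<dots> = (\<lambda>i\<in>{..<p}. \<Oplus>j\<in>{..<q}. (\<lambda>i\<in>{..<p}. s j \<otimes> k j i) i)"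
    by (rule finsum_free_module) (use * in auto)
  also have "\<dots> = (\<lambda>i\<in>{..<p}. dot R q s (\<lambda>j. k j i))"
    by (auto simp: fun_eq_iff dot_def)
  finally show ?thesis .
qed

lemma (in ring) dot_basis_expansion:
  assumes "x \<in> {..<p} \<rightarrow> carrier R" "i < p"
  shows "dot R p x (\<lambda>j. basis_vec R p j i) = x i"
  unfolding dot_def
  by (rule finsum_unique_nonzero[of _ i]) (use assms in \<open>auto simp: basis_vec_def unit_vec_def Pi_def\<close>)

lemma (in ring) free_module_expansion:
  assumes "x \<in> {..<p} \<rightarrow>\<^sub>E carrier R"
  shows "lincomb (free_module R p) p x (basis_vec R p) = x"
proof -
  have "lincomb (free_module R p) p x (basis_vec R p) = (\<lambda>i\<in>{..<p}. dot R p x (\<lambda>j. basis_vec R p j i))"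
    by (rule lincomb_free_module) (use assms basis_vec_closed in blast)+
  also have "\<dots> = x"
    using assms by (auto simp: dot_basis_expansion fun_eq_iff PiE_iff extensional_def)
  finally show ?thesis .
qed

text \<open>Constants such as \<^const>\<open>mod_hom\<close> and \<^const>\<open>gen\<close> exist only for module records without
  extension fields, while \<^locale>\<open>left_module\<close> allows such fields.\<close>

locale lmod = left_module R M
  for R :: "('a, 'k) ring_scheme" (structure) and M :: "('a, 'b) module" (structure)

context lmod
begin

lemma ring_R: "ring R" ..

end

lemma quot_module_simps:
  "carrier (quot_module M K) = a_rcosets\<^bsub>M\<^esub> K" "\<zero>\<^bsub>quot_module M K\<^esub> = K"
  "C \<oplus>\<^bsub>quot_module M K\<^esub> D = C <+>\<^bsub>M\<^esub> D"
  "r \<odot>\<^bsub>quot_module M K\<^esub> C = (\<Union>x\<in>C. K +>\<^bsub>M\<^esub> (r \<odot>\<^bsub>M\<^esub> x))"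
  by (simp_all add: quot_module_def)

locale quotient_of = lmod +
  fixes K
  assumes submod: "submodule K R M"
begin

abbreviation Q where "Q \<equiv> quot_module M K"
abbreviation proj where "proj x \<equiv> K +>\<^bsub>M\<^esub> x"

lemma subgroup_K: "subgroup K (add_monoid M)"
  using submod by (simp add: submodule_def)

lemma K_subset: "K \<subseteq> carrier M"
  by (rule submodule_subset) (rule submod)

sublocale abelian_subgroup K M
  by (intro abelian_subgroupI3 additive_subgroupI subgroup_K M.abelian_group_axioms)

lemma proj_add: "\<lbrakk>x \<in> carrier M; y \<in> carrier M\<rbrakk> \<Longrightarrow> proj x \<oplus>\<^bsub>Q\<^esub> proj y = proj (x \<oplus>\<^bsub>M\<^esub> y)"
  by (simp add: quot_module_simps a_rcos_sum)

lemma proj_eq_iff: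
  assumes "x \<in> carrier M" "y \<in> carrier M"
  shows "proj x = proj y \<longleftrightarrow> x \<ominus>\<^bsub>M\<^esub> y \<in> K"
proof
  assume "proj x = proj y"
  then have "proj (x \<oplus>\<^bsub>M\<^esub> \<ominus>\<^bsub>M\<^esub> y) = K"
    using assms K_subset by (intro M.a_coset_add_inv2)
  then show "x \<ominus>\<^bsub>M\<^esub> y \<in> K"
    using assms M.a_coset_join1[OF _ _ subgroup_K] by (simp add: a_minus_def)
next
  assume "x \<ominus>\<^bsub>M\<^esub> y \<in> K"
  then have "proj (x \<oplus>\<^bsub>M\<^esub> \<ominus>\<^bsub>M\<^esub> y) = K"
    using assms M.a_coset_join2[OF _ subgroup_K] by (simp add: a_minus_def)
  then show "proj x = proj y"
    using assms K_subset by (intro M.a_coset_add_inv1)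
qed

lemma proj_eq_zero_iff: "x \<in> carrier M \<Longrightarrow> proj x = K \<longleftrightarrow> x \<in> K"
  using M.a_coset_join1[OF _ _ subgroup_K] M.a_coset_join2[OF _ subgroup_K] by blast

lemma proj_closed [simp]: "x \<in> carrier M \<Longrightarrow> proj x \<in> carrier Q"
  using M.a_rcosetsI K_subset by (simp add: quot_module_simps)

lemma proj_surj: "C \<in> carrier Q \<Longrightarrow> \<exists>x\<in>carrier M. C = proj x"
  by (auto simp: quot_module_simps A_RCOSETS_def')

lemma mem_proj: "x \<in> carrier M \<Longrightarrow> x \<in> proj x"
  using M.a_rcosI[of "\<zero>\<^bsub>M\<^esub>" K x] K_subset by simp

lemma coset_elem:
  assumes "C \<in> carrier Q" "x \<in> C"
  shows "x \<in> carrier M" "C = proj x"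
proof -
  obtain y where y: "y \<in> carrier M" "C = proj y" using proj_surj[OF assms(1)] by auto
  then show "x \<in> carrier M" using assms M.a_r_coset_subset_G[OF K_subset, of y] by auto
  show "C = proj x"
    using assms y M.a_repr_independence[OF _ _ subgroup_K] by auto
qed

text \<open>The scalar multiple of a coset is a union over all its representatives. \<open>K\<close>
  is closed under scalars, so all cosets in this union coincide.\<close>

lemma proj_smult:
  assumes "r \<in> carrier R" "x \<in> carrier M"
  shows "r \<odot>\<^bsub>Q\<^esub> proj x = proj (r \<odot>\<^bsub>M\<^esub> x)"
proof -
  have "proj (r \<odot>\<^bsub>M\<^esub> y) = proj (r \<odot>\<^bsub>M\<^esub> x)" if y: "y \<in> proj x" for y
  proof -
    note * = coset_elem[OF proj_closed[OF assms(2)] y]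
    then have "x \<ominus>\<^bsub>M\<^esub> y \<in> K" using assms proj_eq_iff by blast
    then have "r \<odot>\<^bsub>M\<^esub> (x \<ominus>\<^bsub>M\<^esub> y) \<in> K" using assms submodule_smult[OF submod] by blast
    then have "(r \<odot>\<^bsub>M\<^esub> x) \<ominus>\<^bsub>M\<^esub> (r \<odot>\<^bsub>M\<^esub> y) \<in> K"
      using * assms by (simp add: a_minus_def smult_r_distr smult_r_minus)
    then show ?thesis
      by (rule sym[OF iffD2[OF proj_eq_iff, rotated 2]]) (use * assms in auto)
  qed
  then have "(\<Union>y\<in>proj x. proj (r \<odot>\<^bsub>M\<^esub> y)) = proj (r \<odot>\<^bsub>M\<^esub> x)"
    using mem_proj[OF assms(2)] by blast
  then show ?thesis by (simp only: quot_module_simps)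
qed

lemma left_module_quot: "left_module R Q"
proof -
  have zero: "\<zero>\<^bsub>Q\<^esub> = proj \<zero>\<^bsub>M\<^esub>" using K_subset by (simp add: quot_module_simps)
  interpret A: abelian_group Q
  proof (rule abelian_groupI)
    show "\<zero>\<^bsub>Q\<^esub> \<in> carrier Q" unfolding zero by simp
    show "\<exists>y\<in>carrier Q. y \<oplus>\<^bsub>Q\<^esub> x = \<zero>\<^bsub>Q\<^esub>" if x: "x \<in> carrier Q" for x
    proof -
      obtain u where u: "u \<in> carrier M" "x = proj u" using proj_surj[OF x] by auto
      then have "proj (\<ominus>\<^bsub>M\<^esub> u) \<oplus>\<^bsub>Q\<^esub> x = \<zero>\<^bsub>Q\<^esub>"
        unfolding zero by (simp add: proj_add M.l_neg)
      then show ?thesis using u by (intro bexI[of _ "proj (\<ominus>\<^bsub>M\<^esub> u)"]) auto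
    qed
  qed (auto dest!: proj_surj simp: proj_add M.a_ac zero)
  show ?thesis
    by unfold_locales
      (auto dest!: proj_surj simp: proj_add proj_smult smult_l_distr smult_r_distr smult_assoc)
qed

lemma proj_hom: "(\<lambda>x. proj x) \<in> mod_hom R M Q"
  by (rule mod_homI) (auto simp: proj_add proj_smult)

sublocale proj: module_hom R M Q "\<lambda>x. proj x"
  by (simp add: module_hom_def module_hom_axioms_def proj_hom left_module_quot left_module_axioms)

end

section \<open>Finitely generated modules\<close>

context lmod
begin

lemma submodule_lincombs:
  assumes "k \<in> {..<q} \<rightarrow> carrier M"
  shows "submodule {lincomb M q s k | s. s \<in> {..<q} \<rightarrow> carrier R} R M"
proof (rule submoduleI)
  show "\<zero>\<^bsub>M\<^esub> \<in> {lincomb M q s k | s. s \<in> {..<q} \<rightarrow> carrier R}"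
    using lincomb_zero_left[OF assms] by (intro CollectI exI[of _ "\<lambda>i. \<zero>"]) simp
next
  fix x y assume "x \<in> {lincomb M q s k | s. s \<in> {..<q} \<rightarrow> carrier R}"
    "y \<in> {lincomb M q s k | s. s \<in> {..<q} \<rightarrow> carrier R}"
  then obtain s t where *: "x = lincomb M q s k" "s \<in> {..<q} \<rightarrow> carrier R"
    "y = lincomb M q t k" "t \<in> {..<q} \<rightarrow> carrier R" by blast
  then have "x \<oplus>\<^bsub>M\<^esub> y = lincomb M q (\<lambda>i. s i \<oplus> t i) k" "(\<lambda>i. s i \<oplus> t i) \<in> {..<q} \<rightarrow> carrier R"
    using assms by (auto simp: lincomb_add_left)
  then show "x \<oplus>\<^bsub>M\<^esub> y \<in> {lincomb M q s k | s. s \<in> {..<q} \<rightarrow> carrier R}"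
    by blast
next
  fix r x assume "r \<in> carrier R" "x \<in> {lincomb M q s k | s. s \<in> {..<q} \<rightarrow> carrier R}"
  then obtain s where "r \<in> carrier R" "x = lincomb M q s k" "s \<in> {..<q} \<rightarrow> carrier R" by blast
  then have "r \<odot>\<^bsub>M\<^esub> x = lincomb M q (\<lambda>i. r \<otimes> s i) k" "(\<lambda>i. r \<otimes> s i) \<in> {..<q} \<rightarrow> carrier R"
    using assms by (auto simp: lincomb_smult)
  then show "r \<odot>\<^bsub>M\<^esub> x \<in> {lincomb M q s k | s. s \<in> {..<q} \<rightarrow> carrier R}"
    by blast
qed (use assms in auto)

lemma lincombs_mem:
  assumes "k \<in> {..<q} \<rightarrow> carrier M" "j < q"
  shows "k j \<in> {lincomb M q s k | s. s \<in> {..<q} \<rightarrow> carrier R}"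
proof -
  have "k j = lincomb M q (unit_vec R j) k" using lincomb_unit_vec[OF assms(2,1)] by simp
  moreover have "unit_vec R j \<in> {..<q} \<rightarrow> carrier R" by simp
  ultimately show ?thesis by blast
qed

lemma lin_span_image:
  assumes "k \<in> {..<q} \<rightarrow> carrier M"
  shows "lin_span R M (k ` {..<q}) = {lincomb M q s k | s. s \<in> {..<q} \<rightarrow> carrier R}"
    (is "_ = ?H")
proof
  have "k ` {..<q} \<subseteq> ?H" using lincombs_mem[OF assms] by blast
  then show "lin_span R M (k ` {..<q}) \<subseteq> ?H"
    using submodule_lincombs[OF assms] unfolding lin_span_def by blast
  have "lincomb M q s k \<in> H"
    if "s \<in> {..<q} \<rightarrow> carrier R" "submodule H R M" "k ` {..<q} \<subseteq> H" for s H
    using that by (intro submodule_lincomb) auto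
  then show "?H \<subseteq> lin_span R M (k ` {..<q})"
    unfolding lin_span_def by blast
qed

lemma gen_le_iff:
  "gen R M \<le> enat q \<longleftrightarrow>
   (\<exists>k\<in>{..<q} \<rightarrow> carrier M. \<forall>x\<in>carrier M. \<exists>s\<in>{..<q} \<rightarrow> carrier R. x = lincomb M q s k)"
proof
  assume "gen R M \<le> enat q"
  \<comment> \<open>A strict bound on an infimum yields a member below the bound, that is, an actual
    generating set with at most \<open>q\<close> elements.\<close>
  then have "gen R M < enat (Suc q)" by (meson enat_ord_simps(2) le_less_trans lessI)
  then obtain S where S: "finite S" "S \<subseteq> carrier M" "lin_span R M S = carrier M" "card S \<le> q"
    unfolding gen_def by (auto simp: Inf_less_iff)
  obtain h where h: "bij_betw h {..<card S} S"
    using ex_bij_betw_nat_finite[OF S(1)] by (auto simp: atLeast0LessThan)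
  \<comment> \<open>A generating set with fewer than \<open>q\<close> elements is padded with zeros
    to a family of length \<open>q\<close>.\<close>
  define k where "k j = (if j < card S then h j else \<zero>\<^bsub>M\<^esub>)" for j
  have k: "k \<in> {..<q} \<rightarrow> carrier M" using h S(2) by (fastforce simp: k_def bij_betw_def)
  have "S \<subseteq> k ` {..<q}"
  proof
    fix x assume "x \<in> S"
    then have "x \<in> h ` {..<card S}" using h by (simp add: bij_betw_def)
    then obtain j where "j < card S" "h j = x" by blast
    then show "x \<in> k ` {..<q}" using S(4) by (auto simp: k_def intro!: image_eqI[of _ _ j])
  qed
  then have "lin_span R M S \<subseteq> lin_span R M (k ` {..<q})"
    unfolding lin_span_def by blast
  then have "carrier M \<subseteq> {lincomb M q s k | s. s \<in> {..<q} \<rightarrow> carrier R}"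
    unfolding lin_span_image[OF k] S(3) .
  then show "\<exists>k\<in>{..<q} \<rightarrow> carrier M. \<forall>x\<in>carrier M. \<exists>s\<in>{..<q} \<rightarrow> carrier R. x = lincomb M q s k"
    using k by blast
next
  assume "\<exists>k\<in>{..<q} \<rightarrow> carrier M. \<forall>x\<in>carrier M. \<exists>s\<in>{..<q} \<rightarrow> carrier R. x = lincomb M q s k"
  then obtain k where k: "k \<in> {..<q} \<rightarrow> carrier M"
    "\<forall>x\<in>carrier M. \<exists>s\<in>{..<q} \<rightarrow> carrier R. x = lincomb M q s k" by auto
  have "lin_span R M (k ` {..<q}) = carrier M"
    unfolding lin_span_image[OF k(1)] using k lincomb_closed[OF _ k(1)] by blast
  then have "gen R M \<le> enat (card (k ` {..<q}))"
    unfolding gen_def using k(1) by (intro Inf_lower) auto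
  also have "\<dots> \<le> enat q" using card_image_le[of "{..<q}" k] by simp
  finally show "gen R M \<le> enat q" .
qed

lemma gen_submodule_le_iff:
  assumes "submodule H R M"
  shows "gen R (M\<lparr>carrier := H\<rparr>) \<le> enat q \<longleftrightarrow>
    (\<exists>k\<in>{..<q} \<rightarrow> carrier M. H = {lincomb M q s k | s. s \<in> {..<q} \<rightarrow> carrier R})"
proof -
  interpret H: lmod R "M\<lparr>carrier := H\<rparr>" by (rule lmod.intro left_module_submodule assms)+
  show ?thesis (is "_ = ?R")
  proof
    assume "gen R (M\<lparr>carrier := H\<rparr>) \<le> enat q"
    then obtain k where k: "k \<in> {..<q} \<rightarrow> H"
      "\<And>x. x \<in> H \<Longrightarrow> \<exists>s\<in>{..<q} \<rightarrow> carrier R. x = lincomb (M\<lparr>carrier := H\<rparr>) q s k"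
      unfolding H.gen_le_iff by auto
    have "\<exists>s. x = lincomb M q s k \<and> s \<in> {..<q} \<rightarrow> carrier R" if "x \<in> H" for x
      using k(2)[OF that] lincomb_submodule[OF assms _ k(1)] by metis
    then have "H = {lincomb M q s k | s. s \<in> {..<q} \<rightarrow> carrier R}"
      using submodule_lincomb[OF assms _ k(1)] by blast
    then show ?R using k(1) submodule_subset[OF assms] by (intro bexI[of _ k]) auto
  next
    assume ?R
    then obtain k where k: "k \<in> {..<q} \<rightarrow> carrier M"
      "H = {lincomb M q s k | s. s \<in> {..<q} \<rightarrow> carrier R}" by auto
    have kH: "k \<in> {..<q} \<rightarrow> H"
      unfolding k(2) using lincombs_mem[OF k(1)] by blast
    show "gen R (M\<lparr>carrier := H\<rparr>) \<le> enat q"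
      unfolding H.gen_le_iff
    proof (intro bexI[of _ k] ballI)
      fix x assume "x \<in> carrier (M\<lparr>carrier := H\<rparr>)"
      then obtain s where "s \<in> {..<q} \<rightarrow> carrier R" "x = lincomb M q s k" using k(2) by auto
      then show "\<exists>s\<in>{..<q} \<rightarrow> carrier R. x = lincomb (M\<lparr>carrier := H\<rparr>) q s k"
        using lincomb_submodule[OF assms _ kH] by metis
    qed (use kH in auto)
  qed
qed

end

section \<open>Presentations by matrices\<close>

definition row_span :: "('a, 'k) ring_scheme \<Rightarrow> nat \<Rightarrow> nat \<Rightarrow> (nat \<Rightarrow> nat \<Rightarrow> 'a) \<Rightarrow> (nat \<Rightarrow> 'a) set" where
  "row_span R p q k = {\<lambda>i\<in>{..<p}. dot R q s (\<lambda>j. k j i) | s. s \<in> {..<q} \<rightarrow> carrier R}"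

definition is_matrix :: "('a, 'k) ring_scheme \<Rightarrow> nat \<Rightarrow> nat \<Rightarrow> (nat \<Rightarrow> nat \<Rightarrow> 'a) \<Rightarrow> bool" where
  "is_matrix R q p k \<longleftrightarrow> (\<forall>j<q. \<forall>i<p. k j i \<in> carrier R)"

text \<open>\<open>R\<^sup>p\<close> modulo the rows of \<open>k\<close>. The test modules, the
  summands of the canonical sequence and its last term are all taken in this form, which has the
  carrier type \<open>'a univ\<close> by construction.\<close>

definition coker :: "('a, 'k) ring_scheme \<Rightarrow> nat \<Rightarrow> nat \<Rightarrow> (nat \<Rightarrow> nat \<Rightarrow> 'a) \<Rightarrow> ('a, 'a univ) module" where
  "coker R p q k = quot_module (free_module R p) (row_span R p q k)"

definition coker_proj ::
  "('a, 'k) ring_scheme \<Rightarrow> nat \<Rightarrow> nat \<Rightarrow> (nat \<Rightarrow> nat \<Rightarrow> 'a) \<Rightarrow> (nat \<Rightarrow> 'a) \<Rightarrow> 'a univ" where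
  "coker_proj R p q k x = row_span R p q k +>\<^bsub>free_module R p\<^esub> restrict x {..<p}"

text \<open>Generators together with a complete set of relations. This replaces the isomorphism with
  a quotient of a free module, so that later arguments compute with linear combinations
  only.\<close>

definition has_presentation ::
  "('a, 'k) ring_scheme \<Rightarrow> nat \<Rightarrow> nat \<Rightarrow> ('a, 'b) module \<Rightarrow> (nat \<Rightarrow> 'b) \<Rightarrow> (nat \<Rightarrow> nat \<Rightarrow> 'a) \<Rightarrow> bool" where
  "has_presentation R p q X x k \<longleftrightarrow> x \<in> {..<p} \<rightarrow> carrier X \<and> is_matrix R q p k \<and>
     (\<forall>y\<in>carrier X. \<exists>\<rho>\<in>{..<p} \<rightarrow> carrier R. y = lincomb X p \<rho> x) \<and>
     (\<forall>\<rho>\<in>{..<p} \<rightarrow> carrier R. lincomb X p \<rho> x = \<zero>\<^bsub>X\<^esub> \<longleftrightarrow>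
        (\<exists>s\<in>{..<q} \<rightarrow> carrier R. \<forall>i<p. \<rho> i = dot R q s (\<lambda>j. k j i)))"

lemma is_matrix_row: "\<lbrakk>is_matrix R q p k; j < q\<rbrakk> \<Longrightarrow> k j \<in> {..<p} \<rightarrow> carrier R"
  by (simp add: is_matrix_def)

lemma is_matrix_col: "\<lbrakk>is_matrix R q p k; i < p\<rbrakk> \<Longrightarrow> (\<lambda>j. k j i) \<in> {..<q} \<rightarrow> carrier R"
  by (simp add: is_matrix_def)

lemma is_matrixD: "\<lbrakk>is_matrix R q p k; j < q; i < p\<rbrakk> \<Longrightarrow> k j i \<in> carrier R"
  by (simp add: is_matrix_def)

lemma is_matrix_opp_ring [simp]: "is_matrix (opp_ring R) q p k = is_matrix R q p k"
  by (simp add: is_matrix_def)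

lemma is_matrix_restrict:
  "is_matrix R q p k \<Longrightarrow> (\<lambda>j. restrict (k j) {..<p}) \<in> {..<q} \<rightarrow> ({..<p} \<rightarrow>\<^sub>E carrier R)"
  by (auto simp: is_matrix_def)

lemma (in ring) dot_cong:
  "\<lbrakk>x' \<in> {..<q} \<rightarrow> carrier R; y' \<in> {..<q} \<rightarrow> carrier R; \<And>i. i < q \<Longrightarrow> x i = x' i;
    \<And>i. i < q \<Longrightarrow> y i = y' i\<rbrakk> \<Longrightarrow> dot R q x y = dot R q x' y'"
  unfolding dot_def by (rule finsum_cong') auto

lemma (in ring) row_span_eq:
  assumes "is_matrix R q p k"
  shows "row_span R p q k =
    {lincomb (free_module R p) q s (\<lambda>j. restrict (k j) {..<p}) | s. s \<in> {..<q} \<rightarrow> carrier R}"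
proof -
  have "lincomb (free_module R p) q s (\<lambda>j. restrict (k j) {..<p}) = (\<lambda>i\<in>{..<p}. dot R q s (\<lambda>j. k j i))"
    if "s \<in> {..<q} \<rightarrow> carrier R" for s
    by (subst lincomb_free_module[OF that is_matrix_restrict[OF assms]])
      (auto simp: fun_eq_iff)
  then show ?thesis unfolding row_span_def by (intro Collect_cong) metis
qed

lemma (in ring) submodule_row_span:
  assumes "is_matrix R q p k"
  shows "submodule (row_span R p q k) R (free_module R p)"
proof -
  interpret F: lmod R "free_module R p" by (intro lmod.intro free_left_module) unfold_locales
  show ?thesis
    unfolding row_span_eq[OF assms]
    by (rule F.submodule_lincombs) (use is_matrix_restrict[OF assms] in simp)
qed

lemma submodule_quotient_of:
  assumes "ring R" "is_matrix R q p k"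
  shows "quotient_of R (free_module R p) (row_span R p q k)"
  using assms
  by (simp add: quotient_of_def quotient_of_axioms_def lmod_def free_left_module ring.submodule_row_span)

context ring
begin

lemma left_module_coker: "is_matrix R q p k \<Longrightarrow> left_module R (coker R p q k)"
  using quotient_of.left_module_quot[OF submodule_quotient_of] ring_axioms by (simp add: coker_def)

lemma coker_proj_lincomb:
  assumes "is_matrix R q p k" "x \<in> {..<p} \<rightarrow> carrier R"
  shows "lincomb (coker R p q k) p x (\<lambda>i. coker_proj R p q k (unit_vec R i)) = coker_proj R p q k x"
proof -
  interpret Q: quotient_of R "free_module R p" "row_span R p q k"
    by (rule submodule_quotient_of) (use assms ring_axioms in auto)
  have r: "restrict x {..<p} \<in> {..<p} \<rightarrow>\<^sub>E carrier R" using assms by auto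
  have "coker_proj R p q k x = Q.proj (lincomb (free_module R p) p (restrict x {..<p}) (basis_vec R p))"
    using free_module_expansion[OF r] by (simp add: coker_proj_def)
  also have "\<dots> = lincomb (coker R p q k) p (restrict x {..<p}) (\<lambda>i. Q.proj (basis_vec R p i))"
    using r unfolding coker_def by (subst Q.proj.lincomb) auto
  also have "\<dots> = lincomb (coker R p q k) p x (\<lambda>i. Q.proj (basis_vec R p i))"
    unfolding coker_def by (rule Q.proj.N.lincomb_cong) (use assms in auto)
  finally show ?thesis by (simp add: coker_proj_def basis_vec_def)
qed

lemma coker_proj_eq_zero_iff:
  assumes "is_matrix R q p k" "x \<in> {..<p} \<rightarrow> carrier R"
  shows "coker_proj R p q k x = \<zero>\<^bsub>coker R p q k\<^esub> \<longleftrightarrow>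
    (\<exists>s\<in>{..<q} \<rightarrow> carrier R. \<forall>i<p. x i = dot R q s (\<lambda>j. k j i))"
proof -
  interpret Q: quotient_of R "free_module R p" "row_span R p q k"
    by (rule submodule_quotient_of) (use assms ring_axioms in auto)
  have r: "restrict x {..<p} \<in> {..<p} \<rightarrow>\<^sub>E carrier R" using assms by auto
  have "coker_proj R p q k x = \<zero>\<^bsub>coker R p q k\<^esub> \<longleftrightarrow> restrict x {..<p} \<in> row_span R p q k"
    using Q.proj_eq_zero_iff[of "restrict x {..<p}"] r
    by (simp add: coker_proj_def coker_def quot_module_simps)
  also have "\<dots> \<longleftrightarrow> (\<exists>s\<in>{..<q} \<rightarrow> carrier R. \<forall>i<p. x i = dot R q s (\<lambda>j. k j i))"
    by (auto simp: row_span_def fun_eq_iff restrict_def)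
  finally show ?thesis .
qed

lemma coker_proj_surj:
  assumes "is_matrix R q p k" "y \<in> carrier (coker R p q k)"
  shows "\<exists>x\<in>{..<p} \<rightarrow>\<^sub>E carrier R. y = coker_proj R p q k x"
proof -
  interpret Q: quotient_of R "free_module R p" "row_span R p q k"
    by (rule submodule_quotient_of) (use assms ring_axioms in auto)
  show ?thesis
    using Q.proj_surj[of y] assms(2) by (auto simp: coker_def coker_proj_def PiE_restrict)
qed

lemma coker_proj_closed:
  assumes "is_matrix R q p k" "x \<in> {..<p} \<rightarrow> carrier R"
  shows "coker_proj R p q k x \<in> carrier (coker R p q k)"
proof -
  interpret Q: quotient_of R "free_module R p" "row_span R p q k"
    by (rule submodule_quotient_of) (use assms ring_axioms in auto)
  have r: "restrict x {..<p} \<in> {..<p} \<rightarrow>\<^sub>E carrier R" using assms by auto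
  show ?thesis unfolding coker_def coker_proj_def using r by simp
qed

lemma coker_has_presentation:
  assumes "is_matrix R q p k"
  shows "has_presentation R p q (coker R p q k) (\<lambda>i. coker_proj R p q k (unit_vec R i)) k"
  unfolding has_presentation_def
proof (intro conjI ballI)
  show "\<exists>\<rho>\<in>{..<p} \<rightarrow> carrier R. y = lincomb (coker R p q k) p \<rho> (\<lambda>i. coker_proj R p q k (unit_vec R i))"
    if y: "y \<in> carrier (coker R p q k)" for y
  proof -
    obtain x where x: "x \<in> {..<p} \<rightarrow>\<^sub>E carrier R" "y = coker_proj R p q k x"
      using coker_proj_surj[OF assms y] by blast
    have "y = lincomb (coker R p q k) p x (\<lambda>i. coker_proj R p q k (unit_vec R i))"
      by (subst coker_proj_lincomb[OF assms]) (use x in simp_all)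
    then show ?thesis using PiE_into_Pi[OF x(1)] by blast
  qed
  show "(\<lambda>i. coker_proj R p q k (unit_vec R i)) \<in> {..<p} \<rightarrow> carrier (coker R p q k)"
    by (intro Pi_I coker_proj_closed[OF assms]) simp
  show "lincomb (coker R p q k) p \<rho> (\<lambda>i. coker_proj R p q k (unit_vec R i)) = \<zero>\<^bsub>coker R p q k\<^esub> \<longleftrightarrow>
      (\<exists>s\<in>{..<q} \<rightarrow> carrier R. \<forall>i<p. \<rho> i = dot R q s (\<lambda>j. k j i))"
    if "\<rho> \<in> {..<p} \<rightarrow> carrier R" for \<rho>
    unfolding coker_proj_lincomb[OF assms that] by (rule coker_proj_eq_zero_iff[OF assms that])
qed (fact assms)

lemma coker_presented:
  assumes "is_matrix R q p k"
  shows "presented R p q (coker R p q k)"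
proof -
  interpret F: lmod R "free_module R p" by (intro lmod.intro free_left_module) unfold_locales
  have "gen R ((free_module R p)\<lparr>carrier := row_span R p q k\<rparr>) \<le> enat q"
    unfolding F.gen_submodule_le_iff[OF submodule_row_span[OF assms]]
    using row_span_eq[OF assms] is_matrix_restrict[OF assms]
    by (intro bexI[of _ "\<lambda>j. restrict (k j) {..<p}"]) auto
  moreover have "mod_iso R (coker R p q k) (quot_module (free_module R p) (row_span R p q k))"
    unfolding mod_iso_def
    by (rule bexI[of _ "\<lambda>x. x"]) (auto simp: coker_def mod_hom_def hom_def bij_betw_def)
  ultimately show ?thesis
    unfolding presented_def using left_module_coker[OF assms] submodule_row_span[OF assms] by blast
qed

lemma presented_imp_iso_coker:
  assumes "presented R p q X"
  shows "left_module R X \<and> (\<exists>k. is_matrix R q p k \<and> mod_iso R X (coker R p q k))"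
proof -
  interpret F: lmod R "free_module R p" by (intro lmod.intro free_left_module) unfold_locales
    obtain K where K: "left_module R X" "submodule K R (free_module R p)"
      "gen R ((free_module R p)\<lparr>carrier := K\<rparr>) \<le> enat q"
      "mod_iso R X (quot_module (free_module R p) K)" using assms by (auto simp: presented_def)
    then obtain k where k: "k \<in> {..<q} \<rightarrow> carrier (free_module R p)"
      "K = {lincomb (free_module R p) q s k | s. s \<in> {..<q} \<rightarrow> carrier R}"
      unfolding F.gen_submodule_le_iff[OF K(2)] by auto
    have m: "is_matrix R q p k" using k(1) by (auto simp: is_matrix_def)
    have "k j = restrict (k j) {..<p}" if "j < q" for j
      using k(1) that by (subst PiE_restrict) auto
    then have "lincomb (free_module R p) q s k = lincomb (free_module R p) q s (\<lambda>j. restrict (k j) {..<p})"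
      if "s \<in> {..<q} \<rightarrow> carrier R" for s
      using that is_matrix_restrict[OF m] by (intro F.lincomb_cong) auto
    then have "K = row_span R p q k" unfolding k(2) row_span_eq[OF m] by (intro Collect_cong) metis
    then show ?thesis
      using K m by (auto simp: coker_def)
qed

end

lemma (in ring) coker_proj_combination:
  assumes k: "is_matrix R q p k" and x: "x \<in> {..<n} \<rightarrow> carrier R" and F: "is_matrix R n p F"
  shows "lincomb (coker R p q k) n x (\<lambda>j. coker_proj R p q k (F j)) = coker_proj R p q k (\<lambda>i. dot R n x (\<lambda>j. F j i))"
proof -
  interpret M: left_module R "coker R p q k" by (rule left_module_coker[OF k])
  let ?e = "\<lambda>i. coker_proj R p q k (unit_vec R i)"
  have e: "?e \<in> {..<p} \<rightarrow> carrier (coker R p q k)" by (intro Pi_I coker_proj_closed[OF k]) simp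
  have "coker_proj R p q k (\<lambda>i. dot R n x (\<lambda>j. F j i)) = lincomb (coker R p q k) p (\<lambda>i. dot R n x (\<lambda>j. F j i)) ?e"
    using x is_matrix_col[OF F] by (intro coker_proj_lincomb[OF k, symmetric] Pi_I dot_closed) auto
  also have "\<dots> = lincomb (coker R p q k) n x (\<lambda>j. lincomb (coker R p q k) p (F j) ?e)"
    by (rule M.lincomb_assoc[OF x _ e]) (use F in \<open>simp add: is_matrix_def\<close>)
  also have "\<dots> = lincomb (coker R p q k) n x (\<lambda>j. coker_proj R p q k (F j))"
    using is_matrix_row[OF F] by (intro M.lincomb_cong x Pi_I coker_proj_closed[OF k] coker_proj_lincomb[OF k]) auto
  finally show ?thesis ..
qed

lemma mod_iso_has_presentation:
  assumes "left_module R X" "left_module R Y" "mod_iso R X Y" "has_presentation R p q Y y k"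
  shows "\<exists>x. has_presentation R p q X x k"
proof -
  obtain f where f: "f \<in> mod_hom R X Y" "bij_betw f (carrier X) (carrier Y)"
    using assms(3) by (auto simp: mod_iso_def)
  interpret f: module_hom R X Y f
    using assms f by (simp add: module_hom_def module_hom_axioms_def)
  define x where "x i = inv_into (carrier X) f (y i)" for i
  have y: "y \<in> {..<p} \<rightarrow> carrier Y" using assms(4) by (simp add: has_presentation_def)
  then have yf: "y i \<in> f ` carrier X" if "i < p" for i
    using f(2) that by (auto simp: bij_betw_def Pi_def)
  then have x: "x \<in> {..<p} \<rightarrow> carrier X" "\<And>i. i < p \<Longrightarrow> f (x i) = y i"
    by (auto simp: x_def f_inv_into_f intro!: inv_into_into)
  have lc: "f (lincomb X p \<rho> x) = lincomb Y p \<rho> y" if "\<rho> \<in> {..<p} \<rightarrow> carrier R" for \<rho>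
    using that x y by (auto simp: f.lincomb intro!: f.N.lincomb_cong)
  have inj: "u = v" if "f u = f v" "u \<in> carrier X" "v \<in> carrier X" for u v
    using that f(2) by (auto simp: bij_betw_def inj_on_def)
  have "has_presentation R p q X x k"
    unfolding has_presentation_def
  proof (intro conjI ballI)
    fix u assume u: "u \<in> carrier X"
    then obtain \<rho> where r: "\<rho> \<in> {..<p} \<rightarrow> carrier R" "f u = lincomb Y p \<rho> y"
      using assms(4) f.closed unfolding has_presentation_def by meson
    then show "\<exists>\<rho>\<in>{..<p} \<rightarrow> carrier R. u = lincomb X p \<rho> x"
      using inj[of u "lincomb X p \<rho> x"] lc[OF r(1)] u x(1) by auto
  next
    fix \<rho> assume r: "\<rho> \<in> {..<p} \<rightarrow> carrier R"
    have "lincomb X p \<rho> x = \<zero>\<^bsub>X\<^esub> \<longleftrightarrow> lincomb Y p \<rho> y = \<zero>\<^bsub>Y\<^esub>"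
      using lc[OF r] inj[of "lincomb X p \<rho> x" "\<zero>\<^bsub>X\<^esub>"] r x f.zero by auto
    then show "lincomb X p \<rho> x = \<zero>\<^bsub>X\<^esub> \<longleftrightarrow> (\<exists>s\<in>{..<q} \<rightarrow> carrier R. \<forall>i<p. \<rho> i = dot R q s (\<lambda>j. k j i))"
      using assms(4) r by (simp add: has_presentation_def)
  qed (use x assms(4) in \<open>auto simp: has_presentation_def\<close>)
  then show ?thesis by blast
qed

lemma presented_has_presentation:
  assumes "ring R" "presented R p q X"
  shows "\<exists>x k. has_presentation R p q X x k"
proof -
  interpret ring R by fact
  show ?thesis
    using presented_imp_iso_coker[OF assms(2)]
    using mod_iso_has_presentation left_module_coker coker_has_presentation by blast
qed

locale presentation = X: lmod R X for R :: "('a, 'k) ring_scheme" (structure) and X :: "('a, 'b) module" +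
  fixes p q x k
  assumes pres: "has_presentation R p q X x k"
begin

lemma x_closed [simp]: "x \<in> {..<p} \<rightarrow> carrier X"
  using pres by (simp add: has_presentation_def)

lemma k_matrix: "is_matrix R q p k"
  using pres by (simp add: has_presentation_def)

lemma generates: "y \<in> carrier X \<Longrightarrow> \<exists>\<rho>\<in>{..<p} \<rightarrow> carrier R. y = lincomb X p \<rho> x"
  using pres by (simp add: has_presentation_def)

lemma relation_iff:
  "\<rho> \<in> {..<p} \<rightarrow> carrier R \<Longrightarrow> lincomb X p \<rho> x = \<zero>\<^bsub>X\<^esub> \<longleftrightarrow>
   (\<exists>s\<in>{..<q} \<rightarrow> carrier R. \<forall>i<p. \<rho> i = dot R q s (\<lambda>j. k j i))"
  using pres by (simp add: has_presentation_def)

definition coords where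
  "coords y = (SOME \<rho>. \<rho> \<in> {..<p} \<rightarrow> carrier R \<and> y = lincomb X p \<rho> x)"

lemma coords:
  assumes "y \<in> carrier X"
  shows "coords y \<in> {..<p} \<rightarrow> carrier R" "lincomb X p (coords y) x = y"
  using someI_ex[of "\<lambda>\<rho>. \<rho> \<in> {..<p} \<rightarrow> carrier R \<and> y = lincomb X p \<rho> x"] generates[OF assms]
  unfolding coords_def[symmetric] by (blast, metis)

lemma relation_diff:
  assumes "\<rho> \<in> {..<p} \<rightarrow> carrier R" "\<sigma> \<in> {..<p} \<rightarrow> carrier R" "lincomb X p \<rho> x = lincomb X p \<sigma> x"
  shows "\<exists>s\<in>{..<q} \<rightarrow> carrier R. \<forall>i<p. \<rho> i \<ominus> \<sigma> i = dot R q s (\<lambda>j. k j i)"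
proof -
  have "lincomb X p (\<lambda>i. \<rho> i \<ominus> \<sigma> i) x = \<zero>\<^bsub>X\<^esub>"
    using assms X.lincomb_diff_left[OF assms(1,2) x_closed]
    by (simp add: X.M.r_neg a_minus_def[of X])
  then show ?thesis
    using assms by (subst relation_iff[symmetric]) auto
qed

end

text \<open>Well-definedness of the assignment of \<open>y\<close> to the generators
  \<open>x\<close>: two coordinate vectors of the same element differ by a combination of rows of
  \<open>k\<close>, and every row annihilates \<open>y\<close>.\<close>

lemma (in lmod) lincomb_eq_of_presentation:
  assumes "presentation R X p q x k" "y \<in> {..<p} \<rightarrow> carrier M"
    "\<And>j. j < q \<Longrightarrow> lincomb M p (k j) y = \<zero>\<^bsub>M\<^esub>"
    "\<rho> \<in> {..<p} \<rightarrow> carrier R" "\<sigma> \<in> {..<p} \<rightarrow> carrier R" "lincomb X p \<rho> x = lincomb X p \<sigma> x"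
  shows "lincomb M p \<rho> y = lincomb M p \<sigma> y"
proof -
  interpret P: presentation R X p q x k by fact
  obtain s where s: "s \<in> {..<q} \<rightarrow> carrier R" "\<And>i. i < p \<Longrightarrow> \<rho> i \<ominus> \<sigma> i = dot R q s (\<lambda>j. k j i)"
    using P.relation_diff[OF assms(4-6)] by auto
  have "lincomb M p \<rho> y \<ominus>\<^bsub>M\<^esub> lincomb M p \<sigma> y = lincomb M p (\<lambda>i. \<rho> i \<ominus> \<sigma> i) y"
    using assms by (simp add: lincomb_diff_left)
  also have "\<dots> = lincomb M p (\<lambda>i. dot R q s (\<lambda>j. k j i)) y"
    by (rule lincomb_cong) (use s assms(2) P.k_matrix in \<open>auto intro!: R.dot_closed simp: is_matrix_def\<close>)
  also have "\<dots> = lincomb M q s (\<lambda>j. lincomb M p (k j) y)"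
    by (rule lincomb_assoc) (use s assms(2) P.k_matrix in \<open>auto simp: is_matrix_def\<close>)
  also have "\<dots> = lincomb M q s (\<lambda>j. \<zero>\<^bsub>M\<^esub>)"
    by (rule lincomb_cong) (use s assms(3) in auto)
  also have "\<dots> = \<zero>\<^bsub>M\<^esub>" using s by simp
  finally show ?thesis using assms by (simp add: M.diff_eq_zero_iff)
qed

text \<open>The universal property of a presentation. The map is computed from arbitrarily chosen
  coordinates; since it does not depend on the choice, it may be evaluated on the sum of two
  coordinate vectors, which gives additivity.\<close>

lemma (in lmod) hom_of_presentation:
  assumes "presentation R X p q x k" "y \<in> {..<p} \<rightarrow> carrier M"
    "\<And>j. j < q \<Longrightarrow> lincomb M p (k j) y = \<zero>\<^bsub>M\<^esub>"
  shows "\<exists>f\<in>mod_hom R X M. \<forall>\<rho>\<in>{..<p} \<rightarrow> carrier R. f (lincomb X p \<rho> x) = lincomb M p \<rho> y"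
proof -
  interpret P: presentation R X p q x k by fact
  define f where "f z = lincomb M p (P.coords z) y" for z
  have f: "f (lincomb X p \<rho> x) = lincomb M p \<rho> y" if "\<rho> \<in> {..<p} \<rightarrow> carrier R" for \<rho>
    unfolding f_def using that P.coords P.X.lincomb_closed P.x_closed
    by (intro lincomb_eq_of_presentation[OF assms]) auto
  have "f \<in> mod_hom R X M"
  proof (rule mod_homI)
    show "f \<in> carrier X \<rightarrow> carrier M" unfolding f_def using P.coords assms(2) by auto
  next
    fix u v assume "u \<in> carrier X" "v \<in> carrier X"
    note uv = P.coords[OF this(1)] P.coords[OF this(2)]
    have "u \<oplus>\<^bsub>X\<^esub> v = lincomb X p (\<lambda>i. P.coords u i \<oplus> P.coords v i) x"
      using uv by (simp add: P.X.lincomb_add_left)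
    then have "f (u \<oplus>\<^bsub>X\<^esub> v) = lincomb M p (\<lambda>i. P.coords u i \<oplus> P.coords v i) y"
      using f uv(1,3) by (simp add: Pi_def)
    then show "f (u \<oplus>\<^bsub>X\<^esub> v) = f u \<oplus>\<^bsub>M\<^esub> f v"
      using uv assms(2) by (simp add: f_def lincomb_add_left)
  next
    fix r u assume r: "r \<in> carrier R" and "u \<in> carrier X"
    note u = P.coords[OF this(2)]
    have "r \<odot>\<^bsub>X\<^esub> u = lincomb X p (\<lambda>i. r \<otimes> P.coords u i) x"
      using u r by (simp add: P.X.lincomb_smult)
    then have "f (r \<odot>\<^bsub>X\<^esub> u) = lincomb M p (\<lambda>i. r \<otimes> P.coords u i) y"
      using f u(1) r by (simp add: Pi_def)
    then show "f (r \<odot>\<^bsub>X\<^esub> u) = r \<odot>\<^bsub>M\<^esub> f u"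
      using u r assms(2) by (simp add: f_def lincomb_smult)
  qed
  then show ?thesis using f by auto
qed

section \<open>Tensor products with finitely presented modules\<close>

locale tensor_product = X: lmod "opp_ring R" X + M: lmod R M
  for R :: "('a, 'k) ring_scheme" (structure) and X :: "('a, 'b) module" and M :: "('a, 'c) module"
begin

abbreviation F where "F \<equiv> free_Abelian_group (carrier X \<times> carrier M)"
abbreviation N where "N \<equiv> tensor_kernel R X M"

sublocale F: comm_group F
  by (rule abelian_free_Abelian_group)

lemma tensor_relations_cases:
  assumes "w \<in> tensor_relations R X M"
  obtains (add_left) z z' y where "w = frag_of (z \<oplus>\<^bsub>X\<^esub> z', y) - frag_of (z, y) - frag_of (z', y)"
      "z \<in> carrier X" "z' \<in> carrier X" "y \<in> carrier M"
  | (add_right) z y y' where "w = frag_of (z, y \<oplus>\<^bsub>M\<^esub> y') - frag_of (z, y) - frag_of (z, y')"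
      "z \<in> carrier X" "y \<in> carrier M" "y' \<in> carrier M"
  | (balance) r z y where "w = frag_of (r \<odot>\<^bsub>X\<^esub> z, y) - frag_of (z, r \<odot>\<^bsub>M\<^esub> y)"
      "r \<in> carrier R" "z \<in> carrier X" "y \<in> carrier M"
  using assms unfolding tensor_relations_def by blast

lemma keys_frag_of_subset: "\<lbrakk>z \<in> carrier X; y \<in> carrier M\<rbrakk> \<Longrightarrow>
    Poly_Mapping.keys (frag_of (z, y)) \<subseteq> carrier X \<times> carrier M"
  by (simp add: keys_frag_of)

lemma keys_diff_subset: "\<lbrakk>Poly_Mapping.keys v \<subseteq> S; Poly_Mapping.keys w \<subseteq> S\<rbrakk> \<Longrightarrow>
    Poly_Mapping.keys (v - w) \<subseteq> S" for v w :: "'z \<Rightarrow>\<^sub>0 int"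
  using keys_diff[of v w] by blast

lemma relations_subset: "tensor_relations R X M \<subseteq> carrier F"
proof
  fix w assume "w \<in> tensor_relations R X M"
  then have "Poly_Mapping.keys w \<subseteq> carrier X \<times> carrier M"
    by (cases rule: tensor_relations_cases)
      (simp_all only: keys_diff_subset keys_frag_of_subset X.M.add.m_closed M.M.add.m_closed
        X.smult_closed M.smult_closed opp_ring_simps)
  then show "w \<in> carrier F" by simp
qed

lemma subgroup_N: "subgroup N F"
  unfolding tensor_kernel_def by (rule F.generate_is_subgroup) (rule relations_subset)

lemma normal_N: "N \<lhd> F"
  by (rule F.subgroup_imp_normal) (rule subgroup_N)

lemma N_carrier: "w \<in> N \<Longrightarrow> Poly_Mapping.keys w \<subseteq> carrier X \<times> carrier M"
  by (rule carrier_free_Abelian_group_iff[THEN iffD1, OF subsetD[OF subgroup.subset[OF subgroup_N]]])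

lemma N_zero: "0 \<in> N"
  using subgroup.one_closed[OF subgroup_N] by simp

lemma N_add: "\<lbrakk>v \<in> N; w \<in> N\<rbrakk> \<Longrightarrow> v + w \<in> N"
  using subgroup.m_closed[OF subgroup_N] by simp

lemma N_neg: "w \<in> N \<Longrightarrow> - w \<in> N"
  using subgroup.m_inv_closed[OF subgroup_N] N_carrier by simp

lemma N_diff: "\<lbrakk>v \<in> N; w \<in> N\<rbrakk> \<Longrightarrow> v - w \<in> N"
  using N_add[OF _ N_neg] by simp

lemma N_relation: "w \<in> tensor_relations R X M \<Longrightarrow> w \<in> N"
  unfolding tensor_kernel_def by (rule generate.incl)

text \<open>Equality of tensors, expressed on representatives: computations take place in the free
  abelian group modulo \<open>N\<close> and avoid cosets.\<close>

definition teq where "teq v w \<longleftrightarrow> v - w \<in> N"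

lemma teq_refl [simp]: "teq v v"
  by (simp add: teq_def N_zero)

lemma teq_sym: "teq v w \<Longrightarrow> teq w v"
  using N_neg[of "v - w"] by (simp add: teq_def)

lemma teq_trans [trans]: "\<lbrakk>teq u v; teq v w\<rbrakk> \<Longrightarrow> teq u w"
  using N_add[of "u - v" "v - w"] by (simp add: teq_def)

lemma teq_add: "\<lbrakk>teq v w; teq v' w'\<rbrakk> \<Longrightarrow> teq (v + v') (w + w')"
  using N_add[of "v - w" "v' - w'"] by (simp add: teq_def algebra_simps)

lemma teq_diff: "\<lbrakk>teq v w; teq v' w'\<rbrakk> \<Longrightarrow> teq (v - v') (w - w')"
  using N_diff[of "v - w" "v' - w'"] by (simp add: teq_def algebra_simps)

lemma teq_sum:
  "(\<And>i. i \<in> A \<Longrightarrow> teq (f i) (g i)) \<Longrightarrow> teq (sum f A) (sum g A)"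
  by (induct A rule: infinite_finite_induct) (auto intro: teq_add)

lemma teq_add_left:
  assumes "x \<in> carrier X" "x' \<in> carrier X" "y \<in> carrier M"
  shows "teq (frag_of (x \<oplus>\<^bsub>X\<^esub> x', y)) (frag_of (x, y) + frag_of (x', y))"
proof -
  have "frag_of (x \<oplus>\<^bsub>X\<^esub> x', y) - frag_of (x, y) - frag_of (x', y) \<in> N"
    by (rule N_relation) (use assms in \<open>unfold tensor_relations_def, blast\<close>)
  then show ?thesis by (simp add: teq_def algebra_simps)
qed

lemma teq_add_right:
  assumes "x \<in> carrier X" "y \<in> carrier M" "y' \<in> carrier M"
  shows "teq (frag_of (x, y \<oplus>\<^bsub>M\<^esub> y')) (frag_of (x, y) + frag_of (x, y'))"
proof -
  have "frag_of (x, y \<oplus>\<^bsub>M\<^esub> y') - frag_of (x, y) - frag_of (x, y') \<in> N"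
    by (rule N_relation) (use assms in \<open>unfold tensor_relations_def, blast\<close>)
  then show ?thesis by (simp add: teq_def algebra_simps)
qed

lemma teq_balance:
  assumes "r \<in> carrier R" "x \<in> carrier X" "y \<in> carrier M"
  shows "teq (frag_of (r \<odot>\<^bsub>X\<^esub> x, y)) (frag_of (x, r \<odot>\<^bsub>M\<^esub> y))"
  unfolding teq_def
  by (rule N_relation) (use assms in \<open>unfold tensor_relations_def, blast\<close>)

lemma teq_zero_right:
  assumes "x \<in> carrier X"
  shows "teq (frag_of (x, \<zero>\<^bsub>M\<^esub>)) 0"
  using teq_add_right[OF assms M.M.zero_closed M.M.zero_closed] N_neg by (force simp: teq_def)

lemma teq_zero_left:
  assumes "y \<in> carrier M"
  shows "teq (frag_of (\<zero>\<^bsub>X\<^esub>, y)) 0"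
  using teq_add_left[OF X.M.zero_closed X.M.zero_closed assms] N_neg by (force simp: teq_def)

lemma teq_finsum_right:
  assumes "finite A" "x \<in> carrier X" "f \<in> A \<rightarrow> carrier M"
  shows "teq (frag_of (x, \<Oplus>\<^bsub>M\<^esub>i\<in>A. f i)) (\<Sum>i\<in>A. frag_of (x, f i))"
  using assms(1,3)
proof (induct set: finite)
  case (insert a A)
  then have "teq (frag_of (x, f a \<oplus>\<^bsub>M\<^esub> (\<Oplus>\<^bsub>M\<^esub>i\<in>A. f i))) (frag_of (x, f a) + frag_of (x, \<Oplus>\<^bsub>M\<^esub>i\<in>A. f i))"
    using assms(2) by (intro teq_add_right) auto
  also have "teq \<dots> (frag_of (x, f a) + (\<Sum>i\<in>A. frag_of (x, f i)))"
    using insert by (intro teq_add) auto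
  finally show ?case using insert by (simp add: Pi_def)
qed (use teq_zero_right assms(2) in simp)

lemma teq_finsum_left:
  assumes "finite A" "y \<in> carrier M" "f \<in> A \<rightarrow> carrier X"
  shows "teq (frag_of (\<Oplus>\<^bsub>X\<^esub>i\<in>A. f i, y)) (\<Sum>i\<in>A. frag_of (f i, y))"
  using assms(1,3)
proof (induct set: finite)
  case (insert a A)
  then have "teq (frag_of (f a \<oplus>\<^bsub>X\<^esub> (\<Oplus>\<^bsub>X\<^esub>i\<in>A. f i), y)) (frag_of (f a, y) + frag_of (\<Oplus>\<^bsub>X\<^esub>i\<in>A. f i, y))"
    using assms(2) by (intro teq_add_left) auto
  also have "teq \<dots> (frag_of (f a, y) + (\<Sum>i\<in>A. frag_of (f i, y)))"
    using insert by (intro teq_add) auto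
  finally show ?case using insert by (simp add: Pi_def)
qed (use teq_zero_left assms(2) in simp)

lemma teq_lincomb_left:
  assumes "y \<in> carrier M" "\<rho> \<in> {..<p} \<rightarrow> carrier R" "x \<in> {..<p} \<rightarrow> carrier X"
  shows "teq (frag_of (lincomb X p \<rho> x, y)) (\<Sum>i<p. frag_of (x i, \<rho> i \<odot>\<^bsub>M\<^esub> y))"
proof -
  have "teq (frag_of (lincomb X p \<rho> x, y)) (\<Sum>i<p. frag_of (\<rho> i \<odot>\<^bsub>X\<^esub> x i, y))"
    unfolding lincomb_def using assms
    by (intro teq_finsum_left Pi_I X.smult_closed) (auto dest: funcset_mem)
  also have "teq \<dots> (\<Sum>i<p. frag_of (x i, \<rho> i \<odot>\<^bsub>M\<^esub> y))"
    using assms by (intro teq_sum teq_balance) auto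
  finally show ?thesis .
qed

lemma rcos_eq_iff:
  assumes "Poly_Mapping.keys v \<subseteq> carrier X \<times> carrier M" "Poly_Mapping.keys w \<subseteq> carrier X \<times> carrier M"
  shows "N #>\<^bsub>F\<^esub> v = N #>\<^bsub>F\<^esub> w \<longleftrightarrow> teq v w"
proof -
  have "v \<in> N #>\<^bsub>F\<^esub> w \<longleftrightarrow> teq v w"
    using assms subgroup.rcos_module[OF subgroup_N F.is_group, of w v] by (simp add: teq_def)
  moreover have "v \<in> N #>\<^bsub>F\<^esub> w \<longleftrightarrow> N #>\<^bsub>F\<^esub> v = N #>\<^bsub>F\<^esub> w"
    using F.repr_independence[OF _ _ subgroup_N, of v w] F.rcos_self[OF _ subgroup_N, of v] assms
    by auto
  ultimately show ?thesis by simp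
qed

lemma carrier_tensor: "carrier (tensor R X M) = {N #>\<^bsub>F\<^esub> w | w. Poly_Mapping.keys w \<subseteq> carrier X \<times> carrier M}"
  by (auto simp: tensor_def carrier_FactGroup)

lemma tensor_one: "\<one>\<^bsub>tensor R X M\<^esub> = N"
  by (simp add: tensor_def)

lemma N_rcos_zero: "N #>\<^bsub>F\<^esub> 0 = N"
  using F.coset_mult_one[OF subgroup.subset[OF subgroup_N]] by simp

lemma group_tensor: "group (tensor R X M)"
  unfolding tensor_def by (rule normal.factorgroup_is_group[OF normal_N])

lemma tensor_mult:
  assumes "Poly_Mapping.keys v \<subseteq> carrier X \<times> carrier M" "Poly_Mapping.keys w \<subseteq> carrier X \<times> carrier M"
  shows "(N #>\<^bsub>F\<^esub> v) \<otimes>\<^bsub>tensor R X M\<^esub> (N #>\<^bsub>F\<^esub> w) = N #>\<^bsub>F\<^esub> (v + w)"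
  using normal.rcos_sum[OF normal_N, of v w] assms by (simp add: tensor_def)

end

locale tensor_presented = tensor_product R X M + P: presentation "opp_ring R" X p q x k
  for R :: "('a, 'k) ring_scheme" (structure) and X :: "('a, 'b) module" and M :: "('a, 'c) module"
    and p q x k
begin

text \<open>The tensor with component \<alpha> \<open>i\<close> at the generator \<open>x i\<close>.
  With \<open>X\<close> presented, \<alpha> is a coordinate vector of the tensor with entries in
  \<open>M\<close>.\<close>

definition ten where "ten \<alpha> = (\<Sum>i<p. frag_of (x i, \<alpha> i))"

lemma x_mem: "i < p \<Longrightarrow> x i \<in> carrier X"
  using funcset_mem[OF P.x_closed] by simp

lemma k_mem: "\<lbrakk>j < q; i < p\<rbrakk> \<Longrightarrow> k j i \<in> carrier R"
  using P.k_matrix by (simp add: is_matrix_def)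

lemma k_col: "i < p \<Longrightarrow> (\<lambda>j. k j i) \<in> {..<q} \<rightarrow> carrier R"
  using k_mem by auto

lemma ten_keys: "\<alpha> \<in> {..<p} \<rightarrow> carrier M \<Longrightarrow> Poly_Mapping.keys (ten \<alpha>) \<subseteq> carrier X \<times> carrier M"
  using sum_closed_free_Abelian_group[of "{..<p}" "\<lambda>i. frag_of (x i, \<alpha> i)" "carrier X \<times> carrier M"]
    x_mem by (auto simp: ten_def keys_frag_of Pi_def)

lemma teq_ten_add:
  "\<lbrakk>\<alpha> \<in> {..<p} \<rightarrow> carrier M; \<beta> \<in> {..<p} \<rightarrow> carrier M\<rbrakk> \<Longrightarrow>
   teq (ten (\<lambda>i. \<alpha> i \<oplus>\<^bsub>M\<^esub> \<beta> i)) (ten \<alpha> + ten \<beta>)"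
  unfolding ten_def sum.distrib[symmetric] by (intro teq_sum teq_add_right x_mem) auto

lemma teq_ten_neg:
  assumes "\<alpha> \<in> {..<p} \<rightarrow> carrier M"
  shows "teq (ten (\<lambda>i. \<ominus>\<^bsub>M\<^esub> \<alpha> i)) (- ten \<alpha>)"
proof -
  have "teq (frag_of (x i, \<ominus>\<^bsub>M\<^esub> \<alpha> i)) (- frag_of (x i, \<alpha> i))" if i: "i < p" for i
  proof -
    have a: "\<alpha> i \<in> carrier M" using assms i by auto
    then have "teq (frag_of (x i, \<zero>\<^bsub>M\<^esub>)) (frag_of (x i, \<ominus>\<^bsub>M\<^esub> \<alpha> i) + frag_of (x i, \<alpha> i))"
      using teq_add_right[OF x_mem[OF i], of "\<ominus>\<^bsub>M\<^esub> \<alpha> i" "\<alpha> i"] by (simp add: M.M.l_neg)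
    from teq_trans[OF teq_sym[OF this] teq_zero_right[OF x_mem[OF i]]]
    show ?thesis by (simp add: teq_def)
  qed
  then show ?thesis unfolding ten_def sum_negf[symmetric] by (intro teq_sum) auto
qed

text \<open>In a pure tensor the coefficients of the first factor with respect to \<open>x\<close>
  are moved to the second factor by the balancing relations; sums and differences are then taken
  componentwise.\<close>

lemma ex_ten:
  assumes "Poly_Mapping.keys w \<subseteq> carrier X \<times> carrier M"
  shows "\<exists>\<alpha>\<in>{..<p} \<rightarrow> carrier M. teq w (ten \<alpha>)"
proof (rule free_Abelian_group_induct[OF assms, of "\<lambda>w. \<exists>\<alpha>\<in>{..<p} \<rightarrow> carrier M. teq w (ten \<alpha>)"])
  have "teq 0 (ten (\<lambda>i. \<zero>\<^bsub>M\<^esub>))"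
    using teq_sum[of "{..<p}" "\<lambda>i. frag_of (x i, \<zero>\<^bsub>M\<^esub>)" "\<lambda>i. 0"] teq_zero_right x_mem
    by (auto simp: ten_def intro: teq_sym)
  then show "\<exists>\<alpha>\<in>{..<p} \<rightarrow> carrier M. teq 0 (ten \<alpha>)" by (intro bexI[of _ "\<lambda>i. \<zero>\<^bsub>M\<^esub>"]) auto
next
  fix v w
  assume "\<exists>\<alpha>\<in>{..<p} \<rightarrow> carrier M. teq v (ten \<alpha>)" "\<exists>\<alpha>\<in>{..<p} \<rightarrow> carrier M. teq w (ten \<alpha>)"
  then obtain \<alpha> \<beta> where ab: "\<alpha> \<in> {..<p} \<rightarrow> carrier M" "teq v (ten \<alpha>)"
    "\<beta> \<in> {..<p} \<rightarrow> carrier M" "teq w (ten \<beta>)" by auto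
  have nb: "(\<lambda>i. \<ominus>\<^bsub>M\<^esub> \<beta> i) \<in> {..<p} \<rightarrow> carrier M" using ab by auto
  have "teq (v - w) (ten \<alpha> + (- ten \<beta>))" using teq_diff[OF ab(2,4)] by simp
  also have "teq \<dots> (ten \<alpha> + ten (\<lambda>i. \<ominus>\<^bsub>M\<^esub> \<beta> i))"
    by (intro teq_add teq_sym[OF teq_ten_neg] ab teq_refl)
  also have "teq \<dots> (ten (\<lambda>i. \<alpha> i \<oplus>\<^bsub>M\<^esub> \<ominus>\<^bsub>M\<^esub> \<beta> i))"
    by (intro teq_sym[OF teq_ten_add] ab nb)
  finally show "\<exists>\<alpha>\<in>{..<p} \<rightarrow> carrier M. teq (v - w) (ten \<alpha>)"
    using ab nb by (intro bexI[of _ "\<lambda>i. \<alpha> i \<oplus>\<^bsub>M\<^esub> \<ominus>\<^bsub>M\<^esub> \<beta> i"]) auto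
next
  fix a assume "a \<in> carrier X \<times> carrier M"
  then obtain z y where a: "a = (z, y)" "z \<in> carrier X" "y \<in> carrier M" by auto
  note c = P.coords[OF a(2)]
  have "teq (frag_of a) (ten (\<lambda>i. P.coords z i \<odot>\<^bsub>M\<^esub> y))"
    using teq_lincomb_left[of y "P.coords z" p x] c a P.x_closed by (simp add: ten_def)
  then show "\<exists>\<alpha>\<in>{..<p} \<rightarrow> carrier M. teq (frag_of a) (ten \<alpha>)"
    using c a by (intro bexI[of _ "\<lambda>i. P.coords z i \<odot>\<^bsub>M\<^esub> y"]) auto
qed

text \<open>After exchanging the sums over \<open>i\<close> and \<open>j\<close> and moving
  \<open>k j i\<close> back to the left, the first factors become the relations \<open>k j\<close>
  of \<open>X\<close>, which are zero.\<close>

lemma ten_combination: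
  assumes "\<mu> \<in> {..<q} \<rightarrow> carrier M"
  shows "teq (ten (\<lambda>i. lincomb M q (\<lambda>j. k j i) \<mu>)) 0"
proof -
  have mu: "\<mu> j \<in> carrier M" if "j < q" for j using assms that by auto
  have "teq (ten (\<lambda>i. lincomb M q (\<lambda>j. k j i) \<mu>)) (\<Sum>i<p. \<Sum>j<q. frag_of (x i, k j i \<odot>\<^bsub>M\<^esub> \<mu> j))"
    unfolding ten_def lincomb_def
    by (intro teq_sum teq_finsum_right x_mem) (use mu k_mem in auto)
  also have "(\<Sum>i<p. \<Sum>j<q. frag_of (x i, k j i \<odot>\<^bsub>M\<^esub> \<mu> j)) = (\<Sum>j<q. \<Sum>i<p. frag_of (x i, k j i \<odot>\<^bsub>M\<^esub> \<mu> j))"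
    by (rule sum.swap)
  also have "teq \<dots> (\<Sum>j<q. frag_of (lincomb X p (k j) x, \<mu> j))"
    by (intro teq_sum teq_sym[OF teq_lincomb_left]) (use mu k_mem P.x_closed in auto)
  also have "teq \<dots> (\<Sum>j<q. 0)"
  proof (intro teq_sum)
    fix j assume "j \<in> {..<q}"
    then have j: "j < q" by simp
    have kj: "k j \<in> {..<p} \<rightarrow> carrier (opp_ring R)" using k_mem j by auto
    have "lincomb X p (k j) x = \<zero>\<^bsub>X\<^esub>"
      unfolding P.relation_iff[OF kj]
    proof (intro bexI[of _ "unit_vec R j"] allI impI)
      fix i assume i: "i < p"
      interpret reg: left_module "opp_ring R" "regular_module (opp_ring R)"
        by (rule regular_left_module) unfold_locales
      show "k j i = dot (opp_ring R) q (unit_vec R j) (\<lambda>j. k j i)"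
        using reg.lincomb_unit_vec[OF j, of "\<lambda>j. k j i"] k_col[OF i] by (simp add: lincomb_regular)
    qed auto
    then show "teq (frag_of (lincomb X p (k j) x, \<mu> j)) 0"
      using teq_zero_left mu[OF j] by simp
  qed
  finally show ?thesis by simp
qed

text \<open>Coordinates on \<open>X\<close> are not additive, but only up to relations of \<open>X\<close>; hence the functionals
  \<open>h i\<close> below kill the tensor relations up to combinations \<open>\<Sum>\<^sub>j k\<^sub>j\<^sub>i \<mu>\<^sub>j\<close>.\<close>

lemma ten_zero_imp_combination:
  assumes \<alpha>: "\<alpha> \<in> {..<p} \<rightarrow> carrier M" and zero: "teq (ten \<alpha>) 0"
  shows "\<exists>\<mu>\<in>{..<q} \<rightarrow> carrier M. \<forall>i<p. \<alpha> i = lincomb M q (\<lambda>j. k j i) \<mu>"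
proof -
  have "\<exists>h. h \<in> hom F (add_monoid M) \<and>
      (\<forall>a\<in>carrier X \<times> carrier M. h (frag_of a) = P.coords (fst a) i \<odot>\<^bsub>M\<^esub> snd a)" if i: "i < p" for i
  proof -
    have "(\<lambda>a. P.coords (fst a) i \<odot>\<^bsub>M\<^esub> snd a) ` (carrier X \<times> carrier M) \<subseteq> carrier (add_monoid M)"
      using P.coords i by (auto simp: Pi_def)
    from comm_group.free_Abelian_group_universal[OF M.M.a_comm_group this]
    show ?thesis by metis
  qed
  then obtain h where h: "\<And>i. i < p \<Longrightarrow> h i \<in> hom F (add_monoid M)"
    "\<And>i z y. \<lbrakk>i < p; z \<in> carrier X; y \<in> carrier M\<rbrakk> \<Longrightarrow> h i (frag_of (z, y)) = P.coords z i \<odot>\<^bsub>M\<^esub> y"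
    by (metis (no_types, lifting) mem_Sigma_iff fst_conv snd_conv)
  have h_closed: "h i w \<in> carrier M" if "i < p" "Poly_Mapping.keys w \<subseteq> carrier X \<times> carrier M" for i w
    using h(1)[OF that(1)] that(2) by (auto simp: hom_def)
  have h_add: "h i (v + w) = h i v \<oplus>\<^bsub>M\<^esub> h i w"
    if "i < p" "Poly_Mapping.keys v \<subseteq> carrier X \<times> carrier M" "Poly_Mapping.keys w \<subseteq> carrier X \<times> carrier M" for i v w
    using h(1)[OF that(1)] that(2,3) by (auto simp: hom_def)
  have h_zero: "h i 0 = \<zero>\<^bsub>M\<^esub>" if "i < p" for i
    using hom_one[OF h(1)[OF that] F.is_group M.M.a_group] by simp
  have h_neg: "h i (- w) = \<ominus>\<^bsub>M\<^esub> h i w" if "i < p" "Poly_Mapping.keys w \<subseteq> carrier X \<times> carrier M" for i w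
    using h_add[OF that(1), of "- w" w] that h_zero h_closed M.M.minus_equality[of "h i (- w)" "h i w"]
    by simp
  have h_diff: "h i (v - w) = h i v \<ominus>\<^bsub>M\<^esub> h i w"
    if "i < p" "Poly_Mapping.keys v \<subseteq> carrier X \<times> carrier M" "Poly_Mapping.keys w \<subseteq> carrier X \<times> carrier M" for i v w
    using h_add[of i v "- w"] h_neg[of i w] that by (simp add: a_minus_def)
  \<comment> \<open>The desired conclusion, turned into a subset of the free abelian group: once it
    is a subgroup containing the tensor relations, it contains the whole kernel \<open>N\<close>,
    and in particular \<open>ten\<close> \<alpha>.\<close>
  define H where "H = {w. Poly_Mapping.keys w \<subseteq> carrier X \<times> carrier M \<and>
    (\<exists>\<mu>\<in>{..<q} \<rightarrow> carrier M. \<forall>i<p. h i w = lincomb M q (\<lambda>j. k j i) \<mu>)}"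
  have "subgroup H F"
  proof
    show "H \<subseteq> carrier F" by (auto simp: H_def)
    show "\<one>\<^bsub>F\<^esub> \<in> H"
      using h_zero k_col by (auto simp: H_def intro!: bexI[of _ "\<lambda>j. \<zero>\<^bsub>M\<^esub>"])
  next
    fix v w assume "v \<in> H" "w \<in> H"
    then obtain \<mu> \<nu> where *: "\<mu> \<in> {..<q} \<rightarrow> carrier M" "\<And>i. i < p \<Longrightarrow> h i v = lincomb M q (\<lambda>j. k j i) \<mu>"
      "\<nu> \<in> {..<q} \<rightarrow> carrier M" "\<And>i. i < p \<Longrightarrow> h i w = lincomb M q (\<lambda>j. k j i) \<nu>"
      and k: "Poly_Mapping.keys v \<subseteq> carrier X \<times> carrier M" "Poly_Mapping.keys w \<subseteq> carrier X \<times> carrier M"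
      by (auto simp: H_def)
    have "h i (v + w) = lincomb M q (\<lambda>j. k j i) (\<lambda>j. \<mu> j \<oplus>\<^bsub>M\<^esub> \<nu> j)" if "i < p" for i
      using that * k k_col by (simp add: h_add M.lincomb_add_right)
    then show "v \<otimes>\<^bsub>F\<^esub> w \<in> H"
      using k keys_add[of v w] * by (auto simp: H_def intro!: bexI[of _ "\<lambda>j. \<mu> j \<oplus>\<^bsub>M\<^esub> \<nu> j"])
  next
    fix v assume "v \<in> H"
    then obtain \<mu> where *: "\<mu> \<in> {..<q} \<rightarrow> carrier M" "\<And>i. i < p \<Longrightarrow> h i v = lincomb M q (\<lambda>j. k j i) \<mu>"
      and k: "Poly_Mapping.keys v \<subseteq> carrier X \<times> carrier M"
      by (auto simp: H_def)
    have "h i (- v) = lincomb M q (\<lambda>j. k j i) (\<lambda>j. \<ominus>\<^bsub>M\<^esub> \<mu> j)" if "i < p" for i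
      using that * k k_col by (simp add: h_neg M.lincomb_neg_right)
    then show "inv\<^bsub>F\<^esub> v \<in> H"
      using k * by (auto simp: H_def intro!: bexI[of _ "\<lambda>j. \<ominus>\<^bsub>M\<^esub> \<mu> j"])
  qed
  moreover have "tensor_relations R X M \<subseteq> H"
  proof
    fix w assume w: "w \<in> tensor_relations R X M"
    have keys: "Poly_Mapping.keys w \<subseteq> carrier X \<times> carrier M"
      using subsetD[OF relations_subset w] by (rule carrier_free_Abelian_group_iff[THEN iffD1])
    have cc: "P.coords z i \<in> carrier R" if "z \<in> carrier X" "i < p" for z i
      using P.coords(1)[OF that(1)] that(2) by auto
    \<comment> \<open>Two coordinate vectors of one element of \<open>X\<close> differ by a
      relation. This measures how far \<open>P.coords\<close> is from being additive and linear, and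
      settles the cases \<open>add_left\<close> and \<open>balance\<close>.\<close>
    have *: "\<exists>\<mu>\<in>{..<q} \<rightarrow> carrier M. \<forall>i<p. (\<rho> i \<ominus> \<sigma> i) \<odot>\<^bsub>M\<^esub> y = lincomb M q (\<lambda>j. k j i) \<mu>"
      if rel: "\<rho> \<in> {..<p} \<rightarrow> carrier R" "\<sigma> \<in> {..<p} \<rightarrow> carrier R" "lincomb X p \<rho> x = lincomb X p \<sigma> x"
        "y \<in> carrier M" for \<rho> \<sigma> y
    proof -
      obtain s where s: "s \<in> {..<q} \<rightarrow> carrier R" "\<And>i. i < p \<Longrightarrow> \<rho> i \<ominus> \<sigma> i = dot (opp_ring R) q s (\<lambda>j. k j i)"
        using P.relation_diff[of \<rho> \<sigma>] rel(1-3) by (auto simp: a_minus_def)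
      have "(\<rho> i \<ominus> \<sigma> i) \<odot>\<^bsub>M\<^esub> y = lincomb M q (\<lambda>j. k j i) (\<lambda>j. s j \<odot>\<^bsub>M\<^esub> y)" if "i < p" for i
        using s that \<open>y \<in> carrier M\<close> k_col by (simp add: M.lincomb_smult_right dot_opp_ring)
      then show ?thesis using s(1) \<open>y \<in> carrier M\<close> by (intro bexI[of _ "\<lambda>j. s j \<odot>\<^bsub>M\<^esub> y"]) auto
    qed
    from w have "\<exists>\<mu>\<in>{..<q} \<rightarrow> carrier M. \<forall>i<p. h i w = lincomb M q (\<lambda>j. k j i) \<mu>"
    proof (cases rule: tensor_relations_cases)
      case a: (add_left z z' y)
      have zz: "z \<oplus>\<^bsub>X\<^esub> z' \<in> carrier X" using a by simp
      have "lincomb X p (P.coords (z \<oplus>\<^bsub>X\<^esub> z')) x = lincomb X p (\<lambda>i. P.coords z i \<oplus> P.coords z' i) x"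
        using P.coords[OF a(2)] P.coords[OF a(3)] P.coords[OF zz] X.lincomb_add_left[of "P.coords z" p "P.coords z'" x]
        by simp
      from *[OF _ _ this a(4)] obtain \<mu> where m: "\<mu> \<in> {..<q} \<rightarrow> carrier M"
        "\<And>i. i < p \<Longrightarrow> (P.coords (z \<oplus>\<^bsub>X\<^esub> z') i \<ominus> (P.coords z i \<oplus> P.coords z' i)) \<odot>\<^bsub>M\<^esub> y = lincomb M q (\<lambda>j. k j i) \<mu>"
        using cc a zz by auto
      have "h i w = lincomb M q (\<lambda>j. k j i) \<mu>" if i: "i < p" for i
      proof -
        have "h i w = (P.coords (z \<oplus>\<^bsub>X\<^esub> z') i \<odot>\<^bsub>M\<^esub> y \<ominus>\<^bsub>M\<^esub> P.coords z i \<odot>\<^bsub>M\<^esub> y) \<ominus>\<^bsub>M\<^esub> P.coords z' i \<odot>\<^bsub>M\<^esub> y"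
          using a zz i by (simp add: h_diff h(2) keys_frag_of_subset keys_diff_subset)
        also have "\<dots> = (P.coords (z \<oplus>\<^bsub>X\<^esub> z') i \<ominus> (P.coords z i \<oplus> P.coords z' i)) \<odot>\<^bsub>M\<^esub> y"
          using a zz i cc by (simp add: a_minus_def M.smult_l_distr M.smult_l_minus M.R.minus_add M.M.a_assoc)
        finally show ?thesis using m(2)[OF i] by simp
      qed
      then show ?thesis using m(1) by auto
    next
      case b: (add_right z y y')
      have "h i w = \<zero>\<^bsub>M\<^esub>" if i: "i < p" for i
      proof -
        have "h i w = (P.coords z i \<odot>\<^bsub>M\<^esub> (y \<oplus>\<^bsub>M\<^esub> y') \<ominus>\<^bsub>M\<^esub> P.coords z i \<odot>\<^bsub>M\<^esub> y) \<ominus>\<^bsub>M\<^esub> P.coords z i \<odot>\<^bsub>M\<^esub> y'"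
          using b i by (simp add: h_diff h(2) keys_frag_of_subset keys_diff_subset)
        also have "\<dots> = (P.coords z i \<odot>\<^bsub>M\<^esub> y \<oplus>\<^bsub>M\<^esub> P.coords z i \<odot>\<^bsub>M\<^esub> y') \<ominus>\<^bsub>M\<^esub>
            (P.coords z i \<odot>\<^bsub>M\<^esub> y \<oplus>\<^bsub>M\<^esub> P.coords z i \<odot>\<^bsub>M\<^esub> y')"
          using b i cc by (simp add: a_minus_def M.smult_r_distr M.M.minus_add M.M.a_assoc)
        also have "\<dots> = \<zero>\<^bsub>M\<^esub>" using b i cc by (simp add: a_minus_def M.M.r_neg)
        finally show ?thesis .
      qed
      then show ?thesis using k_col by (intro bexI[of _ "\<lambda>j. \<zero>\<^bsub>M\<^esub>"]) auto
    next
      case c: (balance r z y)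
      have rz: "r \<odot>\<^bsub>X\<^esub> z \<in> carrier X" using c by simp
      have "lincomb X p (P.coords (r \<odot>\<^bsub>X\<^esub> z)) x = lincomb X p (\<lambda>i. P.coords z i \<otimes> r) x"
        using P.coords[OF c(3)] P.coords[OF rz] X.lincomb_smult[of r "P.coords z" p x] c(2)
        by simp
      from *[OF _ _ this c(4)] obtain \<mu> where m: "\<mu> \<in> {..<q} \<rightarrow> carrier M"
        "\<And>i. i < p \<Longrightarrow> (P.coords (r \<odot>\<^bsub>X\<^esub> z) i \<ominus> (P.coords z i \<otimes> r)) \<odot>\<^bsub>M\<^esub> y = lincomb M q (\<lambda>j. k j i) \<mu>"
        using cc c rz by auto
      have "h i w = lincomb M q (\<lambda>j. k j i) \<mu>" if i: "i < p" for i
      proof -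
        have "h i w = P.coords (r \<odot>\<^bsub>X\<^esub> z) i \<odot>\<^bsub>M\<^esub> y \<ominus>\<^bsub>M\<^esub> P.coords z i \<odot>\<^bsub>M\<^esub> (r \<odot>\<^bsub>M\<^esub> y)"
          using c rz i by (simp add: h_diff h(2) keys_frag_of_subset keys_diff_subset)
        also have "\<dots> = (P.coords (r \<odot>\<^bsub>X\<^esub> z) i \<ominus> (P.coords z i \<otimes> r)) \<odot>\<^bsub>M\<^esub> y"
          using c rz i cc by (simp add: a_minus_def M.smult_l_distr M.smult_l_minus M.smult_assoc)
        finally show ?thesis using m(2)[OF i] by simp
      qed
      then show ?thesis using m(1) by auto
    qed
    then show "w \<in> H" using keys by (simp add: H_def)
  qed
  ultimately have "N \<subseteq> H" unfolding tensor_kernel_def by (intro F.generate_subgroup_incl)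
  then have "ten \<alpha> \<in> H" using zero by (auto simp: teq_def)
  then obtain \<mu> where \<mu>: "\<mu> \<in> {..<q} \<rightarrow> carrier M" "\<And>i. i < p \<Longrightarrow> h i (ten \<alpha>) = lincomb M q (\<lambda>j. k j i) \<mu>"
    by (auto simp: H_def)
  have am: "\<alpha> l \<in> carrier M" if "l < p" for l using \<alpha> that by auto
  have h_ten: "h i (ten \<alpha>) = lincomb M p (\<lambda>l. P.coords (x l) i) \<alpha>" if i: "i < p" for i
  proof -
    have "h i (\<Sum>l<m. frag_of (x l, \<alpha> l)) = (\<Oplus>\<^bsub>M\<^esub>l\<in>{..<m}. P.coords (x l) i \<odot>\<^bsub>M\<^esub> \<alpha> l)
        \<and> Poly_Mapping.keys (\<Sum>l<m. frag_of (x l, \<alpha> l)) \<subseteq> carrier X \<times> carrier M" if "m \<le> p" for m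
      using that
    proof (induct m)
      case 0
      then show ?case using h_zero[OF i] by simp
    next
      case (Suc m)
      have k1: "Poly_Mapping.keys (frag_of (x m, \<alpha> m)) \<subseteq> carrier X \<times> carrier M"
        using Suc x_mem am by (simp add: keys_frag_of)
      have "(\<lambda>l. P.coords (x l) i \<odot>\<^bsub>M\<^esub> \<alpha> l) \<in> {..<m} \<rightarrow> carrier M" "P.coords (x m) i \<odot>\<^bsub>M\<^esub> \<alpha> m \<in> carrier M"
        using Suc i x_mem am P.coords(1) by (auto simp: Pi_def)
      then show ?case
        using Suc k1 i x_mem am keys_add[of "frag_of (x m, \<alpha> m)" "\<Sum>l<m. frag_of (x l, \<alpha> l)"]
        by (auto simp: lessThan_Suc h_add h(2) add.commute)
    qed
    from this[of p] show ?thesis by (simp add: ten_def lincomb_def)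
  qed
  \<comment> \<open>The chosen coordinates of \<open>x l\<close> need not form the unit vector. The
    discrepancy is a relation with coefficients \<open>s l\<close>; its contribution is collected in
    \<nu> and subtracted from \<mu>.\<close>
  have "\<exists>\<mu>. \<mu> \<in> {..<q} \<rightarrow> carrier R \<and> (\<forall>i<p. P.coords (x l) i \<ominus> unit_vec R l i = dot (opp_ring R) q \<mu> (\<lambda>j. k j i))"
    if l: "l < p" for l
  proof -
    have "lincomb X p (P.coords (x l)) x = lincomb X p (unit_vec R l) x"
      using P.coords[OF x_mem[OF l]] X.lincomb_unit_vec[OF l P.x_closed] by simp
    then show ?thesis
      using P.relation_diff[of "P.coords (x l)" "unit_vec R l"] P.coords[OF x_mem[OF l]]
      by (auto simp: a_minus_def)
  qed
  then obtain s where s: "\<And>l. l < p \<Longrightarrow> s l \<in> {..<q} \<rightarrow> carrier R"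
    "\<And>l i. \<lbrakk>l < p; i < p\<rbrakk> \<Longrightarrow> P.coords (x l) i \<ominus> unit_vec R l i = dot (opp_ring R) q (s l) (\<lambda>j. k j i)"
    by metis
  define \<nu> where "\<nu> j = lincomb M p (\<lambda>l. s l j) \<alpha>" for j
  have sm: "s l j \<in> carrier R" if "l < p" "j < q" for l j using s(1)[OF that(1)] that(2) by auto
  have \<nu>: "\<nu> \<in> {..<q} \<rightarrow> carrier M" using sm \<alpha> by (auto simp: \<nu>_def intro!: M.lincomb_closed)
  have "\<alpha> i = lincomb M q (\<lambda>j. k j i) (\<lambda>j. \<mu> j \<ominus>\<^bsub>M\<^esub> \<nu> j)" if i: "i < p" for i
  proof -
    have cm: "(\<lambda>l. P.coords (x l) i) \<in> {..<p} \<rightarrow> carrier R"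
      using P.coords(1) x_mem i by (auto simp: Pi_def)
    have um: "(\<lambda>l. unit_vec R l i) \<in> {..<p} \<rightarrow> carrier R" by simp
    have "lincomb M p (\<lambda>l. unit_vec R l i) \<alpha> = lincomb M p (unit_vec R i) \<alpha>"
      by (rule M.lincomb_cong) (auto simp: unit_vec_def \<alpha>)
    then have "lincomb M p (\<lambda>l. P.coords (x l) i \<ominus> unit_vec R l i) \<alpha> = h i (ten \<alpha>) \<ominus>\<^bsub>M\<^esub> \<alpha> i"
      using M.lincomb_diff_left[OF cm um \<alpha>] h_ten[OF i] M.lincomb_unit_vec[OF i \<alpha>] by simp
    moreover have "lincomb M p (\<lambda>l. P.coords (x l) i \<ominus> unit_vec R l i) \<alpha> = lincomb M p (\<lambda>l. dot R q (\<lambda>j. k j i) (s l)) \<alpha>"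
      by (rule M.lincomb_cong) (use s i \<alpha> k_col in \<open>auto simp: dot_opp_ring intro!: M.R.dot_closed\<close>)
    moreover have "\<dots> = lincomb M q (\<lambda>j. k j i) \<nu>"
    proof -
      have "lincomb M p (\<lambda>l. dot R q (\<lambda>j. k j i) (s l)) \<alpha> = lincomb M q (\<lambda>j. k j i) (\<lambda>j. lincomb M p (\<lambda>l. s l j) \<alpha>)"
        by (rule M.lincomb_assoc[of "\<lambda>j. k j i" q p "\<lambda>j l. s l j" \<alpha>]) (use k_col[OF i] sm \<alpha> in auto)
      then show ?thesis unfolding \<nu>_def[abs_def] .
    qed
    ultimately have "h i (ten \<alpha>) \<ominus>\<^bsub>M\<^esub> \<alpha> i = lincomb M q (\<lambda>j. k j i) \<nu>" by simp
    then have "lincomb M q (\<lambda>j. k j i) \<mu> \<ominus>\<^bsub>M\<^esub> \<alpha> i = lincomb M q (\<lambda>j. k j i) \<nu>" using \<mu> i by simp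
    then have "\<alpha> i = lincomb M q (\<lambda>j. k j i) \<mu> \<ominus>\<^bsub>M\<^esub> lincomb M q (\<lambda>j. k j i) \<nu>"
      using \<mu>(1) k_col[OF i] am[OF i] by (intro M.M.diff_eq_swap) auto
    also have "\<dots> = lincomb M q (\<lambda>j. k j i) (\<lambda>j. \<mu> j \<ominus>\<^bsub>M\<^esub> \<nu> j)"
      using M.lincomb_diff_right[OF k_col[OF i] \<mu>(1) \<nu>] by simp
    finally show ?thesis .
  qed
  then show ?thesis using \<mu>(1) \<nu> by (intro bexI[of _ "\<lambda>j. \<mu> j \<ominus>\<^bsub>M\<^esub> \<nu> j"]) auto
qed

lemma ten_zero_iff:
  assumes "\<alpha> \<in> {..<p} \<rightarrow> carrier M"
  shows "teq (ten \<alpha>) 0 \<longleftrightarrow> (\<exists>\<mu>\<in>{..<q} \<rightarrow> carrier M. \<forall>i<p. \<alpha> i = lincomb M q (\<lambda>j. k j i) \<mu>)"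
proof
  assume "\<exists>\<mu>\<in>{..<q} \<rightarrow> carrier M. \<forall>i<p. \<alpha> i = lincomb M q (\<lambda>j. k j i) \<mu>"
  then obtain \<mu> where "\<mu> \<in> {..<q} \<rightarrow> carrier M" "\<forall>i<p. \<alpha> i = lincomb M q (\<lambda>j. k j i) \<mu>" by auto
  then show "teq (ten \<alpha>) 0" using ten_combination[of \<mu>] by (simp add: ten_def)
qed (rule ten_zero_imp_combination[OF assms])

end

context tensor_presented
begin

definition cls where "cls \<alpha> = N #>\<^bsub>F\<^esub> ten \<alpha>"

lemma cls_surj:
  assumes "c \<in> carrier (tensor R X M)"
  shows "\<exists>\<alpha>\<in>{..<p} \<rightarrow> carrier M. c = cls \<alpha>"
proof -
  obtain w where w: "c = N #>\<^bsub>F\<^esub> w" "Poly_Mapping.keys w \<subseteq> carrier X \<times> carrier M"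
    using assms unfolding carrier_tensor by blast
  obtain \<alpha> where a: "\<alpha> \<in> {..<p} \<rightarrow> carrier M" "teq w (ten \<alpha>)" using ex_ten[OF w(2)] by blast
  then have "c = cls \<alpha>" unfolding cls_def w(1) using w(2) ten_keys by (simp add: rcos_eq_iff)
  then show ?thesis using a(1) by blast
qed

lemma cls_closed: "\<alpha> \<in> {..<p} \<rightarrow> carrier M \<Longrightarrow> cls \<alpha> \<in> carrier (tensor R X M)"
  unfolding carrier_tensor cls_def using ten_keys by blast

lemma cls_eq_one_iff:
  assumes "\<alpha> \<in> {..<p} \<rightarrow> carrier M"
  shows "cls \<alpha> = \<one>\<^bsub>tensor R X M\<^esub> \<longleftrightarrow>
    (\<exists>\<mu>\<in>{..<q} \<rightarrow> carrier M. \<forall>i<p. \<alpha> i = lincomb M q (\<lambda>j. k j i) \<mu>)"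
proof -
  have "cls \<alpha> = \<one>\<^bsub>tensor R X M\<^esub> \<longleftrightarrow> N #>\<^bsub>F\<^esub> ten \<alpha> = N #>\<^bsub>F\<^esub> 0"
    by (simp only: cls_def tensor_one N_rcos_zero)
  also have "\<dots> \<longleftrightarrow> teq (ten \<alpha>) 0"
    by (rule rcos_eq_iff) (use ten_keys[OF assms] in auto)
  finally show ?thesis using ten_zero_iff[OF assms] by simp
qed

lemma cls_cong: "(\<And>i. i < p \<Longrightarrow> \<alpha> i = \<beta> i) \<Longrightarrow> cls \<alpha> = cls \<beta>"
  by (simp add: cls_def ten_def)

lemma cls_add_relation:
  assumes "\<alpha> \<in> {..<p} \<rightarrow> carrier M" "\<mu> \<in> {..<q} \<rightarrow> carrier M"
  shows "cls (\<lambda>i. \<alpha> i \<oplus>\<^bsub>M\<^esub> lincomb M q (\<lambda>j. k j i) \<mu>) = cls \<alpha>"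
proof -
  have c: "(\<lambda>i. lincomb M q (\<lambda>j. k j i) \<mu>) \<in> {..<p} \<rightarrow> carrier M"
    using assms k_col by auto
  then have "(\<lambda>i. \<alpha> i \<oplus>\<^bsub>M\<^esub> lincomb M q (\<lambda>j. k j i) \<mu>) \<in> {..<p} \<rightarrow> carrier M"
    using assms by (auto dest: funcset_mem)
  moreover have "teq (ten (\<lambda>i. \<alpha> i \<oplus>\<^bsub>M\<^esub> lincomb M q (\<lambda>j. k j i) \<mu>)) (ten \<alpha>)"
    using teq_trans[OF teq_ten_add[OF assms(1) c] teq_add[OF teq_refl ten_combination[OF assms(2)]]] by simp
  ultimately show ?thesis
    unfolding cls_def using rcos_eq_iff ten_keys assms(1) by blast
qed

end

section \<open>The functor given by tensoring\<close>

locale tensor_hom = S: tensor_product R X M + T: tensor_product R X M' + f: module_hom R M M' f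
  for R :: "('a, 'k) ring_scheme" (structure) and X :: "('a, 'b) module"
    and M :: "('a, 'c) module" and M' :: "('a, 'd) module" and f
begin

definition ext where "ext = frag_extend (\<lambda>(x, y). frag_of (x, f y))"

lemma ext_frag_of [simp]: "ext (frag_of (x, y)) = frag_of (x, f y)"
  by (simp add: ext_def)

lemma ext_add: "ext (v + w) = ext v + ext w"
  by (simp add: ext_def frag_extend_add)

lemma ext_diff: "ext (v - w) = ext v - ext w"
  by (simp add: ext_def frag_extend_diff)

lemma ext_zero [simp]: "ext 0 = 0"
  by (simp add: ext_def)

lemma ext_sum: "ext (\<Sum>i\<in>A. g i) = (\<Sum>i\<in>A. ext (g i))"
  by (induct A rule: infinite_finite_induct) (simp_all add: ext_add)

lemma ext_keys:
  assumes "Poly_Mapping.keys w \<subseteq> carrier X \<times> carrier M"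
  shows "Poly_Mapping.keys (ext w) \<subseteq> carrier X \<times> carrier M'"
proof (rule free_Abelian_group_induct[OF assms, of "\<lambda>w. Poly_Mapping.keys (ext w) \<subseteq> carrier X \<times> carrier M'"])
  fix v w assume "Poly_Mapping.keys (ext v) \<subseteq> carrier X \<times> carrier M'"
    "Poly_Mapping.keys (ext w) \<subseteq> carrier X \<times> carrier M'"
  then show "Poly_Mapping.keys (ext (v - w)) \<subseteq> carrier X \<times> carrier M'"
    by (simp only: ext_diff T.keys_diff_subset)
qed (auto simp: keys_frag_of)

text \<open>The elements that are sent into \<open>T.N\<close> form a subgroup, so only the
  generating relations matter, and each of them goes to a relation of the same kind because
  \<open>f\<close> is linear.\<close>

lemma ext_N: "w \<in> S.N \<Longrightarrow> ext w \<in> T.N"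
proof -
  define H where "H = {w. Poly_Mapping.keys w \<subseteq> carrier X \<times> carrier M \<and> ext w \<in> T.N}"
  have "subgroup H S.F"
  proof
    show "H \<subseteq> carrier S.F" by (auto simp: H_def)
    show "\<one>\<^bsub>S.F\<^esub> \<in> H" by (simp add: H_def T.N_zero)
    fix v w assume "v \<in> H" "w \<in> H"
    then show "v \<otimes>\<^bsub>S.F\<^esub> w \<in> H" using keys_add[of v w] by (auto simp: H_def ext_add T.N_add)
  next
    fix v assume "v \<in> H"
    then show "inv\<^bsub>S.F\<^esub> v \<in> H" using T.N_neg[of "ext v"] ext_diff[of 0 v] by (simp add: H_def)
  qed
  moreover have "tensor_relations R X M \<subseteq> H"
  proof
    fix w assume w: "w \<in> tensor_relations R X M"
    have keys: "Poly_Mapping.keys w \<subseteq> carrier X \<times> carrier M"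
      using subsetD[OF S.relations_subset w] by (rule carrier_free_Abelian_group_iff[THEN iffD1])
    from w have "ext w \<in> tensor_relations R X M'"
    proof (cases rule: S.tensor_relations_cases)
      case (add_left z z' y)
      then have "ext w = frag_of (z \<oplus>\<^bsub>X\<^esub> z', f y) - frag_of (z, f y) - frag_of (z', f y)" "f y \<in> carrier M'"
        by (simp_all add: ext_diff)
      then show ?thesis using add_left unfolding tensor_relations_def by blast
    next
      case (add_right z y y')
      then have "ext w = frag_of (z, f y \<oplus>\<^bsub>M'\<^esub> f y') - frag_of (z, f y) - frag_of (z, f y')"
        "f y \<in> carrier M'" "f y' \<in> carrier M'"
        by (simp_all add: ext_diff f.add)
      then show ?thesis using add_right unfolding tensor_relations_def by blast
    next
      case (balance r z y)
      then have "ext w = frag_of (r \<odot>\<^bsub>X\<^esub> z, f y) - frag_of (z, r \<odot>\<^bsub>M'\<^esub> f y)" "f y \<in> carrier M'"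
        by (simp_all add: ext_diff f.smult)
      then show ?thesis using balance unfolding tensor_relations_def by blast
    qed
    then show "w \<in> H" using keys T.N_relation by (simp add: H_def)
  qed
  ultimately have "S.N \<subseteq> H" unfolding tensor_kernel_def by (intro S.F.generate_subgroup_incl)
  then show "w \<in> S.N \<Longrightarrow> ext w \<in> T.N" by (auto simp: H_def)
qed

lemma tensor_map_rcos:
  assumes "Poly_Mapping.keys w \<subseteq> carrier X \<times> carrier M"
  shows "tensor_map R X M' f (S.N #>\<^bsub>S.F\<^esub> w) = T.N #>\<^bsub>T.F\<^esub> ext w"
proof -
  have "tensor_map R X M' f (S.N #>\<^bsub>S.F\<^esub> w) = {h + ext (u + w) | h u. h \<in> T.N \<and> u \<in> S.N}"
    by (force simp: tensor_map_def ext_def[symmetric] set_mult_def r_coset_def)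
  also have "\<dots> = {h + ext w | h. h \<in> T.N}"
  proof (intro equalityI subsetI)
    fix z assume "z \<in> {h + ext (u + w) | h u. h \<in> T.N \<and> u \<in> S.N}"
    then obtain h u where "z = h + ext (u + w)" "h \<in> T.N" "u \<in> S.N" by blast
    then have "z = (h + ext u) + ext w" "h + ext u \<in> T.N"
      by (simp_all add: ext_add T.N_add ext_N algebra_simps)
    then show "z \<in> {h + ext w | h. h \<in> T.N}" by blast
  next
    fix z assume "z \<in> {h + ext w | h. h \<in> T.N}"
    then obtain h where "z = h + ext (0 + w)" "h \<in> T.N" by auto
    then show "z \<in> {h + ext (u + w) | h u. h \<in> T.N \<and> u \<in> S.N}" using S.N_zero by blast
  qed
  also have "\<dots> = T.N #>\<^bsub>T.F\<^esub> ext w"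
    by (auto simp: r_coset_def)
  finally show ?thesis .
qed

lemma tensor_map_hom: "tensor_map R X M' f \<in> hom (tensor R X M) (tensor R X M')"
proof (rule homI)
  fix c assume "c \<in> carrier (tensor R X M)"
  then obtain w where "c = S.N #>\<^bsub>S.F\<^esub> w" "Poly_Mapping.keys w \<subseteq> carrier X \<times> carrier M"
    unfolding S.carrier_tensor by blast
  then show "tensor_map R X M' f c \<in> carrier (tensor R X M')"
    unfolding T.carrier_tensor using tensor_map_rcos ext_keys by blast
next
  fix c d assume "c \<in> carrier (tensor R X M)" "d \<in> carrier (tensor R X M)"
  then obtain v w where *: "c = S.N #>\<^bsub>S.F\<^esub> v" "Poly_Mapping.keys v \<subseteq> carrier X \<times> carrier M"
    "d = S.N #>\<^bsub>S.F\<^esub> w" "Poly_Mapping.keys w \<subseteq> carrier X \<times> carrier M"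
    unfolding S.carrier_tensor by blast
  have "Poly_Mapping.keys (v + w) \<subseteq> carrier X \<times> carrier M" using * keys_add[of v w] by auto
  then show "tensor_map R X M' f (c \<otimes>\<^bsub>tensor R X M\<^esub> d)
      = tensor_map R X M' f c \<otimes>\<^bsub>tensor R X M'\<^esub> tensor_map R X M' f d"
    using * by (simp add: S.tensor_mult T.tensor_mult tensor_map_rcos ext_add ext_keys)
qed

lemma tensor_map_group_hom: "group_hom (tensor R X M) (tensor R X M') (tensor_map R X M' f)"
  by (simp add: group_hom_def group_hom_axioms_def S.group_tensor T.group_tensor tensor_map_hom)

lemma tensor_map_cls:
  assumes "presentation (opp_ring R) X p q x k" "\<alpha> \<in> {..<p} \<rightarrow> carrier M"
  shows "tensor_map R X M' f (tensor_presented.cls R X M p x \<alpha>) = tensor_presented.cls R X M' p x (\<lambda>i. f (\<alpha> i))"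
proof -
  interpret S': tensor_presented R X M p q x k
    by (intro tensor_presented.intro assms S.tensor_product_axioms)
  interpret T': tensor_presented R X M' p q x k
    by (intro tensor_presented.intro assms T.tensor_product_axioms)
  have "ext (S'.ten \<alpha>) = T'.ten (\<lambda>i. f (\<alpha> i))"
    by (simp add: S'.ten_def T'.ten_def ext_sum)
  then show ?thesis
    unfolding S'.cls_def T'.cls_def using tensor_map_rcos S'.ten_keys[OF assms(2)] by simp
qed

end

section \<open>Purity as solvability of linear systems\<close>

text \<open>Here \<open>k\<close> has \<open>p\<close> rows, the equations, and \<open>q\<close>
  columns, the unknowns: it is the transpose of the relation matrix of a (p, q)-presented test
  module, which has \<open>p\<close> generators and \<open>q\<close> relations. Equivalently, maps
  into \<open>C\<close> from the module with \<open>q\<close> generators and the \<open>p\<close>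
  relations \<open>k\<close> factor through \<open>g\<close>.\<close>

definition liftable ::
  "('a, 'k) ring_scheme \<Rightarrow> nat \<Rightarrow> nat \<Rightarrow> ('a, 'b) module \<Rightarrow> ('b \<Rightarrow> 'c) \<Rightarrow> ('a, 'c) module \<Rightarrow> bool" where
  "liftable R p q B g C \<longleftrightarrow> (\<forall>k c. is_matrix R p q k \<and> c \<in> {..<q} \<rightarrow> carrier C \<and>
     (\<forall>i<p. lincomb C q (k i) c = \<zero>\<^bsub>C\<^esub>) \<longrightarrow>
     (\<exists>b\<in>{..<q} \<rightarrow> carrier B. (\<forall>j<q. g (b j) = c j) \<and> (\<forall>i<p. lincomb B q (k i) b = \<zero>\<^bsub>B\<^esub>)))"

locale exact_modules = f: module_hom R A B f + g: module_hom R B C g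
  for R :: "('a, 'k) ring_scheme" (structure) and A :: "('a, 'b) module" and f
    and B :: "('a, 'b) module" and g and C :: "('a, 'b) module" +
  assumes inj: "inj_on f (carrier A)"
    and image: "f ` carrier A = {y \<in> carrier B. g y = \<zero>\<^bsub>C\<^esub>}"
    and surj: "g ` carrier B = carrier C"

lemma ses_iff: "ses R A f B g C \<longleftrightarrow> exact_modules R A f B g C"
  by (auto simp: ses_def exact_modules_def exact_modules_axioms_def module_hom_def module_hom_axioms_def)

context exact_modules
begin

lemma gf: "a \<in> carrier A \<Longrightarrow> g (f a) = \<zero>\<^bsub>C\<^esub>"
  using image by blast

lemma surj_family:
  assumes "c \<in> {..<q} \<rightarrow> carrier C"
  shows "\<exists>b\<in>{..<q} \<rightarrow> carrier B. \<forall>j<q. g (b j) = c j"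
proof -
  have "c j \<in> g ` carrier B" if "j < q" for j
    unfolding surj using assms that by auto
  then have "\<forall>j. \<exists>b. j < q \<longrightarrow> b \<in> carrier B \<and> g b = c j" by (metis imageE)
  then obtain b where "\<And>j. j < q \<Longrightarrow> b j \<in> carrier B \<and> g (b j) = c j" by metis
  then show ?thesis by (intro bexI[of _ b]) auto
qed

lemma kernel_family:
  assumes "b \<in> {..<q} \<rightarrow> carrier B" "\<And>j. j < q \<Longrightarrow> g (b j) = \<zero>\<^bsub>C\<^esub>"
  shows "\<exists>a\<in>{..<q} \<rightarrow> carrier A. \<forall>j<q. f (a j) = b j"
proof -
  have "b j \<in> f ` carrier A" if "j < q" for j
    unfolding image using assms that by auto
  then have "\<forall>j. \<exists>a. j < q \<longrightarrow> a \<in> carrier A \<and> f a = b j" by (metis imageE)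
  then obtain a where "\<And>j. j < q \<Longrightarrow> a j \<in> carrier A \<and> f (a j) = b j" by metis
  then show ?thesis by (intro bexI[of _ a]) auto
qed

text \<open>For a test module presented by \<open>k\<close>, an element of the kernel of the tensored map \<open>f\<close> is a
  system with constants in \<open>A\<close> that is solvable in \<open>B\<close>.\<close>

lemma short_exact_tensor_iff:
  assumes "presentation (opp_ring R) X p q x k"
  shows "short_exact_sequence (tensor R X C) (tensor R X B) (tensor R X A)
        (tensor_map R X C g) (tensor_map R X B f) \<longleftrightarrow>
    (\<forall>\<alpha>\<in>{..<p} \<rightarrow> carrier A. \<forall>\<beta>\<in>{..<q} \<rightarrow> carrier B. (\<forall>i<p. f (\<alpha> i) = lincomb B q (\<lambda>j. k j i) \<beta>) \<longrightarrow>
       (\<exists>\<mu>\<in>{..<q} \<rightarrow> carrier A. \<forall>i<p. \<alpha> i = lincomb A q (\<lambda>j. k j i) \<mu>))"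
    (is "?ses \<longleftrightarrow> ?sys")
proof -
  interpret P: presentation "opp_ring R" X p q x k by fact
  have tp: "tensor_product R X Y" if "left_module R Y" for Y :: "('a, 'z) module"
    using that by (simp add: tensor_product_def lmod_def P.X.left_module_axioms)
  interpret TA: tensor_presented R X A p q x k
    by (intro tensor_presented.intro assms tp f.M.left_module_axioms)
  interpret TB: tensor_presented R X B p q x k
    by (intro tensor_presented.intro assms tp f.N.left_module_axioms)
  interpret TC: tensor_presented R X C p q x k
    by (intro tensor_presented.intro assms tp g.N.left_module_axioms)
  interpret tf: tensor_hom R X A B f
    by (intro tensor_hom.intro TA.tensor_product_axioms TB.tensor_product_axioms f.module_hom_axioms)
  interpret tg: tensor_hom R X B C g
    by (intro tensor_hom.intro TB.tensor_product_axioms TC.tensor_product_axioms g.module_hom_axioms)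
  let ?f = "tensor_map R X B f" and ?g = "tensor_map R X C g"
  have f_cls: "?f (TA.cls \<alpha>) = TB.cls (\<lambda>i. f (\<alpha> i))" if "\<alpha> \<in> {..<p} \<rightarrow> carrier A" for \<alpha>
    by (rule tf.tensor_map_cls[OF assms that])
  have g_cls: "?g (TB.cls \<beta>) = TC.cls (\<lambda>i. g (\<beta> i))" if "\<beta> \<in> {..<p} \<rightarrow> carrier B" for \<beta>
    by (rule tg.tensor_map_cls[OF assms that])
  have col: "(\<lambda>j. k j i) \<in> {..<q} \<rightarrow> carrier R" if "i < p" for i by (rule TA.k_col[OF that])
  have f_fam: "(\<lambda>i. f (\<alpha> i)) \<in> {..<p} \<rightarrow> carrier B" if "\<alpha> \<in> {..<p} \<rightarrow> carrier A" for \<alpha>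
    using that by (auto dest: funcset_mem)
  have g_fam: "(\<lambda>i. g (\<beta> i)) \<in> {..<p} \<rightarrow> carrier C" if "\<beta> \<in> {..<p} \<rightarrow> carrier B" for \<beta>
    using that by (auto dest: funcset_mem)
  \<comment> \<open>Right exactness of the tensor product holds for every test module; it is
    verified on coordinate vectors, here and in the computation of the kernel.\<close>
  have gepi: "?g \<in> epi (tensor R X B) (tensor R X C)"
    unfolding epi_iff_subset
  proof (intro conjI tg.tensor_map_hom subsetI)
    fix c assume "c \<in> carrier (tensor R X C)"
    then obtain \<gamma> where \<gamma>: "\<gamma> \<in> {..<p} \<rightarrow> carrier C" "c = TC.cls \<gamma>" using TC.cls_surj by blast
    obtain \<beta> where \<beta>: "\<beta> \<in> {..<p} \<rightarrow> carrier B" "\<forall>i<p. g (\<beta> i) = \<gamma> i" using surj_family[OF \<gamma>(1)] by blast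
    have "c = ?g (TB.cls \<beta>)" using \<beta> \<gamma> by (simp add: g_cls cong: TC.cls_cong)
    then show "c \<in> ?g ` carrier (tensor R X B)" using TB.cls_closed[OF \<beta>(1)] by blast
  qed
  have ker: "kernel (tensor R X B) (tensor R X C) ?g = ?f ` carrier (tensor R X A)"
  proof (intro equalityI subsetI)
    fix b assume "b \<in> kernel (tensor R X B) (tensor R X C) ?g"
    then have b: "b \<in> carrier (tensor R X B)" "?g b = \<one>\<^bsub>tensor R X C\<^esub>" by (auto simp: kernel_def)
    obtain \<beta> where \<beta>: "\<beta> \<in> {..<p} \<rightarrow> carrier B" "b = TB.cls \<beta>" using TB.cls_surj[OF b(1)] by blast
    obtain \<gamma> where \<gamma>: "\<gamma> \<in> {..<q} \<rightarrow> carrier C" "\<forall>i<p. g (\<beta> i) = lincomb C q (\<lambda>j. k j i) \<gamma>"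
      using b(2) TC.cls_eq_one_iff[OF g_fam[OF \<beta>(1)]] \<beta> by (auto simp: g_cls)
    \<comment> \<open>Lifting \<gamma> to \<open>B\<close> and subtracting the corresponding
      combination from \<beta> does not change the class, but puts all components into the kernel of
      \<open>g\<close>, so that they come from \<open>A\<close>.\<close>
    obtain \<delta> where \<delta>: "\<delta> \<in> {..<q} \<rightarrow> carrier B" "\<forall>j<q. g (\<delta> j) = \<gamma> j" using surj_family[OF \<gamma>(1)] by blast
    define \<eta> where "\<eta> j = \<ominus>\<^bsub>B\<^esub> \<delta> j" for j
    have \<eta>: "\<eta> \<in> {..<q} \<rightarrow> carrier B" using \<delta>(1) by (auto simp: \<eta>_def dest: funcset_mem)
    define \<epsilon> where "\<epsilon> i = \<beta> i \<oplus>\<^bsub>B\<^esub> lincomb B q (\<lambda>j. k j i) \<eta>" for i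
    have \<epsilon>: "\<epsilon> \<in> {..<p} \<rightarrow> carrier B"
      using \<beta>(1) \<eta> col by (auto simp: \<epsilon>_def dest: funcset_mem)
    have "g (\<epsilon> i) = \<zero>\<^bsub>C\<^esub>" if i: "i < p" for i
    proof -
      have "lincomb C q (\<lambda>j. k j i) (\<lambda>j. g (\<eta> j)) = lincomb C q (\<lambda>j. k j i) (\<lambda>j. \<ominus>\<^bsub>C\<^esub> \<gamma> j)"
        by (rule g.N.lincomb_cong[OF col[OF i]]) (use funcset_mem[OF \<gamma>(1)] \<delta>(2) funcset_mem[OF \<delta>(1)] in \<open>auto simp: \<eta>_def g.neg\<close>)
      then have "g (\<epsilon> i) = g (\<beta> i) \<oplus>\<^bsub>C\<^esub> \<ominus>\<^bsub>C\<^esub> lincomb C q (\<lambda>j. k j i) \<gamma>"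
        using g.add[of "\<beta> i" "lincomb B q (\<lambda>j. k j i) \<eta>"] g.lincomb[OF col[OF i] \<eta>]
          g.N.lincomb_neg_right[OF col[OF i] \<gamma>(1)] funcset_mem[OF \<beta>(1)] i f.N.lincomb_closed[OF col[OF i] \<eta>]
        by (simp add: \<epsilon>_def)
      then show ?thesis using \<gamma> i col[OF i] by (simp add: g.N.M.r_neg)
    qed
    then obtain \<alpha> where \<alpha>: "\<alpha> \<in> {..<p} \<rightarrow> carrier A" "\<forall>i<p. f (\<alpha> i) = \<epsilon> i"
      using kernel_family[OF \<epsilon>] by blast
    have "b = TB.cls \<epsilon>" unfolding \<beta>(2) \<epsilon>_def using TB.cls_add_relation[OF \<beta>(1) \<eta>] by simp
    also have "\<dots> = ?f (TA.cls \<alpha>)" unfolding f_cls[OF \<alpha>(1)] by (rule TB.cls_cong) (use \<alpha> in simp)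
    finally show "b \<in> ?f ` carrier (tensor R X A)" using TA.cls_closed[OF \<alpha>(1)] by blast
  next
    fix b assume "b \<in> ?f ` carrier (tensor R X A)"
    then obtain a where a: "a \<in> carrier (tensor R X A)" "b = ?f a" by blast
    obtain \<alpha> where \<alpha>: "\<alpha> \<in> {..<p} \<rightarrow> carrier A" "a = TA.cls \<alpha>" using TA.cls_surj[OF a(1)] by blast
    have b: "b = TB.cls (\<lambda>i. f (\<alpha> i))" using a \<alpha> f_cls by simp
    then have "?g b = TC.cls (\<lambda>i. g (f (\<alpha> i)))" using g_cls f_fam[OF \<alpha>(1)] by simp
    also have "\<dots> = \<one>\<^bsub>tensor R X C\<^esub>"
      unfolding TC.cls_eq_one_iff[OF g_fam[OF f_fam[OF \<alpha>(1)]]]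
      by (rule bexI[of _ "\<lambda>j. \<zero>\<^bsub>C\<^esub>"]) (use \<alpha>(1) col gf in \<open>auto dest: funcset_mem\<close>)
    finally show "b \<in> kernel (tensor R X B) (tensor R X C) ?g"
      using TB.cls_closed[OF f_fam[OF \<alpha>(1)]] b by (simp add: kernel_def)
  qed
  interpret tfh: group_hom "tensor R X A" "tensor R X B" ?f by (rule tf.tensor_map_group_hom)
  \<comment> \<open>Of the exactness conditions only injectivity on the left remains to be expressed
    by coordinates.\<close>
  have "?ses \<longleftrightarrow> inj_on ?f (carrier (tensor R X A))"
    unfolding short_exact_sequence_iff
    using gepi ker tf.tensor_map_group_hom TC.group_tensor tg.tensor_map_hom tf.tensor_map_hom
    by (simp add: mon_def)
  also have "\<dots> \<longleftrightarrow> (\<forall>a\<in>carrier (tensor R X A). ?f a = \<one>\<^bsub>tensor R X B\<^esub> \<longrightarrow> a = \<one>\<^bsub>tensor R X A\<^esub>)"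
    unfolding tfh.inj_on_one_iff by blast
  also have "\<dots> \<longleftrightarrow> (\<forall>\<alpha>\<in>{..<p} \<rightarrow> carrier A. TB.cls (\<lambda>i. f (\<alpha> i)) = \<one>\<^bsub>tensor R X B\<^esub> \<longrightarrow>
      TA.cls \<alpha> = \<one>\<^bsub>tensor R X A\<^esub>)"
    using TA.cls_surj TA.cls_closed f_cls by (metis (no_types, lifting))
  also have "\<dots> \<longleftrightarrow> ?sys"
  proof (rule ball_cong[OF refl])
    fix \<alpha> assume \<alpha>: "\<alpha> \<in> {..<p} \<rightarrow> carrier A"
    show "(TB.cls (\<lambda>i. f (\<alpha> i)) = \<one>\<^bsub>tensor R X B\<^esub> \<longrightarrow> TA.cls \<alpha> = \<one>\<^bsub>tensor R X A\<^esub>) \<longleftrightarrow>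
        (\<forall>\<beta>\<in>{..<q} \<rightarrow> carrier B. (\<forall>i<p. f (\<alpha> i) = lincomb B q (\<lambda>j. k j i) \<beta>) \<longrightarrow>
       (\<exists>\<mu>\<in>{..<q} \<rightarrow> carrier A. \<forall>i<p. \<alpha> i = lincomb A q (\<lambda>j. k j i) \<mu>))"
      unfolding TB.cls_eq_one_iff[OF f_fam[OF \<alpha>]] TA.cls_eq_one_iff[OF \<alpha>] by blast
  qed
  finally show ?thesis .
qed

text \<open>A diagram chase in both directions. An arbitrary lift \<open>b\<close> of a solution in
  \<open>C\<close> violates the equations by elements of \<open>A\<close>; a solution \<mu> in
  \<open>A\<close> of the system with these constants corrects \<open>b\<close>. Conversely, a
  solution \<beta> in \<open>B\<close> of a system with constants in \<open>A\<close> maps to a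
  homogeneous solution in \<open>C\<close>; if \<open>b\<close> is a homogeneous lift of it, then
  the difference of \<beta> and \<open>b\<close> comes from \<open>A\<close>.\<close>

lemma system_iff_liftable:
  "(\<forall>k. is_matrix R q p k \<longrightarrow>
     (\<forall>\<alpha>\<in>{..<p} \<rightarrow> carrier A. \<forall>\<beta>\<in>{..<q} \<rightarrow> carrier B. (\<forall>i<p. f (\<alpha> i) = lincomb B q (\<lambda>j. k j i) \<beta>) \<longrightarrow>
       (\<exists>\<mu>\<in>{..<q} \<rightarrow> carrier A. \<forall>i<p. \<alpha> i = lincomb A q (\<lambda>j. k j i) \<mu>)))
   \<longleftrightarrow> liftable R p q B g C" (is "?sys \<longleftrightarrow> _")
proof
  assume sys: ?sys
  show "liftable R p q B g C"
    unfolding liftable_def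
  proof (intro allI impI, elim conjE)
    fix k c assume k: "is_matrix R p q k" and c: "c \<in> {..<q} \<rightarrow> carrier C"
      and kc: "\<forall>i<p. lincomb C q (k i) c = \<zero>\<^bsub>C\<^esub>"
    note row = is_matrix_row[OF k]
    obtain b where b: "b \<in> {..<q} \<rightarrow> carrier B" "\<forall>j<q. g (b j) = c j" using surj_family[OF c] by blast
    have "g (lincomb B q (k i) b) = \<zero>\<^bsub>C\<^esub>" if "i < p" for i
    proof -
      have "g (lincomb B q (k i) b) = lincomb C q (k i) (\<lambda>j. g (b j))" using row[OF that] b by (simp add: g.lincomb)
      also have "\<dots> = lincomb C q (k i) c" by (rule g.N.lincomb_cong) (use row[OF that] b c in auto)
      finally show ?thesis using kc that by simp
    qed
    then obtain \<alpha> where \<alpha>: "\<alpha> \<in> {..<p} \<rightarrow> carrier A" "\<forall>i<p. f (\<alpha> i) = lincomb B q (k i) b"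
      using kernel_family[of "\<lambda>i. lincomb B q (k i) b" p] row b by auto
    have "is_matrix R q p (\<lambda>j i. k i j)" using k by (simp add: is_matrix_def)
    then obtain \<mu> where \<mu>: "\<mu> \<in> {..<q} \<rightarrow> carrier A" "\<forall>i<p. \<alpha> i = lincomb A q (k i) \<mu>"
      using sys[rule_format, of "\<lambda>j i. k i j" \<alpha> b] \<alpha> b(1) by auto
    define b' where "b' j = b j \<ominus>\<^bsub>B\<^esub> f (\<mu> j)" for j
    have fm: "(\<lambda>j. f (\<mu> j)) \<in> {..<q} \<rightarrow> carrier B" using \<mu>(1) by (auto dest: funcset_mem)
    have "g (b' j) = c j" if "j < q" for j
      using that b \<mu>(1) funcset_mem[OF b(1)] funcset_mem[OF \<mu>(1)] funcset_mem[OF c] gf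
      by (simp add: b'_def g.diff a_minus_def[of C] g.N.M.neg_zero)
    moreover have "lincomb B q (k i) b' = \<zero>\<^bsub>B\<^esub>" if i: "i < p" for i
    proof -
      have "lincomb B q (k i) b' = lincomb B q (k i) b \<ominus>\<^bsub>B\<^esub> lincomb B q (k i) (\<lambda>j. f (\<mu> j))"
        unfolding b'_def by (rule f.N.lincomb_diff_right[OF row[OF i] b(1) fm])
      also have "\<dots> = f (\<alpha> i) \<ominus>\<^bsub>B\<^esub> f (\<alpha> i)"
        using f.lincomb[OF row[OF i] \<mu>(1)] \<alpha>(2) \<mu>(2) i by metis
      also have "\<dots> = \<zero>\<^bsub>B\<^esub>"
        using f.closed[OF funcset_mem[OF \<alpha>(1)], of i] i by (simp add: f.N.M.diff_eq_zero_iff)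
      finally show ?thesis .
    qed
    moreover have "b' \<in> {..<q} \<rightarrow> carrier B" using funcset_mem[OF b(1)] funcset_mem[OF fm] by (auto simp: b'_def)
    ultimately show "\<exists>b\<in>{..<q} \<rightarrow> carrier B. (\<forall>j<q. g (b j) = c j) \<and> (\<forall>i<p. lincomb B q (k i) b = \<zero>\<^bsub>B\<^esub>)"
      by blast
  qed
next
  assume lift: "liftable R p q B g C"
  show ?sys
  proof (intro allI impI ballI)
    fix k \<alpha> \<beta>
    assume k: "is_matrix R q p k" and \<alpha>: "\<alpha> \<in> {..<p} \<rightarrow> carrier A" and \<beta>: "\<beta> \<in> {..<q} \<rightarrow> carrier B"
      and f\<alpha>: "\<forall>i<p. f (\<alpha> i) = lincomb B q (\<lambda>j. k j i) \<beta>"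
    note col = is_matrix_col[OF k]
    have k': "is_matrix R p q (\<lambda>i j. k j i)" using k by (simp add: is_matrix_def)
    have gb: "(\<lambda>j. g (\<beta> j)) \<in> {..<q} \<rightarrow> carrier C" using \<beta> by (auto dest: funcset_mem)
    have "lincomb C q (\<lambda>j. k j i) (\<lambda>j. g (\<beta> j)) = \<zero>\<^bsub>C\<^esub>" if i: "i < p" for i
      using g.lincomb[OF col[OF i] \<beta>] f\<alpha> i gf[OF funcset_mem[OF \<alpha>], of i] by simp
    then obtain b where b: "b \<in> {..<q} \<rightarrow> carrier B" "\<forall>j<q. g (b j) = g (\<beta> j)"
      "\<forall>i<p. lincomb B q (\<lambda>j. k j i) b = \<zero>\<^bsub>B\<^esub>"
      using lift[unfolded liftable_def, rule_format, of "\<lambda>i j. k j i" "\<lambda>j. g (\<beta> j)"] k' gb by auto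
    have d: "(\<lambda>j. \<beta> j \<ominus>\<^bsub>B\<^esub> b j) \<in> {..<q} \<rightarrow> carrier B" using \<beta> b(1) by (auto dest: funcset_mem)
    have "g (\<beta> j \<ominus>\<^bsub>B\<^esub> b j) = \<zero>\<^bsub>C\<^esub>" if "j < q" for j
      using that b(2) funcset_mem[OF \<beta>] funcset_mem[OF b(1)] by (simp add: g.diff g.N.M.diff_eq_zero_iff)
    then obtain \<mu> where \<mu>: "\<mu> \<in> {..<q} \<rightarrow> carrier A" "\<forall>j<q. f (\<mu> j) = \<beta> j \<ominus>\<^bsub>B\<^esub> b j"
      using kernel_family[OF d] by blast
    have "\<alpha> i = lincomb A q (\<lambda>j. k j i) \<mu>" if i: "i < p" for i
    proof (rule inj_onD[OF inj])
      have "f (lincomb A q (\<lambda>j. k j i) \<mu>) = lincomb B q (\<lambda>j. k j i) (\<lambda>j. f (\<mu> j))"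
        by (rule f.lincomb[OF col[OF i] \<mu>(1)])
      also have "\<dots> = lincomb B q (\<lambda>j. k j i) (\<lambda>j. \<beta> j \<ominus>\<^bsub>B\<^esub> b j)"
        by (rule f.N.lincomb_cong[OF col[OF i] d]) (use \<mu> in auto)
      also have "\<dots> = f (\<alpha> i)"
        using f.N.lincomb_diff_right[OF col[OF i] \<beta> b(1)] b(3) f\<alpha> i f.closed[OF funcset_mem[OF \<alpha>], of i]
        by (simp add: a_minus_def[of B] f.N.M.neg_zero)
      finally show "f (\<alpha> i) = f (lincomb A q (\<lambda>j. k j i) \<mu>)" by simp
    qed (use \<alpha> \<mu>(1) col[OF i] i in \<open>auto dest: funcset_mem\<close>)
    then show "\<exists>\<mu>\<in>{..<q} \<rightarrow> carrier A. \<forall>i<p. \<alpha> i = lincomb A q (\<lambda>j. k j i) \<mu>" using \<mu>(1) by blast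
  qed
qed

end

text \<open>Every matrix is the relation matrix of a test module with carrier type
  \<open>'a univ\<close>, namely its \<open>coker\<close>, and every test module has a relation
  matrix. Quantifying over test modules thus amounts to quantifying over matrices.\<close>

theorem pq_pure_iff:
  assumes "ring R"
  shows "pq_pure R p q A f B g C \<longleftrightarrow> ses R A f B g C \<and> liftable R p q B g C"
proof (cases "ses R A f B g C")
  case True
  then interpret exact_modules R A f B g C by (simp add: ses_iff)
  interpret opp: ring "opp_ring R" by (rule ring_opp_ring) fact
  have "(\<forall>X :: ('a, 'a univ) module. presented (opp_ring R) p q X \<longrightarrow>
        short_exact_sequence (tensor R X C) (tensor R X B) (tensor R X A)
          (tensor_map R X C g) (tensor_map R X B f)) \<longleftrightarrow>
      (\<forall>k. is_matrix R q p k \<longrightarrow>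
     (\<forall>\<alpha>\<in>{..<p} \<rightarrow> carrier A. \<forall>\<beta>\<in>{..<q} \<rightarrow> carrier B. (\<forall>i<p. f (\<alpha> i) = lincomb B q (\<lambda>j. k j i) \<beta>) \<longrightarrow>
       (\<exists>\<mu>\<in>{..<q} \<rightarrow> carrier A. \<forall>i<p. \<alpha> i = lincomb A q (\<lambda>j. k j i) \<mu>)))"
    (is "?L \<longleftrightarrow> (\<forall>k. is_matrix R q p k \<longrightarrow> ?S k)")
  proof
    assume L: ?L
    show "\<forall>k. is_matrix R q p k \<longrightarrow> ?S k"
    proof (intro allI impI)
      fix k assume k: "is_matrix R q p k"
      then have k': "is_matrix (opp_ring R) q p k" by simp
      have "presentation (opp_ring R) (coker (opp_ring R) p q k) p q
          (\<lambda>i. coker_proj (opp_ring R) p q k (unit_vec (opp_ring R) i)) k"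
        using opp.coker_has_presentation[OF k'] opp.left_module_coker[OF k']
        by (simp add: presentation_def presentation_axioms_def lmod_def)
      from short_exact_tensor_iff[OF this] L[rule_format, OF opp.coker_presented[OF k']] show "?S k"
        by (rule iffD1)
    qed
  next
    assume S: "\<forall>k. is_matrix R q p k \<longrightarrow> ?S k"
    show ?L
    proof (intro allI impI)
      fix X :: "('a, 'a univ) module" assume X: "presented (opp_ring R) p q X"
      obtain x k where "has_presentation (opp_ring R) p q X x k"
        using presented_has_presentation[OF opp.ring_axioms X] by blast
      then have "presentation (opp_ring R) X p q x k"
        using X by (simp add: presentation_def presentation_axioms_def lmod_def presented_def[of "opp_ring R"])
      from short_exact_tensor_iff[OF this] presentation.k_matrix[OF this]
      show "short_exact_sequence (tensor R X C) (tensor R X B) (tensor R X A)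
          (tensor_map R X C g) (tensor_map R X B f)"
        using S by simp
    qed
  qed
  then show ?thesis using True system_iff_liftable[of q p] by (simp add: pq_pure_def)
qed (simp add: pq_pure_def)

section \<open>Direct sums and transport of structure\<close>

definition direct_sum :: "('w \<Rightarrow> ('a, 'b) module) \<Rightarrow> ('a, 'w \<Rightarrow> 'b) module" where
  "direct_sum Z = \<lparr>carrier = {h. (\<forall>w. h w \<in> carrier (Z w)) \<and> finite {w. h w \<noteq> \<zero>\<^bsub>Z w\<^esub>}},
     monoid.mult = undefined, one = undefined, ring.zero = (\<lambda>w. \<zero>\<^bsub>Z w\<^esub>),
     add = (\<lambda>h h' w. h w \<oplus>\<^bsub>Z w\<^esub> h' w), smult = (\<lambda>r h w. r \<odot>\<^bsub>Z w\<^esub> h w)\<rparr>"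

text \<open>The elements of a direct sum are functions into \<open>'a univ\<close>, while purity is
  defined for modules on \<open>'a univ\<close> itself; the sum has to be carried over along an
  injection.\<close>

definition transport :: "('b \<Rightarrow> 'c) \<Rightarrow> ('a, 'b) module \<Rightarrow> ('a, 'c) module" where
  "transport \<iota> M = \<lparr>carrier = \<iota> ` carrier M, monoid.mult = undefined, one = undefined,
     ring.zero = \<iota> \<zero>\<^bsub>M\<^esub>,
     add = (\<lambda>x y. \<iota> (inv_into (carrier M) \<iota> x \<oplus>\<^bsub>M\<^esub> inv_into (carrier M) \<iota> y)),
     smult = (\<lambda>r x. \<iota> (r \<odot>\<^bsub>M\<^esub> inv_into (carrier M) \<iota> x))\<rparr>"

lemma direct_sum_simps:
  "carrier (direct_sum Z) = {h. (\<forall>w. h w \<in> carrier (Z w)) \<and> finite {w. h w \<noteq> \<zero>\<^bsub>Z w\<^esub>}}"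
  "\<zero>\<^bsub>direct_sum Z\<^esub> = (\<lambda>w. \<zero>\<^bsub>Z w\<^esub>)"
  "h \<oplus>\<^bsub>direct_sum Z\<^esub> h' = (\<lambda>w. h w \<oplus>\<^bsub>Z w\<^esub> h' w)"
  "r \<odot>\<^bsub>direct_sum Z\<^esub> h = (\<lambda>w. r \<odot>\<^bsub>Z w\<^esub> h w)"
  by (simp_all add: direct_sum_def)

locale module_family =
  fixes R :: "('a, 'k) ring_scheme" (structure) and Z :: "'w \<Rightarrow> ('a, 'b) module"
  assumes ring_R: "ring R" and modules: "left_module R (Z w)"
begin

sublocale Z: left_module R "Z w" for w by (rule modules)

lemma left_module_direct_sum: "left_module R (direct_sum Z)"
proof -
  interpret ring R by (rule ring_R)
  have fin_add: "finite {w. h w \<oplus>\<^bsub>Z w\<^esub> h' w \<noteq> \<zero>\<^bsub>Z w\<^esub>}"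
    if "finite {w. h w \<noteq> \<zero>\<^bsub>Z w\<^esub>}" "finite {w. h' w \<noteq> \<zero>\<^bsub>Z w\<^esub>}" for h h'
    by (rule finite_subset[OF _ finite_UnI[OF that]]) auto
  have fin_smult: "finite {w. r \<odot>\<^bsub>Z w\<^esub> h w \<noteq> \<zero>\<^bsub>Z w\<^esub>}"
    if "finite {w. h w \<noteq> \<zero>\<^bsub>Z w\<^esub>}" "r \<in> carrier R" for h r
    by (rule finite_subset[OF _ that(1)]) (use that(2) in auto)
  have fin_neg: "finite {w. \<ominus>\<^bsub>Z w\<^esub> h w \<noteq> \<zero>\<^bsub>Z w\<^esub>}" if "finite {w. h w \<noteq> \<zero>\<^bsub>Z w\<^esub>}" for h
    by (rule finite_subset[OF _ that]) auto
  interpret A: abelian_group "direct_sum Z"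
  proof (rule abelian_groupI)
    fix h assume h: "h \<in> carrier (direct_sum Z)"
    then have "(\<lambda>w. \<ominus>\<^bsub>Z w\<^esub> h w) \<oplus>\<^bsub>direct_sum Z\<^esub> h = \<zero>\<^bsub>direct_sum Z\<^esub>"
      by (simp add: direct_sum_simps Z.M.l_neg)
    moreover have "(\<lambda>w. \<ominus>\<^bsub>Z w\<^esub> h w) \<in> carrier (direct_sum Z)"
      using h fin_neg by (simp add: direct_sum_simps)
    ultimately show "\<exists>y\<in>carrier (direct_sum Z). y \<oplus>\<^bsub>direct_sum Z\<^esub> h = \<zero>\<^bsub>direct_sum Z\<^esub>"
      by blast
  qed (simp_all add: direct_sum_simps fin_add Z.M.a_assoc, simp add: Z.M.a_comm)
  show ?thesis
    by unfold_locales
      (simp_all add: direct_sum_simps fin_smult Z.smult_l_distr Z.smult_r_distr Z.smult_assoc)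
qed

lemma component_hom: "(\<lambda>h. h w) \<in> mod_hom R (direct_sum Z) (Z w)"
  by (rule mod_homI) (auto simp: direct_sum_simps)

lemma lincomb_direct_sum:
  assumes "x \<in> {..<q} \<rightarrow> carrier R" "y \<in> {..<q} \<rightarrow> carrier (direct_sum Z)"
  shows "lincomb (direct_sum Z) q x y w = lincomb (Z w) q x (\<lambda>j. y j w)"
proof -
  interpret module_hom R "direct_sum Z" "Z w" "\<lambda>h. h w"
    by (simp add: module_hom_def module_hom_axioms_def left_module_direct_sum modules component_hom)
  show ?thesis using lincomb[OF assms] by simp
qed

definition injection where "injection w z = (\<lambda>v. if v = w then z else \<zero>\<^bsub>Z v\<^esub>)"

lemma injection_hom: "injection w \<in> mod_hom R (Z w) (direct_sum Z)"
proof (rule mod_homI)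
  show "injection w \<in> carrier (Z w) \<rightarrow> carrier (direct_sum Z)"
    by (auto simp: direct_sum_simps injection_def intro: finite_subset[of _ "{w}"])
qed (auto simp: direct_sum_simps injection_def fun_eq_iff)

definition sum_map where "sum_map C \<phi> h = (\<Oplus>\<^bsub>C\<^esub>w\<in>{w. h w \<noteq> \<zero>\<^bsub>Z w\<^esub>}. \<phi> w (h w))"

context
  fixes C :: "('a, 'c) module" and \<phi>
  assumes C: "left_module R C" and \<phi>: "\<And>w. \<phi> w \<in> mod_hom R (Z w) C"
begin

interpretation C: left_module R C by (rule C)

interpretation phi: module_hom R "Z w" C "\<phi> w" for w
  by (simp add: module_hom_def module_hom_axioms_def C modules \<phi>)

text \<open>The sum may be taken over any finite set containing the support. Additivity needs this,
  since two elements and their sum have different supports.\<close>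

lemma sum_map_eq:
  assumes "h \<in> carrier (direct_sum Z)" "finite W" "{w. h w \<noteq> \<zero>\<^bsub>Z w\<^esub>} \<subseteq> W"
  shows "sum_map C \<phi> h = (\<Oplus>\<^bsub>C\<^esub>w\<in>W. \<phi> w (h w))"
  unfolding sum_map_def
  by (rule C.M.add.finprod_mono_neutral_cong_left)
    (use assms in \<open>auto simp: direct_sum_simps\<close>)

lemma sum_map_hom: "sum_map C \<phi> \<in> mod_hom R (direct_sum Z) C"
proof (rule mod_homI)
  show "sum_map C \<phi> \<in> carrier (direct_sum Z) \<rightarrow> carrier C"
    by (auto simp: sum_map_def direct_sum_simps intro!: C.M.finsum_closed)
next
  interpret D: left_module R "direct_sum Z" by (rule left_module_direct_sum)
  fix h h' assume h: "h \<in> carrier (direct_sum Z)" "h' \<in> carrier (direct_sum Z)"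
  define W where "W = {w. h w \<noteq> \<zero>\<^bsub>Z w\<^esub>} \<union> {w. h' w \<noteq> \<zero>\<^bsub>Z w\<^esub>}"
  have W: "finite W" "{w. h w \<noteq> \<zero>\<^bsub>Z w\<^esub>} \<subseteq> W" "{w. h' w \<noteq> \<zero>\<^bsub>Z w\<^esub>} \<subseteq> W"
    "{w. (h \<oplus>\<^bsub>direct_sum Z\<^esub> h') w \<noteq> \<zero>\<^bsub>Z w\<^esub>} \<subseteq> W"
    using h by (auto simp: W_def direct_sum_simps)
  have hw: "h w \<in> carrier (Z w)" "h' w \<in> carrier (Z w)" for w using h by (auto simp: direct_sum_simps)
  have "sum_map C \<phi> (h \<oplus>\<^bsub>direct_sum Z\<^esub> h') = (\<Oplus>\<^bsub>C\<^esub>w\<in>W. \<phi> w (h w) \<oplus>\<^bsub>C\<^esub> \<phi> w (h' w))"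
    using sum_map_eq[OF D.M.a_closed[OF h] W(1,4)] by (simp add: direct_sum_simps phi.add hw)
  also have "\<dots> = sum_map C \<phi> h \<oplus>\<^bsub>C\<^esub> sum_map C \<phi> h'"
    unfolding sum_map_eq[OF h(1) W(1,2)] sum_map_eq[OF h(2) W(1,3)]
    by (rule C.M.finsum_addf) (auto simp: hw)
  finally show "sum_map C \<phi> (h \<oplus>\<^bsub>direct_sum Z\<^esub> h') = sum_map C \<phi> h \<oplus>\<^bsub>C\<^esub> sum_map C \<phi> h'" .
next
  interpret D: left_module R "direct_sum Z" by (rule left_module_direct_sum)
  fix r h assume r: "r \<in> carrier R" and h: "h \<in> carrier (direct_sum Z)"
  define W where "W = {w. h w \<noteq> \<zero>\<^bsub>Z w\<^esub>}"
  have W: "finite W" "{w. h w \<noteq> \<zero>\<^bsub>Z w\<^esub>} \<subseteq> W" "{w. (r \<odot>\<^bsub>direct_sum Z\<^esub> h) w \<noteq> \<zero>\<^bsub>Z w\<^esub>} \<subseteq> W"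
    using h r by (auto simp: W_def direct_sum_simps)
  have hw: "h w \<in> carrier (Z w)" for w using h by (auto simp: direct_sum_simps)
  have "sum_map C \<phi> (r \<odot>\<^bsub>direct_sum Z\<^esub> h) = (\<Oplus>\<^bsub>C\<^esub>w\<in>W. r \<odot>\<^bsub>C\<^esub> \<phi> w (h w))"
    using sum_map_eq[OF D.smult_closed[OF r h] W(1,3)] by (simp add: direct_sum_simps phi.smult hw r)
  also have "\<dots> = r \<odot>\<^bsub>C\<^esub> sum_map C \<phi> h"
    unfolding sum_map_eq[OF h(1) W(1,2)]
    by (rule C.smult_finsum[symmetric]) (auto simp: hw r W)
  finally show "sum_map C \<phi> (r \<odot>\<^bsub>direct_sum Z\<^esub> h) = r \<odot>\<^bsub>C\<^esub> sum_map C \<phi> h" .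
qed

lemma sum_map_injection:
  assumes "z \<in> carrier (Z w)"
  shows "sum_map C \<phi> (injection w z) = \<phi> w z"
proof -
  have "injection w z \<in> carrier (direct_sum Z)"
    using mod_hom_closed[OF injection_hom assms] .
  then have "sum_map C \<phi> (injection w z) = (\<Oplus>\<^bsub>C\<^esub>v\<in>{w}. \<phi> v (injection w z v))"
    by (rule sum_map_eq) (auto simp: injection_def)
  then show ?thesis using assms by (simp add: injection_def)
qed

end

end

locale transported = lmod +
  fixes \<iota> :: "_ \<Rightarrow> _"
  assumes inj: "inj_on \<iota> (carrier M)"
begin

abbreviation ret :: "_ \<Rightarrow> _" where "ret \<equiv> inv_into (carrier M) \<iota>"

lemma ret [simp]: "x \<in> carrier M \<Longrightarrow> ret (\<iota> x) = x"
  using inj by simp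

lemma left_module_transport: "left_module R (transport \<iota> M)"
proof -
  interpret A: abelian_group "transport \<iota> M"
  proof (rule abelian_groupI)
    fix y assume "y \<in> carrier (transport \<iota> M)"
    then obtain x where x: "x \<in> carrier M" "y = \<iota> x" by (auto simp: transport_def)
    then have "\<iota> (\<ominus>\<^bsub>M\<^esub> x) \<oplus>\<^bsub>transport \<iota> M\<^esub> y = \<zero>\<^bsub>transport \<iota> M\<^esub>"
      by (simp add: transport_def M.l_neg)
    then show "\<exists>z\<in>carrier (transport \<iota> M). z \<oplus>\<^bsub>transport \<iota> M\<^esub> y = \<zero>\<^bsub>transport \<iota> M\<^esub>"
      using x(1) by (auto simp: transport_def)
  qed (auto simp: transport_def M.a_assoc, simp add: M.a_comm)
  show ?thesis
    by unfold_locales (auto simp: transport_def smult_l_distr smult_r_distr smult_assoc)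
qed

lemma transport_hom: "\<iota> \<in> mod_hom R M (transport \<iota> M)"
  by (rule mod_homI) (auto simp: transport_def)

lemma ret_hom: "ret \<in> mod_hom R (transport \<iota> M) M"
  by (rule mod_homI) (auto simp: transport_def)

end

section \<open>A canonical pure sequence\<close>

text \<open>A pairing on sequences by interleaving: a pair of sequences becomes one sequence, so a
  graph becomes a set of sequences.\<close>

definition join :: "(nat \<Rightarrow> 'a) \<Rightarrow> (nat \<Rightarrow> 'a) \<Rightarrow> nat \<Rightarrow> 'a" where
  "join w y n = (if even n then w (n div 2) else y (n div 2))"

lemma join_eq_iff: "join w y = join w' y' \<longleftrightarrow> w = w' \<and> y = y'"
proof
  assume *: "join w y = join w' y'"
  have "w n = w' n" "y n = y' n" for n
    using fun_cong[OF *, of "2 * n"] fun_cong[OF *, of "Suc (2 * n)"] by (simp_all add: join_def)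
  then show "w = w' \<and> y = y'" by auto
qed simp

text \<open>A function with values in \<^typ>\<open>'a univ\<close> is coded by its graph.\<close>

definition encode :: "((nat \<Rightarrow> 'a) \<Rightarrow> 'a univ) \<Rightarrow> 'a univ" where
  "encode h = {join w y | w y. y \<in> h w}"

lemma inj_encode: "inj encode"
proof (rule injI, rule ext)
  fix h h' :: "(nat \<Rightarrow> 'a) \<Rightarrow> 'a univ" and w
  assume "encode h = encode h'"
  then have "y \<in> h w \<longleftrightarrow> y \<in> h' w" for y
    unfolding encode_def set_eq_iff by (auto simp: join_eq_iff dest: spec[of _ "join w y"])
  then show "h w = h' w" by blast
qed

lemma liftableD:
  assumes "liftable R p q B g C" "is_matrix R p q k" "c \<in> {..<q} \<rightarrow> carrier C"
    "\<And>i. i < p \<Longrightarrow> lincomb C q (k i) c = \<zero>\<^bsub>C\<^esub>"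
  shows "\<exists>b\<in>{..<q} \<rightarrow> carrier B. (\<forall>j<q. g (b j) = c j) \<and> (\<forall>i<p. lincomb B q (k i) b = \<zero>\<^bsub>B\<^esub>)"
  using assms(1)[unfolded liftable_def, rule_format, of k c] assms(2-4) by simp

lemma liftable_transport:
  assumes "left_module R B" "left_module R B'" "\<iota> \<in> mod_hom R B B'"
    "liftable R p q B (\<lambda>x. g (\<iota> x)) C"
  shows "liftable R p q B' g C"
proof -
  interpret i: module_hom R B B' \<iota>
    using assms by (simp add: module_hom_def module_hom_axioms_def)
  show ?thesis
    unfolding liftable_def
  proof (intro allI impI, elim conjE)
    fix k c assume k: "is_matrix R p q k" and c: "c \<in> {..<q} \<rightarrow> carrier C"
      "\<forall>i<p. lincomb C q (k i) c = \<zero>\<^bsub>C\<^esub>"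
    then obtain b where b: "b \<in> {..<q} \<rightarrow> carrier B" "\<forall>j<q. g (\<iota> (b j)) = c j"
      "\<forall>i<p. lincomb B q (k i) b = \<zero>\<^bsub>B\<^esub>"
      using liftableD[OF assms(4) k c(1)] c(2) by auto
    have "lincomb B' q (k i) (\<lambda>j. \<iota> (b j)) = \<zero>\<^bsub>B'\<^esub>" if "i < p" for i
      using i.lincomb[OF is_matrix_row[OF k that] b(1)] b(3) that by simp
    moreover have "(\<lambda>j. \<iota> (b j)) \<in> {..<q} \<rightarrow> carrier B'" using funcset_mem[OF b(1)] by auto
    ultimately show "\<exists>b\<in>{..<q} \<rightarrow> carrier B'. (\<forall>j<q. g (b j) = c j) \<and> (\<forall>i<p. lincomb B' q (k i) b = \<zero>\<^bsub>B'\<^esub>)"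
      using b(2) by (intro bexI[of _ "\<lambda>j. \<iota> (b j)"]) auto
  qed
qed

lemma ses_kernel:
  assumes "left_module R B" "left_module R C" "g \<in> mod_hom R B C" "g ` carrier B = carrier C"
  shows "ses R (B\<lparr>carrier := {y \<in> carrier B. g y = \<zero>\<^bsub>C\<^esub>}\<rparr>) (\<lambda>x. x) B g C"
proof -
  interpret g: module_hom R B C g using assms by (simp add: module_hom_def module_hom_axioms_def)
  have "submodule {y \<in> carrier B. g y = \<zero>\<^bsub>C\<^esub>} R B"
    by (rule g.M.submoduleI) (auto simp: g.add g.smult)
  then have "left_module R (B\<lparr>carrier := {y \<in> carrier B. g y = \<zero>\<^bsub>C\<^esub>}\<rparr>)"
    by (rule g.M.left_module_submodule)
  then show ?thesis
    using assms by (auto simp: ses_def mod_hom_def hom_def)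
qed

text \<open>\<gamma> names all elements of \<open>C\<close> by sequences, so that a system with a
  solution in \<open>C\<close> can be described by one sequence. This allows sequences as index type
  of the direct sum below.\<close>

locale canonical_sequence = C: lmod R C
  for R :: "('a, 'k) ring_scheme" (structure) and C :: "('a, 'a univ) module" +
  fixes p q :: nat and \<gamma> :: "(nat \<Rightarrow> 'a) \<Rightarrow> 'a univ"
  assumes \<gamma>: "carrier C \<subseteq> range \<gamma>" and q_pos: "q > 0"
begin

text \<open>Decoding of a sequence: positions tagged 0 hold the matrix entries, positions tagged 1
  hold the names of the components of the solution.\<close>

definition raw_matrix :: "(nat \<Rightarrow> 'a) \<Rightarrow> nat \<Rightarrow> nat \<Rightarrow> 'a" where
  "raw_matrix w i j = w (prod_encode (0, prod_encode (i, j)))"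

definition raw_vector where
  "raw_vector w j = \<gamma> (\<lambda>l. w (prod_encode (1, prod_encode (j, l))))"

definition solution where
  "solution k c \<longleftrightarrow> is_matrix R p q k \<and> c \<in> {..<q} \<rightarrow> carrier C \<and> (\<forall>i<p. lincomb C q (k i) c = \<zero>\<^bsub>C\<^esub>)"

text \<open>A sequence that does not describe a solution is read as the zero system with the zero
  solution. Hence every index yields a legitimate summand with a map into \<open>C\<close>.\<close>

definition mat where
  "mat w = (if solution (raw_matrix w) (raw_vector w) then raw_matrix w else (\<lambda>i j. \<zero>))"

definition vec where
  "vec w = (if solution (raw_matrix w) (raw_vector w) then raw_vector w else (\<lambda>j. \<zero>\<^bsub>C\<^esub>))"

lemma solution_mat_vec: "solution (mat w) (vec w)"
  by (auto simp: mat_def vec_def solution_def is_matrix_def)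

lemma mat_matrix: "is_matrix R p q (mat w)"
  and vec_closed: "vec w \<in> {..<q} \<rightarrow> carrier C"
  and mat_vec: "i < p \<Longrightarrow> lincomb C q (mat w i) (vec w) = \<zero>\<^bsub>C\<^esub>"
  using solution_mat_vec[of w] by (simp_all add: solution_def)

lemma ex_code:
  assumes "solution k c"
  shows "\<exists>w. (\<forall>i<p. \<forall>j<q. mat w i j = k i j) \<and> (\<forall>j<q. vec w j = c j)"
proof -
  have c: "c \<in> {..<q} \<rightarrow> carrier C" and k: "is_matrix R p q k"
    and kc: "\<And>i. i < p \<Longrightarrow> lincomb C q (k i) c = \<zero>\<^bsub>C\<^esub>" using assms by (auto simp: solution_def)
  have "c j \<in> range \<gamma>" if "j < q" for j using \<gamma> funcset_mem[OF c] that by auto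
  then have "\<forall>j. \<exists>d. j < q \<longrightarrow> c j = \<gamma> d" by (metis rangeE)
  then obtain d where d: "\<And>j. j < q \<Longrightarrow> c j = \<gamma> (d j)" by metis
  define w where "w n = (case prod_decode n of (t, m) \<Rightarrow> case prod_decode m of (i, j) \<Rightarrow>
      if t = 0 then k i j else d i j)" for n
  have raw: "raw_matrix w = k" "\<And>j. j < q \<Longrightarrow> raw_vector w j = c j"
    by (auto simp: raw_matrix_def raw_vector_def w_def d fun_eq_iff)
  have "lincomb C q (k i) (raw_vector w) = \<zero>\<^bsub>C\<^esub>" if "i < p" for i
    unfolding kc[OF that, symmetric]
    by (rule C.lincomb_cong) (use raw(2) is_matrix_row[OF k that] c in auto)
  moreover have "raw_vector w \<in> {..<q} \<rightarrow> carrier C" using raw(2) funcset_mem[OF c] by auto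
  ultimately have "solution (raw_matrix w) (raw_vector w)"
    using k by (simp add: solution_def raw(1))
  then show ?thesis by (intro exI[of _ w]) (simp add: mat_def vec_def raw)
qed

text \<open>Unknowns become generators and equations become relations, hence the order
  \<open>q\<close>, \<open>p\<close>. A solution of the system in a module is the same as a map from
  \<open>Z w\<close> into that module.\<close>

definition Z where "Z w = coker R q p (mat w)"

sublocale Z: module_family R Z
  by (rule module_family.intro) (simp_all add: Z_def C.R.left_module_coker[OF mat_matrix] C.ring_R)

abbreviation gens where "gens w j \<equiv> coker_proj R q p (mat w) (unit_vec R j)"

lemma presentation_Z: "presentation R (Z w) q p (gens w) (mat w)"
  using C.R.coker_has_presentation[OF mat_matrix] Z.modules[of w]
  by (simp add: presentation_def presentation_axioms_def lmod_def Z_def)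

lemma ex_phi: "\<exists>f\<in>mod_hom R (Z w) C. \<forall>\<rho>\<in>{..<q} \<rightarrow> carrier R. f (coker_proj R q p (mat w) \<rho>) = lincomb C q \<rho> (vec w)"
  using C.hom_of_presentation[OF presentation_Z vec_closed mat_vec, of w]
  by (simp add: Z_def C.R.coker_proj_lincomb[OF mat_matrix] cong: ball_cong)

definition phi where
  "phi w = (SOME f. f \<in> mod_hom R (Z w) C \<and>
     (\<forall>\<rho>\<in>{..<q} \<rightarrow> carrier R. f (coker_proj R q p (mat w) \<rho>) = lincomb C q \<rho> (vec w)))"

lemma phi: "phi w \<in> mod_hom R (Z w) C"
  "\<rho> \<in> {..<q} \<rightarrow> carrier R \<Longrightarrow> phi w (coker_proj R q p (mat w) \<rho>) = lincomb C q \<rho> (vec w)"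
  using someI_ex[of "\<lambda>f. f \<in> mod_hom R (Z w) C \<and>
     (\<forall>\<rho>\<in>{..<q} \<rightarrow> carrier R. f (coker_proj R q p (mat w) \<rho>) = lincomb C q \<rho> (vec w))"] ex_phi[of w]
  unfolding phi_def[symmetric] by blast+

abbreviation S where "S \<equiv> direct_sum Z"
abbreviation \<pi> where "\<pi> \<equiv> Z.sum_map C phi"

lemma \<pi>_hom: "\<pi> \<in> mod_hom R S C"
  by (rule Z.sum_map_hom[OF C.left_module_axioms phi(1)])

text \<open>Every solution in \<open>C\<close> has a code \<open>w\<close>. The generators of the
  summand \<open>Z w\<close> solve the same system universally, and \<open>phi w\<close> maps them
  to the given solution.\<close>

lemma liftable_\<pi>: "liftable R p q S \<pi> C"
  unfolding liftable_def
proof (intro allI impI)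
  fix k c assume "is_matrix R p q k \<and> c \<in> {..<q} \<rightarrow> carrier C \<and> (\<forall>i<p. lincomb C q (k i) c = \<zero>\<^bsub>C\<^esub>)"
  then have sol: "solution k c" by (simp add: solution_def)
  then obtain w where w: "\<And>i j. \<lbrakk>i < p; j < q\<rbrakk> \<Longrightarrow> mat w i j = k i j" "\<And>j. j < q \<Longrightarrow> vec w j = c j"
    using ex_code by blast
  interpret P: presentation R "Z w" q p "gens w" "mat w" by (rule presentation_Z)
  interpret inj: module_hom R "Z w" S "Z.injection w"
    by (simp add: module_hom_def module_hom_axioms_def Z.modules Z.left_module_direct_sum Z.injection_hom)
  have gens: "gens w j \<in> carrier (Z w)" if "j < q" for j using funcset_mem[OF P.x_closed] that by simp
  define b where "b j = Z.injection w (gens w j)" for j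
  have b: "b \<in> {..<q} \<rightarrow> carrier S" using gens by (auto simp: b_def)
  have "\<pi> (b j) = c j" if "j < q" for j
    using Z.sum_map_injection[OF C.left_module_axioms phi(1) gens[OF that]]
      phi(2)[of "unit_vec R j" w] C.lincomb_unit_vec[OF that vec_closed] w(2)[OF that]
    by (simp add: b_def)
  moreover have "lincomb S q (k i) b = \<zero>\<^bsub>S\<^esub>" if i: "i < p" for i
  proof -
    have row: "mat w i \<in> {..<q} \<rightarrow> carrier R" using is_matrix_row[OF mat_matrix i] .
    have "lincomb S q (k i) b = lincomb S q (mat w i) b"
      by (rule inj.N.lincomb_cong[OF row b]) (use w(1) i in auto)
    also have "\<dots> = Z.injection w (lincomb (Z w) q (mat w i) (gens w))"
      unfolding b_def[abs_def] by (rule inj.lincomb[symmetric, OF row P.x_closed])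
    also have "lincomb (Z w) q (mat w i) (gens w) = \<zero>\<^bsub>Z w\<^esub>"
      unfolding P.relation_iff[OF row]
    proof (intro bexI[of _ "unit_vec R i"] allI impI)
      fix j assume "j < q"
      then have "(\<lambda>l. mat w l j) \<in> {..<p} \<rightarrow> carrier R" by (rule is_matrix_col[OF mat_matrix])
      from left_module.lincomb_unit_vec[OF regular_left_module i, of R "\<lambda>l. mat w l j"] this
      show "mat w i j = dot R p (unit_vec R i) (\<lambda>l. mat w l j)"
        by (simp add: lincomb_regular C.ring_R)
    qed auto
    finally show ?thesis by simp
  qed
  ultimately show "\<exists>b\<in>{..<q} \<rightarrow> carrier S. (\<forall>j<q. \<pi> (b j) = c j) \<and> (\<forall>i<p. lincomb S q (k i) b = \<zero>\<^bsub>S\<^esub>)"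
    using b by blast
qed

text \<open>For the zero matrix every family is a solution and therefore lifts. A constant family
  with at least one unknown suffices, whence \<open>q > 0\<close>.\<close>

lemma \<pi>_surj: "\<pi> ` carrier S = carrier C"
proof
  show "\<pi> ` carrier S \<subseteq> carrier C" using mod_hom_closed[OF \<pi>_hom] by blast
  show "carrier C \<subseteq> \<pi> ` carrier S"
  proof
    fix c assume "c \<in> carrier C"
    then obtain b where "b \<in> {..<q} \<rightarrow> carrier S" "\<forall>j<q. \<pi> (b j) = c"
      using liftable_\<pi>[unfolded liftable_def, rule_format, of "\<lambda>i j. \<zero>" "\<lambda>j. c"]
      by (auto simp: is_matrix_def)
    then show "c \<in> \<pi> ` carrier S" using q_pos by (intro image_eqI[of _ _ "b 0"]) auto
  qed
qed

text \<open>The sequence lives on the coded copy of \<open>S\<close>. Later only the lifting of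
  solutions to its middle term is used, so the map \<beta> back to \<open>S\<close> is all that is
  kept of the coding.\<close>

lemma ex_pure_sequence:
  "\<exists>A f B g \<beta>. pq_pure R p q A f B g C \<and> left_module R B \<and> \<beta> \<in> mod_hom R B S \<and> (\<forall>x\<in>carrier B. g x = \<pi> (\<beta> x))"
proof -
  interpret T: transported R S encode
    using Z.left_module_direct_sum inj_on_subset[OF inj_encode]
    by (simp add: transported_def transported_axioms_def lmod_def)
  let ?B = "transport encode S" and ?g = "\<lambda>x. \<pi> (T.ret x)"
  have g: "?g \<in> mod_hom R ?B C" by (rule mod_hom_compose[OF T.ret_hom \<pi>_hom])
  have "?g ` carrier ?B = carrier C"
    unfolding \<pi>_surj[symmetric] by (auto simp: transport_def image_image cong: image_cong_simp)
  note ses = ses_kernel[OF T.left_module_transport C.left_module_axioms g this]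
  have "liftable R p q S (\<lambda>x. ?g (encode x)) C"
    unfolding liftable_def
  proof (intro allI impI)
    fix k c assume *: "is_matrix R p q k \<and> c \<in> {..<q} \<rightarrow> carrier C \<and> (\<forall>i<p. lincomb C q (k i) c = \<zero>\<^bsub>C\<^esub>)"
    obtain b where b: "b \<in> {..<q} \<rightarrow> carrier S" "\<forall>j<q. \<pi> (b j) = c j" "\<forall>i<p. lincomb S q (k i) b = \<zero>\<^bsub>S\<^esub>"
      using liftableD[OF liftable_\<pi>, of k c] * by auto
    then show "\<exists>b\<in>{..<q} \<rightarrow> carrier S. (\<forall>j<q. ?g (encode (b j)) = c j) \<and> (\<forall>i<p. lincomb S q (k i) b = \<zero>\<^bsub>S\<^esub>)"
      using funcset_mem[OF b(1)] by (intro bexI[of _ b]) auto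
  qed
  then have "liftable R p q ?B ?g C"
    by (rule liftable_transport[OF Z.left_module_direct_sum T.left_module_transport T.transport_hom])
  then have "pq_pure R p q (?B\<lparr>carrier := {y \<in> carrier ?B. ?g y = \<zero>\<^bsub>C\<^esub>}\<rparr>) (\<lambda>x. x) ?B ?g C"
    using ses by (simp add: pq_pure_iff[OF C.ring_R])
  then show ?thesis using T.left_module_transport T.ret_hom by blast
qed

end

text \<open>If \<open>(p, q)\<close>-purity implies \<open>(p', q')\<close>-purity, then the module with relation matrix \<open>k\<close> is a
  direct summand of a finite direct sum of modules with \<open>q\<close> generators and relation matrices
  \<open>\<kappa> w\<close>; the equations express this in terms of matrices.\<close>

theorem purity_implication_matrices:
  fixes R :: "('a, 'k) ring_scheme" (structure)
  assumes R: "ring R" and q: "q > 0"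
    and imp: "\<And>A f B g C. pq_pure R p q A f B g C \<Longrightarrow> pq_pure R p' q' A f B g C"
    and k: "is_matrix R p' q' k"
  obtains W :: "(nat \<Rightarrow> 'a) set" and \<kappa> Y G U V Q where "finite W"
    "\<And>w. is_matrix R p q (\<kappa> w)" "\<And>w. is_matrix R q' q (Y w)" "\<And>w. is_matrix R q q' (G w)"
    "\<And>w. is_matrix R p p' (U w)" "\<And>w. is_matrix R p' p (V w)" "is_matrix R q' p' Q"
    "\<And>w t l. \<lbrakk>t < p'; l < q\<rbrakk> \<Longrightarrow> dot R q' (k t) (\<lambda>j. Y w j l) = dot R p (V w t) (\<lambda>i. \<kappa> w i l)"
    "\<And>w i t. \<lbrakk>i < p; t < q'\<rbrakk> \<Longrightarrow> dot R q (\<kappa> w i) (\<lambda>l. G w l t) = dot R p' (U w i) (\<lambda>s. k s t)"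
    "\<And>j i. \<lbrakk>j < q'; i < q'\<rbrakk> \<Longrightarrow> unit_vec R j i \<ominus> (\<Oplus>w\<in>W. dot R q (Y w j) (\<lambda>l. G w l i)) =
       dot R p' (Q j) (\<lambda>t. k t i)"
proof -
  interpret ring R by fact
  let ?C = "coker R q' p' k"
  let ?pr = "coker_proj R q' p' k"
  let ?e = "\<lambda>j. ?pr (unit_vec R j)"
  \<comment> \<open>An element of the cokernel is named by a vector of representatives.\<close>
  have "carrier ?C \<subseteq> range ?pr" using coker_proj_surj[OF k] by blast
  then interpret canonical_sequence R ?C p q ?pr
    using q left_module_coker[OF k] by (simp add: canonical_sequence_def canonical_sequence_axioms_def lmod_def)
  have "presentation R ?C q' p' ?e k"
    using coker_has_presentation[OF k] left_module_coker[OF k]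
    by (simp add: presentation_def presentation_axioms_def lmod_def)
  then interpret P: presentation R ?C q' p' ?e k .
  obtain A f B g \<beta> where pure: "pq_pure R p q A f B g ?C" and B: "left_module R B"
    and \<beta>: "\<beta> \<in> mod_hom R B S" "\<forall>x\<in>carrier B. g x = \<pi> (\<beta> x)"
    using ex_pure_sequence by blast
  interpret \<beta>: module_hom R B S \<beta>
    using B \<beta>(1) Z.left_module_direct_sum by (simp add: module_hom_def module_hom_axioms_def)
  have ke: "lincomb ?C q' (k t) ?e = \<zero>\<^bsub>?C\<^esub>" if t: "t < p'" for t
    unfolding P.relation_iff[OF is_matrix_row[OF k t]]
  proof (intro bexI[of _ "unit_vec R t"] allI impI)
    fix j assume "j < q'"
    then have "(\<lambda>l. k l j) \<in> {..<p'} \<rightarrow> carrier R" by (rule is_matrix_col[OF k])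
    from left_module.lincomb_unit_vec[OF regular_left_module[OF R] t, of "\<lambda>l. k l j"] this
    show "k t j = dot R p' (unit_vec R t) (\<lambda>l. k l j)"
      by (simp add: lincomb_regular)
  qed auto
  \<comment> \<open>The comparison of the two purities enters here: the generators of
    \<open>?C\<close> solve the system \<open>k\<close>, so they lift to a solution in
    \<open>B\<close>, which amounts to a splitting of \<open>g\<close>.\<close>
  have "liftable R p' q' B g ?C" using imp[OF pure] by (simp add: pq_pure_iff[OF R])
  then obtain b0 where b0: "b0 \<in> {..<q'} \<rightarrow> carrier B" "\<forall>j<q'. g (b0 j) = ?e j"
    "\<forall>t<p'. lincomb B q' (k t) b0 = \<zero>\<^bsub>B\<^esub>"
    using liftableD[OF _ k P.x_closed ke] by blast
  define b where "b j = \<beta> (b0 j)" for j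
  have b: "b j \<in> carrier S" if "j < q'" for j using funcset_mem[OF b0(1)] that by (simp add: b_def)
  then have b': "b \<in> {..<q'} \<rightarrow> carrier S" by simp
  have bw: "b j w \<in> carrier (Z w)" if "j < q'" for j w using b[OF that] by (simp add: direct_sum_simps)
  have \<pi>b: "\<pi> (b j) = ?e j" if "j < q'" for j
    using b0(2) that \<beta>(2) funcset_mem[OF b0(1)] by (simp add: b_def)
  have "lincomb S q' (k t) b = \<zero>\<^bsub>S\<^esub>" if t: "t < p'" for t
    using \<beta>.lincomb[OF is_matrix_row[OF k t] b0(1)] b0(3) t by (simp add: b_def[abs_def])
  then have kb: "lincomb (Z w) q' (k t) (\<lambda>j. b j w) = \<zero>\<^bsub>Z w\<^esub>" if t: "t < p'" for t w
    using Z.lincomb_direct_sum[OF is_matrix_row[OF k t] b', of w] t by (simp add: direct_sum_simps)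
  \<comment> \<open>\<open>Y w\<close> is the matrix of the \<open>w\<close>-th component of the
    splitting; below, \<open>G w\<close> is the matrix of \<open>phi w\<close>. Both are determined
    only up to relations.\<close>
  have "\<forall>w j. \<exists>x. j < q' \<longrightarrow> x \<in> {..<q} \<rightarrow>\<^sub>E carrier R \<and> b j w = coker_proj R q p (mat w) x"
    using coker_proj_surj[OF mat_matrix] bw unfolding Z_def by blast
  then obtain Y where Y: "\<And>w j. j < q' \<Longrightarrow> Y w j \<in> {..<q} \<rightarrow>\<^sub>E carrier R"
    "\<And>w j. j < q' \<Longrightarrow> b j w = coker_proj R q p (mat w) (Y w j)"
    unfolding choice_iff by blast
  have Ym: "is_matrix R q' q (Y w)" for w using Y(1) by (fastforce simp: is_matrix_def)
  have "\<forall>w l. \<exists>x. l < q \<longrightarrow> x \<in> {..<q'} \<rightarrow>\<^sub>E carrier R \<and> vec w l = ?pr x"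
    using coker_proj_surj[OF k] funcset_mem[OF vec_closed] by (metis lessThan_iff)
  then obtain G where G: "\<And>w l. l < q \<Longrightarrow> G w l \<in> {..<q'} \<rightarrow>\<^sub>E carrier R"
    "\<And>w l. l < q \<Longrightarrow> vec w l = ?pr (G w l)"
    unfolding choice_iff by blast
  have Gm: "is_matrix R q q' (G w)" for w using G(1) by (fastforce simp: is_matrix_def)
  have dotm: "(\<lambda>l. dot R n x (\<lambda>j. F j l)) \<in> {..<n'} \<rightarrow> carrier R"
    if "is_matrix R n n' F" "x \<in> {..<n} \<rightarrow> carrier R" for n n' F x
    using that is_matrix_col[OF that(1)] by (intro Pi_I dot_closed) auto
  \<comment> \<open>The component of the splitting respects relations: it sends the row
    \<open>k t\<close> to zero in \<open>Z w\<close>, so \<open>k Y\<close> has its rows in the row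
    span of \<open>mat w\<close>, with coefficients \<open>V\<close>.\<close>
  have "\<exists>s. t < p' \<longrightarrow> s \<in> {..<p} \<rightarrow> carrier R \<and> (\<forall>l<q. dot R q' (k t) (\<lambda>j. Y w j l) = dot R p s (\<lambda>i. mat w i l))"
    (is "\<exists>s. ?V w t s") for w t
  proof (cases "t < p'")
    case t: True
    have "lincomb (Z w) q' (k t) (\<lambda>j. coker_proj R q p (mat w) (Y w j)) = \<zero>\<^bsub>Z w\<^esub>"
      unfolding kb[OF t, of w, symmetric]
      by (rule Z.Z.lincomb_cong) (use is_matrix_row[OF k t] bw Y(2) in auto)
    then have "coker_proj R q p (mat w) (\<lambda>l. dot R q' (k t) (\<lambda>j. Y w j l)) = \<zero>\<^bsub>coker R q p (mat w)\<^esub>"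
      using coker_proj_combination[OF mat_matrix is_matrix_row[OF k t] Ym, of w w] by (simp add: Z_def)
    then show ?thesis
      using coker_proj_eq_zero_iff[OF mat_matrix dotm[OF Ym is_matrix_row[OF k t]], of w w] by auto
  qed simp
  then have "\<forall>w t. \<exists>s. ?V w t s" by blast
  then obtain V where V: "\<And>w t. t < p' \<Longrightarrow> V w t \<in> {..<p} \<rightarrow> carrier R"
    "\<And>w t l. \<lbrakk>t < p'; l < q\<rbrakk> \<Longrightarrow> dot R q' (k t) (\<lambda>j. Y w j l) = dot R p (V w t) (\<lambda>i. mat w i l)"
    unfolding choice_iff by blast
  \<comment> \<open>Likewise \<open>phi w\<close> sends the relations of \<open>Z w\<close> to
    relations of \<open>?C\<close>, with coefficients \<open>U\<close>.\<close>
  have "\<exists>s. i < p \<longrightarrow> s \<in> {..<p'} \<rightarrow> carrier R \<and> (\<forall>t<q'. dot R q (mat w i) (\<lambda>l. G w l t) = dot R p' s (\<lambda>j. k j t))"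
    (is "\<exists>s. ?U w i s") for w i
  proof (cases "i < p")
    case i: True
    note row = is_matrix_row[OF mat_matrix i, of w]
    have "lincomb ?C q (mat w i) (\<lambda>l. ?pr (G w l)) = \<zero>\<^bsub>?C\<^esub>"
      unfolding mat_vec[OF i, of w, symmetric]
      by (rule C.lincomb_cong) (use row vec_closed[of w] G(2) in auto)
    then have "?pr (\<lambda>t. dot R q (mat w i) (\<lambda>l. G w l t)) = \<zero>\<^bsub>?C\<^esub>"
      using coker_proj_combination[OF k row Gm, of w] by simp
    then show ?thesis
      using coker_proj_eq_zero_iff[OF k dotm[OF Gm row], of w] by auto
  qed simp
  then have "\<forall>w i. \<exists>s. ?U w i s" by blast
  then obtain U where U: "\<And>w i. i < p \<Longrightarrow> U w i \<in> {..<p'} \<rightarrow> carrier R"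
    "\<And>w i t. \<lbrakk>i < p; t < q'\<rbrakk> \<Longrightarrow> dot R q (mat w i) (\<lambda>l. G w l t) = dot R p' (U w i) (\<lambda>s. k s t)"
    unfolding choice_iff by blast
  \<comment> \<open>The finitely many lifted generators have finite support, so finitely many
    summands are involved.\<close>
  define W where "W = (\<Union>j<q'. {w. b j w \<noteq> \<zero>\<^bsub>Z w\<^esub>})"
  have W: "finite W" using b by (auto simp: W_def direct_sum_simps)
  have YG: "dot R q (Y w j) (\<lambda>l. G w l i) \<in> carrier R" if "j < q'" "i < q'" for w j i
    using is_matrix_row[OF Ym that(1)] is_matrix_col[OF Gm that(2)] by simp
  \<comment> \<open>The splitting followed by \<pi> is the identity on the generators. For
    coordinate matrices this holds up to the relations \<open>k\<close>, and \<open>Q\<close> holds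
    the coefficients.\<close>
  have "\<exists>s. j < q' \<longrightarrow> s \<in> {..<p'} \<rightarrow> carrier R \<and>
      (\<forall>i<q'. unit_vec R j i \<ominus> (\<Oplus>w\<in>W. dot R q (Y w j) (\<lambda>l. G w l i)) = dot R p' s (\<lambda>t. k t i))"
    (is "\<exists>s. ?Q j s") for j
  proof (cases "j < q'")
    case j: True
    let ?u = "\<lambda>w i. dot R q (Y w j) (\<lambda>l. G w l i)"
    have "\<pi> (b j) = (\<Oplus>\<^bsub>?C\<^esub>w\<in>W. phi w (b j w))"
      by (rule Z.sum_map_eq[OF C.left_module_axioms phi(1) b[OF j] W]) (use j in \<open>auto simp: W_def\<close>)
    also have "\<dots> = (\<Oplus>\<^bsub>?C\<^esub>w\<in>W. lincomb ?C q' (?u w) ?e)"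
    proof (rule C.M.finsum_cong'[OF refl])
      show "(\<lambda>w. lincomb ?C q' (?u w) ?e) \<in> W \<rightarrow> carrier ?C"
        using YG[OF j] by (intro Pi_I C.lincomb_closed P.x_closed) auto
      fix w assume "w \<in> W"
      note row = is_matrix_row[OF Ym j, of w]
      have "phi w (b j w) = lincomb ?C q (Y w j) (vec w)"
        unfolding Y(2)[OF j] by (rule phi(2)[OF row])
      also have "\<dots> = lincomb ?C q (Y w j) (\<lambda>l. ?pr (G w l))"
        by (rule C.lincomb_cong[OF row]) (use G(2) is_matrix_row[OF Gm] coker_proj_closed[OF k] in auto)
      also have "\<dots> = ?pr (?u w)" by (rule coker_proj_combination[OF k row Gm])
      also have "\<dots> = lincomb ?C q' (?u w) ?e"
        by (rule coker_proj_lincomb[OF k, symmetric]) (use YG[OF j] in auto)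
      finally show "phi w (b j w) = lincomb ?C q' (?u w) ?e" .
    qed
    also have "\<dots> = lincomb ?C q' (\<lambda>i. \<Oplus>w\<in>W. ?u w i) ?e"
      by (rule C.lincomb_finsum_left[symmetric, OF W _ P.x_closed]) (use YG[OF j] in auto)
    finally have "lincomb ?C q' (unit_vec R j) ?e = lincomb ?C q' (\<lambda>i. \<Oplus>w\<in>W. ?u w i) ?e"
      using \<pi>b[OF j] C.lincomb_unit_vec[OF j P.x_closed] by simp
    moreover have "(\<lambda>i. \<Oplus>w\<in>W. ?u w i) \<in> {..<q'} \<rightarrow> carrier R"
      using YG[OF j] by (intro Pi_I finsum_closed) auto
    ultimately show ?thesis using P.relation_diff[of "unit_vec R j" "\<lambda>i. \<Oplus>w\<in>W. ?u w i"] by auto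
  qed simp
  then have "\<forall>j. \<exists>s. ?Q j s" by blast
  then obtain Q where Q: "\<And>j. j < q' \<Longrightarrow> Q j \<in> {..<p'} \<rightarrow> carrier R"
    "\<And>j i. \<lbrakk>j < q'; i < q'\<rbrakk> \<Longrightarrow> unit_vec R j i \<ominus> (\<Oplus>w\<in>W. dot R q (Y w j) (\<lambda>l. G w l i)) =
       dot R p' (Q j) (\<lambda>t. k t i)"
    unfolding choice_iff by blast
  have rows: "is_matrix R n n' F" if "\<And>j. j < n \<Longrightarrow> F j \<in> {..<n'} \<rightarrow> carrier R" for n n' F
    using funcset_mem[OF that] by (simp add: is_matrix_def)
  show ?thesis
    by (rule that[OF W mat_matrix Ym Gm rows[OF U(1)] rows[OF V(1)] rows[OF Q(1)] V(2) U(2) Q(2)])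
qed

section \<open>Local idempotents and the exchange property\<close>

text \<open>The set \<open>e R e\<close>, described by fixed points and not as an image, so that
  membership of sums and products is checked by rewriting.\<close>

definition corner :: "('a, 'k) ring_scheme \<Rightarrow> 'a \<Rightarrow> 'a set" where
  "corner R e = {x \<in> carrier R. e \<otimes>\<^bsub>R\<^esub> x = x \<and> x \<otimes>\<^bsub>R\<^esub> e = x}"

definition corner_unit :: "('a, 'k) ring_scheme \<Rightarrow> 'a \<Rightarrow> 'a \<Rightarrow> bool" where
  "corner_unit R e x \<longleftrightarrow> x \<in> corner R e \<and> (\<exists>y\<in>corner R e. x \<otimes>\<^bsub>R\<^esub> y = e \<and> y \<otimes>\<^bsub>R\<^esub> x = e)"

lemma corner_ring_simps [simp]:
  "\<one>\<^bsub>corner_ring R e\<^esub> = e" "\<zero>\<^bsub>corner_ring R e\<^esub> = \<zero>\<^bsub>R\<^esub>"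
  "x \<oplus>\<^bsub>corner_ring R e\<^esub> y = x \<oplus>\<^bsub>R\<^esub> y" "x \<otimes>\<^bsub>corner_ring R e\<^esub> y = x \<otimes>\<^bsub>R\<^esub> y"
  by (simp_all add: corner_ring_def)

lemma (in ring) carrier_corner_ring:
  assumes "e \<in> carrier R" "e \<otimes> e = e"
  shows "carrier (corner_ring R e) = corner R e"
proof -
  have "e \<otimes> x \<otimes> e \<in> corner R e" if "x \<in> carrier R" for x
  proof -
    have "e \<otimes> (e \<otimes> x \<otimes> e) = (e \<otimes> e) \<otimes> x \<otimes> e" "(e \<otimes> x \<otimes> e) \<otimes> e = e \<otimes> x \<otimes> (e \<otimes> e)"
      using that assms(1) by (simp_all only: m_assoc m_closed)
    then show ?thesis using that assms by (simp add: corner_def)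
  qed
  moreover have "\<exists>y\<in>carrier R. x = e \<otimes> y \<otimes> e" if "x \<in> corner R e" for x
    using that by (intro bexI[of _ x]) (auto simp: corner_def)
  ultimately show ?thesis by (auto simp: corner_ring_def)
qed

locale idempotent = ring +
  fixes e
  assumes e_closed [simp]: "e \<in> carrier R" and e_idem [simp]: "e \<otimes> e = e"
begin

lemma cornerD:
  assumes "x \<in> corner R e"
  shows "x \<in> carrier R" "e \<otimes> x = x" "x \<otimes> e = x"
  using assms by (auto simp: corner_def)

lemma corner_compress [simp]: "x \<in> carrier R \<Longrightarrow> e \<otimes> x \<otimes> e \<in> corner R e"
  using carrier_corner_ring[OF e_closed e_idem] by (force simp: corner_ring_def)

lemma corner_e [simp]: "e \<in> corner R e" and corner_zero [simp]: "\<zero> \<in> corner R e"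
  by (simp_all add: corner_def)

lemma corner_add [simp]: "\<lbrakk>x \<in> corner R e; y \<in> corner R e\<rbrakk> \<Longrightarrow> x \<oplus> y \<in> corner R e"
  by (simp add: corner_def l_distr r_distr)

lemma corner_neg [simp]: "x \<in> corner R e \<Longrightarrow> \<ominus> x \<in> corner R e"
  by (simp add: corner_def l_minus r_minus)

lemma corner_diff [simp]: "\<lbrakk>x \<in> corner R e; y \<in> corner R e\<rbrakk> \<Longrightarrow> x \<ominus> y \<in> corner R e"
  by (simp add: a_minus_def)

lemma corner_mult: "\<lbrakk>x \<in> corner R e; y \<in> corner R e\<rbrakk> \<Longrightarrow> x \<otimes> y \<in> corner R e"
  by (simp add: corner_def m_assoc) (simp flip: m_assoc)

lemma corner_finsum:
  "\<lbrakk>finite A; f \<in> A \<rightarrow> corner R e\<rbrakk> \<Longrightarrow> (\<Oplus>i\<in>A. f i) \<in> corner R e"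
proof (induct set: finite)
  case (insert a A)
  then have "f a \<in> carrier R" "f \<in> A \<rightarrow> carrier R" by (auto simp: corner_def)
  then show ?case using insert by simp
qed simp

lemma corner_unit_iff: "corner_unit R e x \<longleftrightarrow> x \<in> Units (corner_ring R e)"
  by (auto simp: corner_unit_def Units_def carrier_corner_ring)

lemma ring_corner: "ring (corner_ring R e)"
proof -
  interpret A: abelian_group "corner_ring R e"
  proof (rule abelian_groupI)
    fix x assume "x \<in> carrier (corner_ring R e)"
    then have "x \<in> corner R e" by (simp add: carrier_corner_ring)
    then show "\<exists>y\<in>carrier (corner_ring R e). y \<oplus>\<^bsub>corner_ring R e\<^esub> x = \<zero>\<^bsub>corner_ring R e\<^esub>"
      by (intro bexI[of _ "\<ominus> x"]) (auto simp: carrier_corner_ring cornerD(1) l_neg)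
  qed (auto simp: carrier_corner_ring cornerD(1) a_assoc, simp add: cornerD(1) a_comm)
  show ?thesis
    by unfold_locales (auto simp: carrier_corner_ring corner_mult cornerD m_assoc l_distr r_distr)
qed

end

locale local_idem = idempotent +
  assumes local: "local_ring (corner_ring R e)"
begin

lemma not_unit_zero: "\<not> corner_unit R e \<zero>"
  using local by (auto simp: corner_unit_def local_ring_def cornerD)

lemma corner_unit_add:
  assumes "x \<in> corner R e" "y \<in> corner R e" "corner_unit R e (x \<oplus> y)"
  shows "corner_unit R e x \<or> corner_unit R e y"
  using assms local by (auto simp: local_ring_def corner_unit_iff carrier_corner_ring)

lemma corner_unit_finsum:
  "\<lbrakk>finite A; f \<in> A \<rightarrow> corner R e; corner_unit R e (\<Oplus>i\<in>A. f i)\<rbrakk> \<Longrightarrow> \<exists>i\<in>A. corner_unit R e (f i)"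
proof (induct set: finite)
  case (insert a A)
  then have "f a \<in> corner R e" "f a \<in> carrier R" "f \<in> A \<rightarrow> carrier R" "f \<in> A \<rightarrow> corner R e"
    by (auto simp: corner_def)
  then show ?case using insert corner_unit_add[of "f a" "\<Oplus>i\<in>A. f i"] corner_finsum by auto
qed (simp add: not_unit_zero)

lemma corner_unit_e: "corner_unit R e e"
  unfolding corner_unit_def using corner_e e_idem by blast

end

lemma local_idempotent_iff: "ring R \<Longrightarrow> local_idempotent R e \<longleftrightarrow> local_idem R e"
  by (auto simp: local_idempotent_def local_idem_def idempotent_def local_idem_axioms_def idempotent_axioms_def)

text \<open>One step of the exchange process: the column of \<open>G\<close> belonging to the local idempotent \<open>e\<close> is
  replaced by its image under \<open>t\<close>. Modulo a triangular change of basis this multiplies that column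
  by the unit \<open>e G\<inverse> t G e\<close> of the corner, so \<open>G\<close> stays invertible.\<close>

lemma (in idempotent) exchange_step:
  assumes G: "G \<in> carrier R" "H \<in> carrier R" "G \<otimes> H = \<one>" "H \<otimes> G = \<one>" and t: "t \<in> carrier R"
    and unit: "corner_unit R e (e \<otimes> (H \<otimes> t \<otimes> G) \<otimes> e)"
  shows "\<exists>H'\<in>carrier R. (G \<otimes> (\<one> \<ominus> e) \<oplus> t \<otimes> G \<otimes> e) \<otimes> H' = \<one> \<and> H' \<otimes> (G \<otimes> (\<one> \<ominus> e) \<oplus> t \<otimes> G \<otimes> e) = \<one>"
proof -
  define y where "y = H \<otimes> t \<otimes> G"
  have y: "y \<in> carrier R" using G t by (simp add: y_def)
  obtain d where d: "d \<in> corner R e" "(e \<otimes> y \<otimes> e) \<otimes> d = e" "d \<otimes> (e \<otimes> y \<otimes> e) = e"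
    using unit by (auto simp: corner_unit_def y_def)
  note dc = cornerD[OF d(1)]
  define f where "f = \<one> \<ominus> e"
  have f: "f \<in> carrier R" "f \<otimes> f = f" "f \<otimes> e = \<zero>" "e \<otimes> f = \<zero>" "f \<oplus> e = \<one>"
    by (simp_all add: f_def a_minus_def l_distr r_distr l_minus r_minus r_neg l_neg minus_add a_assoc)
  \<comment> \<open>With respect to the decomposition of the unit into \<open>f\<close> and
    \<open>e\<close>, \<open>K\<close> is triangular with diagonal entries \<open>f\<close> and
    \<open>e y e\<close>. Inverting it as a triangular matrix, with \<open>d\<close> the inverse of
    \<open>e y e\<close>, gives \<open>L\<close>.\<close>
  define K where "K = f \<oplus> y \<otimes> e"
  define L where "L = f \<oplus> d \<ominus> f \<otimes> y \<otimes> d"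
  have K: "K \<in> carrier R" and L: "L \<in> carrier R" using y f dc by (simp_all add: K_def L_def)
  have fd: "f \<otimes> d = \<zero>" "d \<otimes> f = \<zero>"
  proof -
    have "f \<otimes> d = (f \<otimes> e) \<otimes> d" using f(1) dc by (simp only: m_assoc e_closed dc(2))
    then show "f \<otimes> d = \<zero>" using f dc by simp
    have "d \<otimes> f = d \<otimes> (e \<otimes> f)" using f(1) dc by (simp only: m_assoc[symmetric] e_closed dc(3))
    then show "d \<otimes> f = \<zero>" using f dc by simp
  qed
  have yd: "y \<otimes> d = f \<otimes> (y \<otimes> d) \<oplus> e"
  proof -
    have "y \<otimes> d = f \<otimes> (y \<otimes> d) \<oplus> e \<otimes> (y \<otimes> d)"
      using l_distr[OF f(1) e_closed, of "y \<otimes> d"] f(5) y dc(1) by simp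
    also have "e \<otimes> (y \<otimes> d) = (e \<otimes> y \<otimes> e) \<otimes> d" using y dc by (simp add: m_assoc)
    finally show ?thesis using d(2) by simp
  qed
  have ye: "d \<otimes> (y \<otimes> e) = e"
  proof -
    have "d \<otimes> (y \<otimes> e) = (d \<otimes> e) \<otimes> (y \<otimes> e)" using dc by simp
    also have "\<dots> = d \<otimes> (e \<otimes> y \<otimes> e)" using y dc(1) by (simp only: m_assoc e_closed m_closed)
    finally show ?thesis using d(3) by simp
  qed
  have yee: "y \<otimes> e = f \<otimes> (y \<otimes> e) \<oplus> e \<otimes> y \<otimes> e"
  proof -
    have "y \<otimes> e = f \<otimes> (y \<otimes> e) \<oplus> e \<otimes> (y \<otimes> e)"
      using l_distr[OF f(1) e_closed, of "y \<otimes> e"] f(5) y by simp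
    then show ?thesis using y by (simp add: m_assoc)
  qed
  have "K \<otimes> L = \<one>"
  proof -
    have eL: "e \<otimes> L = d"
    proof -
      have "e \<otimes> L = e \<otimes> f \<oplus> e \<otimes> d \<ominus> (e \<otimes> f) \<otimes> y \<otimes> d"
        using f(1) y dc(1) by (simp add: L_def a_minus_def r_distr r_minus m_assoc)
      then show ?thesis using f(4) y dc by (simp add: a_minus_def)
    qed
    have fL: "f \<otimes> L = f \<ominus> f \<otimes> y \<otimes> d"
    proof -
      have "f \<otimes> L = f \<otimes> f \<oplus> f \<otimes> d \<ominus> (f \<otimes> f) \<otimes> y \<otimes> d"
        using f(1) y dc(1) by (simp add: L_def a_minus_def r_distr r_minus m_assoc)
      then show ?thesis using f(1,2) fd y dc by (simp add: a_minus_def)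
    qed
    have "K \<otimes> L = f \<otimes> L \<oplus> y \<otimes> (e \<otimes> L)"
      using f(1) y L by (simp add: K_def l_distr m_assoc)
    also have "\<dots> = (f \<ominus> f \<otimes> y \<otimes> d) \<oplus> (f \<otimes> (y \<otimes> d) \<oplus> e)"
      unfolding eL fL using yd by simp
    also have "\<dots> = f \<oplus> e"
      using f(1) y dc(1) by (simp add: a_minus_def m_assoc a_assoc r_neg1)
    finally show ?thesis using f(5) by simp
  qed
  moreover have "L \<otimes> K = \<one>"
  proof -
    have "d \<otimes> K = e"
      using f(1) y dc(1) fd ye by (simp add: K_def r_distr)
    then have "L \<otimes> K = f \<otimes> K \<oplus> e \<ominus> f \<otimes> y \<otimes> e"
      using f(1) y dc(1) K by (simp add: L_def a_minus_def l_distr l_minus m_assoc)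
    moreover have "f \<otimes> K = f \<oplus> f \<otimes> y \<otimes> e"
    proof -
      have "f \<otimes> K = f \<otimes> f \<oplus> f \<otimes> y \<otimes> e"
        using f(1) y by (simp add: K_def r_distr m_assoc)
      then show ?thesis using f(2) by simp
    qed
    ultimately have "L \<otimes> K = f \<oplus> e \<oplus> (f \<otimes> y \<otimes> e \<ominus> f \<otimes> y \<otimes> e)"
      using f(1) y by (simp add: a_minus_def a_ac)
    then show ?thesis using f(1,5) y by (simp add: a_minus_def r_neg)
  qed
  moreover have GK: "G \<otimes> (\<one> \<ominus> e) \<oplus> t \<otimes> G \<otimes> e = G \<otimes> K"
  proof -
    have "G \<otimes> K = G \<otimes> f \<oplus> (G \<otimes> H) \<otimes> t \<otimes> G \<otimes> e"
      using G(1,2) f(1) t by (simp add: K_def y_def r_distr m_assoc)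
    then show ?thesis using G t by (simp add: f_def)
  qed
  moreover have "(G \<otimes> K) \<otimes> (L \<otimes> H) = G \<otimes> (K \<otimes> L) \<otimes> H" "(L \<otimes> H) \<otimes> (G \<otimes> K) = L \<otimes> (H \<otimes> G) \<otimes> K"
    using G(1,2) K L by (simp_all add: m_assoc)
  ultimately show ?thesis
    unfolding GK using G K L by (intro bexI[of _ "L \<otimes> H"]) simp_all
qed

text \<open>A complete orthogonal set of local idempotents. The ring will be the endomorphism ring
  of \<open>R\<^sup>n / R a\<close> or of \<open>R\<^sup>n\<close>.\<close>

locale local_decomposition = ring +
  fixes A and \<epsilon>
  assumes fin: "finite A" and local: "\<And>i. i \<in> A \<Longrightarrow> local_idempotent R (\<epsilon> i)"
    and orth: "\<And>i j. \<lbrakk>i \<in> A; j \<in> A; i \<noteq> j\<rbrakk> \<Longrightarrow> \<epsilon> i \<otimes> \<epsilon> j = \<zero>"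
    and total: "(\<Oplus>i\<in>A. \<epsilon> i) = \<one>"
begin

lemma local_idem: "i \<in> A \<Longrightarrow> local_idem R (\<epsilon> i)"
  using local[of i] local_idempotent_iff[OF ring_axioms] by simp

lemma eps [simp]: "i \<in> A \<Longrightarrow> \<epsilon> i \<in> carrier R" "i \<in> A \<Longrightarrow> \<epsilon> i \<otimes> \<epsilon> i = \<epsilon> i"
  using local by (simp_all add: local_idempotent_def)

text \<open>Compressed to the corner of \<epsilon> \<open>k\<close>, the elements \<open>p\<close>
  and its complement add up to \<epsilon> \<open>k\<close>, so by locality one of them becomes a
  unit; it is the one applied to the column \<open>k\<close>. Orthogonality keeps the columns
  already treated unchanged.\<close>

lemma exchange_basis:
  assumes p: "p \<in> carrier R" and B: "B \<subseteq> A"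
  shows "\<exists>G\<in>carrier R. (\<exists>H\<in>carrier R. G \<otimes> H = \<one> \<and> H \<otimes> G = \<one>) \<and>
    (\<forall>i\<in>B. (\<exists>x\<in>carrier R. G \<otimes> \<epsilon> i = p \<otimes> x) \<or> (\<exists>x\<in>carrier R. G \<otimes> \<epsilon> i = (\<one> \<ominus> p) \<otimes> x))"
  using finite_subset[OF B fin] B
proof (induct B rule: finite_induct)
  case empty
  then show ?case by (intro bexI[of _ \<one>]) auto
next
  case (insert k B)
  then obtain G H where G: "G \<in> carrier R" "H \<in> carrier R" "G \<otimes> H = \<one>" "H \<otimes> G = \<one>"
    and IH: "\<And>i. i \<in> B \<Longrightarrow> (\<exists>x\<in>carrier R. G \<otimes> \<epsilon> i = p \<otimes> x) \<or> (\<exists>x\<in>carrier R. G \<otimes> \<epsilon> i = (\<one> \<ominus> p) \<otimes> x)"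
    by auto
  have k: "k \<in> A" using insert by auto
  interpret k: local_idem R "\<epsilon> k" by (rule local_idem[OF k])
  let ?c = "\<lambda>t. \<epsilon> k \<otimes> (H \<otimes> t \<otimes> G) \<otimes> \<epsilon> k"
  have "?c p \<oplus> ?c (\<one> \<ominus> p) = \<epsilon> k \<otimes> (H \<otimes> (p \<oplus> (\<one> \<ominus> p)) \<otimes> G) \<otimes> \<epsilon> k"
    using G(1,2) p by (simp add: r_distr l_distr)
  also have "p \<oplus> (\<one> \<ominus> p) = \<one>"
    using p a_lcomm[of p \<one> "\<ominus> p"] by (simp add: a_minus_def r_neg)
  finally have "?c p \<oplus> ?c (\<one> \<ominus> p) = \<epsilon> k" using G by simp
  then have "corner_unit R (\<epsilon> k) (?c p \<oplus> ?c (\<one> \<ominus> p))" using k.corner_unit_e by simp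
  then have "corner_unit R (\<epsilon> k) (?c p) \<or> corner_unit R (\<epsilon> k) (?c (\<one> \<ominus> p))"
    using G p by (intro k.corner_unit_add) auto
  then obtain t where t: "t = p \<or> t = \<one> \<ominus> p" "corner_unit R (\<epsilon> k) (?c t)" by blast
  have tc: "t \<in> carrier R" using t p by auto
  define G' where "G' = G \<otimes> (\<one> \<ominus> \<epsilon> k) \<oplus> t \<otimes> G \<otimes> \<epsilon> k"
  have G': "G' \<in> carrier R" "\<exists>H\<in>carrier R. G' \<otimes> H = \<one> \<and> H \<otimes> G' = \<one>"
    using G tc k k.exchange_step[OF G tc t(2)] by (auto simp: G'_def)
  have old: "G' \<otimes> \<epsilon> i = G \<otimes> \<epsilon> i" if "i \<in> B" for i
  proof -
    have i: "i \<in> A" "i \<noteq> k" using that insert by auto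
    have "G' \<otimes> \<epsilon> i = G \<otimes> (\<epsilon> i \<ominus> \<epsilon> k \<otimes> \<epsilon> i) \<oplus> t \<otimes> G \<otimes> (\<epsilon> k \<otimes> \<epsilon> i)"
      using G(1) tc k i by (simp add: G'_def a_minus_def l_distr r_distr m_assoc l_minus)
    then show ?thesis using orth[OF k i(1)] i G tc k by (simp add: a_minus_def)
  qed
  have "(\<one> \<ominus> \<epsilon> k) \<otimes> \<epsilon> k = \<zero>" using k by (simp add: a_minus_def l_distr l_minus r_neg)
  then have "G' \<otimes> \<epsilon> k = t \<otimes> (G \<otimes> \<epsilon> k)"
    using G(1) tc k by (simp add: G'_def l_distr m_assoc)
  then have new: "\<exists>x\<in>carrier R. G' \<otimes> \<epsilon> k = t \<otimes> x"
    using G k by (intro bexI[of _ "G \<otimes> \<epsilon> k"]) auto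
  show ?case
  proof (rule bexI[of _ G'], intro conjI ballI)
    fix i assume "i \<in> insert k B"
    then show "(\<exists>x\<in>carrier R. G' \<otimes> \<epsilon> i = p \<otimes> x) \<or> (\<exists>x\<in>carrier R. G' \<otimes> \<epsilon> i = (\<one> \<ominus> p) \<otimes> x)"
    proof (cases "i = k")
      case True
      then show ?thesis using new t(1) by auto
    next
      case False
      then have "i \<in> B" using \<open>i \<in> insert k B\<close> by simp
      from IH[OF this] old[OF this] show ?thesis by simp
    qed
  qed (use G' in auto)
qed

text \<open>The exchange property in Nicholson's form, for an arbitrary element \<open>p\<close>. In
  the new basis \<open>G\<close> each column lies in the image of \<open>p\<close> or in that of its
  complement; \<open>E\<close> is the projection onto the columns of the first kind along the
  others.\<close>

theorem exchange:
  assumes p: "p \<in> carrier R"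
  shows "\<exists>E\<in>carrier R. E \<otimes> E = E \<and> (\<exists>x\<in>carrier R. E = p \<otimes> x) \<and> (\<exists>y\<in>carrier R. \<one> \<ominus> E = (\<one> \<ominus> p) \<otimes> y)"
proof -
  obtain G H where G: "G \<in> carrier R" "H \<in> carrier R" "G \<otimes> H = \<one>" "H \<otimes> G = \<one>"
    and *: "\<And>i. i \<in> A \<Longrightarrow> (\<exists>x\<in>carrier R. G \<otimes> \<epsilon> i = p \<otimes> x) \<or> (\<exists>x\<in>carrier R. G \<otimes> \<epsilon> i = (\<one> \<ominus> p) \<otimes> x)"
    using exchange_basis[OF p subset_refl] by blast
  define B where "B = {i \<in> A. \<exists>x\<in>carrier R. G \<otimes> \<epsilon> i = p \<otimes> x}"
  have sub: "G \<otimes> (\<Oplus>i\<in>B'. \<epsilon> i) \<in> {t \<otimes> x | x. x \<in> carrier R}"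
    if BA: "B' \<subseteq> A" and t: "t \<in> carrier R" and ex: "\<And>i. i \<in> B' \<Longrightarrow> \<exists>x\<in>carrier R. G \<otimes> \<epsilon> i = t \<otimes> x" for B' t
  proof -
    have fB: "finite B'" using BA fin finite_subset by blast
    obtain x where x: "\<And>i. i \<in> B' \<Longrightarrow> x i \<in> carrier R" "\<And>i. i \<in> B' \<Longrightarrow> G \<otimes> \<epsilon> i = t \<otimes> x i"
      using ex by metis
    have "G \<otimes> (\<Oplus>i\<in>B'. \<epsilon> i) = (\<Oplus>i\<in>B'. G \<otimes> \<epsilon> i)"
      using BA G by (intro finsum_rdistr fB) auto
    also have "\<dots> = (\<Oplus>i\<in>B'. t \<otimes> x i)" by (rule finsum_cong') (use x t in auto)
    also have "\<dots> = t \<otimes> (\<Oplus>i\<in>B'. x i)" using x t by (intro finsum_rdistr[symmetric] fB) auto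
    finally show ?thesis using x by (auto intro!: finsum_closed)
  qed
  define P where "P = (\<Oplus>i\<in>B. \<epsilon> i)"
  define Q where "Q = (\<Oplus>i\<in>A - B. \<epsilon> i)"
  have BA: "B \<subseteq> A" and fB: "finite B" and fAB: "finite (A - B)"
    using fin by (auto simp: B_def intro: finite_subset)
  have P: "P \<in> carrier R" and Q: "Q \<in> carrier R"
    unfolding P_def Q_def using BA by (auto intro!: finsum_closed)
  have "\<one> = P \<oplus> Q"
  proof -
    have "(\<Oplus>i\<in>B \<union> (A - B). \<epsilon> i) = P \<oplus> Q"
      unfolding P_def Q_def using BA fB fAB by (intro finsum_Un_disjoint) auto
    moreover have "B \<union> (A - B) = A" using BA by auto
    ultimately show ?thesis using total by simp
  qed
  have PP: "P \<otimes> P = P"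
  proof -
    have "P \<otimes> \<epsilon> j = \<epsilon> j" if j: "j \<in> B" for j
    proof -
      have jA: "j \<in> A" using j BA by auto
      have "P \<otimes> \<epsilon> j = (\<Oplus>i\<in>B. \<epsilon> i \<otimes> \<epsilon> j)"
        unfolding P_def using BA jA by (intro finsum_ldistr fB) auto
      also have "\<dots> = \<epsilon> j"
        by (rule finsum_unique_nonzero[OF fB j]) (use BA jA orth in auto)
      finally show ?thesis .
    qed
    then have "(\<Oplus>j\<in>B. P \<otimes> \<epsilon> j) = (\<Oplus>j\<in>B. \<epsilon> j)"
      using BA by (intro finsum_cong') auto
    moreover have "P \<otimes> (\<Oplus>j\<in>B. \<epsilon> j) = (\<Oplus>j\<in>B. P \<otimes> \<epsilon> j)"
      using BA P by (intro finsum_rdistr fB) auto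
    ultimately show ?thesis by (simp flip: P_def)
  qed
  define E where "E = G \<otimes> P \<otimes> H"
  have E: "E \<in> carrier R" using G P by (simp add: E_def)
  have "E \<otimes> E = G \<otimes> P \<otimes> (H \<otimes> G) \<otimes> P \<otimes> H" using G(1,2) P by (simp add: E_def m_assoc)
  also have "\<dots> = G \<otimes> (P \<otimes> P) \<otimes> H" using G P by (simp add: m_assoc)
  finally have EE: "E \<otimes> E = E" using PP by (simp add: E_def)
  have "G \<otimes> (P \<oplus> Q) \<otimes> H = \<one>" unfolding \<open>\<one> = P \<oplus> Q\<close>[symmetric] using G by simp
  moreover have "G \<otimes> (P \<oplus> Q) \<otimes> H = E \<oplus> G \<otimes> Q \<otimes> H" using G(1,2) P Q by (simp add: E_def l_distr r_distr)
  ultimately have one: "\<one> = E \<oplus> G \<otimes> Q \<otimes> H" by simp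
  have "\<one> \<ominus> E = G \<otimes> Q \<otimes> H"
  proof -
    have "E \<oplus> G \<otimes> Q \<otimes> H \<ominus> E = G \<otimes> Q \<otimes> H"
      using E G(1,2) Q by (simp add: a_minus_def a_ac r_neg1 r_neg2)
    then show ?thesis using one by simp
  qed
  moreover have "G \<otimes> P \<in> {p \<otimes> x | x. x \<in> carrier R}"
    unfolding P_def by (rule sub[OF BA p]) (simp add: B_def)
  then obtain x where "x \<in> carrier R" "G \<otimes> P = p \<otimes> x" by blast
  moreover have "G \<otimes> Q \<in> {(\<one> \<ominus> p) \<otimes> x | x. x \<in> carrier R}"
    unfolding Q_def by (rule sub) (use p * in \<open>simp_all add: B_def\<close>, blast)
  then obtain y where "y \<in> carrier R" "G \<otimes> Q = (\<one> \<ominus> p) \<otimes> y" by blast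
  ultimately have "E = p \<otimes> (x \<otimes> H)" "\<one> \<ominus> E = (\<one> \<ominus> p) \<otimes> (y \<otimes> H)" "x \<otimes> H \<in> carrier R" "y \<otimes> H \<in> carrier R"
    using G p by (simp_all add: E_def m_assoc)
  then show ?thesis using E EE by blast
qed

end

section \<open>Endomorphism rings and Krull-Schmidt decompositions\<close>

context lmod
begin

abbreviation End where "End \<equiv> end_ring R M"

lemma End_iff: "f \<in> carrier End \<longleftrightarrow> f \<in> mod_hom R M M \<and> f \<in> extensional (carrier M)"
  by (simp add: end_ring_def)

lemma End_closed: "\<lbrakk>f \<in> carrier End; x \<in> carrier M\<rbrakk> \<Longrightarrow> f x \<in> carrier M"
  using mod_hom_closed[of f R M M x] by (simp add: End_iff)

lemma End_mult: "x \<in> carrier M \<Longrightarrow> (f \<otimes>\<^bsub>End\<^esub> g) x = f (g x)"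
  and End_one: "x \<in> carrier M \<Longrightarrow> \<one>\<^bsub>End\<^esub> x = x"
  and End_zero: "x \<in> carrier M \<Longrightarrow> \<zero>\<^bsub>End\<^esub> x = \<zero>\<^bsub>M\<^esub>"
  and End_add: "x \<in> carrier M \<Longrightarrow> (f \<oplus>\<^bsub>End\<^esub> g) x = f x \<oplus>\<^bsub>M\<^esub> g x"
  by (simp_all add: end_ring_def compose_def)

lemma End_eqI:
  assumes "f \<in> carrier End" "g \<in> carrier End" "\<And>x. x \<in> carrier M \<Longrightarrow> f x = g x"
  shows "f = g"
  using assms by (intro extensionalityI[of f "carrier M"]) (auto simp: End_iff)

lemma End_restrict: "f \<in> mod_hom R M M \<Longrightarrow> restrict f (carrier M) \<in> carrier End"
  by (simp add: End_iff mod_hom_cong[OF left_module_axioms])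

lemma module_hom_End: "f \<in> carrier End \<Longrightarrow> module_hom R M M f"
  by (simp add: End_iff module_hom_def module_hom_axioms_def left_module_axioms)

lemma ring_End: "ring End"
proof -
  have ext: "f \<oplus>\<^bsub>End\<^esub> g \<in> extensional (carrier M)" "f \<otimes>\<^bsub>End\<^esub> g \<in> extensional (carrier M)"
    "\<one>\<^bsub>End\<^esub> \<in> extensional (carrier M)" "\<zero>\<^bsub>End\<^esub> \<in> extensional (carrier M)" for f g
    by (simp_all add: end_ring_def)
  have add: "f \<oplus>\<^bsub>End\<^esub> g \<in> carrier End" if fg: "f \<in> carrier End" "g \<in> carrier End" for f g
  proof -
    interpret f: module_hom R M M f by (rule module_hom_End[OF fg(1)])
    interpret g: module_hom R M M g by (rule module_hom_End[OF fg(2)])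
    have "f \<oplus>\<^bsub>End\<^esub> g \<in> mod_hom R M M"
      by (rule mod_homI) (auto simp: End_add f.add g.add f.smult g.smult smult_r_distr M.a_ac)
    then show ?thesis by (simp add: End_iff ext)
  qed
  have mult: "f \<otimes>\<^bsub>End\<^esub> g \<in> carrier End" if fg: "f \<in> carrier End" "g \<in> carrier End" for f g
  proof -
    interpret f: module_hom R M M f by (rule module_hom_End[OF fg(1)])
    interpret g: module_hom R M M g by (rule module_hom_End[OF fg(2)])
    have "f \<otimes>\<^bsub>End\<^esub> g \<in> mod_hom R M M"
      by (rule mod_homI) (auto simp: End_mult f.add g.add f.smult g.smult)
    then show ?thesis by (simp add: End_iff ext)
  qed
  have one: "\<one>\<^bsub>End\<^esub> \<in> carrier End" "\<zero>\<^bsub>End\<^esub> \<in> carrier End"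
    unfolding End_iff by (auto intro!: mod_homI ext simp: End_one End_zero)
  have neg: "\<exists>g\<in>carrier End. g \<oplus>\<^bsub>End\<^esub> f = \<zero>\<^bsub>End\<^esub>" if f: "f \<in> carrier End" for f
  proof -
    interpret f: module_hom R M M f by (rule module_hom_End[OF f])
    have "(\<lambda>x. \<ominus>\<^bsub>M\<^esub> f x) \<in> mod_hom R M M"
      by (rule mod_homI) (auto simp: f.add f.smult smult_r_minus M.minus_add)
    note g = End_restrict[OF this]
    moreover have "restrict (\<lambda>x. \<ominus>\<^bsub>M\<^esub> f x) (carrier M) \<oplus>\<^bsub>End\<^esub> f = \<zero>\<^bsub>End\<^esub>"
      by (rule End_eqI[OF add[OF g f] one(2)]) (simp add: End_add End_zero M.l_neg)
    ultimately show ?thesis by blast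
  qed
  note simps = End_add End_mult End_one End_zero End_closed
  interpret A: abelian_group End
  proof (rule abelian_groupI)
    fix f g h assume fgh: "f \<in> carrier End" "g \<in> carrier End" "h \<in> carrier End"
    show "f \<oplus>\<^bsub>End\<^esub> g \<oplus>\<^bsub>End\<^esub> h = f \<oplus>\<^bsub>End\<^esub> (g \<oplus>\<^bsub>End\<^esub> h)"
      by (rule End_eqI) (use fgh in \<open>auto simp: add simps M.a_assoc\<close>)
  next
    fix f g assume fg: "f \<in> carrier End" "g \<in> carrier End"
    show "f \<oplus>\<^bsub>End\<^esub> g = g \<oplus>\<^bsub>End\<^esub> f"
      by (rule End_eqI) (use fg in \<open>auto simp: add simps M.a_comm\<close>)
  next
    fix f assume f: "f \<in> carrier End"
    show "\<zero>\<^bsub>End\<^esub> \<oplus>\<^bsub>End\<^esub> f = f"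
      by (rule End_eqI) (use f one in \<open>auto simp: add simps\<close>)
  qed (use add one neg in auto)
  show ?thesis
  proof
    fix f g h assume fgh: "f \<in> carrier End" "g \<in> carrier End" "h \<in> carrier End"
    interpret h: module_hom R M M h by (rule module_hom_End[OF fgh(3)])
    show "f \<otimes>\<^bsub>End\<^esub> g \<otimes>\<^bsub>End\<^esub> h = f \<otimes>\<^bsub>End\<^esub> (g \<otimes>\<^bsub>End\<^esub> h)"
      by (rule End_eqI) (use fgh in \<open>auto simp: mult simps\<close>)
    show "(f \<oplus>\<^bsub>End\<^esub> g) \<otimes>\<^bsub>End\<^esub> h = f \<otimes>\<^bsub>End\<^esub> h \<oplus>\<^bsub>End\<^esub> g \<otimes>\<^bsub>End\<^esub> h"
      by (rule End_eqI) (use fgh in \<open>auto simp: mult add simps\<close>)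
    show "h \<otimes>\<^bsub>End\<^esub> (f \<oplus>\<^bsub>End\<^esub> g) = h \<otimes>\<^bsub>End\<^esub> f \<oplus>\<^bsub>End\<^esub> h \<otimes>\<^bsub>End\<^esub> g"
      by (rule End_eqI) (use fgh in \<open>auto simp: mult add simps h.add\<close>)
  next
    fix f assume f: "f \<in> carrier End"
    show "\<one>\<^bsub>End\<^esub> \<otimes>\<^bsub>End\<^esub> f = f" by (rule End_eqI) (use f one in \<open>auto simp: mult simps\<close>)
    show "f \<otimes>\<^bsub>End\<^esub> \<one>\<^bsub>End\<^esub> = f" by (rule End_eqI) (use f one in \<open>auto simp: mult simps\<close>)
  qed (use mult one in auto)
qed

sublocale End: ring End by (rule ring_End)

lemma End_neg:
  assumes "f \<in> carrier End" "x \<in> carrier M"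
  shows "(\<ominus>\<^bsub>End\<^esub> f) x = \<ominus>\<^bsub>M\<^esub> f x"
proof -
  have "(\<ominus>\<^bsub>End\<^esub> f) x \<oplus>\<^bsub>M\<^esub> f x = (\<ominus>\<^bsub>End\<^esub> f \<oplus>\<^bsub>End\<^esub> f) x" using assms by (simp add: End_add)
  also have "\<dots> = \<zero>\<^bsub>M\<^esub>" using assms by (simp add: End.l_neg End_zero)
  finally show ?thesis
    using assms by (metis M.minus_equality End_closed End.a_inv_closed)
qed

lemma End_diff:
  "\<lbrakk>f \<in> carrier End; g \<in> carrier End; x \<in> carrier M\<rbrakk> \<Longrightarrow> (f \<ominus>\<^bsub>End\<^esub> g) x = f x \<ominus>\<^bsub>M\<^esub> g x"
  by (simp add: a_minus_def End_add End_neg)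

lemma End_finsum:
  assumes "finite A" "f \<in> A \<rightarrow> carrier End" "x \<in> carrier M"
  shows "(\<Oplus>\<^bsub>End\<^esub>i\<in>A. f i) x = (\<Oplus>\<^bsub>M\<^esub>i\<in>A. f i x)"
  using assms(1,2)
proof (induct set: finite)
  case (insert a A)
  then have "f a \<in> carrier End" "f \<in> A \<rightarrow> carrier End" "(\<lambda>i. f i x) \<in> A \<rightarrow> carrier M"
    using assms(3) End_closed by auto
  then show ?case using insert assms(3) End_closed by (simp add: End_add)
qed (use assms(3) in \<open>simp add: End_zero\<close>)

end

lemma local_ring_transfer:
  fixes S :: "('b, 'k) ring_scheme" and T :: "('c, 'l) ring_scheme"
  assumes "local_ring T" "ring S" "bij_betw \<phi> (carrier S) (carrier T)"
    "\<And>x y. \<lbrakk>x \<in> carrier S; y \<in> carrier S\<rbrakk> \<Longrightarrow> \<phi> (x \<otimes>\<^bsub>S\<^esub> y) = \<phi> x \<otimes>\<^bsub>T\<^esub> \<phi> y"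
    "\<And>x y. \<lbrakk>x \<in> carrier S; y \<in> carrier S\<rbrakk> \<Longrightarrow> \<phi> (x \<oplus>\<^bsub>S\<^esub> y) = \<phi> x \<oplus>\<^bsub>T\<^esub> \<phi> y"
    "\<phi> \<one>\<^bsub>S\<^esub> = \<one>\<^bsub>T\<^esub>" "\<phi> \<zero>\<^bsub>S\<^esub> = \<zero>\<^bsub>T\<^esub>"
  shows "local_ring S"
proof -
  interpret S: ring S by fact
  have \<phi>: "\<phi> x \<in> carrier T" if "x \<in> carrier S" for x using assms(3) that by (auto simp: bij_betw_def)
  have inj: "x = y" if "\<phi> x = \<phi> y" "x \<in> carrier S" "y \<in> carrier S" for x y
    using assms(3) that by (auto simp: bij_betw_def inj_on_def)
  have units: "x \<in> Units S \<longleftrightarrow> \<phi> x \<in> Units T" if x: "x \<in> carrier S" for x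
  proof
    assume "x \<in> Units S"
    then obtain y where y: "y \<in> carrier S" "y \<otimes>\<^bsub>S\<^esub> x = \<one>\<^bsub>S\<^esub>" "x \<otimes>\<^bsub>S\<^esub> y = \<one>\<^bsub>S\<^esub>" by (auto simp: Units_def)
    then have "\<phi> y \<otimes>\<^bsub>T\<^esub> \<phi> x = \<one>\<^bsub>T\<^esub>" "\<phi> x \<otimes>\<^bsub>T\<^esub> \<phi> y = \<one>\<^bsub>T\<^esub>"
      using x assms(4)[of y x] assms(4)[of x y] assms(6) by simp_all
    then show "\<phi> x \<in> Units T" using \<phi> x y by (auto simp: Units_def)
  next
    assume "\<phi> x \<in> Units T"
    then obtain z where z: "z \<in> carrier T" "z \<otimes>\<^bsub>T\<^esub> \<phi> x = \<one>\<^bsub>T\<^esub>" "\<phi> x \<otimes>\<^bsub>T\<^esub> z = \<one>\<^bsub>T\<^esub>" by (auto simp: Units_def)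
    then obtain y where y: "y \<in> carrier S" "z = \<phi> y" using assms(3) by (auto simp: bij_betw_def)
    then have "y \<otimes>\<^bsub>S\<^esub> x = \<one>\<^bsub>S\<^esub>" "x \<otimes>\<^bsub>S\<^esub> y = \<one>\<^bsub>S\<^esub>"
      using x z assms(4)[of y x] assms(4)[of x y] assms(6) by (auto intro!: inj)
    then show "x \<in> Units S" using x y by (auto simp: Units_def)
  qed
  have "\<one>\<^bsub>S\<^esub> \<noteq> \<zero>\<^bsub>S\<^esub>" using assms(1,6,7) by (auto simp: local_ring_def)
  moreover have "x \<oplus>\<^bsub>S\<^esub> y \<notin> Units S" if "x \<in> carrier S - Units S" "y \<in> carrier S - Units S" for x y
    using that units \<phi> assms(1,5) units[of "x \<oplus>\<^bsub>S\<^esub> y"] by (auto simp: local_ring_def)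
  ultimately show ?thesis using S.ring_axioms by (simp add: local_ring_def)
qed

section \<open>Projections of a direct sum decomposition\<close>

locale module_decomposition = lmod +
  fixes \<N>
  assumes dec: "direct_sum_of R M \<N>"
begin

lemma sub: "N \<in> \<N> \<Longrightarrow> submodule N R M"
  using dec by (simp add: direct_sum_of_def)

lemma sub_carrier: "\<lbrakk>N \<in> \<N>; x \<in> N\<rbrakk> \<Longrightarrow> x \<in> carrier M"
  using submodule_subset[OF sub] by blast

definition is_dec where
  "is_dec x h \<longleftrightarrow> h \<in> (\<Pi>\<^sub>E N\<in>\<N>. N) \<and> finite {N \<in> \<N>. h N \<noteq> \<zero>\<^bsub>M\<^esub>} \<and>
     x = (\<Oplus>\<^bsub>M\<^esub>N\<in>{N \<in> \<N>. h N \<noteq> \<zero>\<^bsub>M\<^esub>}. h N)"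

lemma is_dec_ex1: "x \<in> carrier M \<Longrightarrow> \<exists>!h. is_dec x h"
  using dec by (simp add: direct_sum_of_def is_dec_def)

definition comp where "comp x = (THE h. is_dec x h)"

lemma is_dec_comp: "x \<in> carrier M \<Longrightarrow> is_dec x (comp x)"
  unfolding comp_def by (rule theI'[OF is_dec_ex1])

lemma is_dec_unique: "\<lbrakk>x \<in> carrier M; is_dec x h\<rbrakk> \<Longrightarrow> comp x = h"
  using is_dec_ex1 is_dec_comp by blast

lemma comp_mem: "\<lbrakk>x \<in> carrier M; N \<in> \<N>\<rbrakk> \<Longrightarrow> comp x N \<in> N"
  using is_dec_comp[of x] by (auto simp: is_dec_def)

lemma comp_carrier: "\<lbrakk>x \<in> carrier M; N \<in> \<N>\<rbrakk> \<Longrightarrow> comp x N \<in> carrier M"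
  using comp_mem sub_carrier by blast

lemma comp_support: "x \<in> carrier M \<Longrightarrow> finite {N \<in> \<N>. comp x N \<noteq> \<zero>\<^bsub>M\<^esub>}"
  using is_dec_comp[of x] by (simp add: is_dec_def)

lemma support_sum:
  assumes "h \<in> (\<Pi> N\<in>\<N>. N)" "finite W" "{N \<in> \<N>. h N \<noteq> \<zero>\<^bsub>M\<^esub>} \<subseteq> W" "W \<subseteq> \<N>"
  shows "(\<Oplus>\<^bsub>M\<^esub>N\<in>{N \<in> \<N>. h N \<noteq> \<zero>\<^bsub>M\<^esub>}. h N) = (\<Oplus>\<^bsub>M\<^esub>N\<in>W. h N)"
proof -
  have "h N \<in> carrier M" if "N \<in> \<N>" for N using assms(1) sub_carrier[OF that] that by (auto simp: Pi_iff)
  then show ?thesis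
    by (intro M.add.finprod_mono_neutral_cong_left) (use assms in auto)
qed

lemma comp_sum:
  assumes "x \<in> carrier M" "finite W" "{N \<in> \<N>. comp x N \<noteq> \<zero>\<^bsub>M\<^esub>} \<subseteq> W" "W \<subseteq> \<N>"
  shows "x = (\<Oplus>\<^bsub>M\<^esub>N\<in>W. comp x N)"
proof -
  have "x = (\<Oplus>\<^bsub>M\<^esub>N\<in>{N \<in> \<N>. comp x N \<noteq> \<zero>\<^bsub>M\<^esub>}. comp x N)"
    using is_dec_comp[OF assms(1)] by (simp add: is_dec_def)
  also have "\<dots> = (\<Oplus>\<^bsub>M\<^esub>N\<in>W. comp x N)"
    by (rule support_sum) (use assms comp_mem in auto)
  finally show ?thesis .
qed

lemma comp_eqI:
  assumes "x \<in> carrier M" "\<And>N. N \<in> \<N> \<Longrightarrow> h N \<in> N" "finite W" "W \<subseteq> \<N>"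
    "\<And>N. \<lbrakk>N \<in> \<N>; N \<notin> W\<rbrakk> \<Longrightarrow> h N = \<zero>\<^bsub>M\<^esub>" "x = (\<Oplus>\<^bsub>M\<^esub>N\<in>W. h N)" "N \<in> \<N>"
  shows "comp x N = h N"
proof -
  have eq: "{N \<in> \<N>. restrict h \<N> N \<noteq> \<zero>\<^bsub>M\<^esub>} = {N \<in> \<N>. h N \<noteq> \<zero>\<^bsub>M\<^esub>}" by auto
  have sW: "{N \<in> \<N>. restrict h \<N> N \<noteq> \<zero>\<^bsub>M\<^esub>} \<subseteq> W" unfolding eq using assms(5) by blast
  have "(\<Oplus>\<^bsub>M\<^esub>N\<in>{N \<in> \<N>. restrict h \<N> N \<noteq> \<zero>\<^bsub>M\<^esub>}. restrict h \<N> N) = (\<Oplus>\<^bsub>M\<^esub>N\<in>W. restrict h \<N> N)"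
    by (rule support_sum[OF _ assms(3) sW assms(4)]) (use assms(2) in auto)
  also have "\<dots> = x" unfolding assms(6)
    by (rule M.finsum_cong') (use assms(2,4) sub_carrier in auto)
  finally have "is_dec x (restrict h \<N>)"
    using assms(2) finite_subset[OF sW assms(3)] by (auto simp: is_dec_def)
  from is_dec_unique[OF assms(1) this] show ?thesis using assms(7) by simp
qed

lemma comp_add:
  assumes "x \<in> carrier M" "y \<in> carrier M" "N \<in> \<N>"
  shows "comp (x \<oplus>\<^bsub>M\<^esub> y) N = comp x N \<oplus>\<^bsub>M\<^esub> comp y N"
proof -
  define W where "W = {N \<in> \<N>. comp x N \<noteq> \<zero>\<^bsub>M\<^esub>} \<union> {N \<in> \<N>. comp y N \<noteq> \<zero>\<^bsub>M\<^esub>}"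
  have W: "finite W" "W \<subseteq> \<N>" using assms comp_support by (auto simp: W_def)
  have "x = (\<Oplus>\<^bsub>M\<^esub>N\<in>W. comp x N)" "y = (\<Oplus>\<^bsub>M\<^esub>N\<in>W. comp y N)"
    by (rule comp_sum[OF _ W(1) _ W(2)]; use assms in \<open>simp add: W_def\<close>)+
  then have "x \<oplus>\<^bsub>M\<^esub> y = (\<Oplus>\<^bsub>M\<^esub>N\<in>W. comp x N) \<oplus>\<^bsub>M\<^esub> (\<Oplus>\<^bsub>M\<^esub>N\<in>W. comp y N)" by simp
  also have "\<dots> = (\<Oplus>\<^bsub>M\<^esub>N\<in>W. comp x N \<oplus>\<^bsub>M\<^esub> comp y N)"
    by (rule M.finsum_addf[symmetric]) (use W assms comp_carrier in auto)
  finally have eq: "x \<oplus>\<^bsub>M\<^esub> y = (\<Oplus>\<^bsub>M\<^esub>N\<in>W. comp x N \<oplus>\<^bsub>M\<^esub> comp y N)" .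
  show ?thesis
    by (rule comp_eqI[OF _ _ W _ eq assms(3)])
      (use assms submodule_add[OF sub] comp_mem in \<open>auto simp: W_def\<close>)
qed

lemma comp_smult:
  assumes "r \<in> carrier R" "x \<in> carrier M" "N \<in> \<N>"
  shows "comp (r \<odot>\<^bsub>M\<^esub> x) N = r \<odot>\<^bsub>M\<^esub> comp x N"
proof -
  define W where "W = {N \<in> \<N>. comp x N \<noteq> \<zero>\<^bsub>M\<^esub>}"
  have W: "finite W" "W \<subseteq> \<N>" using assms comp_support by (auto simp: W_def)
  have "x = (\<Oplus>\<^bsub>M\<^esub>N\<in>W. comp x N)"
    by (rule comp_sum[OF _ W(1) _ W(2)]) (use assms in \<open>simp_all add: W_def\<close>)
  then have "r \<odot>\<^bsub>M\<^esub> x = r \<odot>\<^bsub>M\<^esub> (\<Oplus>\<^bsub>M\<^esub>N\<in>W. comp x N)" by simp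
  also have "\<dots> = (\<Oplus>\<^bsub>M\<^esub>N\<in>W. r \<odot>\<^bsub>M\<^esub> comp x N)"
    by (rule smult_finsum) (use W assms comp_carrier in auto)
  finally have eq: "r \<odot>\<^bsub>M\<^esub> x = (\<Oplus>\<^bsub>M\<^esub>N\<in>W. r \<odot>\<^bsub>M\<^esub> comp x N)" .
  show ?thesis
    by (rule comp_eqI[OF _ _ W _ eq assms(3)])
      (use assms submodule_smult[OF sub] comp_mem in \<open>auto simp: W_def\<close>)
qed

lemma comp_self:
  assumes "N \<in> \<N>" "x \<in> N" "N' \<in> \<N>"
  shows "comp x N' = (if N' = N then x else \<zero>\<^bsub>M\<^esub>)"
proof (rule comp_eqI[of x _ "{N}"])
  show "(if N'' = N then x else \<zero>\<^bsub>M\<^esub>) \<in> N''" if "N'' \<in> \<N>" for N''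
    using that assms submodule_zero[OF sub] by auto
qed (use assms sub_carrier in auto)

definition \<epsilon> where "\<epsilon> N = (\<lambda>x\<in>carrier M. comp x N)"

lemma \<epsilon>_End: "N \<in> \<N> \<Longrightarrow> \<epsilon> N \<in> carrier End"
  unfolding \<epsilon>_def
  by (intro End_restrict mod_homI) (auto simp: comp_add comp_smult comp_carrier)

lemma \<epsilon>_comp:
  assumes "N \<in> \<N>" "N' \<in> \<N>"
  shows "\<epsilon> N \<otimes>\<^bsub>End\<^esub> \<epsilon> N' = (if N = N' then \<epsilon> N else \<zero>\<^bsub>End\<^esub>)"
  by (rule End_eqI)
    (use assms \<epsilon>_End comp_mem comp_carrier in \<open>auto simp: End_mult End_zero \<epsilon>_def comp_self\<close>)

text \<open>Restriction to \<open>N\<close> identifies the corner of the endomorphism ring at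
  \<epsilon> \<open>N\<close> with the endomorphism ring of the submodule \<open>N\<close>, and this
  isomorphism transfers locality.\<close>

lemma local_\<epsilon>:
  assumes N: "N \<in> \<N>" and loc: "local_ring (end_ring R (M\<lparr>carrier := N\<rparr>))"
  shows "local_idempotent End (\<epsilon> N)"
proof -
  interpret e: idempotent End "\<epsilon> N"
    using \<epsilon>_End[OF N] \<epsilon>_comp[OF N N] by unfold_locales auto
  interpret N: lmod R "M\<lparr>carrier := N\<rparr>" by (intro lmod.intro left_module_submodule sub N)
  have corner: "carrier (corner_ring End (\<epsilon> N)) = corner End (\<epsilon> N)"
    by (rule End.carrier_corner_ring) (use \<epsilon>_End[OF N] in auto)
  have \<epsilon>x: "\<epsilon> N x \<in> N" if "x \<in> carrier M" for x using that comp_mem N by (simp add: \<epsilon>_def)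
  have \<epsilon>N: "\<epsilon> N x = x" if "x \<in> N" for x using that comp_self[OF N that N] sub_carrier[OF N] by (simp add: \<epsilon>_def)
  have into: "f x \<in> N" if f: "f \<in> corner End (\<epsilon> N)" and x: "x \<in> carrier M" for f x
  proof -
    have "f x = (\<epsilon> N \<otimes>\<^bsub>End\<^esub> f) x" using e.cornerD(2)[OF f] by simp
    also have "\<dots> = \<epsilon> N (f x)" using x by (simp add: End_mult)
    finally show ?thesis using \<epsilon>x[of "f x"] End_closed[OF e.cornerD(1)[OF f] x] by simp
  qed
  have pre: "f x = f (\<epsilon> N x)" if f: "f \<in> corner End (\<epsilon> N)" and x: "x \<in> carrier M" for f x
  proof -
    have "f x = (f \<otimes>\<^bsub>End\<^esub> \<epsilon> N) x" using e.cornerD(3)[OF f] by simp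
    then show ?thesis using x by (simp add: End_mult)
  qed
  define \<phi> where "\<phi> f = restrict f N" for f :: "'c \<Rightarrow> 'c"
  have \<phi>c: "\<phi> f \<in> carrier (end_ring R (M\<lparr>carrier := N\<rparr>))" if f: "f \<in> corner End (\<epsilon> N)" for f
  proof -
    interpret f: module_hom R M M f by (rule module_hom_End[OF e.cornerD(1)[OF f]])
    have "f \<in> mod_hom R (M\<lparr>carrier := N\<rparr>) (M\<lparr>carrier := N\<rparr>)"
      by (rule mod_homI) (use into[OF f] sub_carrier[OF N] in \<open>auto simp: f.add f.smult\<close>)
    from N.End_restrict[OF this] show ?thesis by (simp add: \<phi>_def)
  qed
  have "bij_betw \<phi> (corner End (\<epsilon> N)) (carrier (end_ring R (M\<lparr>carrier := N\<rparr>)))"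
    unfolding bij_betw_def
  proof
    show "inj_on \<phi> (corner End (\<epsilon> N))"
    proof (rule inj_onI)
      fix f g assume f: "f \<in> corner End (\<epsilon> N)" and g: "g \<in> corner End (\<epsilon> N)" and eq: "\<phi> f = \<phi> g"
      have "f x = g x" if x: "x \<in> carrier M" for x
        using fun_cong[OF eq, of "\<epsilon> N x"] \<epsilon>x[OF x] pre[OF f x] pre[OF g x] by (simp add: \<phi>_def)
      then show "f = g" using f g by (intro End_eqI) (auto simp: e.cornerD)
    qed
    show "\<phi> ` corner End (\<epsilon> N) = carrier (end_ring R (M\<lparr>carrier := N\<rparr>))"
    proof (intro equalityI subsetI)
      fix g assume g: "g \<in> carrier (end_ring R (M\<lparr>carrier := N\<rparr>))"
      interpret g: module_hom R "M\<lparr>carrier := N\<rparr>" "M\<lparr>carrier := N\<rparr>" g by (rule N.module_hom_End[OF g])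
      have gN: "g x \<in> N" if "x \<in> N" for x using g.closed that by simp
      define f where "f = restrict (\<lambda>x. g (\<epsilon> N x)) (carrier M)"
      interpret eN: module_hom R M M "\<epsilon> N" by (rule module_hom_End[OF \<epsilon>_End[OF N]])
      have fE: "f \<in> carrier End"
        unfolding f_def
      proof (intro End_restrict mod_homI)
        show "(\<lambda>x. g (\<epsilon> N x)) \<in> carrier M \<rightarrow> carrier M" using gN \<epsilon>x sub_carrier[OF N] by auto
        show "g (\<epsilon> N (x \<oplus>\<^bsub>M\<^esub> y)) = g (\<epsilon> N x) \<oplus>\<^bsub>M\<^esub> g (\<epsilon> N y)" if "x \<in> carrier M" "y \<in> carrier M" for x y
          using that g.add[of "\<epsilon> N x" "\<epsilon> N y"] \<epsilon>x by (simp add: eN.add)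
        show "g (\<epsilon> N (r \<odot>\<^bsub>M\<^esub> x)) = r \<odot>\<^bsub>M\<^esub> g (\<epsilon> N x)" if "r \<in> carrier R" "x \<in> carrier M" for r x
          using that g.smult[of r "\<epsilon> N x"] \<epsilon>x by (simp add: eN.smult)
      qed
      have "\<epsilon> N \<otimes>\<^bsub>End\<^esub> f = f"
        by (rule End_eqI) (use fE \<epsilon>_End[OF N] gN \<epsilon>x \<epsilon>N in \<open>auto simp: End_mult f_def\<close>)
      moreover have "f \<otimes>\<^bsub>End\<^esub> \<epsilon> N = f"
        by (rule End_eqI) (use fE \<epsilon>_End[OF N] gN \<epsilon>x \<epsilon>N sub_carrier[OF N] in \<open>auto simp: End_mult f_def\<close>)
      ultimately have "f \<in> corner End (\<epsilon> N)" using fE by (simp add: corner_def)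
      moreover have "g = \<phi> f"
      proof
        fix x show "g x = \<phi> f x"
        proof (cases "x \<in> N")
          case True
          then show ?thesis using \<epsilon>N sub_carrier[OF N] by (simp add: \<phi>_def f_def)
        next
          case False
          then show ?thesis using g by (simp add: \<phi>_def N.End_iff extensional_def)
        qed
      qed
      ultimately show "g \<in> \<phi> ` corner End (\<epsilon> N)" by blast
    qed (use \<phi>c in auto)
  qed
  then have "local_ring (corner_ring End (\<epsilon> N))"
    by (intro local_ring_transfer[OF loc e.ring_corner, of \<phi>])
      (use sub_carrier[OF N] into \<epsilon>N corner in \<open>auto simp: \<phi>_def fun_eq_iff end_ring_def compose_def restrict_def\<close>)
  then show ?thesis using \<epsilon>_End[OF N] \<epsilon>_comp[OF N N] by (simp add: local_idempotent_def)
qed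

text \<open>The index set is finite because the module is finitely generated: a summand in which all
  generators have component zero would have the zero projection, and zero is not a local
  idempotent.\<close>

lemma local_decomposition_\<epsilon>:
  assumes loc: "\<And>N. N \<in> \<N> \<Longrightarrow> local_ring (end_ring R (M\<lparr>carrier := N\<rparr>))"
    and x: "x \<in> {..<p} \<rightarrow> carrier M" and gen: "\<And>y. y \<in> carrier M \<Longrightarrow> \<exists>\<rho>\<in>{..<p} \<rightarrow> carrier R. y = lincomb M p \<rho> x"
  shows "local_decomposition End \<N> \<epsilon>"
proof -
  define W where "W = (\<Union>i<p. {N \<in> \<N>. comp (x i) N \<noteq> \<zero>\<^bsub>M\<^esub>})"
  have "\<N> \<subseteq> W"
  proof
    fix N assume N: "N \<in> \<N>"
    interpret e: module_hom R M M "\<epsilon> N" by (rule module_hom_End[OF \<epsilon>_End[OF N]])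
    interpret eloc: local_idem End "\<epsilon> N"
      using local_\<epsilon>[OF N loc[OF N]] local_idempotent_iff[OF ring_End] by simp
    show "N \<in> W"
    proof (rule ccontr)
      assume "N \<notin> W"
      then have z: "\<epsilon> N (x i) = \<zero>\<^bsub>M\<^esub>" if "i < p" for i
        using N that funcset_mem[OF x] by (auto simp: W_def \<epsilon>_def)
      have "\<epsilon> N y = \<zero>\<^bsub>M\<^esub>" if y: "y \<in> carrier M" for y
      proof -
        obtain \<rho> where \<rho>: "\<rho> \<in> {..<p} \<rightarrow> carrier R" "y = lincomb M p \<rho> x" using gen[OF y] by blast
        have "\<epsilon> N y = lincomb M p \<rho> (\<lambda>i. \<epsilon> N (x i))" unfolding \<rho>(2) by (rule e.lincomb[OF \<rho>(1) x])
        also have "\<dots> = lincomb M p \<rho> (\<lambda>i. \<zero>\<^bsub>M\<^esub>)" by (rule lincomb_cong[OF \<rho>(1)]) (use z in auto)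
        finally show ?thesis using \<rho>(1) by simp
      qed
      then have "\<epsilon> N = \<zero>\<^bsub>End\<^esub>" by (intro End_eqI \<epsilon>_End[OF N]) (auto simp: End_zero)
      then show False using eloc.not_unit_zero eloc.corner_unit_e by simp
    qed
  qed
  moreover have "finite W" using comp_support funcset_mem[OF x] by (auto simp: W_def)
  ultimately have fin: "finite \<N>" using finite_subset by blast
  have total: "(\<Oplus>\<^bsub>End\<^esub>N\<in>\<N>. \<epsilon> N) = \<one>\<^bsub>End\<^esub>"
  proof (rule End_eqI)
    fix y assume y: "y \<in> carrier M"
    have "(\<Oplus>\<^bsub>End\<^esub>N\<in>\<N>. \<epsilon> N) y = (\<Oplus>\<^bsub>M\<^esub>N\<in>\<N>. \<epsilon> N y)"
      using \<epsilon>_End by (intro End_finsum[OF fin _ y]) auto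
    also have "\<dots> = (\<Oplus>\<^bsub>M\<^esub>N\<in>\<N>. comp y N)"
      by (rule M.finsum_cong') (use y comp_carrier in \<open>auto simp: \<epsilon>_def\<close>)
    also have "\<dots> = y" by (rule comp_sum[OF y fin, symmetric]) auto
    finally show "(\<Oplus>\<^bsub>End\<^esub>N\<in>\<N>. \<epsilon> N) y = \<one>\<^bsub>End\<^esub> y" using y by (simp add: End_one)
  qed (use \<epsilon>_End in \<open>auto intro!: End.finsum_closed\<close>)
  show ?thesis
    using fin total \<epsilon>_comp local_\<epsilon> loc
    by (simp add: local_decomposition_def local_decomposition_axioms_def ring_End)
qed

end

lemma krull_schmidt_local_decomposition:
  fixes R :: "('a, 'k) ring_scheme" and M :: "('a, 'a univ) module"
  assumes "krull_schmidt R" "presented R p q M" "p > 0" "q > 0"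
  shows "\<exists>A \<epsilon>. local_decomposition (end_ring R M) (A :: 'a univ set set) \<epsilon>"
proof -
  have "finitely_presented R M" using assms by (auto simp: finitely_presented_def)
  then obtain \<N> where \<N>: "direct_sum_of R M \<N>" "\<And>N. N \<in> \<N> \<Longrightarrow> local_ring (end_ring R (M\<lparr>carrier := N\<rparr>))"
    using assms(1) by (auto simp: krull_schmidt_def)
  have R: "ring R" using assms(1) by (simp add: krull_schmidt_def)
  obtain x k where x: "has_presentation R p q M x k" using presented_has_presentation[OF R assms(2)] by blast
  interpret module_decomposition R M \<N>
    using assms(2) \<N>(1) by (simp add: module_decomposition_def module_decomposition_axioms_def lmod_def presented_def)
  have "local_decomposition (end_ring R M) \<N> \<epsilon>"
    by (rule local_decomposition_\<epsilon>[OF \<N>(2), of x p]) (use x in \<open>simp_all add: has_presentation_def\<close>)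
  then show ?thesis by blast
qed

section \<open>Reducing the number of generators\<close>

context ring
begin

lemma regular: "left_module R (regular_module R)"
  by (rule regular_left_module) (rule ring_axioms)

lemmas dot_add_right = left_module.lincomb_add_right[OF regular, unfolded lincomb_regular regular_module_simps]
  and dot_smult = left_module.lincomb_smult[OF regular, unfolded lincomb_regular regular_module_simps]
  and dot_smult_right = left_module.lincomb_smult_right[OF regular, unfolded lincomb_regular regular_module_simps]
  and dot_unit_vec = left_module.lincomb_unit_vec[OF regular, unfolded lincomb_regular regular_module_simps]
  and dot_assoc = left_module.lincomb_assoc[OF regular, unfolded lincomb_regular regular_module_simps]
  and dot_finsum_right = left_module.lincomb_finsum_right[OF regular, unfolded lincomb_regular regular_module_simps finsum_regular_module]
  and dot_zero_right = left_module.lincomb_zero_right[OF regular, unfolded lincomb_regular regular_module_simps]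

lemma regular_minus: "x \<in> carrier R \<Longrightarrow> y \<in> carrier R \<Longrightarrow> x \<ominus>\<^bsub>regular_module R\<^esub> y = x \<ominus> y"
proof -
  assume xy: "x \<in> carrier R" "y \<in> carrier R"
  interpret M: left_module R "regular_module R" by (rule regular)
  have "\<ominus>\<^bsub>regular_module R\<^esub> y = \<ominus> y"
    using xy by (intro M.M.minus_equality) (auto simp: l_neg)
  then show ?thesis by (simp add: a_minus_def)
qed

lemma dot_diff_right:
  assumes "x \<in> {..<q} \<rightarrow> carrier R" "y \<in> {..<q} \<rightarrow> carrier R" "y' \<in> {..<q} \<rightarrow> carrier R"
  shows "dot R q x (\<lambda>i. y i \<ominus> y' i) = dot R q x y \<ominus> dot R q x y'"
proof -
  interpret M: left_module R "regular_module R" by (rule regular)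
  have "dot R q x (\<lambda>i. y i \<ominus> y' i) = lincomb (regular_module R) q x (\<lambda>i. y i \<ominus>\<^bsub>regular_module R\<^esub> y' i)"
    unfolding lincomb_regular using funcset_mem[OF assms(2)] funcset_mem[OF assms(3)]
    by (intro dot_cong assms(1)) (auto simp: regular_minus)
  also have "\<dots> = dot R q x y \<ominus> dot R q x y'"
    using assms M.lincomb_diff_right[of x q y y'] by (simp add: lincomb_regular regular_minus)
  finally show ?thesis .
qed

end

text \<open>The last two assumptions exclude \<open>I = 0\<close> and \<open>I = e R\<close>. They
  make annihilators of the row \<open>a\<close>, and elements \<open>z e\<close> with
  \<open>z\<close> in \<open>I\<close>, nonunits of the corner.\<close>

locale ideal_generators = local_idem +
  fixes n a
  assumes a: "a \<in> {..<n} \<rightarrow> carrier R" and ea: "i < n \<Longrightarrow> e \<otimes> a i = a i"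
    and a_nonzero: "\<exists>i<n. a i \<noteq> \<zero>"
    and e_notin: "\<not> (\<exists>c\<in>{..<n} \<rightarrow> carrier R. e = dot R n a c)"
begin

definition I where "I = {dot R n a c | c. c \<in> {..<n} \<rightarrow> carrier R}"

lemma a_closed [simp]: "i < n \<Longrightarrow> a i \<in> carrier R"
  using funcset_mem[OF a] by simp

lemma I_dot: "c \<in> {..<n} \<rightarrow> carrier R \<Longrightarrow> dot R n a c \<in> I"
  by (auto simp: I_def)

lemma I_carrier: "x \<in> I \<Longrightarrow> x \<in> carrier R"
  using a by (auto simp: I_def)

lemma I_add: "\<lbrakk>x \<in> I; y \<in> I\<rbrakk> \<Longrightarrow> x \<oplus> y \<in> I"
proof -
  assume "x \<in> I" "y \<in> I"
  then obtain c d where c: "c \<in> {..<n} \<rightarrow> carrier R" "x = dot R n a c"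
    and d: "d \<in> {..<n} \<rightarrow> carrier R" "y = dot R n a d" by (auto simp: I_def)
  have "x \<oplus> y = dot R n a (\<lambda>i. c i \<oplus> d i)" using c d a by (simp add: dot_add_right)
  moreover have "(\<lambda>i. c i \<oplus> d i) \<in> {..<n} \<rightarrow> carrier R" using funcset_mem[OF c(1)] funcset_mem[OF d(1)] by auto
  ultimately show ?thesis by (simp add: I_dot)
qed

lemma I_mult: "\<lbrakk>x \<in> I; s \<in> carrier R\<rbrakk> \<Longrightarrow> x \<otimes> s \<in> I"
proof -
  assume "x \<in> I" and s: "s \<in> carrier R"
  then obtain c where c: "c \<in> {..<n} \<rightarrow> carrier R" "x = dot R n a c" by (auto simp: I_def)
  have "x \<otimes> s = dot R n a (\<lambda>i. c i \<otimes> s)" using c a s by (simp add: dot_smult_right)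
  moreover have "(\<lambda>i. c i \<otimes> s) \<in> {..<n} \<rightarrow> carrier R" using funcset_mem[OF c(1)] s by auto
  ultimately show ?thesis by (simp add: I_dot)
qed

lemma e_dot:
  assumes "c \<in> {..<n} \<rightarrow> carrier R"
  shows "e \<otimes> dot R n a c = dot R n a c"
proof -
  have "e \<otimes> dot R n a c = dot R n (\<lambda>i. e \<otimes> a i) c" using assms a by (simp add: dot_smult)
  also have "\<dots> = dot R n a c" by (rule dot_cong[OF a assms]) (simp_all add: ea)
  finally show ?thesis .
qed

lemma e_I: "x \<in> I \<Longrightarrow> e \<otimes> x = x"
  using e_dot by (auto simp: I_def)

lemma I_corner: "z \<in> I \<Longrightarrow> z \<otimes> e \<in> corner R e"
  using e_I[of "z \<otimes> e"] I_mult[of z e] I_carrier[of z] by (simp add: corner_def m_assoc)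

text \<open>A right inverse would bring \<open>e\<close> itself into the right ideal
  \<open>I\<close>.\<close>

lemma I_not_unit: "z \<in> I \<Longrightarrow> \<not> corner_unit R e (z \<otimes> e)"
proof
  assume z: "z \<in> I" and "corner_unit R e (z \<otimes> e)"
  then obtain v where v: "v \<in> corner R e" "(z \<otimes> e) \<otimes> v = e" by (auto simp: corner_unit_def)
  then have "e \<in> I" using I_mult[OF I_mult[OF z e_closed] cornerD(1)[OF v(1)]] by simp
  then show False using e_notin by (auto simp: I_def)
qed

lemma annihilator_not_unit:
  assumes "s \<in> carrier R" "\<And>j. j < n \<Longrightarrow> s \<otimes> a j = \<zero>"
  shows "\<not> corner_unit R e s"
proof
  assume "corner_unit R e s"
  then obtain v where v: "v \<in> corner R e" "v \<otimes> s = e" by (auto simp: corner_unit_def)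
  have "a j = \<zero>" if j: "j < n" for j
  proof -
    have "a j = (v \<otimes> s) \<otimes> a j" using v(2) ea[OF j] by simp
    also have "\<dots> = v \<otimes> (s \<otimes> a j)" using cornerD(1)[OF v(1)] assms(1) j by (simp add: m_assoc)
    finally show ?thesis using assms(2)[OF j] cornerD(1)[OF v(1)] by simp
  qed
  then show False using a_nonzero by blast
qed

lemma ze_a: "\<lbrakk>z \<in> carrier R; j < n\<rbrakk> \<Longrightarrow> z \<otimes> e \<otimes> a j = z \<otimes> a j"
  by (simp add: m_assoc ea)

text \<open>The unit \<open>s\<close> is the sum of \<open>t\<close>, of \<open>z e\<close> with
  \<open>z\<close> in \<open>I\<close>, and of a rest that annihilates \<open>a\<close>. The last
  two are not units, so locality leaves only \<open>t\<close>.\<close>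

lemma unit_congruence:
  assumes s: "s \<in> corner R e" "corner_unit R e s" and t: "t \<in> corner R e" and z: "z \<in> I"
    and eq: "\<And>j. j < n \<Longrightarrow> s \<otimes> a j \<ominus> t \<otimes> a j = z \<otimes> a j"
  shows "corner_unit R e t"
proof (rule ccontr)
  assume nt: "\<not> corner_unit R e t"
  note zc = I_corner[OF z] I_carrier[OF z]
  let ?u = "s \<ominus> t \<ominus> z \<otimes> e"
  have u: "?u \<in> corner R e" using s t zc by simp
  have "?u \<otimes> a j = \<zero>" if j: "j < n" for j
  proof -
    have "?u \<otimes> a j = (s \<otimes> a j \<ominus> t \<otimes> a j) \<ominus> z \<otimes> a j"
      using j cornerD(1)[OF s(1)] cornerD(1)[OF t] zc ze_a[OF zc(2) j]
      by (simp add: a_minus_def l_distr l_minus)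
    then show ?thesis using eq[OF j] zc j by (simp add: a_minus_def r_neg)
  qed
  then have nu: "\<not> corner_unit R e ?u" using u by (intro annihilator_not_unit) (auto simp: cornerD)
  have "?u \<oplus> (t \<oplus> z \<otimes> e) = s"
  proof -
    have "?u \<oplus> (t \<oplus> z \<otimes> e) = s \<oplus> (\<ominus> t \<oplus> (\<ominus> (z \<otimes> e) \<oplus> (z \<otimes> e \<oplus> t)))"
      using cornerD(1)[OF s(1)] cornerD(1)[OF t] zc(2)
      by (simp add: a_minus_def a_assoc a_comm[of t "z \<otimes> e"])
    then show ?thesis using cornerD(1)[OF s(1)] cornerD(1)[OF t] zc(2) by (simp add: r_neg1 l_neg)
  qed
  then have "corner_unit R e (?u \<oplus> (t \<oplus> z \<otimes> e))" using s(2) by (simp only:)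
  then have "corner_unit R e (t \<oplus> z \<otimes> e)"
    using corner_unit_add[OF u corner_add[OF t zc(1)]] nu by blast
  then show False
    using corner_unit_add[OF t zc(1)] nt I_not_unit[OF z] by blast
qed

lemma unit_of_sum:
  assumes "finite A" "lam \<in> A \<rightarrow> corner R e" "z \<in> I"
    "\<And>j. j < n \<Longrightarrow> a j \<ominus> (\<Oplus>k\<in>A. lam k) \<otimes> a j = z \<otimes> a j"
  shows "\<exists>k\<in>A. corner_unit R e (lam k)"
proof -
  have "corner_unit R e (\<Oplus>k\<in>A. lam k)"
    by (rule unit_congruence[OF corner_e corner_unit_e _ assms(3)])
      (use assms corner_finsum in \<open>auto simp: ea\<close>)
  then show ?thesis by (rule corner_unit_finsum[OF assms(1,2)])
qed

text \<open>Since the entries of \<open>a\<close> generate \<open>I\<close>, this expresses that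
  \<open>r\<close> elements of \<open>I\<close> generate it as a right ideal.\<close>

definition few_generators where
  "few_generators r \<longleftrightarrow> (\<exists>y C. y \<in> {..<r} \<rightarrow> I \<and> is_matrix R r n C \<and> (\<forall>j<n. a j = dot R r y (\<lambda>l. C l j)))"

text \<open>On \<open>a\<close>, left multiplication by \<open>\<one> \<ominus> z\<close> agrees
  with that by the corner element \<open>e \<ominus> z \<otimes> e\<close>, a unit because
  \<open>z e\<close> is not one. Its inverse satisfies \<open>v = e \<oplus> z \<otimes> v\<close>,
  so left multiplication by \<open>v\<close> preserves \<open>I\<close> even though \<open>I\<close>
  is only a right ideal.\<close>

lemma few_generatorsI:
  assumes z: "z \<in> I" and y: "y \<in> {..<r} \<rightarrow> I" and C: "is_matrix R r n C"
    and eq: "\<And>j. j < n \<Longrightarrow> a j \<ominus> z \<otimes> a j = dot R r y (\<lambda>l. C l j)"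
  shows "few_generators r"
proof -
  note zc = I_corner[OF z] I_carrier[OF z]
  have yc: "y \<in> {..<r} \<rightarrow> carrier R" using funcset_mem[OF y] I_carrier by auto
  let ?u = "e \<ominus> z \<otimes> e"
  have u: "?u \<in> corner R e" using zc by simp
  have "corner_unit R e ?u"
  proof -
    have "?u \<oplus> z \<otimes> e = e" using zc by (simp add: a_minus_def a_assoc l_neg)
    then have "corner_unit R e (?u \<oplus> z \<otimes> e)" using corner_unit_e by simp
    then show ?thesis using corner_unit_add[OF u zc(1)] I_not_unit[OF z] by blast
  qed
  then obtain v where v: "v \<in> corner R e" "?u \<otimes> v = e" "v \<otimes> ?u = e" by (auto simp: corner_unit_def)
  note vc = cornerD[OF v(1)]
  have "v = (?u \<oplus> z \<otimes> e) \<otimes> v" using zc vc by (simp add: a_minus_def a_assoc l_neg)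
  also have "\<dots> = e \<oplus> z \<otimes> (e \<otimes> v)" using v(2) cornerD(1)[OF u] zc vc(1) by (simp add: l_distr m_assoc)
  finally have v_eq: "v = e \<oplus> z \<otimes> v" using vc by simp
  have vI: "v \<otimes> x \<in> I" if x: "x \<in> I" for x
  proof -
    have "v \<otimes> x = (e \<oplus> z \<otimes> v) \<otimes> x" using v_eq by simp
    also have "\<dots> = x \<oplus> z \<otimes> (v \<otimes> x)"
      using I_carrier[OF x] e_I[OF x] zc vc(1) by (simp add: l_distr m_assoc)
    also have "\<dots> \<in> I" by (rule I_add[OF x I_mult[OF z]]) (use I_carrier[OF x] vc in simp)
    finally show ?thesis .
  qed
  have "a j = dot R r (\<lambda>l. v \<otimes> y l) (\<lambda>l. C l j)" if j: "j < n" for j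
  proof -
    have "a j = (v \<otimes> ?u) \<otimes> a j" using v(3) ea[OF j] by simp
    also have "\<dots> = v \<otimes> (?u \<otimes> a j)" using cornerD(1)[OF u] vc(1) j by (simp add: m_assoc)
    also have "?u \<otimes> a j = a j \<ominus> z \<otimes> a j"
      using zc j ze_a[OF zc(2) j] by (simp add: a_minus_def l_distr l_minus ea)
    finally show ?thesis unfolding eq[OF j] using dot_smult[OF vc(1) yc is_matrix_col[OF C j]] by simp
  qed
  then show ?thesis
    unfolding few_generators_def using C vI funcset_mem[OF y]
    by (intro exI[of _ "\<lambda>l. v \<otimes> y l"] exI[of _ C]) auto
qed

end

text \<open>The identity matrix is, modulo matrices with rows in \<open>R a\<close>, a sum of products \<open>B w C w\<close> of
  inner dimension \<open>r\<close>, each inducing an endomorphism of the module presented by the row \<open>a\<close>.\<close>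

locale factored_identity = ideal_generators +
  fixes W r B C c and \<Lambda>
  assumes finW: "finite W" and B: "w \<in> W \<Longrightarrow> is_matrix R n r (B w)" and C: "w \<in> W \<Longrightarrow> is_matrix R r n (C w)"
    and c: "c \<in> {..<n} \<rightarrow> carrier R" and \<Lambda>: "w \<in> W \<Longrightarrow> \<Lambda> w \<in> carrier R"
    and eigen: "\<lbrakk>w \<in> W; j < n\<rbrakk> \<Longrightarrow> dot R n a (\<lambda>i. dot R r (B w i) (\<lambda>l. C w l j)) = \<Lambda> w \<otimes> a j"
    and identity: "\<lbrakk>i < n; j < n\<rbrakk> \<Longrightarrow>
      unit_vec R i j \<ominus> (\<Oplus>w\<in>W. dot R r (B w i) (\<lambda>l. C w l j)) = c i \<otimes> a j"
begin

definition T where "T w i j = dot R r (B w i) (\<lambda>l. C w l j)"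

lemma T_closed: "\<lbrakk>w \<in> W; i < n; j < n\<rbrakk> \<Longrightarrow> T w i j \<in> carrier R"
  unfolding T_def by (intro dot_closed is_matrix_row[OF B] is_matrix_col[OF C])

lemma T_matrix: "w \<in> W \<Longrightarrow> is_matrix R n n (T w)"
  by (simp add: is_matrix_def T_closed)

text \<open>The row \<open>a B\<close>. Its \<open>r\<close> entries lie in \<open>I\<close> for any
  matrix \<open>B\<close>, because \<open>I\<close> is a right ideal; they are the candidates for a
  smaller set of generators.\<close>

definition Y where "Y w l = dot R n a (\<lambda>i. B w i l)"

lemma Y_I: "w \<in> W \<Longrightarrow> Y w \<in> {..<r} \<rightarrow> I"
  using is_matrix_col[OF B] I_dot by (auto simp: Y_def)

lemma Y_closed: "w \<in> W \<Longrightarrow> Y w \<in> {..<r} \<rightarrow> carrier R"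
  using funcset_mem[OF Y_I] I_carrier by auto

lemma aT: "\<lbrakk>w \<in> W; j < n\<rbrakk> \<Longrightarrow> dot R n a (\<lambda>i. T w i j) = dot R r (Y w) (\<lambda>l. C w l j)"
  unfolding T_def Y_def
  by (rule dot_assoc[symmetric, OF a]) (use is_matrixD[OF B] is_matrix_col[OF C] in auto)

lemma few_generators_ideal:
  assumes ideal: "\<And>s x. \<lbrakk>s \<in> carrier R; x \<in> I\<rbrakk> \<Longrightarrow> s \<otimes> x \<in> I"
  shows "few_generators r"
proof -
  define lam where "lam w = e \<otimes> \<Lambda> w \<otimes> e" for w
  have l: "lam w \<in> corner R e" if "w \<in> W" for w using \<Lambda>[OF that] by (simp add: lam_def)
  have la: "lam w \<otimes> a j = dot R n a (\<lambda>i. T w i j)" if w: "w \<in> W" and j: "j < n" for w j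
  proof -
    have "lam w \<otimes> a j = e \<otimes> (\<Lambda> w \<otimes> a j)" using \<Lambda>[OF w] j by (simp add: lam_def m_assoc ea)
    also have "\<dots> = e \<otimes> dot R n a (\<lambda>i. T w i j)" using eigen[OF w j] by (simp add: T_def)
    also have "\<dots> = dot R n a (\<lambda>i. T w i j)" by (rule e_dot) (use T_closed[OF w] j in auto)
    finally show ?thesis .
  qed
  \<comment> \<open>Multiplying the decomposition of the identity matrix by the row \<open>a\<close>
    from the left turns its error term into multiplication of \<open>a\<close> by an element of
    \<open>I\<close>.\<close>
  have "a j \<ominus> (\<Oplus>w\<in>W. lam w) \<otimes> a j = dot R n a c \<otimes> a j" if j: "j < n" for j
  proof -
    have Tj: "(\<lambda>i. \<Oplus>w\<in>W. T w i j) \<in> {..<n} \<rightarrow> carrier R" using T_closed j by (auto intro!: finsum_closed)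
    have "dot R n a c \<otimes> a j = dot R n a (\<lambda>i. c i \<otimes> a j)"
      using dot_smult_right[OF a a_closed[OF j] c] by simp
    also have "\<dots> = dot R n a (\<lambda>i. unit_vec R i j \<ominus> (\<Oplus>w\<in>W. T w i j))"
      by (rule dot_cong[OF a]) (use identity j Tj in \<open>auto simp: T_def dest: funcset_mem\<close>)
    also have "\<dots> = dot R n a (\<lambda>i. unit_vec R i j) \<ominus> dot R n a (\<lambda>i. \<Oplus>w\<in>W. T w i j)"
      by (rule dot_diff_right[OF a _ Tj]) simp
    also have "dot R n a (\<lambda>i. unit_vec R i j) = a j"
      unfolding dot_def by (rule finsum_unique_nonzero[of _ j]) (use j in \<open>auto simp: unit_vec_def\<close>)
    also have "dot R n a (\<lambda>i. \<Oplus>w\<in>W. T w i j) = (\<Oplus>w\<in>W. dot R n a (\<lambda>i. T w i j))"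
      by (rule dot_finsum_right[OF finW _ a]) (use T_closed j in auto)
    also have "\<dots> = (\<Oplus>w\<in>W. lam w \<otimes> a j)"
      by (rule finsum_cong') (use la l j cornerD(1) in \<open>auto\<close>)
    also have "\<dots> = (\<Oplus>w\<in>W. lam w) \<otimes> a j"
      by (rule finsum_ldistr[symmetric]) (use finW l j cornerD(1) in auto)
    finally show ?thesis by simp
  qed
  from unit_of_sum[OF finW _ I_dot[OF c] this]
  obtain w where w: "w \<in> W" "corner_unit R e (lam w)" using l by blast
  then obtain v where v: "v \<in> corner R e" "v \<otimes> lam w = e" by (auto simp: corner_unit_def)
  note vc = cornerD(1)[OF v(1)]
  have "a j = dot R r (\<lambda>l. v \<otimes> Y w l) (\<lambda>l. C w l j)" if j: "j < n" for j
  proof -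
    have "a j = (v \<otimes> lam w) \<otimes> a j" using v(2) ea[OF j] by simp
    also have "\<dots> = v \<otimes> dot R r (Y w) (\<lambda>l. C w l j)"
      using vc cornerD(1)[OF l[OF w(1)]] j by (simp add: m_assoc la[OF w(1) j] aT[OF w(1) j])
    also have "\<dots> = dot R r (\<lambda>l. v \<otimes> Y w l) (\<lambda>l. C w l j)"
      by (rule dot_smult[symmetric, OF vc Y_closed[OF w(1)] is_matrix_col[OF C[OF w(1)] j]])
    finally show ?thesis .
  qed
  then show ?thesis
    unfolding few_generators_def using ideal[OF vc] funcset_mem[OF Y_I[OF w(1)]] C[OF w(1)]
    by (intro exI[of _ "\<lambda>l. v \<otimes> Y w l"] exI[of _ "C w"]) auto
qed

end

section \<open>One-sided ideals over Krull-Schmidt rings\<close>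

locale krull_schmidt_identity = factored_identity +
  assumes ks: "krull_schmidt R"
begin

lemma n_pos: "n > 0"
  using a_nonzero by auto

definition kN :: "nat \<Rightarrow> nat \<Rightarrow> 'a" where "kN = (\<lambda>_. a)"
text \<open>A single zero relation presents the free module \<open>R\<^sup>n\<close> as finitely
  presented with a positive number of relations, and puts it into the same type as
  \<open>R\<^sup>n / R a\<close>.\<close>

definition kL :: "nat \<Rightarrow> nat \<Rightarrow> 'a" where "kL = (\<lambda>_ _. \<zero>)"

lemma kN_matrix: "is_matrix R (Suc 0) n kN" and kL_matrix: "is_matrix R (Suc 0) n kL"
  by (simp_all add: is_matrix_def kN_def kL_def)

definition N where "N = coker R n (Suc 0) kN"
definition L where "L = coker R n (Suc 0) kL"
abbreviation pN where "pN \<equiv> coker_proj R n (Suc 0) kN"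
abbreviation pL where "pL \<equiv> coker_proj R n (Suc 0) kL"

sublocale N: lmod R N
  unfolding N_def by (intro lmod.intro left_module_coker kN_matrix)

sublocale L: lmod R L
  unfolding L_def by (intro lmod.intro left_module_coker kL_matrix)

lemma presentation_N: "presentation R N n (Suc 0) (\<lambda>i. coker_proj R n (Suc 0) kN (unit_vec R i)) kN"
  using coker_has_presentation[OF kN_matrix]
  by (intro presentation.intro presentation_axioms.intro N.lmod_axioms) (simp add: N_def)

lemma presentation_L: "presentation R L n (Suc 0) (\<lambda>i. coker_proj R n (Suc 0) kL (unit_vec R i)) kL"
  using coker_has_presentation[OF kL_matrix]
  by (intro presentation.intro presentation_axioms.intro L.lmod_axioms) (simp add: L_def)

lemma pN_closed: "x \<in> {..<n} \<rightarrow> carrier R \<Longrightarrow> pN x \<in> carrier N"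
  and pL_closed: "x \<in> {..<n} \<rightarrow> carrier R \<Longrightarrow> pL x \<in> carrier L"
  unfolding N_def L_def by (intro coker_proj_closed kN_matrix kL_matrix; simp)+

lemma pN_lincomb: "x \<in> {..<n} \<rightarrow> carrier R \<Longrightarrow> lincomb N n x (\<lambda>i. pN (unit_vec R i)) = pN x"
  and pL_lincomb: "x \<in> {..<n} \<rightarrow> carrier R \<Longrightarrow> lincomb L n x (\<lambda>i. pL (unit_vec R i)) = pL x"
  unfolding N_def L_def by (intro coker_proj_lincomb kN_matrix kL_matrix; simp)+

lemma pN_gens: "(\<lambda>i. pN (unit_vec R i)) \<in> {..<n} \<rightarrow> carrier N"
  and pL_gens: "(\<lambda>i. pL (unit_vec R i)) \<in> {..<n} \<rightarrow> carrier L"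
  by (intro Pi_I pN_closed pL_closed; simp)+

lemma pN_surj: "y \<in> carrier N \<Longrightarrow> \<exists>x\<in>{..<n} \<rightarrow> carrier R. y = pN x"
  using coker_proj_surj[OF kN_matrix] PiE_into_Pi unfolding N_def by blast

lemma pL_surj: "y \<in> carrier L \<Longrightarrow> \<exists>x\<in>{..<n} \<rightarrow> carrier R. y = pL x"
  using coker_proj_surj[OF kL_matrix] PiE_into_Pi unfolding L_def by blast

lemma pL_smult: "\<lbrakk>s \<in> carrier R; x \<in> {..<n} \<rightarrow> carrier R\<rbrakk> \<Longrightarrow> pL (\<lambda>i. s \<otimes> x i) = s \<odot>\<^bsub>L\<^esub> pL x"
proof -
  assume *: "s \<in> carrier R" "x \<in> {..<n} \<rightarrow> carrier R"
  then have "(\<lambda>i. s \<otimes> x i) \<in> {..<n} \<rightarrow> carrier R" by (auto dest: funcset_mem)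
  from pL_lincomb[OF this] L.lincomb_smult[OF * pL_gens] pL_lincomb[OF *(2)] show ?thesis by simp
qed

lemma pN_zero_iff:
  assumes "x \<in> {..<n} \<rightarrow> carrier R"
  shows "pN x = \<zero>\<^bsub>N\<^esub> \<longleftrightarrow> (\<exists>s\<in>carrier R. \<forall>i<n. x i = s \<otimes> a i)"
proof -
  have d: "dot R (Suc 0) s (\<lambda>j. kN j i) = s 0 \<otimes> a i" if "s 0 \<in> carrier R" "i < n" for s i
    using that by (simp add: dot_def kN_def lessThan_Suc)
  have "pN x = \<zero>\<^bsub>N\<^esub> \<longleftrightarrow> (\<exists>s\<in>{..<Suc 0} \<rightarrow> carrier R. \<forall>i<n. x i = dot R (Suc 0) s (\<lambda>j. kN j i))"
    unfolding N_def by (rule coker_proj_eq_zero_iff[OF kN_matrix assms])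
  also have "\<dots> \<longleftrightarrow> (\<exists>s\<in>carrier R. \<forall>i<n. x i = s \<otimes> a i)"
  proof
    assume "\<exists>s\<in>{..<Suc 0} \<rightarrow> carrier R. \<forall>i<n. x i = dot R (Suc 0) s (\<lambda>j. kN j i)"
    then obtain s where "s \<in> {..<Suc 0} \<rightarrow> carrier R" "\<forall>i<n. x i = dot R (Suc 0) s (\<lambda>j. kN j i)" by blast
    then show "\<exists>s\<in>carrier R. \<forall>i<n. x i = s \<otimes> a i"
      using d[of s] by (intro bexI[of _ "s 0"]) auto
  next
    assume "\<exists>s\<in>carrier R. \<forall>i<n. x i = s \<otimes> a i"
    then obtain s where "s \<in> carrier R" "\<forall>i<n. x i = s \<otimes> a i" by blast
    then show "\<exists>s\<in>{..<Suc 0} \<rightarrow> carrier R. \<forall>i<n. x i = dot R (Suc 0) s (\<lambda>j. kN j i)"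
      using d[of "\<lambda>_. s"] by (intro bexI[of _ "\<lambda>_. s"]) auto
  qed
  finally show ?thesis .
qed

lemma pL_inj:
  assumes "x \<in> {..<n} \<rightarrow> carrier R" "y \<in> {..<n} \<rightarrow> carrier R" "pL x = pL y" "i < n"
  shows "x i = y i"
proof -
  interpret P: presentation R L n "Suc 0" "\<lambda>i. pL (unit_vec R i)" kL by (rule presentation_L)
  have "lincomb L n x (\<lambda>i. pL (unit_vec R i)) = lincomb L n y (\<lambda>i. pL (unit_vec R i))"
    using assms by (simp add: pL_lincomb)
  from P.relation_diff[OF assms(1,2) this] obtain s
    where s: "s \<in> {..<Suc 0} \<rightarrow> carrier R" "\<forall>i<n. x i \<ominus> y i = dot R (Suc 0) s (\<lambda>j. kL j i)" by blast
  have "dot R (Suc 0) s (\<lambda>j. kL j i) = \<zero>" using dot_zero_right[OF s(1)] by (simp add: kL_def)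
  then show ?thesis using s(2) assms diff_eq_zero_iff[of "x i" "y i"] by (auto dest: funcset_mem)
qed

lemma hom_L:
  assumes "left_module R X" "g \<in> {..<n} \<rightarrow> carrier X"
  shows "\<exists>f\<in>mod_hom R L X. \<forall>\<rho>\<in>{..<n} \<rightarrow> carrier R. f (pL \<rho>) = lincomb X n \<rho> g"
proof -
  interpret X: lmod R X by (intro lmod.intro assms)
  have "lincomb X n (kL j) g = \<zero>\<^bsub>X\<^esub>" for j using assms(2) by (simp add: kL_def)
  from X.hom_of_presentation[OF presentation_L assms(2) this] show ?thesis by (simp add: pL_lincomb)
qed

lemma hom_N:
  assumes "left_module R X" "g \<in> {..<n} \<rightarrow> carrier X" "lincomb X n a g = \<zero>\<^bsub>X\<^esub>"
  shows "\<exists>f\<in>mod_hom R N X. \<forall>\<rho>\<in>{..<n} \<rightarrow> carrier R. f (pN \<rho>) = lincomb X n \<rho> g"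
proof -
  interpret X: lmod R X by (intro lmod.intro assms)
  have "lincomb X n (kN j) g = \<zero>\<^bsub>X\<^esub>" for j using assms(3) by (simp add: kN_def)
  from X.hom_of_presentation[OF presentation_N assms(2) this] show ?thesis by (simp add: pN_lincomb)
qed

text \<open>The canonical projection of \<open>R\<^sup>n\<close> onto
  \<open>R\<^sup>n / R a\<close>.\<close>

definition q where
  "q = (SOME f. f \<in> mod_hom R L N \<and> (\<forall>\<rho>\<in>{..<n} \<rightarrow> carrier R. f (pL \<rho>) = pN \<rho>))"

lemma q: "q \<in> mod_hom R L N" "\<rho> \<in> {..<n} \<rightarrow> carrier R \<Longrightarrow> q (pL \<rho>) = pN \<rho>"
proof -
  have "\<exists>f. f \<in> mod_hom R L N \<and> (\<forall>\<rho>\<in>{..<n} \<rightarrow> carrier R. f (pL \<rho>) = pN \<rho>)"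
    using hom_L[OF N.left_module_axioms pN_gens] by (auto simp: pN_lincomb)
  from someI_ex[OF this] show "q \<in> mod_hom R L N" "\<rho> \<in> {..<n} \<rightarrow> carrier R \<Longrightarrow> q (pL \<rho>) = pN \<rho>"
    unfolding q_def by blast+
qed

sublocale q: module_hom R L N q
  by (simp add: module_hom_def module_hom_axioms_def q L.left_module_axioms N.left_module_axioms)

text \<open>The row \<open>a\<close> as an element of the free module; it generates the kernel of
  \<open>q\<close>.\<close>

definition \<alpha> where "\<alpha> = pL a"

lemma \<alpha>_closed [simp]: "\<alpha> \<in> carrier L"
  unfolding \<alpha>_def by (rule pL_closed[OF a])

lemma q_\<alpha>: "q \<alpha> = \<zero>\<^bsub>N\<^esub>"
  unfolding \<alpha>_def q(2)[OF a] pN_zero_iff[OF a] by (intro bexI[of _ \<one>]) auto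

lemma smult_\<alpha>: "s \<in> carrier R \<Longrightarrow> s \<odot>\<^bsub>L\<^esub> \<alpha> = pL (\<lambda>j. s \<otimes> a j)"
  unfolding \<alpha>_def using pL_smult[OF _ a] by simp

lemma ker_q:
  assumes "y \<in> carrier L" "q y = \<zero>\<^bsub>N\<^esub>"
  shows "\<exists>s\<in>carrier R. y = s \<odot>\<^bsub>L\<^esub> \<alpha>"
proof -
  obtain x where x: "x \<in> {..<n} \<rightarrow> carrier R" "y = pL x" using pL_surj[OF assms(1)] by blast
  then obtain s where s: "s \<in> carrier R" "\<forall>i<n. x i = s \<otimes> a i"
    using assms(2) q(2)[OF x(1)] pN_zero_iff[OF x(1)] by auto
  have "pL x = pL (\<lambda>i. s \<otimes> a i)" using s by (simp add: coker_proj_def restrict_def cong: if_cong)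
  then show ?thesis using s x smult_\<alpha> by auto
qed

lemma e_\<alpha>: "e \<odot>\<^bsub>L\<^esub> \<alpha> = \<alpha>"
  unfolding smult_\<alpha>[OF e_closed] unfolding \<alpha>_def using ea by (simp add: coker_proj_def restrict_def cong: if_cong)

text \<open>The kernel of \<open>q\<close> consists of the multiples of \<alpha>, which gives a
  scalar \<open>s\<close>. Because \<open>e\<close> fixes \<alpha>, the scalar may be replaced by
  \<open>e s e\<close>.\<close>

lemma eigenvalue:
  assumes F: "F \<in> carrier L.End" and "q (F \<alpha>) = \<zero>\<^bsub>N\<^esub>"
  shows "\<exists>l\<in>corner R e. F \<alpha> = l \<odot>\<^bsub>L\<^esub> \<alpha>"
proof -
  interpret F: module_hom R L L F by (rule L.module_hom_End[OF F])
  obtain s where s: "s \<in> carrier R" "F \<alpha> = s \<odot>\<^bsub>L\<^esub> \<alpha>" using ker_q[OF _ assms(2)] by auto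
  have "F \<alpha> = F (e \<odot>\<^bsub>L\<^esub> \<alpha>)" by (simp add: e_\<alpha>)
  also have "\<dots> = e \<odot>\<^bsub>L\<^esub> (s \<odot>\<^bsub>L\<^esub> (e \<odot>\<^bsub>L\<^esub> \<alpha>))" unfolding e_\<alpha> s(2)[symmetric] by (rule F.smult[OF e_closed \<alpha>_closed, unfolded e_\<alpha>])
  also have "\<dots> = (e \<otimes> s \<otimes> e) \<odot>\<^bsub>L\<^esub> \<alpha>" using s(1) by (simp add: L.smult_assoc)
  finally show ?thesis using s(1) by (intro bexI[of _ "e \<otimes> s \<otimes> e"]) auto
qed

text \<open>If \<open>F\<close> induces zero on \<open>N\<close>, it sends the basis vectors to
  multiples \<open>d i\<close> of \<alpha>. By linearity \<alpha>, whose coordinates are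
  \<open>a\<close>, is multiplied by \<open>dot R n a d\<close>, an element of \<open>I\<close>.
  Endomorphisms of \<open>L\<close> with the same effect on \<open>N\<close> thus have eigenvalues
  congruent modulo \<open>I\<close>.\<close>

lemma vanishing:
  assumes F: "F \<in> carrier L.End" and qF: "\<And>y. y \<in> carrier L \<Longrightarrow> q (F y) = \<zero>\<^bsub>N\<^esub>"
  shows "\<exists>z\<in>I. F \<alpha> = z \<odot>\<^bsub>L\<^esub> \<alpha>"
proof -
  interpret F: module_hom R L L F by (rule L.module_hom_End[OF F])
  have "\<exists>s\<in>carrier R. F (pL (unit_vec R i)) = s \<odot>\<^bsub>L\<^esub> \<alpha>" for i
    by (rule ker_q) (simp_all add: pL_closed qF)
  then obtain d where d: "\<And>i. d i \<in> carrier R" "\<And>i. F (pL (unit_vec R i)) = d i \<odot>\<^bsub>L\<^esub> \<alpha>" by metis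
  have "F \<alpha> = F (lincomb L n a (\<lambda>i. pL (unit_vec R i)))" unfolding \<alpha>_def pL_lincomb[OF a] ..
  also have "\<dots> = lincomb L n a (\<lambda>i. F (pL (unit_vec R i)))" by (rule F.lincomb[OF a pL_gens])
  also have "\<dots> = lincomb L n a (\<lambda>i. d i \<odot>\<^bsub>L\<^esub> \<alpha>)" by (simp only: d(2))
  also have "\<dots> = dot R n a d \<odot>\<^bsub>L\<^esub> \<alpha>" by (rule L.lincomb_smult_right[OF a \<alpha>_closed]) (use d in auto)
  finally show ?thesis using I_dot[of d] d by auto
qed

text \<open>Projectivity of the free module \<open>L\<close>: the values on the basis vectors are
  lifted along \<open>q\<close>.\<close>

lemma lift:
  assumes f: "f \<in> carrier N.End"
  shows "\<exists>F\<in>carrier L.End. \<forall>y\<in>carrier L. q (F y) = f (q y)"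
proof -
  interpret f: module_hom R N N f by (rule N.module_hom_End[OF f])
  have "\<exists>g\<in>carrier L. q g = f (pN (unit_vec R i))" for i
  proof -
    have "f (pN (unit_vec R i)) \<in> carrier N" by (simp add: pN_closed)
    then obtain x where "x \<in> {..<n} \<rightarrow> carrier R" "f (pN (unit_vec R i)) = pN x" using pN_surj by blast
    then show ?thesis using q(2) pL_closed by (intro bexI[of _ "pL x"]) auto
  qed
  then obtain g where g: "\<And>i. g i \<in> carrier L" "\<And>i. q (g i) = f (pN (unit_vec R i))" by metis
  then have gp: "g \<in> {..<n} \<rightarrow> carrier L" by auto
  obtain F where F: "F \<in> mod_hom R L L" "\<And>\<rho>. \<rho> \<in> {..<n} \<rightarrow> carrier R \<Longrightarrow> F (pL \<rho>) = lincomb L n \<rho> g"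
    using hom_L[OF L.left_module_axioms gp] by blast
  have "q (F y) = f (q y)" if y: "y \<in> carrier L" for y
  proof -
    obtain \<rho> where \<rho>: "\<rho> \<in> {..<n} \<rightarrow> carrier R" "y = pL \<rho>" using pL_surj[OF y] by blast
    have "q (F y) = lincomb N n \<rho> (\<lambda>i. q (g i))" unfolding \<rho>(2) F(2)[OF \<rho>(1)] by (rule q.lincomb[OF \<rho>(1) gp])
    also have "\<dots> = f (lincomb N n \<rho> (\<lambda>i. pN (unit_vec R i)))" unfolding g(2) by (rule f.lincomb[OF \<rho>(1) pN_gens, symmetric])
    also have "\<dots> = f (q y)" using \<rho> q(2) by (simp add: pN_lincomb)
    finally show ?thesis .
  qed
  then show ?thesis using L.End_restrict[OF F(1)] by (intro bexI[of _ "restrict F (carrier L)"]) auto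
qed

lemma ex_T: "w \<in> W \<Longrightarrow> \<exists>F\<in>carrier L.End. \<forall>\<rho>\<in>{..<n} \<rightarrow> carrier R. F (pL \<rho>) = pL (\<lambda>j. dot R n \<rho> (\<lambda>i. T w i j))"
proof -
  assume w: "w \<in> W"
  have g: "(\<lambda>i. pL (T w i)) \<in> {..<n} \<rightarrow> carrier L"
    using is_matrix_row[OF T_matrix[OF w]] by (intro Pi_I pL_closed) auto
  obtain F where F: "F \<in> mod_hom R L L"
    "\<And>\<rho>. \<rho> \<in> {..<n} \<rightarrow> carrier R \<Longrightarrow> F (pL \<rho>) = lincomb L n \<rho> (\<lambda>i. pL (T w i))"
    using hom_L[OF L.left_module_axioms g] by blast
  have "restrict F (carrier L) (pL \<rho>) = pL (\<lambda>j. dot R n \<rho> (\<lambda>i. T w i j))" if "\<rho> \<in> {..<n} \<rightarrow> carrier R" for \<rho>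
    using F(2)[OF that] pL_closed[OF that] coker_proj_combination[OF kL_matrix that T_matrix[OF w]]
    by (simp add: L_def)
  then show ?thesis using L.End_restrict[OF F(1)] by blast
qed

text \<open>The matrix \<open>T w\<close> descends to the quotient \<open>N\<close> because
  \<open>a\<close> is an eigenvector: the relation \<open>a\<close> is sent to a multiple of
  itself.\<close>

lemma ex_t: "w \<in> W \<Longrightarrow> \<exists>f\<in>carrier N.End. \<forall>\<rho>\<in>{..<n} \<rightarrow> carrier R. f (pN \<rho>) = pN (\<lambda>j. dot R n \<rho> (\<lambda>i. T w i j))"
proof -
  assume w: "w \<in> W"
  have comb: "lincomb N n \<rho> (\<lambda>i. pN (T w i)) = pN (\<lambda>j. dot R n \<rho> (\<lambda>i. T w i j))" if "\<rho> \<in> {..<n} \<rightarrow> carrier R" for \<rho>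
    unfolding N_def by (rule coker_proj_combination[OF kN_matrix that T_matrix[OF w]])
  have aT: "(\<lambda>j. dot R n a (\<lambda>i. T w i j)) \<in> {..<n} \<rightarrow> carrier R"
    using is_matrix_col[OF T_matrix[OF w]] a by (intro Pi_I dot_closed) auto
  have "pN (\<lambda>j. dot R n a (\<lambda>i. T w i j)) = \<zero>\<^bsub>N\<^esub>"
    unfolding pN_zero_iff[OF aT] using eigen[OF w] \<Lambda>[OF w] unfolding T_def by blast
  then have z: "lincomb N n a (\<lambda>i. pN (T w i)) = \<zero>\<^bsub>N\<^esub>" using comb[OF a] by simp
  have g: "(\<lambda>i. pN (T w i)) \<in> {..<n} \<rightarrow> carrier N"
    using is_matrix_row[OF T_matrix[OF w]] by (intro Pi_I pN_closed) auto
  obtain F where F: "F \<in> mod_hom R N N"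
    "\<And>\<rho>. \<rho> \<in> {..<n} \<rightarrow> carrier R \<Longrightarrow> F (pN \<rho>) = lincomb N n \<rho> (\<lambda>i. pN (T w i))"
    using hom_N[OF N.left_module_axioms g z] by blast
  have "restrict F (carrier N) (pN \<rho>) = pN (\<lambda>j. dot R n \<rho> (\<lambda>i. T w i j))" if "\<rho> \<in> {..<n} \<rightarrow> carrier R" for \<rho>
    using F(2)[OF that] pN_closed[OF that] comb[OF that] by simp
  then show ?thesis using N.End_restrict[OF F(1)] by blast
qed

text \<open>The error in the decomposition of the identity matrix has its rows in
  \<open>R a\<close>, so it disappears in \<open>N\<close>.\<close>

lemma sum_t:
  assumes t: "\<And>w. w \<in> W \<Longrightarrow> t w \<in> carrier N.End"
    "\<And>w \<rho>. \<lbrakk>w \<in> W; \<rho> \<in> {..<n} \<rightarrow> carrier R\<rbrakk> \<Longrightarrow> t w (pN \<rho>) = pN (\<lambda>j. dot R n \<rho> (\<lambda>i. T w i j))"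
  shows "(\<Oplus>\<^bsub>N.End\<^esub>w\<in>W. t w) = \<one>\<^bsub>N.End\<^esub>"
proof -
  have tE: "t \<in> W \<rightarrow> carrier N.End" using t(1) by auto
  have S: "(\<Oplus>\<^bsub>N.End\<^esub>w\<in>W. t w) \<in> carrier N.End" by (rule N.End.finsum_closed[OF tE])
  interpret S: module_hom R N N "\<Oplus>\<^bsub>N.End\<^esub>w\<in>W. t w" by (rule N.module_hom_End[OF S])
  have sT: "(\<lambda>j. \<Oplus>w\<in>W. T w i j) \<in> {..<n} \<rightarrow> carrier R" if "i < n" for i
    using T_closed that by (auto intro!: finsum_closed)
  have gen: "(\<Oplus>\<^bsub>N.End\<^esub>w\<in>W. t w) (pN (unit_vec R i)) = pN (unit_vec R i)" if i: "i < n" for i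
  proof -
    have row: "T w i \<in> {..<n} \<rightarrow> carrier R" if "w \<in> W" for w by (rule is_matrix_row[OF T_matrix[OF that] i])
    have pi: "pN (unit_vec R i) \<in> carrier N" by (simp add: pN_closed)
    have "(\<Oplus>\<^bsub>N.End\<^esub>w\<in>W. t w) (pN (unit_vec R i)) = (\<Oplus>\<^bsub>N\<^esub>w\<in>W. t w (pN (unit_vec R i)))"
      by (rule N.End_finsum[OF finW tE pi])
    also have "\<dots> = (\<Oplus>\<^bsub>N\<^esub>w\<in>W. lincomb N n (T w i) (\<lambda>j. pN (unit_vec R j)))"
    proof (rule N.M.finsum_cong'[OF refl])
      show "(\<lambda>w. lincomb N n (T w i) (\<lambda>j. pN (unit_vec R j))) \<in> W \<rightarrow> carrier N"
        using row pN_gens by auto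
      fix w assume w: "w \<in> W"
      have "t w (pN (unit_vec R i)) = pN (\<lambda>j. dot R n (unit_vec R i) (\<lambda>i. T w i j))"
        by (rule t(2)[OF w]) simp
      also have "\<dots> = pN (T w i)"
        using dot_unit_vec[OF i is_matrix_col[OF T_matrix[OF w]]] by (simp add: coker_proj_def restrict_def cong: if_cong)
      finally show "t w (pN (unit_vec R i)) = lincomb N n (T w i) (\<lambda>j. pN (unit_vec R j))"
        using pN_lincomb[OF row[OF w]] by simp
    qed
    also have "\<dots> = lincomb N n (\<lambda>j. \<Oplus>w\<in>W. T w i j) (\<lambda>j. pN (unit_vec R j))"
      by (rule N.lincomb_finsum_left[symmetric, OF finW _ pN_gens]) (use T_closed i in auto)
    finally have eq: "(\<Oplus>\<^bsub>N.End\<^esub>w\<in>W. t w) (pN (unit_vec R i)) = lincomb N n (\<lambda>j. \<Oplus>w\<in>W. T w i j) (\<lambda>j. pN (unit_vec R j))" .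
    have ud: "(\<lambda>j. unit_vec R i j \<ominus> (\<Oplus>w\<in>W. T w i j)) \<in> {..<n} \<rightarrow> carrier R"
      using funcset_mem[OF sT[OF i]] by auto
    have "pN (\<lambda>j. unit_vec R i j \<ominus> (\<Oplus>w\<in>W. T w i j)) = \<zero>\<^bsub>N\<^esub>"
      unfolding pN_zero_iff[OF ud]
      by (rule bexI[of _ "c i"]) (use identity[OF i] funcset_mem[OF c] i in \<open>auto simp: T_def\<close>)
    then have "lincomb N n (unit_vec R i) (\<lambda>j. pN (unit_vec R j)) \<ominus>\<^bsub>N\<^esub>
        lincomb N n (\<lambda>j. \<Oplus>w\<in>W. T w i j) (\<lambda>j. pN (unit_vec R j)) = \<zero>\<^bsub>N\<^esub>"
      using N.lincomb_diff_left[of "unit_vec R i" n "\<lambda>j. \<Oplus>w\<in>W. T w i j", OF _ sT[OF i] pN_gens] pN_lincomb[OF ud] by simp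
    then have "lincomb N n (unit_vec R i) (\<lambda>j. pN (unit_vec R j)) = lincomb N n (\<lambda>j. \<Oplus>w\<in>W. T w i j) (\<lambda>j. pN (unit_vec R j))"
      using sT[OF i] pN_gens by (subst (asm) N.M.diff_eq_zero_iff) auto
    then show ?thesis using eq pN_lincomb[of "unit_vec R i"] by simp
  qed
  show ?thesis
  proof (rule N.End_eqI[OF S N.End.one_closed])
    fix y assume y: "y \<in> carrier N"
    then obtain \<rho> where \<rho>: "\<rho> \<in> {..<n} \<rightarrow> carrier R" "y = pN \<rho>" using pN_surj by blast
    have "(\<Oplus>\<^bsub>N.End\<^esub>w\<in>W. t w) y = lincomb N n \<rho> (\<lambda>i. (\<Oplus>\<^bsub>N.End\<^esub>w\<in>W. t w) (pN (unit_vec R i)))"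
      unfolding \<rho>(2) by (subst pN_lincomb[OF \<rho>(1), symmetric], rule S.lincomb[OF \<rho>(1) pN_gens])
    also have "\<dots> = lincomb N n \<rho> (\<lambda>i. pN (unit_vec R i))"
      by (rule N.lincomb_cong[OF \<rho>(1) pN_gens]) (use gen in auto)
    also have "\<dots> = y" using \<rho> by (simp add: pN_lincomb)
    finally show "(\<Oplus>\<^bsub>N.End\<^esub>w\<in>W. t w) y = \<one>\<^bsub>N.End\<^esub> y" using y by (simp add: N.End_one)
  qed
qed

lemma smult_\<alpha>_inj:
  assumes "s \<in> carrier R" "t \<in> carrier R" "s \<odot>\<^bsub>L\<^esub> \<alpha> = t \<odot>\<^bsub>L\<^esub> \<alpha>" "j < n"
  shows "s \<otimes> a j = t \<otimes> a j"
  using pL_inj[of "\<lambda>j. s \<otimes> a j" "\<lambda>j. t \<otimes> a j", OF _ _ _ assms(4)] assms(1-3) smult_\<alpha> by auto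

lemma diff_smult_\<alpha>:
  assumes "s \<in> carrier R" "t \<in> carrier R" "z \<in> carrier R" "s \<odot>\<^bsub>L\<^esub> \<alpha> \<ominus>\<^bsub>L\<^esub> t \<odot>\<^bsub>L\<^esub> \<alpha> = z \<odot>\<^bsub>L\<^esub> \<alpha>" "j < n"
  shows "s \<otimes> a j \<ominus> t \<otimes> a j = z \<otimes> a j"
proof -
  have "(s \<ominus> t) \<odot>\<^bsub>L\<^esub> \<alpha> = z \<odot>\<^bsub>L\<^esub> \<alpha>"
    using assms by (simp add: a_minus_def L.smult_l_distr L.smult_l_minus)
  from smult_\<alpha>_inj[OF _ assms(3) this assms(5)] show ?thesis
    using assms by (simp add: a_minus_def l_distr l_minus)
qed

text \<open>A summand \<open>\<pi>\<close> of \<open>N\<close> on which the row \<open>a\<close> lives is cut out, by the exchange property of \<open>R\<^sup>n\<close>,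
  by an idempotent \<open>E\<close> of \<open>R\<^sup>n\<close> fixing \<open>a\<close>; since \<open>\<pi>\<close> factors through some \<open>t w\<close>, so does \<open>E\<close> modulo \<open>a\<close>.\<close>

theorem few_generators_krull_schmidt: "few_generators r"
proof -
  obtain A :: "'a univ set set" and \<pi> where dN: "local_decomposition N.End A \<pi>"
    using krull_schmidt_local_decomposition[OF ks coker_presented[OF kN_matrix] n_pos] by (auto simp: N_def)
  interpret dN: local_decomposition N.End A \<pi> by (rule dN)
  obtain A' :: "'a univ set set" and \<epsilon> where dL: "local_decomposition L.End A' \<epsilon>"
    using krull_schmidt_local_decomposition[OF ks coker_presented[OF kL_matrix] n_pos] by (auto simp: L_def)
  interpret dL: local_decomposition L.End A' \<epsilon> by (rule dL)
  \<comment> \<open>The projections of \<open>N\<close> are lifted to the free module. The lifts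
    \<open>P k\<close> need not be idempotent or orthogonal, but each has \<alpha> as an
    eigenvector, with eigenvalue \<open>l k\<close>.\<close>
  have "\<forall>k. \<exists>F. k \<in> A \<longrightarrow> F \<in> carrier L.End \<and> (\<forall>y\<in>carrier L. q (F y) = \<pi> k (q y))"
    using lift dN.eps(1) by blast
  then obtain P where P: "\<And>k. k \<in> A \<Longrightarrow> P k \<in> carrier L.End"
    "\<And>k y. \<lbrakk>k \<in> A; y \<in> carrier L\<rbrakk> \<Longrightarrow> q (P k y) = \<pi> k (q y)"
    unfolding choice_iff by blast
  have PE: "P \<in> A \<rightarrow> carrier L.End" using P(1) by auto
  have \<pi>0: "f \<zero>\<^bsub>N\<^esub> = \<zero>\<^bsub>N\<^esub>" if "f \<in> carrier N.End" for f
  proof -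
    interpret f: module_hom R N N f by (rule N.module_hom_End[OF that])
    show ?thesis by simp
  qed
  have "\<forall>k. \<exists>l. k \<in> A \<longrightarrow> l \<in> corner R e \<and> P k \<alpha> = l \<odot>\<^bsub>L\<^esub> \<alpha>"
  proof
    fix k show "\<exists>l. k \<in> A \<longrightarrow> l \<in> corner R e \<and> P k \<alpha> = l \<odot>\<^bsub>L\<^esub> \<alpha>"
      using eigenvalue[OF P(1), of k] P(2)[of k \<alpha>] q_\<alpha> \<pi>0[OF dN.eps(1)] by auto
  qed
  then obtain l where l: "\<And>k. k \<in> A \<Longrightarrow> l k \<in> corner R e" "\<And>k. k \<in> A \<Longrightarrow> P k \<alpha> = l k \<odot>\<^bsub>L\<^esub> \<alpha>"
    unfolding choice_iff by blast
  have lE: "l \<in> A \<rightarrow> carrier R" using l(1) cornerD(1) by auto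
  \<comment> \<open>The lifts add up to the identity modulo endomorphisms that induce zero on
    \<open>N\<close>, so on \<alpha> the error is a multiplier in \<open>I\<close>.\<close>
  obtain z where z: "z \<in> I" "(\<one>\<^bsub>L.End\<^esub> \<ominus>\<^bsub>L.End\<^esub> (\<Oplus>\<^bsub>L.End\<^esub>k\<in>A. P k)) \<alpha> = z \<odot>\<^bsub>L\<^esub> \<alpha>"
  proof -
    have S: "(\<Oplus>\<^bsub>L.End\<^esub>k\<in>A. P k) \<in> carrier L.End" by (rule L.End.finsum_closed[OF PE])
    have "q ((\<one>\<^bsub>L.End\<^esub> \<ominus>\<^bsub>L.End\<^esub> (\<Oplus>\<^bsub>L.End\<^esub>k\<in>A. P k)) y) = \<zero>\<^bsub>N\<^esub>" if y: "y \<in> carrier L" for y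
    proof -
      have Py: "(\<lambda>k. P k y) \<in> A \<rightarrow> carrier L" using P(1) y L.End_closed by auto
      have "q ((\<one>\<^bsub>L.End\<^esub> \<ominus>\<^bsub>L.End\<^esub> (\<Oplus>\<^bsub>L.End\<^esub>k\<in>A. P k)) y) = q (y \<ominus>\<^bsub>L\<^esub> (\<Oplus>\<^bsub>L\<^esub>k\<in>A. P k y))"
        using y S by (simp add: L.End_diff L.End_one L.End_finsum[OF dN.fin PE y])
      also have "\<dots> = q y \<ominus>\<^bsub>N\<^esub> (\<Oplus>\<^bsub>N\<^esub>k\<in>A. q (P k y))"
        using y q.finsum[OF dN.fin Py] L.M.finsum_closed[OF Py] by (simp add: q.diff)
      also have "(\<Oplus>\<^bsub>N\<^esub>k\<in>A. q (P k y)) = (\<Oplus>\<^bsub>N\<^esub>k\<in>A. \<pi> k (q y))"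
        by (rule N.M.finsum_cong') (use P(2) y N.End_closed[OF dN.eps(1)] in auto)
      also have "\<dots> = (\<Oplus>\<^bsub>N.End\<^esub>k\<in>A. \<pi> k) (q y)"
        by (rule N.End_finsum[symmetric, OF dN.fin]) (use y in auto)
      also have "\<dots> = q y" using y by (simp add: dN.total N.End_one)
      finally show ?thesis using y by (simp add: N.M.diff_eq_zero_iff)
    qed
    from vanishing[of "\<one>\<^bsub>L.End\<^esub> \<ominus>\<^bsub>L.End\<^esub> (\<Oplus>\<^bsub>L.End\<^esub>k\<in>A. P k)", OF _ this] S that show ?thesis by auto
  qed
  \<comment> \<open>The eigenvalues add up to a unit of the local corner, so one of them is a unit.
    This selects the summand of \<open>N\<close> that carries \<open>a\<close>.\<close>
  have "\<exists>k\<in>A. corner_unit R e (l k)"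
  proof (rule unit_of_sum[OF dN.fin _ z(1)])
    fix j assume j: "j < n"
    have S: "(\<Oplus>\<^bsub>L.End\<^esub>k\<in>A. P k) \<in> carrier L.End" by (rule L.End.finsum_closed[OF PE])
    have "(\<Oplus>\<^bsub>L.End\<^esub>k\<in>A. P k) \<alpha> = (\<Oplus>\<^bsub>L\<^esub>k\<in>A. l k \<odot>\<^bsub>L\<^esub> \<alpha>)"
      unfolding L.End_finsum[OF dN.fin PE \<alpha>_closed]
      by (rule L.M.finsum_cong') (use l lE in auto)
    also have "\<dots> = (\<Oplus>k\<in>A. l k) \<odot>\<^bsub>L\<^esub> \<alpha>" by (rule L.finsum_smult[symmetric, OF dN.fin \<alpha>_closed lE])
    finally have "\<one> \<odot>\<^bsub>L\<^esub> \<alpha> \<ominus>\<^bsub>L\<^esub> (\<Oplus>k\<in>A. l k) \<odot>\<^bsub>L\<^esub> \<alpha> = z \<odot>\<^bsub>L\<^esub> \<alpha>"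
      using z(2) S by (simp add: L.End_diff L.End_one)
    from diff_smult_\<alpha>[OF one_closed finsum_closed[OF lE] I_carrier[OF z(1)] this j]
    show "a j \<ominus> (\<Oplus>k\<in>A. l k) \<otimes> a j = z \<otimes> a j" using j by simp
  qed (use l(1) in auto)
  then obtain k where k: "k \<in> A" "corner_unit R e (l k)" by blast
  define p where "p = P k"
  have p: "p \<in> carrier L.End" "\<And>y. y \<in> carrier L \<Longrightarrow> q (p y) = \<pi> k (q y)" "p \<alpha> = l k \<odot>\<^bsub>L\<^esub> \<alpha>"
    using P l k by (auto simp: p_def)
  have \<pi>k: "\<pi> k \<in> carrier N.End" "\<And>x. x \<in> carrier N \<Longrightarrow> \<pi> k (\<pi> k x) = \<pi> k x"
  proof -
    show "\<pi> k \<in> carrier N.End" by (rule dN.eps(1)[OF k(1)])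
    show "\<pi> k (\<pi> k x) = \<pi> k x" if "x \<in> carrier N" for x
      using N.End_mult[OF that, of "\<pi> k" "\<pi> k"] dN.eps(2)[OF k(1)] by simp
  qed
  interpret \<pi>k: module_hom R N N "\<pi> k" by (rule N.module_hom_End[OF \<pi>k(1)])
  \<comment> \<open>Exchange in the endomorphism ring of \<open>R\<^sup>n\<close> replaces the lift
    \<open>p\<close> of \<pi> \<open>k\<close> by a genuine idempotent.\<close>
  obtain E X Y' where E: "E \<in> carrier L.End" "E \<otimes>\<^bsub>L.End\<^esub> E = E" "X \<in> carrier L.End" "E = p \<otimes>\<^bsub>L.End\<^esub> X"
    "Y' \<in> carrier L.End" "\<one>\<^bsub>L.End\<^esub> \<ominus>\<^bsub>L.End\<^esub> E = (\<one>\<^bsub>L.End\<^esub> \<ominus>\<^bsub>L.End\<^esub> p) \<otimes>\<^bsub>L.End\<^esub> Y'"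
    using dL.exchange[OF p(1)] by blast
  interpret E: module_hom R L L E by (rule L.module_hom_End[OF E(1)])
  \<comment> \<open>\<open>E\<close> still lifts \<pi> \<open>k\<close>: as a right multiple of
    \<open>p\<close> it has values in the image of \<pi> \<open>k\<close> modulo \<open>R a\<close>,
    and as its complement is a right multiple of that of \<open>p\<close>, the values of the
    complement are killed by \<pi> \<open>k\<close>.\<close>
  have qE: "q (E y) = \<pi> k (q y)" if y: "y \<in> carrier L" for y
  proof -
    have "E y = p (X y)" using E(4) y by (simp add: L.End_mult)
    then have "q (E y) = \<pi> k (q (X y))" using p(2) L.End_closed[OF E(3) y] by simp
    then have 1: "\<pi> k (q (E y)) = q (E y)" using \<pi>k(2) L.End_closed[OF E(3) y] by simp
    have "y \<ominus>\<^bsub>L\<^esub> E y = (\<one>\<^bsub>L.End\<^esub> \<ominus>\<^bsub>L.End\<^esub> E) y" using E(1) y by (simp add: L.End_diff L.End_one)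
    also have "\<dots> = Y' y \<ominus>\<^bsub>L\<^esub> p (Y' y)"
      unfolding E(6) using y p(1) L.End_closed[OF E(5) y] by (simp add: L.End_mult L.End_diff L.End_one)
    finally have "q (y \<ominus>\<^bsub>L\<^esub> E y) = q (Y' y) \<ominus>\<^bsub>N\<^esub> \<pi> k (q (Y' y))"
      using L.End_closed[OF E(5) y] L.End_closed[OF p(1)] p(2) by (simp add: q.diff)
    then have "\<pi> k (q (y \<ominus>\<^bsub>L\<^esub> E y)) = \<zero>\<^bsub>N\<^esub>"
      using L.End_closed[OF E(5) y] by (simp add: \<pi>k.diff \<pi>k(2) N.M.diff_eq_zero_iff)
    then show ?thesis using y 1 by (simp add: q.diff \<pi>k.diff N.M.diff_eq_zero_iff)
  qed
  obtain m where m: "m \<in> corner R e" "E \<alpha> = m \<odot>\<^bsub>L\<^esub> \<alpha>"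
    using eigenvalue[OF E(1)] qE[OF \<alpha>_closed] q_\<alpha> by auto
  note mc = cornerD(1)[OF m(1)] and lc = cornerD(1)[OF l(1)[OF k(1)]]
  \<comment> \<open>\<open>E\<close> and \<open>p\<close> induce the same map on \<open>N\<close>,
    so their eigenvalues are congruent modulo \<open>I\<close>, and one is a unit with the
    other.\<close>
  have "corner_unit R e m"
  proof -
    have "q ((p \<ominus>\<^bsub>L.End\<^esub> E) y) = \<zero>\<^bsub>N\<^esub>" if y: "y \<in> carrier L" for y
      using y p(1,2) E(1) qE L.End_closed[OF p(1) y] by (simp add: L.End_diff q.diff N.M.diff_eq_zero_iff)
    from vanishing[of "p \<ominus>\<^bsub>L.End\<^esub> E", OF _ this] obtain z' where z': "z' \<in> I" "(p \<ominus>\<^bsub>L.End\<^esub> E) \<alpha> = z' \<odot>\<^bsub>L\<^esub> \<alpha>"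
      using p(1) E(1) by auto
    then have "l k \<odot>\<^bsub>L\<^esub> \<alpha> \<ominus>\<^bsub>L\<^esub> m \<odot>\<^bsub>L\<^esub> \<alpha> = z' \<odot>\<^bsub>L\<^esub> \<alpha>"
      using p E(1) m(2) by (simp add: L.End_diff)
    from diff_smult_\<alpha>[OF lc mc I_carrier[OF z'(1)] this]
    show ?thesis by (rule unit_congruence[OF l(1)[OF k(1)] k(2) m(1) z'(1)])
  qed
  then obtain v where v: "v \<in> corner R e" "v \<otimes> m = e" by (auto simp: corner_unit_def)
  \<comment> \<open>An idempotent with a unit eigenvalue fixes its eigenvector; cancel
    \<open>m\<close>.\<close>
  have E\<alpha>: "E \<alpha> = \<alpha>"
  proof -
    have "E (E \<alpha>) = E \<alpha>" using L.End_mult[OF \<alpha>_closed, of E E] E(2) by simp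
    then have "m \<odot>\<^bsub>L\<^esub> (m \<odot>\<^bsub>L\<^esub> \<alpha>) = m \<odot>\<^bsub>L\<^esub> \<alpha>" using m(2) mc by (simp add: E.smult)
    then have "v \<odot>\<^bsub>L\<^esub> (m \<odot>\<^bsub>L\<^esub> (m \<odot>\<^bsub>L\<^esub> \<alpha>)) = v \<odot>\<^bsub>L\<^esub> (m \<odot>\<^bsub>L\<^esub> \<alpha>)" by simp
    then have "(v \<otimes> m) \<odot>\<^bsub>L\<^esub> (m \<odot>\<^bsub>L\<^esub> \<alpha>) = (v \<otimes> m) \<odot>\<^bsub>L\<^esub> \<alpha>"
      using mc cornerD(1)[OF v(1)] by (simp add: L.smult_assoc)
    then have "(e \<otimes> m) \<odot>\<^bsub>L\<^esub> \<alpha> = \<alpha>" using v(2) mc by (simp add: L.smult_assoc e_\<alpha>)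
    then show ?thesis using cornerD(2)[OF m(1)] m(2) by simp
  qed
  have "\<forall>w. \<exists>f. w \<in> W \<longrightarrow> f \<in> carrier N.End \<and> (\<forall>\<rho>\<in>{..<n} \<rightarrow> carrier R. f (pN \<rho>) = pN (\<lambda>j. dot R n \<rho> (\<lambda>i. T w i j)))"
    using ex_t by blast
  then obtain t where t: "\<And>w. w \<in> W \<Longrightarrow> t w \<in> carrier N.End"
    "\<And>w \<rho>. \<lbrakk>w \<in> W; \<rho> \<in> {..<n} \<rightarrow> carrier R\<rbrakk> \<Longrightarrow> t w (pN \<rho>) = pN (\<lambda>j. dot R n \<rho> (\<lambda>i. T w i j))"
    unfolding choice_iff by blast
  interpret lk: local_idem N.End "\<pi> k" by (rule dN.local_idem[OF k(1)])
  \<comment> \<open>The maps \<open>t w\<close> add up to the identity of \<open>N\<close>, so their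
    compressions add up to the unit \<pi> \<open>k\<close> of a local corner, and one compression is
    invertible there; \<open>h\<close> will be its inverse.\<close>
  obtain w where w: "w \<in> W" "corner_unit N.End (\<pi> k) (\<pi> k \<otimes>\<^bsub>N.End\<^esub> t w \<otimes>\<^bsub>N.End\<^esub> \<pi> k)"
  proof -
    have tE: "t \<in> W \<rightarrow> carrier N.End" using t(1) by auto
    have "(\<Oplus>\<^bsub>N.End\<^esub>w\<in>W. \<pi> k \<otimes>\<^bsub>N.End\<^esub> t w \<otimes>\<^bsub>N.End\<^esub> \<pi> k)
        = (\<Oplus>\<^bsub>N.End\<^esub>w\<in>W. \<pi> k \<otimes>\<^bsub>N.End\<^esub> t w) \<otimes>\<^bsub>N.End\<^esub> \<pi> k"
      by (rule N.End.finsum_ldistr[symmetric, OF finW]) (use t(1) \<pi>k(1) in auto)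
    also have "(\<Oplus>\<^bsub>N.End\<^esub>w\<in>W. \<pi> k \<otimes>\<^bsub>N.End\<^esub> t w) = \<pi> k \<otimes>\<^bsub>N.End\<^esub> (\<Oplus>\<^bsub>N.End\<^esub>w\<in>W. t w)"
      by (rule N.End.finsum_rdistr[symmetric, OF finW \<pi>k(1) tE])
    also have "\<dots> \<otimes>\<^bsub>N.End\<^esub> \<pi> k = \<pi> k" using sum_t[OF t] \<pi>k(1) by simp
    finally have "corner_unit N.End (\<pi> k) (\<Oplus>\<^bsub>N.End\<^esub>w\<in>W. \<pi> k \<otimes>\<^bsub>N.End\<^esub> t w \<otimes>\<^bsub>N.End\<^esub> \<pi> k)"
      using lk.corner_unit_e by simp
    from lk.corner_unit_finsum[OF finW _ this] t(1) that show ?thesis by auto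
  qed
  then obtain h where h: "h \<in> corner N.End (\<pi> k)"
    "h \<otimes>\<^bsub>N.End\<^esub> (\<pi> k \<otimes>\<^bsub>N.End\<^esub> t w \<otimes>\<^bsub>N.End\<^esub> \<pi> k) = \<pi> k"
    by (auto simp: corner_unit_def)
  note hE = lk.cornerD(1)[OF h(1)]
  obtain H where H: "H \<in> carrier L.End" "\<And>y. y \<in> carrier L \<Longrightarrow> q (H y) = h (q y)" using lift[OF hE] by blast
  obtain Tw where Tw: "Tw \<in> carrier L.End"
    "\<And>\<rho>. \<rho> \<in> {..<n} \<rightarrow> carrier R \<Longrightarrow> Tw (pL \<rho>) = pL (\<lambda>j. dot R n \<rho> (\<lambda>i. T w i j))"
    using ex_T[OF w(1)] by blast
  have colT: "(\<lambda>j. dot R n \<rho> (\<lambda>i. T w i j)) \<in> {..<n} \<rightarrow> carrier R" if "\<rho> \<in> {..<n} \<rightarrow> carrier R" for \<rho>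
    using is_matrix_col[OF T_matrix[OF w(1)]] that by (intro Pi_I dot_closed) auto
  have qT: "q (Tw y) = t w (q y)" if y: "y \<in> carrier L" for y
  proof -
    obtain \<rho> where \<rho>: "\<rho> \<in> {..<n} \<rightarrow> carrier R" "y = pL \<rho>" using pL_surj[OF y] by blast
    then show ?thesis using Tw(2) t(2)[OF w(1)] q(2) colT by simp
  qed
  \<comment> \<open>On \<open>N\<close> this is \<pi> \<open>k\<close> minus \<open>h\<close> times
    the compression of \<open>t w\<close>, hence zero. As \<open>E\<close> fixes \<alpha>,
    \<open>H E Tw\<close> fixes \<alpha> up to a multiplier \<open>z'\<close> in \<open>I\<close>.
    This is how the unit congruent to \<open>e\<close> modulo \<open>I\<close> arises.\<close>
  define D where "D = E \<ominus>\<^bsub>L.End\<^esub> H \<otimes>\<^bsub>L.End\<^esub> E \<otimes>\<^bsub>L.End\<^esub> Tw \<otimes>\<^bsub>L.End\<^esub> E"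
  have DE: "D \<in> carrier L.End" using E(1) H(1) Tw(1) by (simp add: D_def)
  have Dy: "D y = E y \<ominus>\<^bsub>L\<^esub> H (E (Tw (E y)))" if "y \<in> carrier L" for y
    using that E(1) H(1) Tw(1) by (simp add: D_def L.End_diff L.End_mult L.End_closed)
  have "q (D y) = \<zero>\<^bsub>N\<^esub>" if y: "y \<in> carrier L" for y
  proof -
    have c: "E y \<in> carrier L" "Tw (E y) \<in> carrier L" "E (Tw (E y)) \<in> carrier L" "H (E (Tw (E y))) \<in> carrier L"
      using y E(1) H(1) Tw(1) by (simp_all add: L.End_closed)
    have "q (H (E (Tw (E y)))) = h (\<pi> k (t w (\<pi> k (q y))))"
      using c y H(2) qE qT by simp
    also have "\<dots> = (h \<otimes>\<^bsub>N.End\<^esub> (\<pi> k \<otimes>\<^bsub>N.End\<^esub> t w \<otimes>\<^bsub>N.End\<^esub> \<pi> k)) (q y)"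
      using y by (simp add: N.End_mult N.End_closed[OF t(1)[OF w(1)]])
    also have "\<dots> = \<pi> k (q y)" unfolding h(2) ..
    finally show ?thesis using c y qE by (simp add: Dy q.diff N.M.diff_eq_zero_iff)
  qed
  from vanishing[OF DE this] obtain z' where z': "z' \<in> I" "D \<alpha> = z' \<odot>\<^bsub>L\<^esub> \<alpha>" by blast
  have Cp: "(\<lambda>i. pL (C w i)) \<in> {..<r} \<rightarrow> carrier L"
    using is_matrix_row[OF C[OF w(1)]] by (intro Pi_I pL_closed) auto
  \<comment> \<open>\<open>Tw\<close> \<alpha> is the combination of the \<open>r\<close> rows of
    \<open>C w\<close> with coefficients \<open>Y w\<close>. Applying \<open>H E\<close> changes the
    rows into \<open>C'\<close> and leaves the coefficients, which lie in \<open>I\<close>,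
    untouched.\<close>
  have "\<forall>i. \<exists>x. i < r \<longrightarrow> x \<in> {..<n} \<rightarrow> carrier R \<and> H (E (pL (C w i))) = pL x"
    using pL_surj L.End_closed[OF H(1)] L.End_closed[OF E(1)] funcset_mem[OF Cp] by (meson lessThan_iff)
  then obtain C' where C': "\<And>i. i < r \<Longrightarrow> C' i \<in> {..<n} \<rightarrow> carrier R"
    "\<And>i. i < r \<Longrightarrow> H (E (pL (C w i))) = pL (C' i)"
    unfolding choice_iff by blast
  have C'm: "is_matrix R r n C'" using funcset_mem[OF C'(1)] by (simp add: is_matrix_def)
  interpret H: module_hom R L L H by (rule L.module_hom_End[OF H(1)])
  note Yw = Y_closed[OF w(1)]
  have YC: "(\<lambda>j. dot R r (Y w) (\<lambda>i. C' i j)) \<in> {..<n} \<rightarrow> carrier R"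
    using is_matrix_col[OF C'm] Yw by (intro Pi_I dot_closed) auto
  have "Tw \<alpha> = pL (\<lambda>j. dot R r (Y w) (\<lambda>i. C w i j))"
    unfolding \<alpha>_def Tw(2)[OF a] using aT[OF w(1)] by (simp add: coker_proj_def restrict_def cong: if_cong)
  also have "\<dots> = lincomb L r (Y w) (\<lambda>i. pL (C w i))"
    unfolding L_def by (rule coker_proj_combination[symmetric, OF kL_matrix Yw C[OF w(1)]])
  finally have "H (E (Tw \<alpha>)) = lincomb L r (Y w) (\<lambda>i. H (E (pL (C w i))))"
    using E.lincomb[OF Yw Cp] H.lincomb[OF Yw, of "\<lambda>i. E (pL (C w i))"] funcset_mem[OF Cp] by simp
  also have "\<dots> = lincomb L r (Y w) (\<lambda>i. pL (C' i))"
    by (rule L.lincomb_cong[OF Yw]) (use C' pL_closed in auto)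
  also have "\<dots> = pL (\<lambda>j. dot R r (Y w) (\<lambda>i. C' i j))"
    unfolding L_def by (rule coker_proj_combination[OF kL_matrix Yw C'm])
  finally have HET: "H (E (Tw \<alpha>)) = pL (\<lambda>j. dot R r (Y w) (\<lambda>i. C' i j))" .
  have "a j \<ominus> z' \<otimes> a j = dot R r (Y w) (\<lambda>i. C' i j)" if j: "j < n" for j
  proof -
    have hc: "H (E (Tw \<alpha>)) \<in> carrier L" using H(1) Tw(1) E(1) by (simp add: L.End_closed)
    have zc: "z' \<in> carrier R" by (rule I_carrier[OF z'(1)])
    have "\<alpha> \<ominus>\<^bsub>L\<^esub> H (E (Tw \<alpha>)) = z' \<odot>\<^bsub>L\<^esub> \<alpha>" using Dy[OF \<alpha>_closed] z'(2) E\<alpha> by simp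
    then have "H (E (Tw \<alpha>)) = \<alpha> \<ominus>\<^bsub>L\<^esub> z' \<odot>\<^bsub>L\<^esub> \<alpha>"
      by (rule L.M.diff_eq_swap[OF \<alpha>_closed hc])
    also have "\<dots> = (\<one> \<ominus> z') \<odot>\<^bsub>L\<^esub> \<alpha>" using zc by (simp add: a_minus_def L.smult_l_distr L.smult_l_minus)
    also have "\<dots> = pL (\<lambda>j. (\<one> \<ominus> z') \<otimes> a j)" using zc by (simp add: smult_\<alpha>)
    finally have "pL (\<lambda>j. (\<one> \<ominus> z') \<otimes> a j) = pL (\<lambda>j. dot R r (Y w) (\<lambda>i. C' i j))" using HET by simp
    from pL_inj[OF _ YC this j] zc have "(\<one> \<ominus> z') \<otimes> a j = dot R r (Y w) (\<lambda>i. C' i j)" by auto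
    then show ?thesis using zc j by (simp add: a_minus_def l_distr l_minus)
  qed
  then show ?thesis by (rule few_generatorsI[OF z'(1) Y_I[OF w(1)] C'm])
qed

end

section \<open>Comparing purities\<close>

lemma (in ring) dot_single:
  assumes "0 < p" "x \<in> {..<p} \<rightarrow> carrier R" "y \<in> carrier R"
  shows "dot R p x (\<lambda>t. if t = 0 then y else \<zero>) = x 0 \<otimes> y"
    and "dot R p (\<lambda>t. if t = 0 then y else \<zero>) x = y \<otimes> x 0"
  unfolding dot_def
  by (rule finsum_unique_nonzero[of _ 0]; use assms in \<open>auto dest: funcset_mem\<close>)+

context ideal_generators
begin

lemma few_generators_of_identity:
  assumes "factored_identity R e n a W r B C c \<Lambda>"
    and "(\<forall>s\<in>carrier R. \<forall>x\<in>I. s \<otimes> x \<in> I) \<or> krull_schmidt R"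
  shows "few_generators r"
proof -
  interpret factored_identity R e n a W r B C c \<Lambda> by fact
  show ?thesis
  proof (cases "krull_schmidt R")
    case True
    then interpret krull_schmidt_identity R e n a W r B C c \<Lambda> by unfold_locales
    show ?thesis by (rule few_generators_krull_schmidt)
  next
    case False
    then show ?thesis using assms(2) few_generators_ideal by blast
  qed
qed

lemma few_generators_left:
  assumes q: "q > 0" and p': "p' > 0"
    and imp: "\<And>A f B g C. pq_pure R p q A f B g C \<Longrightarrow> pq_pure R p' n A f B g C"
    and I: "(\<forall>s\<in>carrier R. \<forall>x\<in>I. s \<otimes> x \<in> I) \<or> krull_schmidt R"
  shows "few_generators q"
proof -
  \<comment> \<open>Row 0 is \<open>a\<close>, and zero rows pad the matrix to the prescribed number
    \<open>p'\<close> of equations; the cokernel is \<open>R\<^sup>n / R a\<close> for every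
    \<open>p' > 0\<close>.\<close>
  define k where "k t i = (if t = 0 then a i else \<zero>)" for t :: nat and i
  have k: "is_matrix R p' n k" by (simp add: is_matrix_def k_def)
  obtain W :: "(nat \<Rightarrow> 'a) set" and \<kappa> Y G U V Q where W: "finite W"
    and \<kappa>: "\<And>w. is_matrix R p q (\<kappa> w)" and Y: "\<And>w. is_matrix R n q (Y w)" and G: "\<And>w. is_matrix R q n (G w)"
    and U: "\<And>w. is_matrix R p p' (U w)" and V: "\<And>w. is_matrix R p' p (V w)" and Q: "is_matrix R n p' Q"
    and kY: "\<And>w t l. \<lbrakk>t < p'; l < q\<rbrakk> \<Longrightarrow> dot R n (k t) (\<lambda>j. Y w j l) = dot R p (V w t) (\<lambda>i. \<kappa> w i l)"
    and \<kappa>G: "\<And>w i t. \<lbrakk>i < p; t < n\<rbrakk> \<Longrightarrow> dot R q (\<kappa> w i) (\<lambda>l. G w l t) = dot R p' (U w i) (\<lambda>s. k s t)"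
    and one: "\<And>j i. \<lbrakk>j < n; i < n\<rbrakk> \<Longrightarrow> unit_vec R j i \<ominus> (\<Oplus>w\<in>W. dot R q (Y w j) (\<lambda>l. G w l i)) =
       dot R p' (Q j) (\<lambda>t. k t i)"
    by (rule purity_implication_matrices[where p = p and p' = p' and q = q and q' = n and k = k,
          OF ring_axioms q imp k]) (assumption | rule that)+
  have k0: "dot R p' x (\<lambda>t. k t j) = x 0 \<otimes> a j" if "x \<in> {..<p'} \<rightarrow> carrier R" "j < n" for x j
    unfolding k_def using dot_single(1)[OF p' that(1) a_closed[OF that(2)]] .
  have "factored_identity R e n a W q Y G (\<lambda>i. Q i 0) (\<lambda>w. dot R p (V w 0) (\<lambda>i. U w i 0))"
  proof (intro factored_identity.intro factored_identity_axioms.intro)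
    show "ideal_generators R e n a" by (rule ideal_generators_axioms)
    fix w j assume j: "j < n"
    have V0: "V w 0 \<in> {..<p} \<rightarrow> carrier R" by (rule is_matrix_row[OF V p'])
    have Gj: "(\<lambda>l. G w l j) \<in> {..<q} \<rightarrow> carrier R" by (rule is_matrix_col[OF G j])
    have aY: "dot R n a (\<lambda>i. Y w i l) = dot R p (V w 0) (\<lambda>i. \<kappa> w i l)" if "l < q" for l
    proof -
      have "dot R n a (\<lambda>i. Y w i l) = dot R n (k 0) (\<lambda>j. Y w j l)" by (simp add: k_def[abs_def])
      then show ?thesis using kY[OF p' that] by simp
    qed
    \<comment> \<open>In matrix form, \<open>k Y = V \<kappa>\<close> and
      \<open>\<kappa> G = U k\<close> give \<open>k Y G = V U k\<close>. Rows of \<open>k\<close>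
      other than row 0 vanish, so the eigenvalue is the entry (0, 0) of \<open>V U\<close>.\<close>
    have "dot R n a (\<lambda>i. dot R q (Y w i) (\<lambda>l. G w l j)) = dot R q (\<lambda>l. dot R n a (\<lambda>i. Y w i l)) (\<lambda>l. G w l j)"
      by (rule dot_assoc[symmetric, OF a is_matrixD[OF Y] Gj])
    also have "\<dots> = dot R q (\<lambda>l. dot R p (V w 0) (\<lambda>i. \<kappa> w i l)) (\<lambda>l. G w l j)"
      by (rule dot_cong[OF _ Gj]) (use aY V0 is_matrix_col[OF \<kappa>] in auto)
    also have "\<dots> = dot R p (V w 0) (\<lambda>i. dot R q (\<kappa> w i) (\<lambda>l. G w l j))"
      by (rule dot_assoc[OF V0 is_matrixD[OF \<kappa>] Gj])
    also have "\<dots> = dot R p (V w 0) (\<lambda>i. U w i 0 \<otimes> a j)"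
      by (rule dot_cong[OF V0])
        (use \<kappa>G j k0[OF is_matrix_row[OF U] j] is_matrixD[OF U _ p'] in auto)
    also have "\<dots> = dot R p (V w 0) (\<lambda>i. U w i 0) \<otimes> a j"
      by (rule dot_smult_right[OF V0 a_closed[OF j]]) (use is_matrixD[OF U _ p'] in auto)
    finally show "dot R n a (\<lambda>i. dot R q (Y w i) (\<lambda>l. G w l j)) = dot R p (V w 0) (\<lambda>i. U w i 0) \<otimes> a j" .
  next
    fix w show "dot R p (V w 0) (\<lambda>i. U w i 0) \<in> carrier R"
      using is_matrix_row[OF V p'] is_matrixD[OF U _ p'] by (intro dot_closed) auto
  next
    fix i j assume "i < n" "j < n"
    then show "unit_vec R i j \<ominus> (\<Oplus>w\<in>W. dot R q (Y w i) (\<lambda>l. G w l j)) = Q i 0 \<otimes> a j"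
      using one k0[OF is_matrix_row[OF Q]] by simp
  qed (use W Y G is_matrixD[OF Q _ p'] in auto)
  then show ?thesis using few_generators_of_identity I by blast
qed

text \<open>For right modules all matrices are transposed; the error term \<open>D\<close> of the resulting
  decomposition of the identity kills the row \<open>a\<close> and is therefore a sum of matrices with one
  nonzero column.\<close>

lemma few_generators_right:
  assumes r: "r > 0" and q: "q > 0" and q': "q' > 0"
    and imp: "\<And>A f B g C. pq_pure (opp_ring R) r q A f B g C \<Longrightarrow> pq_pure (opp_ring R) n q' A f B g C"
    and I: "(\<forall>s\<in>carrier R. \<forall>x\<in>I. s \<otimes> x \<in> I) \<or> krull_schmidt R"
  shows "few_generators r"
proof -
  \<comment> \<open>All \<open>n\<close> relations concern generator 0. Over the opposite ring this
    presents the right module \<open>R / I\<close>, together with \<open>q' - 1\<close> free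
    summands that bring the number of unknowns to \<open>q'\<close>.\<close>
  define k where "k t i = (if i = 0 then a t else \<zero>)" for t and i :: nat
  have k: "is_matrix (opp_ring R) n q' k" by (simp add: is_matrix_def k_def)
  obtain W :: "(nat \<Rightarrow> 'a) set" and \<kappa> Y G U V Q where W: "finite W"
    and \<kappa>: "\<And>w. is_matrix (opp_ring R) r q (\<kappa> w)" and Y: "\<And>w. is_matrix (opp_ring R) q' q (Y w)"
    and G: "\<And>w. is_matrix (opp_ring R) q q' (G w)" and U: "\<And>w. is_matrix (opp_ring R) r n (U w)"
    and V: "\<And>w. is_matrix (opp_ring R) n r (V w)" and Q: "is_matrix (opp_ring R) q' n Q"
    and kY: "\<And>w t l. \<lbrakk>t < n; l < q\<rbrakk> \<Longrightarrow>
      dot (opp_ring R) q' (k t) (\<lambda>j. Y w j l) = dot (opp_ring R) r (V w t) (\<lambda>i. \<kappa> w i l)"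
    and \<kappa>G: "\<And>w i t. \<lbrakk>i < r; t < q'\<rbrakk> \<Longrightarrow>
      dot (opp_ring R) q (\<kappa> w i) (\<lambda>l. G w l t) = dot (opp_ring R) n (U w i) (\<lambda>s. k s t)"
    and one: "\<And>j i. \<lbrakk>j < q'; i < q'\<rbrakk> \<Longrightarrow>
      unit_vec (opp_ring R) j i \<ominus>\<^bsub>opp_ring R\<^esub> (\<Oplus>\<^bsub>opp_ring R\<^esub>w\<in>W. dot (opp_ring R) q (Y w j) (\<lambda>l. G w l i)) =
       dot (opp_ring R) n (Q j) (\<lambda>t. k t i)"
    by (rule purity_implication_matrices[where p = r and p' = n and q = q and q' = q' and k = k,
          OF ring_opp_ring[OF ring_axioms] q imp k]) (assumption | rule that)+
  note \<kappa> = \<kappa>[unfolded is_matrix_opp_ring] and Y = Y[unfolded is_matrix_opp_ring] and G = G[unfolded is_matrix_opp_ring]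
    and U = U[unfolded is_matrix_opp_ring] and V = V[unfolded is_matrix_opp_ring] and Q = Q[unfolded is_matrix_opp_ring]
  \<comment> \<open>The entry (0, 0) of \<open>Y G\<close>, that is, the action on the generator of
    \<open>R / I\<close>; the factors are reversed because the product is that of the opposite
    ring.\<close>
  define g where "g w = dot R q (\<lambda>l. G w l 0) (Y w 0)" for w
  have G0: "(\<lambda>l. G w l 0) \<in> {..<q} \<rightarrow> carrier R" for w by (rule is_matrix_col[OF G q'])
  have Y0: "Y w 0 \<in> {..<q} \<rightarrow> carrier R" for w by (rule is_matrix_row[OF Y q'])
  have Q0: "Q 0 \<in> {..<n} \<rightarrow> carrier R" by (rule is_matrix_row[OF Q q'])
  have gc: "g w \<in> carrier R" for w unfolding g_def by (rule dot_closed[OF G0 Y0])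
  have kY': "Y w 0 l \<otimes> a t = dot R r (\<lambda>i. \<kappa> w i l) (V w t)" if "t < n" "l < q" for w t l
  proof -
    have "dot R q' (\<lambda>j. Y w j l) (k t) = Y w 0 l \<otimes> a t"
      unfolding k_def using dot_single(1)[OF q' is_matrix_col[OF Y that(2)] a_closed[OF that(1)]] .
    then show ?thesis using kY[OF that] by (simp add: dot_opp_ring)
  qed
  have \<kappa>G': "dot R q (\<lambda>l. G w l 0) (\<kappa> w i) = dot R n a (U w i)" if "i < r" for w i
    using \<kappa>G[OF that q'] by (simp add: dot_opp_ring k_def)
  have one': "\<one> \<ominus> (\<Oplus>w\<in>W. g w) = dot R n a (Q 0)"
    using one[OF q' q'] by (simp add: dot_opp_ring k_def g_def unit_vec_def a_minus_def)
  \<comment> \<open>The transpose of \<open>V U\<close>, the action on the free module of relations.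
    Its inner dimension is \<open>r\<close>, the number of relations of the factoring modules, and
    compatibility with the action on generators makes \<open>a\<close> an eigenvector with
    eigenvalue \<open>g w\<close>.\<close>
  define T where "T w i j = dot R r (\<lambda>l. U w l i) (V w j)" for w i j
  have Tc: "T w i j \<in> carrier R" if "i < n" "j < n" for w i j
    unfolding T_def by (rule dot_closed[OF is_matrix_col[OF U that(1)] is_matrix_row[OF V that(2)]])
  have aT: "dot R n a (\<lambda>i. T w i j) = g w \<otimes> a j" if j: "j < n" for w j
  proof -
    have Vj: "V w j \<in> {..<r} \<rightarrow> carrier R" by (rule is_matrix_row[OF V j])
    have "dot R n a (\<lambda>i. T w i j) = dot R r (\<lambda>l. dot R n a (\<lambda>i. U w l i)) (V w j)"
      unfolding T_def by (rule dot_assoc[symmetric, OF a _ Vj]) (use is_matrixD[OF U] in auto)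
    also have "\<dots> = dot R r (\<lambda>l. dot R q (\<lambda>x. G w x 0) (\<lambda>x. \<kappa> w l x)) (V w j)"
      by (rule dot_cong[OF _ Vj]) (use \<kappa>G' a is_matrix_row[OF U] in auto)
    also have "\<dots> = dot R q (\<lambda>x. G w x 0) (\<lambda>x. dot R r (\<lambda>l. \<kappa> w l x) (V w j))"
      by (rule dot_assoc[OF G0 _ Vj]) (use is_matrixD[OF \<kappa>] in auto)
    also have "\<dots> = dot R q (\<lambda>x. G w x 0) (\<lambda>x. Y w 0 x \<otimes> a j)"
      by (rule dot_cong[OF G0]) (use kY'[OF j] funcset_mem[OF Y0] j in auto)
    also have "\<dots> = g w \<otimes> a j"
      unfolding g_def by (rule dot_smult_right[OF G0 a_closed[OF j] Y0])
    finally show ?thesis .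
  qed
  define D where "D i j = (unit_vec R i j \<ominus> (\<Oplus>w\<in>W. T w i j)) \<ominus> Q 0 i \<otimes> a j" for i j
  have sT: "(\<Oplus>w\<in>W. T w i j) \<in> carrier R" if "i < n" "j < n" for i j
    using Tc that by (intro finsum_closed) auto
  have Dc: "D i j \<in> carrier R" if "i < n" "j < n" for i j
    using sT[OF that] that funcset_mem[OF Q0, of i] by (simp add: D_def)
  have aD: "dot R n a (\<lambda>i. D i j) = \<zero>" if j: "j < n" for j
  proof -
    have uj: "(\<lambda>i. unit_vec R i j) \<in> {..<n} \<rightarrow> carrier R" by simp
    have Tj: "(\<lambda>i. \<Oplus>w\<in>W. T w i j) \<in> {..<n} \<rightarrow> carrier R" using sT j by auto
    have uT: "(\<lambda>i. unit_vec R i j \<ominus> (\<Oplus>w\<in>W. T w i j)) \<in> {..<n} \<rightarrow> carrier R" using sT j by auto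
    have Qa: "(\<lambda>i. Q 0 i \<otimes> a j) \<in> {..<n} \<rightarrow> carrier R" using funcset_mem[OF Q0] j by auto
    have u: "dot R n a (\<lambda>i. unit_vec R i j) = a j"
      unfolding dot_def by (rule finsum_unique_nonzero[of _ j]) (use j in \<open>auto simp: unit_vec_def\<close>)
    have "dot R n a (\<lambda>i. \<Oplus>w\<in>W. T w i j) = (\<Oplus>w\<in>W. dot R n a (\<lambda>i. T w i j))"
      by (rule dot_finsum_right[OF W _ a]) (use Tc j in auto)
    also have "\<dots> = (\<Oplus>w\<in>W. g w \<otimes> a j)" by (rule finsum_cong') (use aT gc j in auto)
    also have "\<dots> = (\<Oplus>w\<in>W. g w) \<otimes> a j" by (rule finsum_ldistr[symmetric, OF W]) (use gc j in auto)
    finally have s: "dot R n a (\<lambda>i. \<Oplus>w\<in>W. T w i j) = (\<Oplus>w\<in>W. g w) \<otimes> a j" .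
    have gs: "(\<Oplus>w\<in>W. g w) \<in> carrier R" using gc by (intro finsum_closed) auto
    have "dot R n a (\<lambda>i. D i j) = (a j \<ominus> (\<Oplus>w\<in>W. g w) \<otimes> a j) \<ominus> dot R n a (Q 0) \<otimes> a j"
      unfolding D_def dot_diff_right[OF a uT Qa] dot_diff_right[OF a uj Tj] u s
        dot_smult_right[OF a a_closed[OF j] Q0] ..
    also have "\<dots> = ((\<one> \<ominus> (\<Oplus>w\<in>W. g w)) \<ominus> dot R n a (Q 0)) \<otimes> a j"
      using gs a Q0 j by (simp add: a_minus_def l_distr l_minus)
    also have "\<dots> = \<zero>" unfolding one' using a Q0 j by (simp add: a_minus_def r_neg)
    finally show ?thesis .
  qed
  \<comment> \<open>The index set receives one new element for each column of \<open>D\<close>. The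
    corresponding factors use only position 0 of the inner dimension, which exists as
    \<open>r > 0\<close>, and have eigenvalue zero because \<open>D\<close> kills
    \<open>a\<close>.\<close>
  let ?W = "Inl ` W \<union> Inr ` {..<n} :: ((nat \<Rightarrow> 'a) + nat) set"
  define B where "B = case_sum (\<lambda>w i l. U w l i) (\<lambda>x i l. if l = 0 then D i x else \<zero>)"
  define C where "C = case_sum (\<lambda>w l j. V w j l) (\<lambda>x l j. if l = 0 then (if j = x then \<one> else \<zero>) else \<zero>)"
  define \<Lambda> :: "(nat \<Rightarrow> 'a) + nat \<Rightarrow> 'a" where "\<Lambda> = case_sum g (\<lambda>x. \<zero>)"
  have Bm: "is_matrix R n r (B w)" if "w \<in> ?W" for w
    using that is_matrixD[OF U] Dc by (auto simp: B_def is_matrix_def)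
  have Cm: "is_matrix R r n (C w)" for w
    using is_matrixD[OF V] by (auto simp: C_def is_matrix_def split: sum.split)
  have BCl: "dot R r (B (Inl w) i) (\<lambda>l. C (Inl w) l j) = T w i j" for w i j
    by (simp add: B_def C_def T_def)
  have BCr: "dot R r (B (Inr x) i) (\<lambda>l. C (Inr x) l j) = (if x = j then D i x else \<zero>)"
    if "i < n" "x < n" for x i j
  proof -
    have b: "(\<lambda>l. if l = 0 then D i x else \<zero>) \<in> {..<r} \<rightarrow> carrier R" using Dc that by auto
    have "dot R r (\<lambda>l. if l = 0 then D i x else \<zero>) (\<lambda>l. if l = 0 then (if j = x then \<one> else \<zero>) else \<zero>)
        = D i x \<otimes> (if j = x then \<one> else \<zero>)"
      using dot_single(1)[OF r b, of "if j = x then \<one> else \<zero>"] by simp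
    then show ?thesis using Dc[OF that] by (auto simp: B_def C_def)
  qed
  have "factored_identity R e n a ?W r B C (Q 0) \<Lambda>"
  proof (intro factored_identity.intro factored_identity_axioms.intro)
    show "ideal_generators R e n a" by (rule ideal_generators_axioms)
    fix w j assume w: "w \<in> ?W" and j: "j < n"
    show "dot R n a (\<lambda>i. dot R r (B w i) (\<lambda>l. C w l j)) = \<Lambda> w \<otimes> a j"
    proof (cases w)
      case (Inl v)
      then show ?thesis using aT[OF j] by (simp add: BCl \<Lambda>_def)
    next
      case (Inr x)
      then have x: "x < n" using w by auto
      have "dot R n a (\<lambda>i. dot R r (B w i) (\<lambda>l. C w l j)) = dot R n a (\<lambda>i. if x = j then D i x else \<zero>)"
        unfolding Inr by (rule dot_cong[OF a]) (use BCr x Dc in auto)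
      also have "\<dots> = \<zero>" using aD[OF x] dot_zero_right[OF a] by (cases "x = j") simp_all
      finally show ?thesis using j Inr by (simp add: \<Lambda>_def)
    qed
  next
    fix w show "w \<in> ?W \<Longrightarrow> \<Lambda> w \<in> carrier R" using gc by (auto simp: \<Lambda>_def)
  next
    fix i j assume i: "i < n" and j: "j < n"
    let ?h = "\<lambda>w. dot R r (B w i) (\<lambda>l. C w l j)"
    have hc: "?h \<in> ?W \<rightarrow> carrier R"
      using is_matrix_row[OF Bm i] is_matrix_col[OF Cm j] by (intro Pi_I dot_closed) auto
    have "(\<Oplus>w\<in>?W. ?h w) = (\<Oplus>w\<in>Inl ` W. ?h w) \<oplus> (\<Oplus>w\<in>Inr ` {..<n}. ?h w)"
      by (rule finsum_Un_disjoint) (use W hc in auto)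
    also have "(\<Oplus>w\<in>Inl ` W. ?h w) = (\<Oplus>w\<in>W. T w i j)"
      using Tc[OF i j] by (subst finsum_reindex) (auto simp: BCl)
    also have "(\<Oplus>w\<in>Inr ` {..<n}. ?h w) = (\<Oplus>x\<in>{..<n}. if x = j then D i x else \<zero>)"
      using Dc[OF i] j by (subst finsum_reindex) (auto simp: BCr[OF i] intro!: finsum_cong')
    also have "\<dots> = D i j" by (rule finsum_unique_nonzero[of _ j]) (use j Dc[OF i j] in auto)
    finally have "(\<Oplus>w\<in>?W. ?h w) = (\<Oplus>w\<in>W. T w i j) \<oplus> D i j" .
    then have "unit_vec R i j \<ominus> (\<Oplus>w\<in>?W. ?h w) = unit_vec R i j \<ominus> ((\<Oplus>w\<in>W. T w i j) \<oplus> D i j)" by simp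
    also have "\<dots> = (unit_vec R i j \<ominus> (\<Oplus>w\<in>W. T w i j)) \<ominus> D i j"
      using sT[OF i j] Dc[OF i j] by (simp add: a_minus_def minus_add a_assoc)
    also have "\<dots> = Q 0 i \<otimes> a j"
      by (rule diff_eq_swap[symmetric]) (use sT[OF i j] funcset_mem[OF Q0, of i] i j in \<open>auto simp: D_def\<close>)
    finally show "unit_vec R i j \<ominus> (\<Oplus>w\<in>?W. ?h w) = Q 0 i \<otimes> a j" .
  qed (use W Bm Cm Q0 in auto)
  then show ?thesis using few_generators_of_identity I by blast
qed

end

section \<open>Minimal generating rows of the ideal\<close>

lemma (in ring) right_ideal_of_ideal:
  assumes "ideal I R"
  shows "right_ideal I R"
proof -
  interpret ideal I R by fact
  interpret O: ring "opp_ring R" by (rule ring_opp_ring[OF ring_axioms])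
  interpret M: left_module "opp_ring R" "regular_module (opp_ring R)" by (rule regular_left_module[OF O.ring_axioms])
  show ?thesis
    by (rule M.submoduleI) (auto simp: I_r_closed a_subset[THEN subsetD])
qed

lemma (in ring) gen_right_le_iff:
  assumes "right_ideal I R"
  shows "gen_right R I \<le> enat q \<longleftrightarrow>
    (\<exists>y\<in>{..<q} \<rightarrow> carrier R. I = {dot R q y c | c. c \<in> {..<q} \<rightarrow> carrier R})"
proof -
  interpret O: ring "opp_ring R" by (rule ring_opp_ring[OF ring_axioms])
  interpret M: lmod "opp_ring R" "regular_module (opp_ring R)"
    by (intro lmod.intro regular_left_module O.ring_axioms)
  show ?thesis
    unfolding gen_right_def M.gen_submodule_le_iff[OF assms]
    by (simp add: lincomb_regular dot_opp_ring)
qed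

text \<open>Since \<open>n \<ge> 2\<close> is minimal, \<open>I\<close> is not zero, which needs no
  generator, and \<open>e\<close> is not in \<open>I\<close>, which would force
  \<open>I = e R\<close> with the single generator \<open>e\<close>. Associativity of matrix
  products turns \<open>few_generators r\<close> into a generating family of \<open>I\<close> of
  length \<open>r\<close>.\<close>

lemma (in ring) ex_ideal_generators:
  assumes I: "right_ideal I R" and gen: "gen_right R I = enat n" and n: "n \<ge> 2"
    and e: "local_idempotent R e" and sub: "I \<subseteq> (\<lambda>x. e \<otimes> x) ` carrier R"
  obtains a where "ideal_generators R e n a" "ideal_generators.I R n a = I"
    "\<And>r. ideal_generators.few_generators R n a r \<Longrightarrow> n \<le> r"
proof -
  interpret e: local_idem R e using e local_idempotent_iff[OF ring_axioms] by simp
  obtain a where a: "a \<in> {..<n} \<rightarrow> carrier R" "I = {dot R n a c | c. c \<in> {..<n} \<rightarrow> carrier R}"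
    using gen gen_right_le_iff[OF I, of n] by auto
  have min: "n \<le> q" if "y \<in> {..<q} \<rightarrow> carrier R" "I = {dot R q y c | c. c \<in> {..<q} \<rightarrow> carrier R}" for q y
    using gen_right_le_iff[OF I, of q] that gen by auto
  have aI: "a i \<in> I" if i: "i < n" for i
  proof -
    have "a i = dot R n a (unit_vec R i)"
      unfolding dot_def by (rule finsum_unique_nonzero[symmetric, of _ i])
        (use i funcset_mem[OF a(1)] in \<open>auto simp: unit_vec_def\<close>)
    then show ?thesis unfolding a(2) by auto
  qed
  have ea: "e \<otimes> x = x" if "x \<in> I" for x
  proof -
    obtain y where "y \<in> carrier R" "x = e \<otimes> y" using sub \<open>x \<in> I\<close> by blast
    then show ?thesis by (simp flip: m_assoc)
  qed
  have "\<exists>i<n. a i \<noteq> \<zero>"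
  proof (rule ccontr)
    assume "\<not> (\<exists>i<n. a i \<noteq> \<zero>)"
    then have "dot R n a c = \<zero>" if "c \<in> {..<n} \<rightarrow> carrier R" for c
      unfolding dot_def using that by (intro add.finprod_one_eqI) (auto dest: funcset_mem)
    then have "I = {\<zero>}" unfolding a(2) by (auto intro!: exI[of _ "\<lambda>_. \<zero>"])
    then have "I = {dot R 0 a c | c. c \<in> {..<0} \<rightarrow> carrier R}" by (simp add: dot_def)
    from min[OF _ this] n show False by simp
  qed
  moreover have "\<not> (\<exists>c\<in>{..<n} \<rightarrow> carrier R. e = dot R n a c)"
  proof
    assume "\<exists>c\<in>{..<n} \<rightarrow> carrier R. e = dot R n a c"
    then have eI: "e \<in> I" unfolding a(2) by blast
    have "e \<otimes> s \<in> I" if "s \<in> carrier R" for s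
      using submodule_smult[OF I, of s e] that eI by simp
    moreover have "x \<in> carrier R \<and> x = e \<otimes> x" if "x \<in> I" for x
      using ea[OF that] that sub by auto
    ultimately have "I = {e \<otimes> s | s. s \<in> carrier R}" by blast
    also have "\<dots> = {dot R 1 (\<lambda>_. e) c | c. c \<in> {..<1} \<rightarrow> carrier R}"
    proof (intro equalityI subsetI)
      fix x assume "x \<in> {e \<otimes> s | s. s \<in> carrier R}"
      then obtain s where "s \<in> carrier R" "x = e \<otimes> s" by blast
      then show "x \<in> {dot R 1 (\<lambda>_. e) c | c. c \<in> {..<1} \<rightarrow> carrier R}"
        by (intro CollectI exI[of _ "\<lambda>_. s"]) (simp add: dot_def lessThan_Suc)
    next
      fix x assume "x \<in> {dot R 1 (\<lambda>_. e) c | c. c \<in> {..<1} \<rightarrow> carrier R}"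
      then obtain c where "c \<in> {..<1} \<rightarrow> carrier R" "x = dot R 1 (\<lambda>_. e) c" by blast
      then show "x \<in> {e \<otimes> s | s. s \<in> carrier R}"
        by (intro CollectI exI[of _ "c 0"]) (auto simp: dot_def lessThan_Suc)
    qed
    finally have "n \<le> 1" by (rule min[rotated]) simp
    then show False using n by simp
  qed
  ultimately have gens: "ideal_generators R e n a"
    using a(1) ea aI by (intro ideal_generators.intro ideal_generators_axioms.intro e.local_idem_axioms) auto
  then interpret G: ideal_generators R e n a .
  have GI: "G.I = I" unfolding G.I_def a(2) ..
  have "n \<le> r" if "G.few_generators r" for r
  proof -
    obtain y C where y: "y \<in> {..<r} \<rightarrow> I" and C: "is_matrix R r n C"
      and eq: "\<And>j. j < n \<Longrightarrow> a j = dot R r y (\<lambda>l. C l j)"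
      using \<open>G.few_generators r\<close> unfolding G.few_generators_def GI by blast
    have yc: "y \<in> {..<r} \<rightarrow> carrier R" using funcset_mem[OF y] G.I_carrier GI by auto
    have "dot R n a c = dot R r y (\<lambda>l. dot R n (C l) c)" if c: "c \<in> {..<n} \<rightarrow> carrier R" for c
    proof -
      have "dot R n a c = dot R n (\<lambda>j. dot R r y (\<lambda>l. C l j)) c"
        by (rule dot_cong[OF _ c]) (use eq yc is_matrix_col[OF C] in auto)
      also have "\<dots> = dot R r y (\<lambda>l. dot R n (C l) c)" by (rule dot_assoc[OF yc is_matrixD[OF C] c])
      finally show ?thesis .
    qed
    moreover have "(\<lambda>l. dot R n (C l) c) \<in> {..<r} \<rightarrow> carrier R" if "c \<in> {..<n} \<rightarrow> carrier R" for c
      using that is_matrix_row[OF C] by (intro Pi_I dot_closed) auto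
    ultimately have "I \<subseteq> {dot R r y d | d. d \<in> {..<r} \<rightarrow> carrier R}" unfolding a(2) by blast
    moreover have "dot R r y d \<in> I" if d: "d \<in> {..<r} \<rightarrow> carrier R" for d
    proof -
      interpret O: ring "opp_ring R" by (rule ring_opp_ring[OF ring_axioms])
      interpret M: left_module "opp_ring R" "regular_module (opp_ring R)"
        by (rule regular_left_module[OF O.ring_axioms])
      show ?thesis using M.submodule_lincomb[OF I, of d r y] d y by (simp add: lincomb_regular dot_opp_ring)
    qed
    ultimately have "I = {dot R r y d | d. d \<in> {..<r} \<rightarrow> carrier R}" by blast
    from min[OF yc this] show ?thesis .
  qed
  then show ?thesis using that[OF gens GI] by blast
qed

theorem theorem3p6:
  fixes R :: "('a, 'k) ring_scheme" (structure) and n m r s :: nat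
  assumes "ring R"
    and "n > 0" and "m > 0" and "r > 0" and "s > 0"
    and "n \<noteq> r"
    and "(semiperfect R \<and>
           (\<exists>I e. ideal I R \<and> gen_right R I = enat (max n r) \<and>
                  local_idempotent R e \<and> I \<subseteq> (\<lambda>x. e \<otimes> x) ` carrier R)) \<or>
         (krull_schmidt R \<and>
           (\<exists>I e. right_ideal I R \<and> gen_right R I = enat (max n r) \<and>
                  local_idempotent R e \<and> I \<subseteq> (\<lambda>x. e \<otimes> x) ` carrier R))"
  shows "\<not> equivalent_purities_left R (m, n) (s, r) \<and>
         \<not> equivalent_purities_right R (n, m) (r, s)"
proof -
  interpret ring R by fact
  obtain I e where I: "right_ideal I R" "gen_right R I = enat (max n r)" "local_idempotent R e"
    "I \<subseteq> (\<lambda>x. e \<otimes> x) ` carrier R" and cases: "ideal I R \<or> krull_schmidt R"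
    using assms(7) right_ideal_of_ideal by blast
  have "max n r \<ge> 2" using assms(2,4,6) by auto
  from ex_ideal_generators[OF I(1,2) this I(3,4)] obtain a where
    gens: "ideal_generators R e (max n r) a" and aI: "ideal_generators.I R (max n r) a = I"
    and min: "\<And>q. ideal_generators.few_generators R (max n r) a q \<Longrightarrow> max n r \<le> q" by blast
  interpret G: ideal_generators R e "max n r" a by (rule gens)
  have closed: "(\<forall>s\<in>carrier R. \<forall>x\<in>G.I. s \<otimes> x \<in> G.I) \<or> krull_schmidt R"
    using cases unfolding aI by (auto intro: ideal.I_l_closed)
  have less: "min n r < max n r" using assms(6) by auto
  \<comment> \<open>The failing implication always goes from the smaller to the larger of
    \<open>n\<close> and \<open>r\<close>, whatever the other parameters are; the case distinction
    below only decides which of the two purities has the smaller one.\<close>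
  have left: "\<not> (\<forall>A f B g C. pq_pure R p (min n r) A f B g C \<longrightarrow> pq_pure R p' (max n r) A f B g C)"
    if "p' > 0" for p p'
    using G.few_generators_left[of "min n r" p' p] that closed min[of "min n r"] less assms(2,4) by force
  have right: "\<not> (\<forall>A f B g C. pq_pure (opp_ring R) (min n r) q A f B g C \<longrightarrow>
      pq_pure (opp_ring R) (max n r) q' A f B g C)"
    if "q > 0" "q' > 0" for q q'
    using G.few_generators_right[of "min n r" q q'] that closed min[of "min n r"] less assms(2,4) by force
  show ?thesis
  proof (cases "n < r")
    case True
    then have "min n r = n" "max n r = r" by auto
    then show ?thesis
      using left[OF assms(5), of m] right[OF assms(3,5)]
      unfolding equivalent_purities_right_def equivalent_purities_left_def by simp blast
  next
    case False
    then have "min n r = r" "max n r = n" by auto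
    then show ?thesis
      using left[OF assms(3), of s] right[OF assms(5,3)]
      unfolding equivalent_purities_right_def equivalent_purities_left_def by simp blast
  qed
qed

end
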